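(* Let $\alpha\in(0,1)$ and let $K_0:(0,\infty)\to\mathbb R$ be a $C^\infty$ function such that (i) $-K_0'$ is a nontrivial (not identically zero) completely monotone function, i.e. $(-1)^n\frac{d^n}{dt^n}\bigl(-K_0'(t)\bigr)\ge 0$ for all $t>0$ and all integers $n\ge 0$; (ii) $\int_0^1 |K_0(t)|\,t^{-\alpha}\,dt<\infty$. Then for every integer $m\ge 2$ there exist an angular velocity $\Omega_m\in\mathbb R$ and a branch $V_m$ of nontrivial $m$-fold symmetric rotating vortex patches, i.e. of pairs $(\Omega,D)$ for which there is a constant $\mu\in\mathbb R$ with $$\int_D K_0(|z-y|)\,dA(y)+\frac{\Omega}{2}|z|^2=\mu\qquad\text{for all } z\in\partial D,$$ and $V_m$ bifurcates from the trivial Rankine vortex (the unit disk $\mathbb D$) at the angular velocity $\Omega_m$. Moreover, the boundaries of these vortex patches are of Hölder class $C^{1+\alpha}$.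
   Context: $\mathbb D=\{z\in\mathbb C:|z|<1\}$, $\mathbb T=\partial\mathbb D$, $\mathbb R^2$ is identified with $\mathbb C$, and $dA$ is two-dimensional Lebesgue measure. The active scalar equation is $\partial_t\omega+v\cdot\nabla\omega=0$, $v=\nabla^\perp\psi$ with $\nabla^\perp=(\partial_2,-\partial_1)$, and $\psi(x)=\int_{\mathbb R^2}K_0(|x-y|)\omega(y)\,dA(y)$. A rotating patch with angular velocity $\Omega$ is a solution of the form $\omega(t)=\mathbf 1_{e^{i\Omega t}D}$; for a bounded simply connected domain $D$ with sufficiently regular boundary this is characterized by the boundary equation $\int_D K_0(|z-y|)\,dA(y)+\frac{\Omega}{2}|z|^2=\mu$ for all $z\in\partial D$, for some constant $\mu\in\mathbb R$. The unit disk solves it for every $\Omega\in\mathbb R$ (the trivial branch). A domain $D$ is $m$-fold symmetric if $e^{2\pi i/m}D=D$. Domains near the disk are parametrized by interior conformal maps $\Phi:\mathbb D\to D$ of the form $\Phi=\mathrm{Id}+f$, with $f\in C^{1+\alpha}(\mathbb T)$, $f(w)=\sum_{n\ge 2}f_nw^n$, $f_n\in\mathbb R$. "The branch $V_m$ bifurcates from the Rankine vortex at $\Omega_m$" means: there are $\delta>0$ and a continuous curve $s\in(-\delta,\delta)\mapsto(\Omega_s,f_s)\in\mathbb R\times C^{1+\alpha}(\mathbb T)$, with each $f_s$ having an expansion $f_s(w)=\sum_{n\ge 2}f_{s,n}w^n$, $f_{s,n}\in\mathbb R$, such that $(\Omega_0,f_0)=(\Omega_m,0)$, $f_s\ne0$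 for $s\neq0$, and for every $s$ the pair $(\Omega_s,D_s)$, $D_s=(\mathrm{Id}+f_s)(\mathbb D)$, is an $m$-fold symmetric rotating patch. *)

theory Defs
  imports "HOL-Analysis.Analysis"
begin

text \<open>Only the values of \<open>K\<close> on \<open>(0, \<infinity>)\<close> matter here and below, since \<open>deriv\<close> is local.\<close>

definition smooth_on_pos :: "(real \<Rightarrow> real) \<Rightarrow> bool" where
  "smooth_on_pos K \<longleftrightarrow> (\<forall>n. \<forall>t>0. ((deriv ^^ n) K) field_differentiable (at t))"

definition completely_monotone :: "(real \<Rightarrow> real) \<Rightarrow> bool" where
  "completely_monotone g \<longleftrightarrow>
     smooth_on_pos g \<and> (\<forall>n. \<forall>t>0. (- 1) ^ n * (deriv ^^ n) g t \<ge> 0)"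

text \<open>
  The space \<open>C\<^sup>1\<^sup>+\<^sup>\<alpha>\<close> on the unit circle. Derivatives on the circle are taken with respect to
  the angle; for the boundary values of a holomorphic \<open>f\<close> this is \<open>i w f'(w)\<close>. Functions on the
  circle are total functions on the complex plane whose values off the circle are ignored.
\<close>

definition circle_deriv :: "(complex \<Rightarrow> complex) \<Rightarrow> complex \<Rightarrow> complex" where
  "circle_deriv f w = vector_derivative (\<lambda>t. f (w * cis t)) (at 0)"

definition holder_on_circle :: "real \<Rightarrow> (complex \<Rightarrow> complex) \<Rightarrow> bool" where
  "holder_on_circle \<alpha> g \<longleftrightarrow>
     (\<exists>C. \<forall>z\<in>sphere 0 1. \<forall>w\<in>sphere 0 1. norm (g z - g w) \<le> C * norm (z - w) powr \<alpha>)"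

definition C1_holder_circle :: "real \<Rightarrow> (complex \<Rightarrow> complex) \<Rightarrow> bool" where
  "C1_holder_circle \<alpha> f \<longleftrightarrow>
     (\<forall>w\<in>sphere 0 1. (\<lambda>t::real. f (w * cis t)) differentiable (at 0)) \<and>
     holder_on_circle \<alpha> (circle_deriv f)"

text \<open>The suprema below are those of bounded nonempty sets when \<open>f\<close> is in \<open>C\<^sup>1\<^sup>+\<^sup>\<alpha>\<close>.\<close>

definition C1_holder_norm :: "real \<Rightarrow> (complex \<Rightarrow> complex) \<Rightarrow> real" where
  "C1_holder_norm \<alpha> f =
     (SUP w\<in>sphere 0 1. norm (f w)) +
     (SUP w\<in>sphere 0 1. norm (circle_deriv f w)) +
     (SUP (z, w)\<in>{(z, w). z \<in> sphere 0 1 \<and> w \<in> sphere 0 1 \<and> z \<noteq> w}.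
        norm (circle_deriv f z - circle_deriv f w) / norm (z - w) powr \<alpha>)"

definition m_fold_symmetric :: "nat \<Rightarrow> complex set \<Rightarrow> bool" where
  "m_fold_symmetric m D \<longleftrightarrow> (\<lambda>z. cis (2 * pi / real m) * z) ` D = D"

definition rotating_patch :: "(real \<Rightarrow> real) \<Rightarrow> real \<Rightarrow> complex set \<Rightarrow> bool" where
  "rotating_patch K \<Omega> D \<longleftrightarrow>
     D \<noteq> {} \<and> open D \<and> bounded D \<and> simply_connected D \<and>
     (\<exists>\<mu>::real. \<forall>z\<in>frontier D.
        set_integrable lborel D (\<lambda>y. K (norm (z - y))) \<and>
        (LINT y:D|lborel. K (norm (z - y))) + \<Omega> / 2 * (norm z)\<^sup>2 = \<mu>)"

text \<open>The boundary is a regular Jordan curve of class \<open>C\<^sup>1\<^sup>+\<^sup>\<alpha>\<close>.\<close>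

definition C1_holder_boundary :: "real \<Rightarrow> complex set \<Rightarrow> bool" where
  "C1_holder_boundary \<alpha> D \<longleftrightarrow>
     (\<exists>\<gamma>. C1_holder_circle \<alpha> \<gamma> \<and> inj_on \<gamma> (sphere 0 1) \<and>
        (\<forall>w\<in>sphere 0 1. circle_deriv \<gamma> w \<noteq> 0) \<and>
        frontier D = \<gamma> ` sphere 0 1)"

text \<open>
  \<open>f s\<close> is used both as a function on the circle and as its extension to the closed disk; both
  are given by the power series.
\<close>

definition branch_from_disk ::
  "real \<Rightarrow> (real \<Rightarrow> real) \<Rightarrow> nat \<Rightarrow> real \<Rightarrow> (real \<times> complex set) set \<Rightarrow> bool" where
  "branch_from_disk \<alpha> K m \<Omega>\<^sub>m V \<longleftrightarrow>
     (\<exists>\<delta>>0. \<exists>(\<Omega> :: real \<Rightarrow> real) (f :: real \<Rightarrow> complex \<Rightarrow> complex) (a :: real \<Rightarrow> nat \<Rightarrow> real).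
        (\<forall>s\<in>{-\<delta><..<\<delta>}. C1_holder_circle \<alpha> (f s)) \<and>
        (\<forall>s\<in>{-\<delta><..<\<delta>}. \<forall>w\<in>cball 0 1.
           (\<lambda>n. of_real (a s (n + 2)) * w ^ (n + 2)) sums f s w) \<and>
        continuous_on {-\<delta><..<\<delta>} \<Omega> \<and>
        (\<forall>s\<in>{-\<delta><..<\<delta>}.
           ((\<lambda>r. C1_holder_norm \<alpha> (\<lambda>w. f r w - f s w)) \<longlongrightarrow> 0) (at s within {-\<delta><..<\<delta>})) \<and>
        \<Omega> 0 = \<Omega>\<^sub>m \<and> (\<forall>w\<in>sphere 0 1. f 0 w = 0) \<and>
        (\<forall>s\<in>{-\<delta><..<\<delta>} - {0}. \<exists>w\<in>sphere 0 1. f s w \<noteq> 0) \<and>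
        (\<forall>s\<in>{-\<delta><..<\<delta>}.
           (\<lambda>w. w + f s w) holomorphic_on ball 0 1 \<and>
           inj_on (\<lambda>w. w + f s w) (ball 0 1) \<and>
           rotating_patch K (\<Omega> s) ((\<lambda>w. w + f s w) ` ball 0 1) \<and>
           m_fold_symmetric m ((\<lambda>w. w + f s w) ` ball 0 1)) \<and>
        V = (\<lambda>s. (\<Omega> s, (\<lambda>w. w + f s w) ` ball 0 1)) ` ({-\<delta><..<\<delta>} - {0}))"

end

theory Submission
  imports Defs "HOL-Complex_Analysis.Complex_Analysis"
begin

text \<open>
  The tangential derivative of the boundary equation along the image of the circle under
  \<open>\<Phi> = id + f\<close> reads \<open>\<integral> K \<bar>\<Phi>(\<tau>) - \<Phi>(w)\<bar> Im (...) d\<theta> + \<Omega> Im (...) = 0\<close>, where \<open>\<tau> = w e\<^sup>i\<^sup>\<theta>\<close>. With the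
  unknown \<open>f'\<close> in a weighted \<open>\<ell>\<^sup>1\<close> Banach algebra of Fourier series in \<open>(w, \<tau>/w)\<close> one has
  \<open>\<bar>\<Phi>(\<tau>) - \<Phi>(w)\<bar> = 2 sin (\<theta>/2) (1 + q)\<close> with a small element \<open>q\<close>, and Taylor expansion of \<open>K\<close> turns the
  equation into a convergent series in the algebra: complete monotonicity bounds the \<open>j\<close>-th Taylor
  term of \<open>K\<close> at \<open>t\<close> by a geometric factor times values of \<open>K\<close> itself at comparable points. No
  singular integral has to be estimated.

  The linearization at the disk is diagonal: on \<open>f' = w\<^sup>k\<^sup>m\<close> it is \<open>km/(km+1)\<close> times
  \<open>K\<^sub>k\<^sub>m - K\<^sub>1 + \<Omega>\<close>, where \<open>K\<^sub>n\<close> are the cosine coefficients of \<open>K (2 sin (\<theta>/2))\<close>. This function is convex,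
  hence \<open>K\<^sub>k\<^sub>m < K\<^sub>m\<close> for \<open>k \<ge> 2\<close>, and \<open>K\<^sub>n\<close> tends to \<open>0\<close>; at \<open>\<Omega>\<^sub>m = K\<^sub>1 - K\<^sub>m\<close> the kernel is one-dimensional and
  the other multipliers stay away from \<open>0\<close>. After division by the amplitude the bifurcation equation
  is solved by contraction. A curl identity for the regularised kernel shows that a solution makes the
  relative potential constant along the boundary; the weight makes \<open>f'\<close> Lipschitz on the closed disk.
\<close>

section \<open>A weighted Wiener algebra on the two-dimensional torus\<close>

text \<open>Differentiating the kernel worsens its singularity, so a direct treatment in Hoelder
  spaces would need bounds for singular integrals. Measuring every perturbation relative to the
  chord avoids this, because t^j times the j-th derivative of K at t is no more singular than K. The
  price is that the difference quotient of f must lie in the same algebra as f'. If f' = w^n, this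
  quotient is an average of n + 1 monomials that differ only in the exponent of \<zeta>. A weight
  that sees the exponent of w alone therefore gives the quotient operator norm at most 1, and the
  single power in the weight makes f'' continuous up to the circle, as the curl identity requires.
  Real coefficients encode symmetry under complex conjugation, and counting exponents of w in
  multiples of \<open>m\<close> encodes rotational symmetry; with both built into the space, only
  one direction is left in the kernel. Transversality is the fact that \<Omega> acts on that
  direction with the nonzero multiplier m / (m + 1).\<close>

definition weight :: "int \<times> int \<Rightarrow> real" where
  "weight p = 1 + \<bar>real_of_int (fst p)\<bar>"

lemma weight_ge_1: "1 \<le> weight p"
  by (simp add: weight_def)

lemma weight_pos [simp]: "0 < weight p" "0 \<le> weight p" "weight p \<noteq> 0"
  using weight_ge_1[of p] by linarith+

text \<open>Submultiplicativity of the weight is what gives convolution the norm inequality of a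
  normed algebra.\<close>

lemma weight_add: "weight (p + q) \<le> weight p * weight q"
proof -
  have "\<bar>real_of_int (fst p + fst q)\<bar> \<le> \<bar>real_of_int (fst p)\<bar> + \<bar>real_of_int (fst q)\<bar>"
    by simp
  also have "\<dots> \<le> \<bar>real_of_int (fst p)\<bar> + \<bar>real_of_int (fst q)\<bar> + \<bar>real_of_int (fst p)\<bar> * \<bar>real_of_int (fst q)\<bar>"
    by simp
  finally show ?thesis by (simp add: weight_def algebra_simps)
qed

section \<open>The Banach space of weighted absolutely summable coefficients\<close>

typedef wiener = "{c :: int \<times> int \<Rightarrow> real. (\<lambda>p. weight p * \<bar>c p\<bar>) summable_on UNIV}"
  morphisms coef Abs_wiener
  by (rule exI[of _ "\<lambda>_. 0"]) simp

setup_lifting type_definition_wiener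

lemma coef_summable: "(\<lambda>p. weight p * \<bar>coef c p\<bar>) summable_on UNIV"
  using coef[of c] by simp

instantiation wiener :: real_normed_vector
begin

lift_definition zero_wiener :: wiener is "\<lambda>_. 0" by simp

lift_definition plus_wiener :: "wiener \<Rightarrow> wiener \<Rightarrow> wiener" is "\<lambda>c d p. c p + d p"
proof -
  fix c d :: "int \<times> int \<Rightarrow> real"
  assume "(\<lambda>p. weight p * \<bar>c p\<bar>) summable_on UNIV" "(\<lambda>p. weight p * \<bar>d p\<bar>) summable_on UNIV"
  hence "(\<lambda>p. weight p * \<bar>c p\<bar> + weight p * \<bar>d p\<bar>) summable_on UNIV"
    by (rule summable_on_add)
  thus "(\<lambda>p. weight p * \<bar>c p + d p\<bar>) summable_on UNIV"
    by (rule summable_on_comparison_test) (auto simp flip: distrib_left)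
qed

lift_definition uminus_wiener :: "wiener \<Rightarrow> wiener" is "\<lambda>c p. - c p" by simp

lift_definition scaleR_wiener :: "real \<Rightarrow> wiener \<Rightarrow> wiener" is "\<lambda>r c p. r * c p"
proof -
  fix r and c :: "int \<times> int \<Rightarrow> real"
  assume "(\<lambda>p. weight p * \<bar>c p\<bar>) summable_on UNIV"
  from summable_on_cmult_right[OF this, of "\<bar>r\<bar>"]
  show "(\<lambda>p. weight p * \<bar>r * c p\<bar>) summable_on UNIV"
    by (simp add: abs_mult algebra_simps)
qed

definition minus_wiener :: "wiener \<Rightarrow> wiener \<Rightarrow> wiener" where
  "minus_wiener c d = c + (- d)"

lift_definition norm_wiener :: "wiener \<Rightarrow> real" is "\<lambda>c. \<Sum>\<^sub>\<infinity>p. weight p * \<bar>c p\<bar>" .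

definition sgn_wiener :: "wiener \<Rightarrow> wiener" where
  "sgn_wiener x = inverse (norm x) *\<^sub>R x"

definition dist_wiener :: "wiener \<Rightarrow> wiener \<Rightarrow> real" where
  "dist_wiener x y = norm (x - y)"

definition uniformity_wiener :: "(wiener \<times> wiener) filter" where
  "uniformity_wiener = (INF e\<in>{0<..}. principal {(x, y). dist x y < e})"

definition open_wiener :: "wiener set \<Rightarrow> bool" where
  "open_wiener U = (\<forall>x\<in>U. eventually (\<lambda>(x', y). x' = x \<longrightarrow> y \<in> U) uniformity)"

instance
proof
  fix a b c :: wiener and r s :: real and U :: "wiener set"
  show "a + b + c = a + (b + c)" by transfer (simp add: algebra_simps)
  show "a + b = b + a" by transfer (simp add: algebra_simps)
  show "0 + a = a" by transfer simp
  show "- a + a = 0" by transfer simp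
  show "a - b = a + - b" by (simp add: minus_wiener_def)
  show "r *\<^sub>R (a + b) = r *\<^sub>R a + r *\<^sub>R b" by transfer (simp add: algebra_simps)
  show "(r + s) *\<^sub>R a = r *\<^sub>R a + s *\<^sub>R a" by transfer (simp add: algebra_simps)
  show "r *\<^sub>R s *\<^sub>R a = (r * s) *\<^sub>R a" by transfer (simp add: algebra_simps)
  show "1 *\<^sub>R a = a" by transfer simp
  show "sgn a = inverse (norm a) *\<^sub>R a" by (rule sgn_wiener_def)
  show "dist a b = norm (a - b)" by (rule dist_wiener_def)
  show "uniformity = (INF e\<in>{0<..}. principal {(x, y :: wiener). dist x y < e})"
    by (rule uniformity_wiener_def)
  show "open U = (\<forall>x\<in>U. eventually (\<lambda>(x', y). x' = x \<longrightarrow> y \<in> U) uniformity)"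
    by (rule open_wiener_def)
  show "norm a = 0 \<longleftrightarrow> a = 0"
  proof transfer
    fix c :: "int \<times> int \<Rightarrow> real"
    assume c: "(\<lambda>p. weight p * \<bar>c p\<bar>) summable_on UNIV"
    show "(\<Sum>\<^sub>\<infinity>p. weight p * \<bar>c p\<bar>) = 0 \<longleftrightarrow> c = (\<lambda>_. 0)"
    proof
      assume "(\<Sum>\<^sub>\<infinity>p. weight p * \<bar>c p\<bar>) = 0"
      hence "weight p * \<bar>c p\<bar> = 0" for p
        using nonneg_infsum_le_0D[of "\<lambda>p. weight p * \<bar>c p\<bar>" UNIV p] c by auto
      thus "c = (\<lambda>_. 0)" by auto
    qed simp
  qed
  show "norm (a + b) \<le> norm a + norm b"
  proof transfer
    fix c d :: "int \<times> int \<Rightarrow> real"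
    assume c: "(\<lambda>p. weight p * \<bar>c p\<bar>) summable_on UNIV" and d: "(\<lambda>p. weight p * \<bar>d p\<bar>) summable_on UNIV"
    have s: "(\<lambda>p. weight p * \<bar>c p\<bar> + weight p * \<bar>d p\<bar>) summable_on UNIV"
      using c d by (rule summable_on_add)
    have le: "weight p * \<bar>c p + d p\<bar> \<le> weight p * \<bar>c p\<bar> + weight p * \<bar>d p\<bar>" for p
      using mult_left_mono[OF abs_triangle_ineq[of "c p" "d p"], of "weight p"]
      by (simp only: distrib_left weight_pos)
    have "(\<Sum>\<^sub>\<infinity>p. weight p * \<bar>c p + d p\<bar>) \<le> (\<Sum>\<^sub>\<infinity>p. weight p * \<bar>c p\<bar> + weight p * \<bar>d p\<bar>)"
      using s le by (intro infsum_mono summable_on_comparison_test[OF s]) auto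
    thus "(\<Sum>\<^sub>\<infinity>p. weight p * \<bar>c p + d p\<bar>) \<le> (\<Sum>\<^sub>\<infinity>p. weight p * \<bar>c p\<bar>) + (\<Sum>\<^sub>\<infinity>p. weight p * \<bar>d p\<bar>)"
      using c d by (simp add: infsum_add)
  qed
  show "norm (r *\<^sub>R a) = \<bar>r\<bar> * norm a"
    by transfer (simp add: abs_mult mult.left_commute infsum_cmult_right')
qed

end

lemma norm_wiener_eq: "norm c = (\<Sum>\<^sub>\<infinity>p. weight p * \<bar>coef c p\<bar>)"
  by (rule norm_wiener.rep_eq)

lemmas coef_simps [simp] =
  zero_wiener.rep_eq plus_wiener.rep_eq uminus_wiener.rep_eq scaleR_wiener.rep_eq

lemma coef_minus [simp]: "coef (a - b) p = coef a p - coef b p"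
  unfolding minus_wiener_def plus_wiener.rep_eq uminus_wiener.rep_eq by simp

lemma wiener_eqI: "(\<And>p. coef a p = coef b p) \<Longrightarrow> a = b"
  using coef_inject by blast

lemma sum_weight_coef_le: "finite F \<Longrightarrow> (\<Sum>p\<in>F. weight p * \<bar>coef c p\<bar>) \<le> norm c"
  unfolding norm_wiener_eq by (intro finite_sum_le_infsum coef_summable) auto

lemma weight_coef_le: "weight p * \<bar>coef c p\<bar> \<le> norm c"
  using sum_weight_coef_le[of "{p}" c] by simp

lemma coef_le: "\<bar>coef c p\<bar> \<le> norm c"
  using weight_coef_le[of p c] mult_right_mono[OF weight_ge_1[of p], of "\<bar>coef c p\<bar>"] by simp

text \<open>A Fatou-type criterion. Bounds on finite partial sums pass to coefficientwise limits,
  and here they become membership in the space together with a norm bound.\<close>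

lemma wiener_bounded_finite_sums:
  assumes "\<And>F. finite F \<Longrightarrow> (\<Sum>p\<in>F. weight p * \<bar>c p\<bar>) \<le> B"
  obtains a where "coef a = c" "norm a \<le> B"
proof -
  have s: "(\<lambda>p. weight p * \<bar>c p\<bar>) summable_on UNIV"
    using assms by (intro nonneg_bdd_above_summable_on bdd_aboveI[where M=B]) auto
  define a where "a = Abs_wiener c"
  have c: "coef a = c" unfolding a_def using s by (simp add: Abs_wiener_inverse)
  have "norm a \<le> B" unfolding norm_wiener_eq c
    using s assms by (intro infsum_le_finite_sums) auto
  with c show ?thesis using that by blast
qed

instance wiener :: banach
proof
  fix X :: "nat \<Rightarrow> wiener" assume X: "Cauchy X"
  have "Cauchy (\<lambda>n. coef (X n) p)" for p
  proof (rule CauchyI)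
    fix e :: real assume "0 < e"
    then obtain M where M: "norm (X m - X n) < e" if "m \<ge> M" "n \<ge> M" for m n
      using CauchyD[OF X] by blast
    have "norm (coef (X m) p - coef (X n) p) < e" if "m \<ge> M" "n \<ge> M" for m n
      using coef_le[of "X m - X n" p] M[OF that] by simp
    thus "\<exists>M. \<forall>m\<ge>M. \<forall>n\<ge>M. norm (coef (X m) p - coef (X n) p) < e" by blast
  qed
  hence "convergent (\<lambda>n. coef (X n) p)" for p by (simp add: Cauchy_convergent_iff)
  then obtain c where c: "(\<lambda>n. coef (X n) p) \<longlonglongrightarrow> c p" for p
    unfolding convergent_def by metis
  \<comment> \<open>Completeness by finite sums: on a finite set the limit in \<open>m\<close> may
    be taken under the sum, and only afterwards is the difference from \<open>c\<close> known to be
    an element of the space.\<close>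
  have ev: "\<exists>M. \<forall>n\<ge>M. \<exists>a. coef a = (\<lambda>p. coef (X n) p - c p) \<and> norm a \<le> e" if e: "e > 0" for e
  proof -
    obtain M where M: "norm (X m - X n) < e" if "m \<ge> M" "n \<ge> M" for m n
      using CauchyD[OF X e] by blast
    have "\<exists>a. coef a = (\<lambda>p. coef (X n) p - c p) \<and> norm a \<le> e" if n: "n \<ge> M" for n
    proof -
      have "(\<Sum>p\<in>F. weight p * \<bar>coef (X n) p - c p\<bar>) \<le> e" if F: "finite F" for F
      proof (rule tendsto_upperbound)
        show "(\<lambda>m. \<Sum>p\<in>F. weight p * \<bar>coef (X n) p - coef (X m) p\<bar>)
                \<longlonglongrightarrow> (\<Sum>p\<in>F. weight p * \<bar>coef (X n) p - c p\<bar>)"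
          by (intro tendsto_intros c)
        show "\<forall>\<^sub>F m in sequentially. (\<Sum>p\<in>F. weight p * \<bar>coef (X n) p - coef (X m) p\<bar>) \<le> e"
          unfolding eventually_sequentially
        proof (intro exI allI impI)
          fix m assume "M \<le> m"
          with M[OF n this] show "(\<Sum>p\<in>F. weight p * \<bar>coef (X n) p - coef (X m) p\<bar>) \<le> e"
            using sum_weight_coef_le[OF F, of "X n - X m"] by simp
        qed
      qed simp
      thus ?thesis by (metis wiener_bounded_finite_sums)
    qed
    thus ?thesis by blast
  qed
  obtain n0 a0 where a0: "coef a0 = (\<lambda>p. coef (X n0) p - c p)"
    using ev[of 1] by (metis order_refl zero_less_one)
  \<comment> \<open>The coefficient function \<open>c\<close> becomes an element by subtracting from
    one term of the sequence the element that represents its distance from \<open>c\<close>.\<close>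
  define L where "L = X n0 - a0"
  have L: "coef L p = c p" for p by (simp add: L_def a0)
  have "X \<longlonglongrightarrow> L"
  proof (rule LIMSEQ_I)
    fix e :: real assume "e > 0"
    then obtain M where M: "\<forall>n\<ge>M. \<exists>a. coef a = (\<lambda>p. coef (X n) p - c p) \<and> norm a \<le> e / 2"
      using ev[of "e / 2"] by auto
    have "norm (X n - L) < e" if n: "n \<ge> M" for n
    proof -
      obtain a where "coef a = (\<lambda>p. coef (X n) p - c p)" "norm a \<le> e / 2" using M n by blast
      moreover have "X n - L = a" by (rule wiener_eqI) (simp add: L calculation)
      ultimately show ?thesis using \<open>e > 0\<close> by simp
    qed
    thus "\<exists>no. \<forall>n\<ge>no. norm (X n - L) < e" by blast
  qed
  thus "convergent X" by (auto simp: convergent_def)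
qed

section \<open>Monomials and linear extension from them\<close>

lift_definition emon :: "int \<times> int \<Rightarrow> wiener" is "\<lambda>p q. if q = p then 1 else 0"
proof -
  fix p :: "int \<times> int"
  show "(\<lambda>q. weight q * \<bar>if q = p then 1 else 0\<bar>) summable_on UNIV"
    by (rule finite_nonzero_values_imp_summable_on) (rule finite_subset[of _ "{p}"], auto)
qed

lemma coef_emon: "coef (emon p) q = (if q = p then 1 else 0)"
  by (rule emon.rep_eq[THEN fun_cong])

lemma norm_emon [simp]: "norm (emon p) = weight p"
proof -
  have "(\<Sum>\<^sub>\<infinity>q. weight q * \<bar>coef (emon p) q\<bar>) = (\<Sum>\<^sub>\<infinity>q\<in>{p}. weight q * \<bar>coef (emon p) q\<bar>)"
    by (rule infsum_cong_neutral) (auto simp: coef_emon)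
  thus ?thesis by (simp add: norm_wiener_eq coef_emon)
qed

lemma bounded_linear_coef: "bounded_linear (\<lambda>c. coef c p)"
  by (rule bounded_linear_intro[of _ 1]) (auto simp: coef_le)

text \<open>For targets larger than the scalars, \<open>wlin u\<close> is the bounded linear extension of
  a map \<open>u\<close> on monomials with \<open>norm (u p) \<le> C * weight p\<close>.\<close>

definition wlin :: "(int \<times> int \<Rightarrow> 'b::banach) \<Rightarrow> wiener \<Rightarrow> 'b" where
  "wlin u c = (\<Sum>\<^sub>\<infinity>p. coef c p *\<^sub>R u p)"

lemma wlin_abs_summable:
  assumes "\<And>p. norm (u p) \<le> C * weight p"
  shows "(\<lambda>p. norm (coef c p *\<^sub>R u p)) summable_on UNIV"
proof (rule summable_on_comparison_test)
  show "(\<lambda>p. C * (weight p * \<bar>coef c p\<bar>)) summable_on UNIV"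
    by (intro summable_on_cmult_right coef_summable)
  show "norm (coef c p *\<^sub>R u p) \<le> C * (weight p * \<bar>coef c p\<bar>)" for p
    using mult_left_mono[OF assms[of p], of "\<bar>coef c p\<bar>"] by (simp add: mult.commute mult.left_commute)
qed auto

lemma wlin_has_sum:
  assumes "\<And>p. norm (u p) \<le> C * weight p"
  shows "((\<lambda>p. coef c p *\<^sub>R u p) has_sum wlin u c) UNIV"
  unfolding wlin_def using abs_summable_summable[OF wlin_abs_summable[OF assms]] by (rule has_sum_infsum)

lemma norm_wlin_le:
  assumes "\<And>p. norm (u p) \<le> C * weight p"
  shows "norm (wlin u c) \<le> C * norm c"
proof -
  have "norm (wlin u c) \<le> (\<Sum>\<^sub>\<infinity>p. norm (coef c p *\<^sub>R u p))"
    unfolding wlin_def using wlin_abs_summable[OF assms] by (rule norm_infsum_bound)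
  also have "\<dots> \<le> (\<Sum>\<^sub>\<infinity>p. C * (weight p * \<bar>coef c p\<bar>))"
  proof (rule infsum_mono[OF wlin_abs_summable[OF assms] summable_on_cmult_right[OF coef_summable]])
    show "norm (coef c p *\<^sub>R u p) \<le> C * (weight p * \<bar>coef c p\<bar>)" for p
      using mult_left_mono[OF assms[of p], of "\<bar>coef c p\<bar>"] by (simp add: mult.commute mult.left_commute)
  qed
  also have "\<dots> = C * norm c" by (simp add: norm_wiener_eq infsum_cmult_right')
  finally show ?thesis .
qed

lemma bounded_linear_wlin:
  assumes "\<And>p. norm (u p) \<le> C * weight p"
  shows "bounded_linear (wlin u)"
proof (rule bounded_linear_intro)
  note hs = wlin_has_sum[OF assms]
  show "wlin u (a + b) = wlin u a + wlin u b" for a b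
    using has_sum_add[OF hs[of a] hs[of b]] hs[of "a + b"]
    by (auto simp: scaleR_add_left intro: has_sum_unique)
  show "wlin u (r *\<^sub>R a) = r *\<^sub>R wlin u a" for r a
    using has_sum_scaleR[OF hs[of a], of r] hs[of "r *\<^sub>R a"] by (auto intro: has_sum_unique)
  show "norm (wlin u a) \<le> norm a * C" for a
    using norm_wlin_le[OF assms, of a] by (simp add: mult.commute)
qed

lemma wlin_emon [simp]: "wlin u (emon p) = u p"
proof -
  have "wlin u (emon p) = (\<Sum>\<^sub>\<infinity>q\<in>{p}. coef (emon p) q *\<^sub>R u q)"
    unfolding wlin_def by (rule infsum_cong_neutral) (auto simp: coef_emon)
  thus ?thesis by (simp add: coef_emon)
qed

lemma has_sum_coef_functional:
  fixes u :: "int \<times> int \<Rightarrow> wiener"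
  assumes "\<And>p. norm (u p) \<le> C * weight p"
  shows "coef (wlin u c) q = (\<Sum>\<^sub>\<infinity>p. coef c p * coef (u p) q)"
proof -
  have "((\<lambda>p. coef (coef c p *\<^sub>R u p) q) has_sum coef (wlin u c) q) UNIV"
    by (rule has_sum_bounded_linear[OF bounded_linear_coef wlin_has_sum[OF assms]])
  thus ?thesis by (simp add: infsumI)
qed

lemma wlin_emon_id: "wlin emon c = c"
proof (rule wiener_eqI)
  fix q
  have "coef (wlin emon c) q = (\<Sum>\<^sub>\<infinity>p. coef c p * coef (emon p) q)"
    by (rule has_sum_coef_functional[of _ 1]) simp
  also have "\<dots> = (\<Sum>\<^sub>\<infinity>p\<in>{q}. coef c p * coef (emon p) q)"
    by (rule infsum_cong_neutral) (auto simp: coef_emon)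
  finally show "coef (wlin emon c) q = coef c q" by (simp add: coef_emon)
qed

lemma wiener_has_sum: "((\<lambda>p. coef c p *\<^sub>R emon p) has_sum c) UNIV"
  using wlin_has_sum[of emon 1 c] by (simp add: wlin_emon_id)

lemma bounded_linear_has_sum_emon:
  assumes "bounded_linear F"
  shows "((\<lambda>p. coef c p *\<^sub>R F (emon p)) has_sum F c) UNIV"
proof -
  interpret bounded_linear F by fact
  from has_sum_bounded_linear[OF assms wiener_has_sum[of c]] show ?thesis
    by (simp add: scaleR)
qed

text \<open>Monomials span a dense subspace, so identities between bounded operators reduce to
  identities between exponents.\<close>

lemma bounded_linear_eq_on_emon:
  assumes "bounded_linear F" "bounded_linear G" "\<And>p. F (emon p) = G (emon p)"
  shows "F c = G c"
  using bounded_linear_has_sum_emon[OF assms(1), of c] bounded_linear_has_sum_emon[OF assms(2), of c]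
  by (auto simp: assms(3) intro: has_sum_unique)

section \<open>Convolution as product\<close>

instantiation wiener :: "{real_normed_algebra_1, comm_ring_1}"
begin

definition one_wiener :: wiener where
  "one_wiener = emon (0, 0)"

text \<open>Convolution, written as an iterated linear extension of addition of exponents.
  Bilinearity and the norm bound then come from \<open>wlin\<close>, the algebra laws from the
  density of monomials, and no double sum is rearranged.\<close>

definition times_wiener :: "wiener \<Rightarrow> wiener \<Rightarrow> wiener" where
  "times_wiener c d = wlin (\<lambda>p. wlin (\<lambda>q. emon (p + q)) d) c"

lemma emon_shift_bound: "norm (emon (p + q)) \<le> weight p * weight q"
  using weight_add[of p q] by simp

lemma shift_bound: "norm (wlin (\<lambda>q. emon (p + q)) d) \<le> norm d * weight p"
  using norm_wlin_le[OF emon_shift_bound, of p d] by (simp add: mult.commute)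

lemma bounded_linear_times_left: "bounded_linear (\<lambda>c. c * d :: wiener)"
  unfolding times_wiener_def using shift_bound by (rule bounded_linear_wlin)

lemma norm_times_le: "norm (c * d :: wiener) \<le> norm c * norm d"
  unfolding times_wiener_def using norm_wlin_le[OF shift_bound, of d c] by (simp add: mult.commute)

lemma bounded_linear_times_right: "bounded_linear (\<lambda>d. c * d :: wiener)"
proof (rule bounded_linear_intro)
  note hs = wlin_has_sum[OF shift_bound, where c=c]
  note bl = bounded_linear_wlin[OF emon_shift_bound]
  show "c * (a + b) = c * a + c * b" for a b
    unfolding times_wiener_def
    using has_sum_add[OF hs[of a] hs[of b]] hs[of "a + b"]
    by (auto simp: linear_simps(1)[OF bl] scaleR_add_right intro: has_sum_unique)
  show "c * (r *\<^sub>R a) = r *\<^sub>R (c * a)" for r a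
    unfolding times_wiener_def
    using has_sum_scaleR[OF hs[of a], of r] hs[of "r *\<^sub>R a"]
    by (auto simp: linear_simps(5)[OF bl] scaleR_left_commute mult.commute intro: has_sum_unique)
  show "norm (c * a) \<le> norm a * norm c" for a
    using norm_times_le[of c a] by (simp add: mult.commute)
qed

lemma emon_times: "emon p * emon q = emon (p + q)"
  by (simp add: times_wiener_def)

instance
proof
  fix a b c :: wiener and r :: real
  note l = bounded_linear_times_left and r = bounded_linear_times_right
  note ll = bounded_linear_compose[OF l l] and lr = bounded_linear_compose[OF l r]
    and rl = bounded_linear_compose[OF r l] and rr = bounded_linear_compose[OF r r]
  have 1: "emon p * emon q * emon s = emon p * (emon q * emon s)" for p q s
    by (simp add: emon_times add.assoc)
  \<comment> \<open>Monomials are replaced by general elements one factor at a time, starting from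
    the right.\<close>
  have 2: "emon p * emon q * c = emon p * (emon q * c)" for p q
    by (rule bounded_linear_eq_on_emon[of "\<lambda>c. emon p * emon q * c", OF r rr 1])
  have 3: "emon p * b * c = emon p * (b * c)" for p
    by (rule bounded_linear_eq_on_emon[of "\<lambda>b. emon p * b * c", OF lr rl 2])
  show "a * b * c = a * (b * c)"
    by (rule bounded_linear_eq_on_emon[of "\<lambda>a. a * b * c", OF ll l 3])
  have 1: "emon p * emon q = emon q * emon p" for p q
    by (simp add: emon_times add.commute)
  have 2: "emon p * b = b * emon p" for p
    by (rule bounded_linear_eq_on_emon[of "\<lambda>b. emon p * b", OF r l 1])
  show comm: "a * b = b * a" for a b :: wiener
  proof (rule bounded_linear_eq_on_emon[of "\<lambda>a. a * b", OF l r])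
    show "emon p * b = b * emon p" for p
      by (rule bounded_linear_eq_on_emon[of "\<lambda>b. emon p * b", OF r l]) (simp add: emon_times add.commute)
  qed
  show one: "1 * a = a" for a :: wiener
  proof (rule bounded_linear_eq_on_emon[of "\<lambda>a. 1 * a", OF r bounded_linear_ident])
    show "1 * emon p = emon p" for p
      unfolding one_wiener_def emon_times by (simp flip: zero_prod_def)
  qed
  show "a * 1 = a" using comm[of a 1] one[of a] by simp
  show "(a + b) * c = a * c + b * c"
    by (rule linear_simps(1)[OF l])
  show "a * (b + c) = a * b + a * c"
    by (rule linear_simps(1)[OF r])
  show "r *\<^sub>R a * b = r *\<^sub>R (a * b)"
    by (rule linear_simps(5)[OF l])
  show "a * r *\<^sub>R b = r *\<^sub>R (a * b)"
    by (rule linear_simps(5)[OF r])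
  show "norm (a * b) \<le> norm a * norm b" by (rule norm_times_le)
  show "norm (1 :: wiener) = 1" by (simp add: one_wiener_def weight_def)
  have "norm (1 :: wiener) \<noteq> norm (0 :: wiener)"
    unfolding one_wiener_def norm_emon by simp
  thus "(0 :: wiener) \<noteq> 1" by metis
qed

end

section \<open>Calculus of maps with a locally quadratic remainder\<close>

text \<open>\<open>affine_approx H h l\<close>: near \<open>0\<close>, \<open>H\<close> is \<open>h + l\<close> up to a remainder whose Lipschitz constant is
  proportional to the distance from \<open>0\<close>.\<close>

definition quad_lipschitz :: "('a::real_normed_vector \<Rightarrow> 'b::real_normed_vector) \<Rightarrow> bool" where
  "quad_lipschitz R \<longleftrightarrow> R 0 = 0 \<and> (\<exists>C>0. \<exists>d>0. \<forall>y1 y2. norm y1 \<le> d \<longrightarrow> norm y2 \<le> d \<longrightarrow>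
      norm (R y1 - R y2) \<le> C * (norm y1 + norm y2) * norm (y1 - y2))"

definition affine_approx ::
  "('a::real_normed_vector \<Rightarrow> 'b::real_normed_vector) \<Rightarrow> 'b \<Rightarrow> ('a \<Rightarrow> 'b) \<Rightarrow> bool" where
  "affine_approx H h l \<longleftrightarrow> bounded_linear l \<and> quad_lipschitz (\<lambda>y. H y - h - l y)"

lemma quad_lipschitzI:
  fixes R :: "'a::real_normed_vector \<Rightarrow> 'b::real_normed_vector"
  assumes "R 0 = 0" "d > 0"
    "\<And>y1 y2. norm y1 \<le> d \<Longrightarrow> norm y2 \<le> d \<Longrightarrow>
      norm (R y1 - R y2) \<le> C * (norm y1 + norm y2) * norm (y1 - y2)"
  shows "quad_lipschitz R"
  unfolding quad_lipschitz_def
proof (intro conjI exI allI impI)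
  show "max C 1 > 0" by simp
  fix y1 y2 :: 'a assume y: "norm y1 \<le> d" "norm y2 \<le> d"
  have "C * (norm y1 + norm y2) * norm (y1 - y2) \<le> max C 1 * (norm y1 + norm y2) * norm (y1 - y2)"
    by (intro mult_right_mono) auto
  with assms(3)[OF y] show "norm (R y1 - R y2) \<le> max C 1 * (norm y1 + norm y2) * norm (y1 - y2)"
    by linarith
qed fact+

lemma quad_lipschitzE:
  assumes "quad_lipschitz R"
  obtains C d where "C > 0" "d > 0" "R 0 = 0"
    "\<And>y1 y2. norm y1 \<le> d \<Longrightarrow> norm y2 \<le> d \<Longrightarrow>
      norm (R y1 - R y2) \<le> C * (norm y1 + norm y2) * norm (y1 - y2)"
  using assms unfolding quad_lipschitz_def by blast

lemma quad_lipschitz_0 [simp]: "quad_lipschitz (\<lambda>_. 0)"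
  by (rule quad_lipschitzI[of _ 1 0]) auto

lemma quad_lipschitz_add:
  fixes R S :: "'a::real_normed_vector \<Rightarrow> 'b::real_normed_vector"
  assumes "quad_lipschitz R" "quad_lipschitz S"
  shows "quad_lipschitz (\<lambda>y. R y + S y)"
proof -
  obtain C d where C: "C > 0" "d > 0" "R 0 = 0"
    "\<And>y1 y2. norm y1 \<le> d \<Longrightarrow> norm y2 \<le> d \<Longrightarrow>
      norm (R y1 - R y2) \<le> C * (norm y1 + norm y2) * norm (y1 - y2)"
    using assms(1) by (rule quad_lipschitzE) blast
  obtain C' d' where C': "C' > 0" "d' > 0" "S 0 = 0"
    "\<And>y1 y2. norm y1 \<le> d' \<Longrightarrow> norm y2 \<le> d' \<Longrightarrow>
      norm (S y1 - S y2) \<le> C' * (norm y1 + norm y2) * norm (y1 - y2)"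
    using assms(2) by (rule quad_lipschitzE) blast
  show ?thesis
  proof (rule quad_lipschitzI[of _ "min d d'" "C + C'"])
    fix y1 y2 :: 'a assume "norm y1 \<le> min d d'" "norm y2 \<le> min d d'"
    hence "norm (R y1 - R y2) + norm (S y1 - S y2)
      \<le> C * (norm y1 + norm y2) * norm (y1 - y2) + C' * (norm y1 + norm y2) * norm (y1 - y2)"
      by (intro add_mono C C') auto
    thus "norm (R y1 + S y1 - (R y2 + S y2)) \<le> (C + C') * (norm y1 + norm y2) * norm (y1 - y2)"
      using norm_triangle_ineq[of "R y1 - R y2" "S y1 - S y2"] by (simp add: algebra_simps)
  qed (use C C' in auto)
qed

lemma quad_lipschitz_linear:
  fixes R :: "'a::real_normed_vector \<Rightarrow> 'b::real_normed_vector"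
  assumes "quad_lipschitz R" "bounded_linear F"
  shows "quad_lipschitz (\<lambda>y. F (R y))"
proof -
  obtain C d where C: "C > 0" "d > 0" "R 0 = 0"
    "\<And>y1 y2. norm y1 \<le> d \<Longrightarrow> norm y2 \<le> d \<Longrightarrow>
      norm (R y1 - R y2) \<le> C * (norm y1 + norm y2) * norm (y1 - y2)"
    using assms(1) by (rule quad_lipschitzE) blast
  interpret F: bounded_linear F by fact
  obtain K where K: "K > 0" "\<And>x. norm (F x) \<le> norm x * K" using F.pos_bounded by blast
  show ?thesis
  proof (rule quad_lipschitzI[of _ d "C * K"])
    fix y1 y2 :: 'a assume y: "norm y1 \<le> d" "norm y2 \<le> d"
    have "norm (F (R y1) - F (R y2)) \<le> norm (R y1 - R y2) * K"
      using K(2) by (simp flip: F.diff)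
    also have "\<dots> \<le> C * (norm y1 + norm y2) * norm (y1 - y2) * K"
      using C(4)[OF y] K(1) by (intro mult_right_mono) auto
    finally show "norm (F (R y1) - F (R y2)) \<le> C * K * (norm y1 + norm y2) * norm (y1 - y2)"
      by (simp add: algebra_simps)
  qed (use C F.zero in auto)
qed

lemma affine_approx_0: "affine_approx H h l \<Longrightarrow> H 0 = h"
  unfolding affine_approx_def quad_lipschitz_def
  by (auto simp: linear_simps(3))

lemma affine_approx_const [intro]: "affine_approx (\<lambda>_. h) h (\<lambda>_. 0)"
  by (simp add: affine_approx_def bounded_linear_zero)

lemma affine_approx_linear [intro]: "bounded_linear l \<Longrightarrow> affine_approx l 0 l"
  by (simp add: affine_approx_def)

lemma affine_approx_add:
  assumes "affine_approx H h l" "affine_approx H' h' l'"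
  shows "affine_approx (\<lambda>y. H y + H' y) (h + h') (\<lambda>y. l y + l' y)"
proof -
  have "quad_lipschitz (\<lambda>y. (H y - h - l y) + (H' y - h' - l' y))"
    using assms unfolding affine_approx_def by (intro quad_lipschitz_add) auto
  also have "(\<lambda>y. (H y - h - l y) + (H' y - h' - l' y)) = (\<lambda>y. H y + H' y - (h + h') - (l y + l' y))"
    by (simp add: algebra_simps)
  finally show ?thesis
    using assms by (auto simp: affine_approx_def intro: bounded_linear_add)
qed

lemma affine_approx_compose:
  assumes "affine_approx H h l" "bounded_linear F"
  shows "affine_approx (\<lambda>y. F (H y)) (F h) (\<lambda>y. F (l y))"
proof -
  interpret F: bounded_linear F by fact
  show ?thesis
    using assms quad_lipschitz_linear[OF _ assms(2), of "\<lambda>y. H y - h - l y"]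
    by (auto simp: affine_approx_def F.diff intro: bounded_linear_compose)
qed

lemma affine_approx_minus:
  assumes "affine_approx H h l" "affine_approx H' h' l'"
  shows "affine_approx (\<lambda>y. H y - H' y) (h - h') (\<lambda>y. l y - l' y)"
  using affine_approx_add[OF assms(1) affine_approx_compose[OF assms(2) bounded_linear_minus[OF bounded_linear_ident]]]
  by simp

lemma affine_approx_local_bounds:
  assumes "affine_approx H h l"
  obtains C d where "C > 0" "d > 0"
    "\<And>y1 y2. norm y1 \<le> d \<Longrightarrow> norm y2 \<le> d \<Longrightarrow> norm (H y1 - H y2) \<le> C * norm (y1 - y2)"
    "\<And>y. norm y \<le> d \<Longrightarrow> norm (H y) \<le> C"
    "\<And>y. norm y \<le> d \<Longrightarrow> norm (H y - h) \<le> C * norm y"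
proof -
  have q: "quad_lipschitz (\<lambda>y. H y - h - l y)" and l: "bounded_linear l"
    using assms by (auto simp: affine_approx_def)
  obtain C d where C: "C > 0" "d > 0"
    "\<And>y1 y2. norm y1 \<le> d \<Longrightarrow> norm y2 \<le> d \<Longrightarrow>
      norm ((H y1 - h - l y1) - (H y2 - h - l y2)) \<le> C * (norm y1 + norm y2) * norm (y1 - y2)"
    using q by (rule quad_lipschitzE) blast
  interpret l: bounded_linear l by fact
  obtain K where K: "K > 0" "\<And>x. norm (l x) \<le> norm x * K" using l.pos_bounded by blast
  define C' where "C' = 2 * C * d + K"
  have lip: "norm (H y1 - H y2) \<le> C' * norm (y1 - y2)" if y: "norm y1 \<le> d" "norm y2 \<le> d" for y1 y2
  proof -
    have "norm (H y1 - H y2) \<le> norm ((H y1 - h - l y1) - (H y2 - h - l y2)) + norm (l (y1 - y2))"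
      using norm_triangle_ineq[of "(H y1 - h - l y1) - (H y2 - h - l y2)" "l (y1 - y2)"]
      by (simp add: l.diff)
    also have "\<dots> \<le> C * (norm y1 + norm y2) * norm (y1 - y2) + norm (y1 - y2) * K"
      by (intro add_mono C(3) y K)
    also have "\<dots> \<le> C * (d + d) * norm (y1 - y2) + norm (y1 - y2) * K"
      using y C by (intro add_mono mult_right_mono mult_left_mono) auto
    finally show ?thesis by (simp add: C'_def algebra_simps)
  qed
  have C': "C' > 0" using C K by (auto simp: C'_def intro!: add_pos_pos mult_pos_pos)
  have at0: "norm (H y - h) \<le> C' * norm y" if "norm y \<le> d" for y
    using lip[OF that, of 0] C affine_approx_0[OF assms] by simp
  define C'' where "C'' = max C' (norm h + C' * d)"
  show ?thesis
  proof (rule that[of C'' d])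
    show "norm (H y) \<le> C''" if "norm y \<le> d" for y
    proof -
      have "norm (H y) \<le> norm h + norm (H y - h)" by (metis norm_triangle_sub)
      also have "\<dots> \<le> norm h + C' * d"
        using at0[OF that] mult_left_mono[OF that, of C'] C' by linarith
      finally show ?thesis by (simp add: C''_def)
    qed
    show "norm (H y - h) \<le> C'' * norm y" if "norm y \<le> d" for y
      using at0[OF that] mult_right_mono[of C' C'' "norm y"] by (simp add: C''_def)
    show "norm (H y1 - H y2) \<le> C'' * norm (y1 - y2)" if "norm y1 \<le> d" "norm y2 \<le> d" for y1 y2
      using lip[OF that] mult_right_mono[of C' C'' "norm (y1 - y2)"] by (simp add: C''_def)
  qed (use C C' in \<open>auto simp: C''_def\<close>)
qed

text \<open>The remainder of the product splits into (H - h)(H' - h'), \<open>h\<close> times the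
  remainder of H', and the remainder of H times h'. The last two are quadratic by linearity; the
  first is quadratic because both factors are Lipschitz and vanish at 0.\<close>

lemma affine_approx_mult:
  fixes H H' :: "'a::real_normed_vector \<Rightarrow> 'b::real_normed_algebra"
  assumes "affine_approx H h l" "affine_approx H' h' l'"
  shows "affine_approx (\<lambda>y. H y * H' y) (h * h') (\<lambda>y. h * l' y + l y * h')"
proof -
  define R where "R y = H y - h - l y" for y
  define G where "G y = H' y - h'" for y
  have R: "quad_lipschitz R" using assms(1) by (simp add: affine_approx_def R_def[abs_def])
  have l: "bounded_linear l" and l': "bounded_linear l'" using assms by (auto simp: affine_approx_def)
  have G: "affine_approx G 0 l'"
    using affine_approx_minus[OF assms(2) affine_approx_const[of h']] by (simp add: G_def[abs_def])
  have q: "quad_lipschitz (\<lambda>y. (H y - h) * G y)"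
  proof -
    obtain C d where C: "C > 0" "d > 0"
      "\<And>y1 y2. norm y1 \<le> d \<Longrightarrow> norm y2 \<le> d \<Longrightarrow> norm (H y1 - H y2) \<le> C * norm (y1 - y2)"
      "\<And>y. norm y \<le> d \<Longrightarrow> norm (H y - h) \<le> C * norm y"
      using affine_approx_local_bounds[OF assms(1)] by metis
    obtain C' d' where C': "C' > 0" "d' > 0"
      "\<And>y1 y2. norm y1 \<le> d' \<Longrightarrow> norm y2 \<le> d' \<Longrightarrow> norm (G y1 - G y2) \<le> C' * norm (y1 - y2)"
      "\<And>y. norm y \<le> d' \<Longrightarrow> norm (G y) \<le> C' * norm y"
      using affine_approx_local_bounds[OF G] by (metis diff_0_right)
    show ?thesis
    proof (rule quad_lipschitzI[of _ "min d d'" "C * C'"])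
      show "(H 0 - h) * G 0 = 0" using affine_approx_0[OF assms(1)] by simp
      fix y1 y2 :: 'a assume y: "norm y1 \<le> min d d'" "norm y2 \<le> min d d'"
      have "norm ((H y1 - h) * G y1 - (H y2 - h) * G y2)
          = norm ((H y1 - h) * (G y1 - G y2) + (H y1 - H y2) * G y2)"
        by (simp add: algebra_simps)
      also have "\<dots> \<le> norm (H y1 - h) * norm (G y1 - G y2) + norm (H y1 - H y2) * norm (G y2)"
        by (intro order.trans[OF norm_triangle_ineq] add_mono norm_mult_ineq)
      also have "\<dots> \<le> (C * norm y1) * (C' * norm (y1 - y2)) + (C * norm (y1 - y2)) * (C' * norm y2)"
        using y C C' by (intro add_mono mult_mono) auto
      finally show "norm ((H y1 - h) * G y1 - (H y2 - h) * G y2)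
          \<le> C * C' * (norm y1 + norm y2) * norm (y1 - y2)"
        by (simp add: algebra_simps)
    qed (use C C' in auto)
  qed
  have q2: "quad_lipschitz (\<lambda>y. h * (G y - l' y))" "quad_lipschitz (\<lambda>y. R y * h')"
    using quad_lipschitz_linear[OF _ bounded_linear_mult_right[of h], of "\<lambda>y. G y - l' y"]
      quad_lipschitz_linear[OF R bounded_linear_mult_left[of h']] G
    by (auto simp: affine_approx_def)
  have "quad_lipschitz (\<lambda>y. (H y - h) * G y + (h * (G y - l' y) + R y * h'))"
    by (intro quad_lipschitz_add q q2)
  also have "(\<lambda>y. (H y - h) * G y + (h * (G y - l' y) + R y * h'))
      = (\<lambda>y. H y * H' y - h * h' - (h * l' y + l y * h'))"
    by (simp add: R_def G_def algebra_simps)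
  finally show ?thesis
    by (auto simp: affine_approx_def intro!: bounded_linear_add l l'
      bounded_linear_const_mult bounded_linear_mult_const)
qed

lemma quad_lipschitz_cong:
  fixes R S :: "'a::real_normed_vector \<Rightarrow> 'b::real_normed_vector"
  assumes "quad_lipschitz R" "d > 0" "\<And>y. norm y \<le> d \<Longrightarrow> R y = S y"
  shows "quad_lipschitz S"
proof -
  obtain C e where C: "C > 0" "e > 0" "R 0 = 0"
    "\<And>y1 y2. norm y1 \<le> e \<Longrightarrow> norm y2 \<le> e \<Longrightarrow>
      norm (R y1 - R y2) \<le> C * (norm y1 + norm y2) * norm (y1 - y2)"
    using assms(1) by (rule quad_lipschitzE) blast
  show ?thesis
  proof (rule quad_lipschitzI[of _ "min d e" C])
    show "S 0 = 0" using C assms(2) assms(3)[of 0] by simp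
    show "min d e > 0" using C assms by simp
    fix y1 y2 :: 'a assume y: "norm y1 \<le> min d e" "norm y2 \<le> min d e"
    show "norm (S y1 - S y2) \<le> C * (norm y1 + norm y2) * norm (y1 - y2)"
      using C(4)[of y1 y2] assms(3)[of y1] assms(3)[of y2] y by simp
  qed
qed

lemma affine_approx_cong:
  fixes H G :: "'a::real_normed_vector \<Rightarrow> 'b::real_normed_vector"
  assumes "affine_approx H h l" "d > 0" "\<And>y. norm y \<le> d \<Longrightarrow> H y = G y"
  shows "affine_approx G h l"
  using assms quad_lipschitz_cong[of "\<lambda>y. H y - h - l y" d "\<lambda>y. G y - h - l y"]
  by (simp add: affine_approx_def)

section \<open>Power series with operator coefficients\<close>

lemma norm_power_diff_le:
  fixes a b :: "'a::real_normed_algebra_1"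
  assumes "norm a \<le> r" "norm b \<le> r"
  shows "norm (a ^ Suc n - b ^ Suc n) \<le> real (Suc n) * r ^ n * norm (a - b)"
proof (induction n)
  case (Suc n)
  have r: "0 \<le> r" using assms(1) norm_ge_zero order.trans by blast
  have "a ^ Suc (Suc n) - b ^ Suc (Suc n) = a * (a ^ Suc n - b ^ Suc n) + (a - b) * b ^ Suc n"
    by (simp add: algebra_simps)
  also have "norm \<dots> \<le> norm a * norm (a ^ Suc n - b ^ Suc n) + norm (a - b) * norm (b ^ Suc n)"
    by (intro order.trans[OF norm_triangle_ineq] add_mono norm_mult_ineq)
  also have "\<dots> \<le> r * (real (Suc n) * r ^ n * norm (a - b)) + norm (a - b) * r ^ Suc n"
    using Suc.IH assms r
    by (intro add_mono mult_mono mult_left_mono order.trans[OF norm_power_ineq] power_mono) auto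
  finally show ?case by (simp add: algebra_simps)
qed simp

text \<open>The operators may grow like powers of \<open>\<rho>\<close>, as integration against the
  Taylor coefficients of the kernel does; the margin 1/2 leaves a geometric majorant.\<close>

lemma power_series_operator_summable:
  fixes x b :: "'b::{real_normed_algebra_1, banach}" and J :: "nat \<Rightarrow> 'b \<Rightarrow> 'b"
  assumes "\<And>j c. norm (J j c) \<le> C * \<rho> ^ j * norm c" "C \<ge> 0" "\<rho> > 0" "\<rho> * norm x \<le> 1/2"
  shows "summable (\<lambda>j. norm (J j (x ^ j * b) :: 'b))"
proof (rule summable_comparison_test)
  show "summable (\<lambda>j. C * norm b * (1/2) ^ j)" by (intro summable_mult summable_geometric) auto
  show "\<exists>N. \<forall>n\<ge>N. norm (norm (J n (x ^ n * b))) \<le> C * norm b * (1/2) ^ n"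
  proof (intro exI allI impI)
    fix n :: nat
    have "norm (J n (x ^ n * b)) \<le> C * \<rho> ^ n * norm (x ^ n * b)" by (rule assms)
    also have "\<dots> \<le> C * \<rho> ^ n * (norm x ^ n * norm b)"
      using assms by (intro mult_left_mono order.trans[OF norm_mult_ineq] mult_right_mono norm_power_ineq) auto
    also have "\<dots> = C * norm b * (\<rho> * norm x) ^ n" by (simp add: power_mult_distrib)
    also have "\<dots> \<le> C * norm b * (1/2) ^ n"
      using assms by (intro mult_left_mono power_mono) auto
    finally show "norm (norm (J n (x ^ n * b))) \<le> C * norm b * (1/2) ^ n" by simp
  qed
qed

text \<open>Both the square root and the expanded boundary integral have this form. The terms of
  index 0 and 1 contain the linear part, and every term from index 2 on has two small factors
  \<open>x y\<close>, so the tail is a quadratic remainder.\<close>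

lemma affine_approx_series:
  fixes x B :: "'a::real_normed_vector \<Rightarrow> 'b::{real_normed_algebra_1, banach}"
    and J :: "nat \<Rightarrow> 'b \<Rightarrow> 'b"
  assumes x: "affine_approx x 0 lx" and B: "affine_approx B b lB"
    and J: "\<And>j. bounded_linear (J j)" "\<And>j c. norm (J j c) \<le> C * \<rho> ^ j * norm c"
    and C: "C \<ge> 0" and \<rho>: "\<rho> > 0"
  shows "affine_approx (\<lambda>y. \<Sum>j. J j (x y ^ j * B y)) (J 0 b) (\<lambda>y. J 0 (lB y) + J 1 (lx y * b))"
proof -
  obtain C1 d1 where C1: "C1 > 0" "d1 > 0"
    "\<And>y1 y2. norm y1 \<le> d1 \<Longrightarrow> norm y2 \<le> d1 \<Longrightarrow> norm (x y1 - x y2) \<le> C1 * norm (y1 - y2)"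
    "\<And>y. norm y \<le> d1 \<Longrightarrow> norm (x y) \<le> C1 * norm y"
    using affine_approx_local_bounds[OF x] by (metis diff_0_right)
  obtain C2 d2 where C2: "C2 > 0" "d2 > 0"
    "\<And>y1 y2. norm y1 \<le> d2 \<Longrightarrow> norm y2 \<le> d2 \<Longrightarrow> norm (B y1 - B y2) \<le> C2 * norm (y1 - y2)"
    "\<And>y. norm y \<le> d2 \<Longrightarrow> norm (B y) \<le> C2"
    using affine_approx_local_bounds[OF B] by metis
  \<comment> \<open>The radius makes \<open>\<rho> * norm (x y)\<close> at most 1/8. The sum over
    two points is then at most 1/4, and powers of 1/4 still beat the factor
    \<open>j + 2 \<le> 2 * 2 ^ j\<close> that differences of powers produce.\<close>
  define d where "d = min (min d1 d2) (1 / (8 * C1 * \<rho>))"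
  have d: "d > 0" "d \<le> d1" "d \<le> d2" using C1 C2 \<rho> by (auto simp: d_def)
  have "d \<le> 1 / (8 * C1 * \<rho>)" by (simp add: d_def)
  hence dC: "C1 * d * \<rho> \<le> 1/8" using C1 \<rho> by (simp add: field_simps)
  have xsmall: "\<rho> * norm (x y) \<le> 1/8" if "norm y \<le> d" for y
  proof -
    have "norm (x y) \<le> C1 * d"
      using C1(4)[of y] that d C1(1) mult_left_mono[OF that, of C1] by linarith
    hence "\<rho> * norm (x y) \<le> \<rho> * (C1 * d)"
      using \<rho> by (intro mult_left_mono) auto
    thus ?thesis using dC by (simp add: mult_ac)
  qed
  have summ: "summable (\<lambda>j. norm (J j (x y ^ j * B y)))" if "norm y \<le> d" for y
    using xsmall[OF that] by (intro power_series_operator_summable[of J C \<rho>] J C \<rho>) linarith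
  define T where "T y = (\<Sum>j. J (j + 2) (x y ^ (j + 2) * B y))" for y
  have split: "J 0 (B y) + J 1 (x y * B y) + T y = (\<Sum>j. J j (x y ^ j * B y))" if "norm y \<le> d" for y
    using suminf_split_initial_segment[OF summable_norm_cancel[OF summ[OF that]], of 2]
    by (simp add: T_def eval_nat_numeral add.commute)
  define K where "K = 2 * C * C2 * \<rho>\<^sup>2 * (2 * C1 + 1 / \<rho>) * C1"
  have T: "quad_lipschitz T"
  proof (rule quad_lipschitzI[of _ d K])
    show "T 0 = 0" using affine_approx_0[OF x] bounded_linear.linear[OF J(1)]
      by (simp add: T_def linear_0)
    fix y1 y2 :: 'a assume y: "norm y1 \<le> d" "norm y2 \<le> d"
    \<comment> \<open>Both points are bounded by the sum of their norms. Of the j + 1 factors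
      \<open>r\<close> in a difference of powers, \<open>j\<close> go into the geometric series, and
      the spare one supplies \<open>norm y1 + norm y2\<close>.\<close>
    define r where "r = norm (x y1) + norm (x y2)"
    define D where "D = norm (y1 - y2)"
    have r: "0 \<le> r" "\<rho> * r \<le> 1/4" "norm (x y1) \<le> r" "norm (x y2) \<le> r"
      using xsmall[OF y(1)] xsmall[OF y(2)] by (auto simp: r_def algebra_simps)
    have rC: "r \<le> C1 * (norm y1 + norm y2)"
      using C1(4)[of y1] C1(4)[of y2] y d by (simp add: r_def algebra_simps)
    have r\<rho>: "r \<le> 1 / \<rho>" using r(2) \<rho> by (simp add: field_simps)
    have jbound: "norm (J (j + 2) (x y1 ^ (j + 2) * B y1) - J (j + 2) (x y2 ^ (j + 2) * B y2))
        \<le> C * C2 * \<rho>\<^sup>2 * r * D * (2 * C1 + 1 / \<rho>) * (1/2) ^ j" (is "?l \<le> _") for j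
    proof -
      have "x y1 ^ (j + 2) * B y1 - x y2 ^ (j + 2) * B y2
          = (x y1 ^ Suc (j + 1) - x y2 ^ Suc (j + 1)) * B y1 + x y2 ^ (j + 2) * (B y1 - B y2)"
        by (simp add: algebra_simps)
      also have "norm \<dots> \<le> norm (x y1 ^ Suc (j + 1) - x y2 ^ Suc (j + 1)) * norm (B y1)
          + norm (x y2 ^ (j + 2)) * norm (B y1 - B y2)"
        by (intro order.trans[OF norm_triangle_ineq] add_mono norm_mult_ineq)
      also have "\<dots> \<le> (real (Suc (j + 1)) * r ^ (j + 1) * norm (x y1 - x y2)) * C2
          + r ^ (j + 2) * (C2 * D)"
        using r C2 y d
        by (intro add_mono mult_mono norm_power_diff_le order.trans[OF norm_power_ineq] power_mono)
           (auto simp: D_def)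
      also have "\<dots> \<le> (real (Suc (j + 1)) * r ^ (j + 1) * (C1 * D)) * C2 + r ^ (j + 2) * (C2 * D)"
        using r C2 C1 y d
        by (intro add_mono mult_right_mono mult_left_mono) (auto simp: D_def)
      also have "\<dots> = C2 * D * r ^ (j + 1) * (real (j + 2) * C1 + r)"
        by (simp add: algebra_simps)
      finally have 1: "norm (x y1 ^ (j + 2) * B y1 - x y2 ^ (j + 2) * B y2)
          \<le> C2 * D * r ^ (j + 1) * (real (j + 2) * C1 + r)" .
      have "?l = norm (J (j + 2) (x y1 ^ (j + 2) * B y1 - x y2 ^ (j + 2) * B y2))"
        by (simp add: linear_simps(2)[OF J(1)])
      also have "\<dots> \<le> C * \<rho> ^ (j + 2) * (C2 * D * r ^ (j + 1) * (real (j + 2) * C1 + r))"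
        using C \<rho> 1 by (intro order.trans[OF J(2)] mult_left_mono) auto
      also have "\<dots> = C * C2 * \<rho>\<^sup>2 * r * D * ((\<rho> * r) ^ j * (real (j + 2) * C1 + r))"
        by (simp add: power_mult_distrib power_add algebra_simps power2_eq_square)
      also have "\<dots> \<le> C * C2 * \<rho>\<^sup>2 * r * D * ((2 * C1 + 1 / \<rho>) * (1/2) ^ j)"
      proof (rule mult_left_mono)
        have j2: "real (j + 2) \<le> 2 * 2 ^ j" by (induction j) auto
        have "real (j + 2) * C1 \<le> 2 * 2 ^ j * C1" using j2 C1 by (intro mult_right_mono) auto
        moreover have "1 * (1 / \<rho>) \<le> 2 ^ j * (1 / \<rho>)" using \<rho> by (intro mult_right_mono) auto
        ultimately have "real (j + 2) * C1 + r \<le> 2 * 2 ^ j * C1 + 2 ^ j * (1 / \<rho>)"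
          using r\<rho> by linarith
        moreover have "(\<rho> * r) ^ j \<le> (1/4) ^ j" using r \<rho> by (intro power_mono) auto
        ultimately have "(\<rho> * r) ^ j * (real (j + 2) * C1 + r) \<le> (1/4) ^ j * (2 * 2 ^ j * C1 + 2 ^ j * (1 / \<rho>))"
          using r C1 by (intro mult_mono) auto
        also have "\<dots> = (2 * C1 + 1 / \<rho>) * ((1/4) ^ j * 2 ^ j)" by (simp add: algebra_simps)
        also have "(1/4) ^ j * 2 ^ j = ((1/2) ^ j :: real)" by (simp flip: power_mult_distrib)
        finally show "(\<rho> * r) ^ j * (real (j + 2) * C1 + r) \<le> (2 * C1 + 1 / \<rho>) * (1/2) ^ j" .
      qed (use C C2 r in \<open>auto simp: D_def\<close>)
      finally show ?thesis by (simp add: mult_ac)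
    qed
    have s: "summable (\<lambda>j. J (j + 2) (x y ^ (j + 2) * B y))" if "norm y \<le> d" for y
      using summable_norm_cancel[OF summ[OF that]] by (rule summable_ignore_initial_segment)
    have geo: "summable (\<lambda>j. C * C2 * \<rho>\<^sup>2 * r * D * (2 * C1 + 1 / \<rho>) * (1/2) ^ j)"
      by (intro summable_mult summable_geometric) auto
    have "norm (T y1 - T y2)
        = norm (\<Sum>j. J (j + 2) (x y1 ^ (j + 2) * B y1) - J (j + 2) (x y2 ^ (j + 2) * B y2))"
      unfolding T_def suminf_diff[OF s[OF y(1)] s[OF y(2)]] ..
    also have "\<dots> \<le> (\<Sum>j. C * C2 * \<rho>\<^sup>2 * r * D * (2 * C1 + 1 / \<rho>) * (1/2) ^ j)"
      by (rule norm_suminf_le[OF jbound geo])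
    also have "\<dots> = 2 * C * C2 * \<rho>\<^sup>2 * (2 * C1 + 1 / \<rho>) * D * r"
      using suminf_geometric[of "1/2 :: real"] suminf_mult[OF summable_geometric[of "1/2::real"]] by simp
    also have "\<dots> \<le> 2 * C * C2 * \<rho>\<^sup>2 * (2 * C1 + 1 / \<rho>) * D * (C1 * (norm y1 + norm y2))"
      using rC C C1 C2 \<rho> by (intro mult_left_mono) (auto simp: D_def)
    finally show "norm (T y1 - T y2) \<le> K * (norm y1 + norm y2) * norm (y1 - y2)"
      by (simp add: K_def D_def mult_ac)
  qed (rule d)
  have T': "affine_approx T 0 (\<lambda>_. 0)" using T by (simp add: affine_approx_def bounded_linear_zero)
  have "affine_approx (\<lambda>y. J 0 (B y) + J 1 (x y * B y) + T y) (J 0 b + J 1 (0 * b) + 0)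
      (\<lambda>y. J 0 (lB y) + J 1 (0 * lB y + lx y * b) + 0)"
    by (intro affine_approx_add affine_approx_compose[OF _ J(1)] affine_approx_mult x B T')
  hence "affine_approx (\<lambda>y. J 0 (B y) + J 1 (x y * B y) + T y) (J 0 b) (\<lambda>y. J 0 (lB y) + J 1 (lx y * b))"
    using bounded_linear.linear[OF J(1)] by (simp add: linear_0)
  thus ?thesis using d(1) split by (rule affine_approx_cong)
qed

text \<open>Consecutive coefficients have the ratio (1/2 - j) / (j + 1), of modulus at most 1. The
  square root series thus has growth rate 1 in \<open>affine_approx_series\<close>.\<close>

lemma abs_gbinomial_half_le: "\<bar>(1/2 :: real) gchoose j\<bar> \<le> 1"
proof (induction j)
  case (Suc j)
  have "(1/2 :: real) gchoose Suc j = (1/2 gchoose j) * ((1/2 - real j) / real (Suc j))"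
    using gbinomial_absorb_comp[of "1/2::real" j] Suc_times_gbinomial[of j "1/2::real"]
      gbinomial_mult_1[of "1/2::real" j] by (simp add: field_simps)
  also have "\<bar>\<dots>\<bar> \<le> 1 * 1"
    unfolding abs_mult using Suc.IH by (intro mult_mono) (auto simp: field_simps)
  finally show ?case by simp
qed simp

text \<open>\<open>sqrt1m p\<close> is \<open>sqrt (1 + p) - 1\<close>.\<close>

definition sqrt1m :: "'a::{real_normed_algebra_1, banach} \<Rightarrow> 'a" where
  "sqrt1m p = (\<Sum>j. (if j = 0 then 0 else (1/2 :: real) gchoose j) *\<^sub>R p ^ j)"

lemma affine_approx_sqrt1m:
  fixes p :: "'a::real_normed_vector \<Rightarrow> 'b::{real_normed_algebra_1, banach}"
  assumes "affine_approx p 0 l"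
  shows "affine_approx (\<lambda>y. sqrt1m (p y)) 0 (\<lambda>y. (1/2) *\<^sub>R l y)"
proof -
  have "affine_approx (\<lambda>y. \<Sum>j. (if j = 0 then 0 else (1/2 :: real) gchoose j) *\<^sub>R (p y ^ j * 1))
     ((if 0 = (0::nat) then 0 else (1/2 :: real) gchoose 0) *\<^sub>R 1)
     (\<lambda>y. (if 0 = (0::nat) then 0 else (1/2 :: real) gchoose 0) *\<^sub>R 0 +
       (if 1 = (0::nat) then 0 else (1/2 :: real) gchoose 1) *\<^sub>R (l y * 1))"
    by (rule affine_approx_series[OF assms affine_approx_const, of _ 1 1])
       (auto intro: bounded_linear_scaleR_right bounded_linear_zero
          mult_left_le_one_le order.trans[OF mult_right_mono[OF abs_gbinomial_half_le]])
  thus ?thesis by (simp add: sqrt1m_def)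
qed

lemma sqrt1m_sums:
  fixes p :: "'a::{real_normed_algebra_1, banach}"
  assumes "norm p \<le> 1/2"
  shows "(\<lambda>j. (if j = 0 then 0 else (1/2 :: real) gchoose j) *\<^sub>R p ^ j) sums sqrt1m p"
proof -
  have "summable (\<lambda>j. norm ((if j = 0 then 0 else (1/2 :: real) gchoose j) *\<^sub>R (p ^ j * 1)))"
    by (rule power_series_operator_summable[of _ 1 1])
       (use assms in \<open>auto intro: order.trans[OF mult_right_mono[OF abs_gbinomial_half_le]]\<close>)
  from summable_norm_cancel[OF this] show ?thesis
    unfolding sqrt1m_def by (simp add: summable_sums)
qed

lemma sqrt1m_real:
  fixes p :: real
  assumes "\<bar>p\<bar> \<le> 1/2"
  shows "1 + sqrt1m p = sqrt (1 + p)"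
proof -
  have "(\<lambda>j. (1/2 gchoose j) * p ^ j) sums (1 + p) powr (1/2)"
    using assms by (intro gen_binomial_real) auto
  moreover have "(\<lambda>j. (if j = 0 then 1 else 0) + (if j = 0 then 0 else (1/2 :: real) gchoose j) *\<^sub>R p ^ j) sums (1 + sqrt1m p)"
    using sqrt1m_sums[of p] assms by (intro sums_add sums_If_finite[of "\<lambda>j. j = 0" "\<lambda>_. 1", simplified]) auto
  moreover have "(if j = 0 then 1 else 0) + (if j = 0 then 0 else (1/2 :: real) gchoose j) *\<^sub>R p ^ j
      = (1/2 gchoose j) * p ^ j" for j by simp
  ultimately show ?thesis using assms by (simp add: sums_iff powr_half_sqrt)
qed

text \<open>Bounded algebra homomorphisms commute with the series. This serves \<open>bar\<close>,
  where it yields the symmetry of the root, the evaluations at points, and the inclusion of the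
  reals in the complex numbers.\<close>

lemma bounded_hom_sqrt1m:
  fixes F :: "'a::{real_normed_algebra_1, banach} \<Rightarrow> 'b::{real_normed_algebra_1, banach}"
  assumes "bounded_linear F" "F 1 = 1" "\<And>a b. F (a * b) = F a * F b"
    and "norm p \<le> 1/2" "norm (F p) \<le> 1/2"
  shows "F (sqrt1m p) = sqrt1m (F p)"
proof -
  interpret F: bounded_linear F by fact
  have pow: "F (p ^ j) = F p ^ j" for j by (induction j) (auto simp: assms)
  have "(\<lambda>j. F ((if j = 0 then 0 else (1/2 :: real) gchoose j) *\<^sub>R p ^ j)) sums F (sqrt1m p)"
    by (rule F.sums[OF sqrt1m_sums[OF assms(4)]])
  thus ?thesis using sqrt1m_sums[OF assms(5)]
    by (simp only: F.scaleR pow sums_iff)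
qed

section \<open>Bifurcation from a simple kernel by contraction\<close>

text \<open>The bound r/2 at 0 and the Lipschitz constant 1/2 keep the ball invariant. Continuity in
  the parameter is needed at fixed \<open>u\<close> only: the contraction absorbs half of the
  difference of two fixed points, and what remains is twice the change of the map at one of
  them.\<close>

lemma uniform_contraction_continuous_fixed_point:
  fixes \<Psi> :: "'s::metric_space \<Rightarrow> 'a::banach \<Rightarrow> 'a"
  assumes r: "r \<ge> 0"
    and lip: "\<And>s u v. s \<in> S \<Longrightarrow> norm u \<le> r \<Longrightarrow> norm v \<le> r \<Longrightarrow> norm (\<Psi> s u - \<Psi> s v) \<le> norm (u - v) / 2"
    and bd: "\<And>s. s \<in> S \<Longrightarrow> norm (\<Psi> s 0) \<le> r / 2"
    and cont: "\<And>u. norm u \<le> r \<Longrightarrow> continuous_on S (\<lambda>s. \<Psi> s u)"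
  obtains U where "\<And>s. s \<in> S \<Longrightarrow> \<Psi> s (U s) = U s" "\<And>s. s \<in> S \<Longrightarrow> norm (U s) \<le> r"
    "continuous_on S U"
    "\<And>s u. s \<in> S \<Longrightarrow> norm u \<le> r \<Longrightarrow> \<Psi> s u = u \<Longrightarrow> U s = u"
proof -
  have ex: "\<exists>!u. u \<in> cball 0 r \<and> \<Psi> s u = u" if s: "s \<in> S" for s
  proof (rule Banach_fix[of _ "1/2"])
    show "complete (cball 0 r :: 'a set)" by (intro complete_eq_closed[THEN iffD2]) auto
    show "\<Psi> s ` cball 0 r \<subseteq> cball 0 r"
    proof clarify
      fix u :: 'a assume "u \<in> cball 0 r"
      hence "norm u \<le> r" by simp
      with lip[OF s this, of 0] bd[OF s] r norm_triangle_sub[of "\<Psi> s u" "\<Psi> s 0"]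
      show "\<Psi> s u \<in> cball 0 r" by simp
    qed
    show "dist (\<Psi> s u) (\<Psi> s v) \<le> 1 / 2 * dist u v" if "u \<in> cball 0 r" "v \<in> cball 0 r" for u v
      using lip[OF s, of u v] that by (simp add: dist_norm)
  qed (use r in auto)
  define U where "U s = (THE u. u \<in> cball 0 r \<and> \<Psi> s u = u)" for s
  have U: "U s \<in> cball 0 r \<and> \<Psi> s (U s) = U s" if "s \<in> S" for s
    unfolding U_def by (rule theI'[OF ex[OF that]])
  have "continuous_on S U"
    unfolding continuous_on_def
  proof
    fix s assume s: "s \<in> S"
    show "(U \<longlongrightarrow> U s) (at s within S)"
    proof (rule LIM_zero_cancel, rule Lim_null_comparison[rotated])
      have "((\<lambda>t. \<Psi> t (U s)) \<longlongrightarrow> \<Psi> s (U s)) (at s within S)"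
        using cont[of "U s"] U[OF s] s by (auto simp: continuous_on_def)
      from tendsto_mult_left[OF tendsto_norm[OF LIM_zero[OF this]], of 2]
      show "((\<lambda>t. 2 * norm (\<Psi> t (U s) - \<Psi> s (U s))) \<longlongrightarrow> 0) (at s within S)" by simp
      show "\<forall>\<^sub>F t in at s within S. norm (U t - U s) \<le> 2 * norm (\<Psi> t (U s) - \<Psi> s (U s))"
        unfolding eventually_at_filter
      proof (intro always_eventually allI impI)
        fix t assume t: "t \<in> S"
        have "U t - U s = (\<Psi> t (U t) - \<Psi> t (U s)) + (\<Psi> t (U s) - \<Psi> s (U s))"
          using U[OF t] U[OF s] by simp
        hence "norm (U t - U s) \<le> norm (\<Psi> t (U t) - \<Psi> t (U s)) + norm (\<Psi> t (U s) - \<Psi> s (U s))"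
          by (metis norm_triangle_ineq)
        with lip[OF t, of "U t" "U s"] U[OF t] U[OF s]
        show "norm (U t - U s) \<le> 2 * norm (\<Psi> t (U s) - \<Psi> s (U s))" by simp
      qed
    qed
  qed
  moreover have "U s = u" if "s \<in> S" "norm u \<le> r" "\<Psi> s u = u" for s u
    using ex[OF that(1)] U[OF that(1)] that by auto
  ultimately show ?thesis using that U by auto
qed

text \<open>The value at \<open>s = 0\<close> is the limit: a quadratic remainder at
  \<open>s\<close> times \<open>v\<close> is of second order in \<open>s\<close>.\<close>

definition rescaled :: "('a::real_normed_vector \<Rightarrow> 'b::real_normed_vector) \<Rightarrow> real \<Rightarrow> 'a \<Rightarrow> 'b" where
  "rescaled R s v = (if s = 0 then 0 else (1 / s) *\<^sub>R R (s *\<^sub>R v))"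

context
  fixes R :: "'a::real_normed_vector \<Rightarrow> 'b::real_normed_vector" and C d E :: real
  assumes C: "C > 0" and R0: "R 0 = 0"
    and R: "\<And>y1 y2. norm y1 \<le> d \<Longrightarrow> norm y2 \<le> d \<Longrightarrow>
      norm (R y1 - R y2) \<le> C * (norm y1 + norm y2) * norm (y1 - y2)"
    and E: "E > 0"
begin

text \<open>Of the two factors \<open>s\<close> in a quadratic remainder one survives the division,
  so the rescaled remainder is a small perturbation for small amplitude.\<close>

lemma rescaled_lipschitz:
  assumes "\<bar>s\<bar> * E \<le> d" "norm v \<le> E" "norm w \<le> E"
  shows "norm (rescaled R s v - rescaled R s w) \<le> 2 * C * E * \<bar>s\<bar> * norm (v - w)"
proof (cases "s = 0")
  case False
  have n: "norm (s *\<^sub>R v) \<le> \<bar>s\<bar> * E" "norm (s *\<^sub>R w) \<le> \<bar>s\<bar> * E"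
    using assms by (auto intro: mult_left_mono)
  have "norm (rescaled R s v - rescaled R s w) = norm (R (s *\<^sub>R v) - R (s *\<^sub>R w)) / \<bar>s\<bar>"
    using False by (simp add: rescaled_def divide_inverse mult.commute flip: scaleR_right_diff_distrib)
  also have "\<dots> \<le> (C * (\<bar>s\<bar> * E + \<bar>s\<bar> * E) * norm (s *\<^sub>R v - s *\<^sub>R w)) / \<bar>s\<bar>"
    using n assms C by (intro divide_right_mono order.trans[OF R] mult_right_mono mult_left_mono add_mono) auto
  also have "\<dots> = 2 * C * E * \<bar>s\<bar> * norm (v - w)"
    using False by (simp flip: scaleR_right_diff_distrib)
  finally show ?thesis .
qed (simp add: rescaled_def)

lemma rescaled_bound:
  assumes "\<bar>s\<bar> * E \<le> d" "norm v \<le> E"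
  shows "norm (rescaled R s v) \<le> 2 * C * E\<^sup>2 * \<bar>s\<bar>"
proof -
  have "rescaled R s 0 = 0" by (simp add: rescaled_def R0)
  hence "norm (rescaled R s v) \<le> 2 * C * E * \<bar>s\<bar> * norm v"
    using rescaled_lipschitz[OF assms, of 0] E by simp
  also have "\<dots> \<le> 2 * C * E * \<bar>s\<bar> * E" using assms C E by (intro mult_left_mono) auto
  finally show ?thesis by (simp add: power2_eq_square mult_ac)
qed

lemma continuous_on_rescaled:
  assumes "\<delta> * E \<le> d" "norm v \<le> E"
  shows "continuous_on {-\<delta><..<\<delta>} (\<lambda>s. rescaled R s v)"
  unfolding continuous_on_def
proof
  fix s assume s: "s \<in> {-\<delta><..<\<delta>}"
  hence s': "\<bar>s\<bar> < \<delta>" by auto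
  have bd: "\<bar>t\<bar> * E \<le> d" if "t \<in> {-\<delta><..<\<delta>}" for t
  proof -
    have "\<bar>t\<bar> \<le> \<delta>" using that by auto
    thus ?thesis using assms(1) mult_right_mono[OF _ less_imp_le[OF E], of "\<bar>t\<bar>" \<delta>] by linarith
  qed
  show "((\<lambda>s. rescaled R s v) \<longlongrightarrow> rescaled R s v) (at s within {-\<delta><..<\<delta>})"
  proof (cases "s = 0")
    case True
    show ?thesis
    proof (rule LIM_zero_cancel, rule Lim_null_comparison[rotated])
      show "((\<lambda>t. 2 * C * E\<^sup>2 * \<bar>t\<bar>) \<longlongrightarrow> 0) (at s within {-\<delta><..<\<delta>})"
        using True by (auto intro!: tendsto_eq_intros)
      show "\<forall>\<^sub>F t in at s within {-\<delta><..<\<delta>}. norm (rescaled R t v - rescaled R s v) \<le> 2 * C * E\<^sup>2 * \<bar>t\<bar>"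
        unfolding eventually_at_filter
      proof (intro always_eventually allI impI)
        fix t assume "t \<in> {-\<delta><..<\<delta>}"
        from rescaled_bound[OF bd[OF this] assms(2)]
        show "norm (rescaled R t v - rescaled R s v) \<le> 2 * C * E\<^sup>2 * \<bar>t\<bar>"
          using True by (simp add: rescaled_def[of R 0])
      qed
    qed
  next
    case False
    have n: "norm (t *\<^sub>R v) \<le> d" if "t \<in> {-\<delta><..<\<delta>}" for t
      using bd[OF that] mult_left_mono[OF assms(2), of "\<bar>t\<bar>"] by simp
    have "((\<lambda>t. R (t *\<^sub>R v)) \<longlongrightarrow> R (s *\<^sub>R v)) (at s within {-\<delta><..<\<delta>})"
    proof (rule LIM_zero_cancel, rule Lim_null_comparison[rotated])
      show "((\<lambda>t. C * (d + d) * norm (t *\<^sub>R v - s *\<^sub>R v)) \<longlongrightarrow> 0) (at s within {-\<delta><..<\<delta>})"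
        by (auto intro!: tendsto_eq_intros)
      show "\<forall>\<^sub>F t in at s within {-\<delta><..<\<delta>}. norm (R (t *\<^sub>R v) - R (s *\<^sub>R v)) \<le> C * (d + d) * norm (t *\<^sub>R v - s *\<^sub>R v)"
        unfolding eventually_at_filter
      proof (intro always_eventually allI impI)
        fix t assume t: "t \<in> {-\<delta><..<\<delta>}"
        have "norm (R (t *\<^sub>R v) - R (s *\<^sub>R v)) \<le> C * (norm (t *\<^sub>R v) + norm (s *\<^sub>R v)) * norm (t *\<^sub>R v - s *\<^sub>R v)"
          by (rule R[OF n[OF t] n[OF s]])
        also have "\<dots> \<le> C * (d + d) * norm (t *\<^sub>R v - s *\<^sub>R v)"
          using C n[OF t] n[OF s] by (intro mult_right_mono mult_left_mono add_mono) auto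
        finally show "norm (R (t *\<^sub>R v) - R (s *\<^sub>R v)) \<le> C * (d + d) * norm (t *\<^sub>R v - s *\<^sub>R v)" .
      qed
    qed
    hence "((\<lambda>t. (1 / t) *\<^sub>R R (t *\<^sub>R v)) \<longlongrightarrow> (1 / s) *\<^sub>R R (s *\<^sub>R v)) (at s within {-\<delta><..<\<delta>})"
      using False by (intro tendsto_intros) auto
    moreover have "\<forall>\<^sub>F t in at s within {-\<delta><..<\<delta>}. t \<noteq> 0"
      by (rule tendsto_imp_eventually_ne[OF tendsto_ident_at False])
    hence "\<forall>\<^sub>F t in at s within {-\<delta><..<\<delta>}. (1 / t) *\<^sub>R R (t *\<^sub>R v) = rescaled R t v"
      by eventually_elim (simp add: rescaled_def)
    ultimately have "((\<lambda>t. rescaled R t v) \<longlongrightarrow> (1 / s) *\<^sub>R R (s *\<^sub>R v)) (at s within {-\<delta><..<\<delta>})"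
      by (rule Lim_transform_eventually)
    thus ?thesis using False by (simp add: rescaled_def[of R s])
  qed
qed

end

text \<open>After division by the amplitude \<open>s\<close>, the equation for the amplitude-one corrections
  \<open>u = (\<lambda>, h)\<close> of parameter and solution is a contraction, uniformly in \<open>s\<close>.\<close>

lemma bifurcation_fixed_point:
  fixes e :: "'a::banach" and T M H :: "'a \<Rightarrow> 'a" and cf :: "'a \<Rightarrow> real"
  assumes T: "bounded_linear T" and M: "bounded_linear M" and H: "bounded_linear H" and cf: "bounded_linear cf"
    and P: "quad_lipschitz P" and Q: "quad_lipschitz Q" and \<epsilon>: "\<epsilon> > 0"
  obtains \<delta> U where "\<delta> > 0" "continuous_on {-\<delta><..<\<delta>} U" "U 0 = 0"
    "\<And>s. \<bar>s\<bar> < \<delta> \<Longrightarrow> norm (U s) \<le> \<epsilon>"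
    "\<And>s. \<bar>s\<bar> < \<delta> \<Longrightarrow> U s = - T (cf (U s) *\<^sub>R M (H (U s)) +
        (rescaled P s (e + H (U s)) + cf (U s) *\<^sub>R rescaled Q s (e + H (U s))))"
proof -
  have bd: "\<exists>K>0. \<forall>x. norm (F x) \<le> K * norm x" if "bounded_linear F" for F :: "'a \<Rightarrow> 'c::real_normed_vector"
    using bounded_linear.pos_bounded[OF that] by (metis mult.commute)
  obtain K1 where K1: "K1 > 0" "\<And>x. norm (T x) \<le> K1 * norm x" using bd[OF T] by blast
  obtain K2 where K2: "K2 > 0" "\<And>x. norm (M x) \<le> K2 * norm x" using bd[OF M] by blast
  obtain K3 where K3: "K3 > 0" "\<And>x. norm (H x) \<le> K3 * norm x" using bd[OF H] by blast
  obtain K4 where K4: "K4 > 0" "\<And>x. norm (cf x) \<le> K4 * norm x" using bd[OF cf] by blast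
  obtain C1 d1 where C1: "C1 > 0" "d1 > 0" "P 0 = 0" "\<And>y1 y2. norm y1 \<le> d1 \<Longrightarrow> norm y2 \<le> d1 \<Longrightarrow>
      norm (P y1 - P y2) \<le> C1 * (norm y1 + norm y2) * norm (y1 - y2)"
    using P by (rule quad_lipschitzE) blast
  obtain C2 d2 where C2: "C2 > 0" "d2 > 0" "Q 0 = 0" "\<And>y1 y2. norm y1 \<le> d2 \<Longrightarrow> norm y2 \<le> d2 \<Longrightarrow>
      norm (Q y1 - Q y2) \<le> C2 * (norm y1 + norm y2) * norm (y1 - y2)"
    using Q by (rule quad_lipschitzE) blast
  define E where "E = norm e + K3"
  have E: "E > 0" using K3(1) by (simp add: E_def add_nonneg_pos)
  \<comment> \<open>\<open>L1\<close> collects the bilinear term, whose Lipschitz constant is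
    proportional to the radius; \<open>L2\<close> collects the terms that carry a factor
    \<open>s\<close>; \<open>L3\<close> bounds the map at 0. Hence \<open>r\<close> can be fixed
    independently of \<open>s\<close>, and \<open>\<delta>\<close> is adapted to it.\<close>
  define L1 where "L1 = K1 * (2 * K4 * (K2 * K3))"
  define L2 where "L2 = K1 * (2 * C1 * E * K3 + (K4 * (2 * C2 * E\<^sup>2) + K4 * (2 * C2 * E * K3)))"
  define L3 where "L3 = K1 * (2 * C1 * E\<^sup>2)"
  have L: "L1 > 0" "L2 > 0" "L3 > 0"
    unfolding L1_def L2_def L3_def using K1(1) K2(1) K3(1) K4(1) C1(1) C2(1) E
    by (auto intro!: mult_pos_pos add_pos_pos)
  define r where "r = Min {1, \<epsilon>, 1 / (4 * L1)}"
  have r: "r > 0" "r \<le> 1" "r \<le> \<epsilon>" "r \<le> 1 / (4 * L1)" using L \<epsilon> by (auto simp: r_def)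
  have Lr: "L1 * r \<le> 1/4" using r(4) L(1) by (simp add: field_simps)
  define \<delta> where "\<delta> = Min {d1 / E, d2 / E, 1 / (4 * L2), r / (2 * L3)}"
  have \<delta>: "\<delta> > 0" using L r C1 C2 E by (auto simp: \<delta>_def)
  have "\<delta> \<le> d1 / E" "\<delta> \<le> d2 / E" "\<delta> \<le> 1 / (4 * L2)" "\<delta> \<le> r / (2 * L3)" by (auto simp: \<delta>_def)
  hence \<delta>E: "\<delta> * E \<le> d1" "\<delta> * E \<le> d2" and \<delta>L: "L2 * \<delta> \<le> 1/4" "L3 * \<delta> \<le> r / 2"
    using E L by (auto simp: field_simps)
  have sE: "\<bar>s\<bar> * E \<le> d1" "\<bar>s\<bar> * E \<le> d2" if "\<bar>s\<bar> < \<delta>" for s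
    using \<delta>E mult_right_mono[OF less_imp_le[OF that] less_imp_le[OF E]] by linarith+
  define p where "p s u = rescaled P s (e + H u)" for s u
  define q where "q s u = rescaled Q s (e + H u)" for s u
  define \<Psi> where "\<Psi> s u = - T (cf u *\<^sub>R M (H u) + (p s u + cf u *\<^sub>R q s u))" for s u
  have nE: "norm (e + H u) \<le> E" if "norm u \<le> r" for u
  proof -
    have "norm (H u) \<le> K3 * 1" using K3 that r by (intro order.trans[OF K3(2)] mult_left_mono) auto
    thus ?thesis using norm_triangle_ineq[of e "H u"] by (simp add: E_def)
  qed
  have Hd: "norm ((e + H u) - (e + H v)) \<le> K3 * norm (u - v)" for u v
    using K3(2)[of "u - v"] by (simp add: linear_simps(2)[OF H])
  have plip: "norm (p s u - p s v) \<le> (2 * C1 * E * K3) * \<bar>s\<bar> * norm (u - v)"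
    and qlip: "norm (q s u - q s v) \<le> (2 * C2 * E * K3) * \<bar>s\<bar> * norm (u - v)"
    if "\<bar>s\<bar> < \<delta>" "norm u \<le> r" "norm v \<le> r" for s u v
  proof -
    have "norm (p s u - p s v) \<le> 2 * C1 * E * \<bar>s\<bar> * norm ((e + H u) - (e + H v))"
      unfolding p_def using C1 E sE nE that by (intro rescaled_lipschitz[of C1 P d1 E]) auto
    also have "\<dots> \<le> 2 * C1 * E * \<bar>s\<bar> * (K3 * norm (u - v))"
      using Hd[of u v] C1 E by (intro mult_left_mono) auto
    finally show "norm (p s u - p s v) \<le> (2 * C1 * E * K3) * \<bar>s\<bar> * norm (u - v)" by (simp add: mult_ac)
    have "norm (q s u - q s v) \<le> 2 * C2 * E * \<bar>s\<bar> * norm ((e + H u) - (e + H v))"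
      unfolding q_def using C2 E sE nE that by (intro rescaled_lipschitz[of C2 Q d2 E]) auto
    also have "\<dots> \<le> 2 * C2 * E * \<bar>s\<bar> * (K3 * norm (u - v))"
      using Hd[of u v] C2 E by (intro mult_left_mono) auto
    finally show "norm (q s u - q s v) \<le> (2 * C2 * E * K3) * \<bar>s\<bar> * norm (u - v)" by (simp add: mult_ac)
  qed
  have pbd: "norm (p s u) \<le> 2 * C1 * E\<^sup>2 * \<bar>s\<bar>" and qbd: "norm (q s u) \<le> 2 * C2 * E\<^sup>2 * \<bar>s\<bar>"
    if "\<bar>s\<bar> < \<delta>" "norm u \<le> r" for s u
    unfolding p_def q_def
    using C1 C2 E sE nE that by (auto intro: rescaled_bound[of C1 P d1 E] rescaled_bound[of C2 Q d2 E])
  have cfd: "\<bar>cf u - cf v\<bar> \<le> K4 * norm (u - v)" for u v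
    using K4(2)[of "u - v"] by (simp add: linear_simps(2)[OF cf])
  have cfr: "\<bar>cf u\<bar> \<le> K4 * r" "\<bar>cf u\<bar> \<le> K4" if "norm u \<le> r" for u
    using K4(2)[of u] mult_left_mono[OF that, of K4] mult_left_mono[OF r(2), of K4] K4(1)
    unfolding real_norm_def by linarith+
  have MH: "norm (M (H u)) \<le> K2 * (K3 * norm u)" for u
    using K2 K3 by (intro order.trans[OF K2(2)] mult_left_mono) auto
  have lip: "norm (\<Psi> s u - \<Psi> s v) \<le> norm (u - v) / 2" if s: "\<bar>s\<bar> < \<delta>" and u: "norm u \<le> r" and v: "norm v \<le> r" for s u v
  proof -
    define D where "D = norm (u - v)"
    have D: "D \<ge> 0" by (simp add: D_def)
    have "norm (\<Psi> s u - \<Psi> s v)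
      = norm (T ((cf u - cf v) *\<^sub>R M (H u) + cf v *\<^sub>R M (H (u - v)) + ((p s u - p s v) +
          ((cf u - cf v) *\<^sub>R q s u + cf v *\<^sub>R (q s u - q s v)))))"
      by (subst norm_minus_cancel[symmetric], rule arg_cong[where f=norm])
        (simp add: \<Psi>_def linear_simps[OF T] linear_simps[OF M] linear_simps[OF H] algebra_simps)
    also have "\<dots> \<le> K1 * (K4 * D * (K2 * (K3 * r)) + K4 * r * (K2 * (K3 * D)) +
        ((2 * C1 * E * K3) * \<bar>s\<bar> * D + (K4 * D * (2 * C2 * E\<^sup>2 * \<bar>s\<bar>) + K4 * ((2 * C2 * E * K3) * \<bar>s\<bar> * D))))"
    proof (intro order.trans[OF K1(2)] mult_left_mono order.trans[OF norm_triangle_ineq] add_mono)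
      show "norm ((cf u - cf v) *\<^sub>R M (H u)) \<le> K4 * D * (K2 * (K3 * r))"
        unfolding norm_scaleR
        using cfd[of u v] MH[of u] u K2 K3 K4 D
        by (intro mult_mono order.trans[OF MH]) (auto simp: D_def)
      show "norm (cf v *\<^sub>R M (H (u - v))) \<le> K4 * r * (K2 * (K3 * D))"
        unfolding norm_scaleR D_def using cfr[OF v] K4 r by (intro mult_mono MH) auto
      show "norm (p s u - p s v) \<le> (2 * C1 * E * K3) * \<bar>s\<bar> * D"
        unfolding D_def by (rule plip[OF s u v])
      show "norm ((cf u - cf v) *\<^sub>R q s u) \<le> K4 * D * (2 * C2 * E\<^sup>2 * \<bar>s\<bar>)"
        unfolding norm_scaleR D_def using cfd[of u v] qbd[OF s u] K4 by (intro mult_mono) auto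
      show "norm (cf v *\<^sub>R (q s u - q s v)) \<le> K4 * ((2 * C2 * E * K3) * \<bar>s\<bar> * D)"
        unfolding norm_scaleR D_def using cfr[OF v] qlip[OF s u v] K4 by (intro mult_mono) auto
    qed (use K1 in auto)
    also have "\<dots> = (L1 * r + L2 * \<bar>s\<bar>) * D"
      by (simp add: L1_def L2_def algebra_simps)
    also have "\<dots> \<le> (1/4 + 1/4) * D"
    proof (intro mult_right_mono add_mono)
      show "L2 * \<bar>s\<bar> \<le> 1/4"
        using \<delta>L(1) mult_left_mono[OF less_imp_le[OF s] less_imp_le[OF L(2)]] by linarith
    qed (use Lr D in auto)
    finally show ?thesis by (simp add: D_def)
  qed
  have bd0: "norm (\<Psi> s 0) \<le> r / 2" if "\<bar>s\<bar> < \<delta>" for s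
  proof -
    have "norm (\<Psi> s 0) \<le> K1 * norm (p s 0)"
      unfolding \<Psi>_def norm_minus_cancel using K1(2) by (simp add: linear_simps(3)[OF cf])
    also have "\<dots> \<le> K1 * (2 * C1 * E\<^sup>2 * \<bar>s\<bar>)"
      using pbd[OF that, of 0] r K1 by (intro mult_left_mono) auto
    also have "\<dots> = L3 * \<bar>s\<bar>" by (simp add: L3_def)
    also have "\<dots> \<le> L3 * \<delta>" using that L by (intro mult_left_mono) auto
    finally show ?thesis using \<delta>L(2) by simp
  qed
  have cont: "continuous_on {-\<delta><..<\<delta>} (\<lambda>s. \<Psi> s u)" if "norm u \<le> r" for u
  proof -
    have "continuous_on {-\<delta><..<\<delta>} (\<lambda>s. p s u)" "continuous_on {-\<delta><..<\<delta>} (\<lambda>s. q s u)"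
      unfolding p_def q_def using C1 C2 E \<delta>E nE[OF that]
      by (auto intro: continuous_on_rescaled[of C1 P d1 E] continuous_on_rescaled[of C2 Q d2 E])
    thus ?thesis unfolding \<Psi>_def
      by (intro continuous_intros bounded_linear.continuous_on[OF T])
  qed
  obtain U where U: "\<And>s. s \<in> {-\<delta><..<\<delta>} \<Longrightarrow> \<Psi> s (U s) = U s"
    "\<And>s. s \<in> {-\<delta><..<\<delta>} \<Longrightarrow> norm (U s) \<le> r" "continuous_on {-\<delta><..<\<delta>} U"
    "\<And>s u. s \<in> {-\<delta><..<\<delta>} \<Longrightarrow> norm u \<le> r \<Longrightarrow> \<Psi> s u = u \<Longrightarrow> U s = u"
    using uniform_contraction_continuous_fixed_point[of r "{-\<delta><..<\<delta>}" \<Psi>] r(1) lip bd0 cont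
    by (auto simp: abs_less_iff)
  have "\<Psi> 0 0 = 0"
    by (simp add: \<Psi>_def p_def q_def rescaled_def linear_simps(3)[OF T] linear_simps(3)[OF cf])
  hence "U 0 = 0" using U(4)[of 0 0] \<delta> r by auto
  show ?thesis
  proof (rule that[OF \<delta> U(3) \<open>U 0 = 0\<close>])
    fix s assume "\<bar>s\<bar> < \<delta>"
    hence s: "s \<in> {-\<delta><..<\<delta>}" by auto
    show "norm (U s) \<le> \<epsilon>" using U(2)[OF s] r by simp
    show "U s = - T (cf (U s) *\<^sub>R M (H (U s)) +
        (rescaled P s (e + H (U s)) + cf (U s) *\<^sub>R rescaled Q s (e + H (U s))))"
      using U(1)[OF s] by (simp add: \<Psi>_def p_def q_def)
  qed
qed

section \<open>Completely monotone kernels\<close>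

text \<open>On [0, pi/2] the concave sine lies above its chord. This compares chords of the circle
  with angles.\<close>

lemma half_sine_ge: "0 \<le> \<theta> \<Longrightarrow> \<theta> \<le> pi \<Longrightarrow> \<theta> / pi \<le> sin (\<theta> / 2)"
proof -
  assume t: "0 \<le> \<theta>" "\<theta> \<le> pi"
  have "concave_on {0..pi} sin"
  proof (rule f''_le0_imp_concave)
    show "(sin has_real_derivative cos x) (at x)" for x by (rule DERIV_sin)
    show "(cos has_real_derivative - sin x) (at x)" for x by (rule DERIV_cos)
    show "- sin x \<le> 0" if "x \<in> {0..pi}" for x using that by (auto intro: sin_ge_zero)
  qed auto
  from concave_onD[OF this, of "\<theta> / pi" 0 "pi / 2"] t
  show ?thesis by (simp add: field_simps)
qed

lemma set_borel_measurable_open_cont: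
  fixes f :: "real \<Rightarrow> real"
  assumes "continuous_on {a<..<b} f"
  shows "set_borel_measurable lborel {a<..<b} f"
  unfolding set_borel_measurable_def
  using borel_measurable_continuous_on_indicator[OF _ assms] by simp

lemma sin_half_pos: "0 < \<theta> \<Longrightarrow> \<theta> < 2 * pi \<Longrightarrow> 0 < sin (\<theta> / 2)"
  by (rule sin_gt_zero) auto

section \<open>Derivative bounds and Taylor series from complete monotonicity\<close>

locale cm_kernel =
  fixes K :: "real \<Rightarrow> real"
  assumes smooth: "smooth_on_pos K"
    and cm: "completely_monotone (\<lambda>t. - deriv K t)"
    and nontriv: "\<exists>t>0. - deriv K t \<noteq> 0"
    and integ: "set_integrable lborel {0<..<1} K"
begin

definition kd :: "nat \<Rightarrow> real \<Rightarrow> real" where "kd n = (deriv ^^ n) K"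

lemma kd_0 [simp]: "kd 0 = K" by (simp add: kd_def)

lemma DERIV_kd: "t > 0 \<Longrightarrow> (kd n has_real_derivative kd (Suc n) t) (at t)"
  using smooth unfolding smooth_on_pos_def kd_def
  by (simp add: DERIV_deriv_iff_field_differentiable)

lemma continuous_on_kd: "continuous_on {0<..} (kd n)"
  by (rule continuous_at_imp_continuous_on) (auto intro: DERIV_isCont[OF DERIV_kd])

lemma isCont_kd: "t > 0 \<Longrightarrow> isCont (kd n) t"
  by (rule DERIV_isCont[OF DERIV_kd])

text \<open>\<open>deriv\<close> depends only on the values near a point, so the induction can stay
  inside the open half-line, where all derivatives exist.\<close>

lemma deriv_pow_minus: "t > 0 \<Longrightarrow> (deriv ^^ n) (\<lambda>t. - deriv K t) t = - kd (Suc n) t"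
proof (induction n arbitrary: t)
  case (Suc n)
  have "(deriv ^^ Suc n) (\<lambda>t. - deriv K t) t = deriv (\<lambda>t. - kd (Suc n) t) t"
  proof (simp, rule deriv_cong_ev)
    show "\<forall>\<^sub>F t in nhds t. (deriv ^^ n) (\<lambda>t. - deriv K t) t = - kd (Suc n) t"
      using eventually_nhds_in_open[of "{0<..}" t] Suc.prems
      by (auto elim!: eventually_mono simp: Suc.IH)
  qed simp
  also have "\<dots> = - kd (Suc (Suc n)) t"
    by (rule DERIV_imp_deriv) (intro DERIV_minus DERIV_kd Suc.prems)
  finally show ?case .
qed (simp add: kd_def)

lemma kd_sign: "t > 0 \<Longrightarrow> (-1) ^ n * kd (Suc n) t \<le> 0"
proof -
  assume t: "t > 0"
  hence "0 \<le> (-1) ^ n * (deriv ^^ n) (\<lambda>t. - deriv K t) t"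
    using cm unfolding completely_monotone_def by blast
  thus ?thesis by (simp add: deriv_pow_minus[OF t])
qed

lemma kd1_le: "t > 0 \<Longrightarrow> kd 1 t \<le> 0" and kd2_ge: "t > 0 \<Longrightarrow> kd 2 t \<ge> 0"
  using kd_sign[of t 0] kd_sign[of t 1] by (auto simp: numeral_2_eq_2)

lemma K_antimono:
  assumes "0 < s" "s \<le> t" shows "K t \<le> K s"
proof (rule DERIV_nonpos_imp_nonincreasing[OF assms(2)])
  fix x assume "s \<le> x" with assms
  show "\<exists>y. (K has_real_derivative y) (at x) \<and> y \<le> 0"
    using DERIV_kd[of x 0] kd1_le[of x] by (intro exI[of _ "kd 1 x"]) simp
qed

lemma kd1_mono:
  assumes "0 < s" "s \<le> t" shows "kd 1 s \<le> kd 1 t"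
proof (rule DERIV_nonneg_imp_nondecreasing[OF assms(2)])
  fix x assume "s \<le> x" with assms
  show "\<exists>y. (kd 1 has_real_derivative y) (at x) \<and> 0 \<le> y"
    using DERIV_kd[of x 1] kd2_ge[of x] by (intro exI[of _ "kd 2 x"]) (simp add: numeral_2_eq_2)
qed

lemma abs_K_le: "0 < a \<Longrightarrow> a \<le> t \<Longrightarrow> t \<le> b \<Longrightarrow> \<bar>K t\<bar> \<le> \<bar>K a\<bar> + \<bar>K b\<bar>"
  using K_antimono[of a t] K_antimono[of t b] by linarith

text \<open>All terms of the Taylor expansion of \<open>- K'\<close> at \<open>t\<close>, evaluated at \<open>t/2\<close>, are nonnegative.\<close>

lemma abs_kd_le:
  assumes t: "t > 0"
  shows "\<bar>kd (Suc n) t\<bar> \<le> fact n * (2 / t) ^ n * (- kd 1 (t / 2))"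
proof -
  obtain \<xi> where \<xi>: "t / 2 < \<xi>" "\<xi> < t" and eq: "kd 1 (t / 2) =
      (\<Sum>m<Suc n. kd (Suc m) t / fact m * (t / 2 - t) ^ m) + kd (Suc (Suc n)) \<xi> / fact (Suc n) * (t / 2 - t) ^ Suc n"
    using Taylor[of "Suc n" "\<lambda>m. kd (Suc m)" "kd 1" "t / 2" t t "t / 2"] t DERIV_kd
    by (auto split: if_splits)
  have neg: "(t / 2 - t) ^ m = (-1) ^ m * (t / 2) ^ m" for m
    by (simp flip: power_mult_distrib)
  have le: "kd (Suc m) s / fact m * (t / 2 - t) ^ m \<le> 0" if "s > 0" for m s
  proof -
    have "kd (Suc m) s / fact m * (t / 2 - t) ^ m = ((-1) ^ m * kd (Suc m) s) * ((t / 2) ^ m / fact m)"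
      unfolding neg by (simp add: field_simps)
    also have "\<dots> \<le> 0" using t by (intro mult_nonpos_nonneg kd_sign[OF that]) auto
    finally show ?thesis .
  qed
  have "kd 1 (t / 2) \<le> kd (Suc n) t / fact n * (t / 2 - t) ^ n"
    unfolding eq using le[of \<xi> "Suc n"] \<xi> t sum_nonpos[of "{..<n}" "\<lambda>m. kd (Suc m) t / fact m * (t / 2 - t) ^ m"] le[OF t]
    by simp
  also have "\<dots> = - (\<bar>kd (Suc n) t\<bar> * ((t / 2) ^ n / fact n))"
  proof -
    have "(-1) ^ n * kd (Suc n) t = - \<bar>kd (Suc n) t\<bar>"
      using kd_sign[OF t, of n] by (cases "even n") auto
    thus ?thesis unfolding neg by (simp add: field_simps)
  qed
  finally have "\<bar>kd (Suc n) t\<bar> * ((t / 2) ^ n / fact n) \<le> - kd 1 (t / 2)" by simp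
  thus ?thesis using t by (simp add: field_simps)
qed

text \<open>The derivative is increasing and nonpositive, so its modulus at \<open>t/2\<close> is at
  most the mean slope over [t/4, t/2]. This trades the derivative for values of the kernel, whose
  integrability is known.\<close>

lemma kd1_half_le: 
  assumes t: "t > 0"
  shows "t * (- kd 1 (t / 2)) \<le> 4 * (K (t / 4) - K (t / 2))"
proof -
  obtain z where z: "t / 4 < z" "z < t / 2" "K (t / 2) - K (t / 4) = (t / 2 - t / 4) * kd 1 z"
    using MVT2[of "t / 4" "t / 2" K "kd 1"] t DERIV_kd[of _ 0] by auto
  have "kd 1 z \<le> kd 1 (t / 2)" using z t by (intro kd1_mono) auto
  hence "t * kd 1 z \<le> t * kd 1 (t / 2)" using t by simp
  thus ?thesis using z(3) by (simp add: algebra_simps)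
qed

text \<open>The Taylor coefficients at 0 of x -> K (t (1 + x)); the power of \<open>t\<close>
  offsets the stronger singularity of the derivative.\<close>

definition kap :: "nat \<Rightarrow> real \<Rightarrow> real" where
  "kap j t = kd j t * t ^ j / fact j"

text \<open>The arguments \<open>t/2\<close> and \<open>t/4\<close> come from evaluating the Taylor
  expansion at \<open>t/2\<close> and from the mean value step that follows it.\<close>

definition kmaj :: "real \<Rightarrow> real" where
  "kmaj t = \<bar>K t\<bar> + \<bar>K (t / 4)\<bar> + \<bar>K (t / 2)\<bar>"

lemma kmaj_nonneg: "0 \<le> kmaj t" by (simp add: kmaj_def)

text \<open>Chaining \<open>abs_kd_le\<close> with \<open>kd1_half_le\<close> leaves the rate 2 per
  order and no power of \<open>t\<close>. This rate is the \<open>\<rho>\<close> with which the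
  kernel series is treated later.\<close>

lemma kap_bound:
  assumes t: "t > 0"
  shows "\<bar>kap j t\<bar> \<le> 2 * 2 ^ j * kmaj t"
proof (cases j)
  case 0
  thus ?thesis by (simp add: kap_def kmaj_def)
next
  case (Suc n)
  have "\<bar>kap j t\<bar> = \<bar>kd (Suc n) t\<bar> * (t ^ Suc n / fact (Suc n))"
    using t by (simp add: kap_def Suc abs_mult)
  also have "\<dots> \<le> fact n * (2 / t) ^ n * (- kd 1 (t / 2)) * (t ^ Suc n / fact (Suc n))"
    using t by (intro mult_right_mono abs_kd_le) auto
  also have "\<dots> = ((2 / t) ^ n * t ^ n) * (t * (- kd 1 (t / 2))) * (fact n / fact (Suc n))"
    by simp
  also have "(2 / t) ^ n * t ^ n = 2 ^ n" using t by (simp flip: power_mult_distrib)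
  also have "2 ^ n * (t * (- kd 1 (t / 2))) * (fact n / fact (Suc n)) = 2 ^ n * (t * (- kd 1 (t / 2))) / real (Suc n)"
    by (simp add: divide_simps)
  also have "\<dots> \<le> 2 ^ n * (4 * (K (t / 4) - K (t / 2))) / 1"
  proof (rule frac_le)
    show "2 ^ n * (t * (- kd 1 (t / 2))) \<le> 2 ^ n * (4 * (K (t / 4) - K (t / 2)))"
      by (rule mult_left_mono[OF kd1_half_le[OF t]]) simp
    show "0 \<le> 2 ^ n * (4 * (K (t / 4) - K (t / 2)))"
      using K_antimono[of "t / 4" "t / 2"] t by simp
  qed auto
  also have "\<dots> \<le> 2 ^ n * (4 * kmaj t)" by (auto simp: kmaj_def)
  finally show ?thesis by (simp add: Suc)
qed

lemma continuous_on_kap: "continuous_on {0<..} (kap j)"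
  unfolding kap_def by (intro continuous_intros continuous_on_kd) auto

text \<open>The intermediate point of the remainder is at least 7t/8. There the derivative bound has
  rate 2 / (7t/8), the increment is at most t/8, and their product is the convergence ratio
  2/7.\<close>

lemma K_taylor_sums:
  assumes t: "t > 0" and x: "\<bar>x\<bar> \<le> 1/8"
  shows "(\<lambda>j. kap j t * x ^ j) sums K (t * (1 + x))"
proof (cases "x = 0")
  case True
  thus ?thesis using powser_sums_zero[of "\<lambda>j. kap j t"] by (simp add: kap_def)
next
  case False
  define C where "C = t / 8 * (- kd 1 (7 * t / 16))"
  have C: "C \<ge> 0" using kd1_le[of "7 * t / 16"] t by (auto simp: C_def mult_nonneg_nonpos)
  have rem: "\<bar>K (t * (1 + x)) - (\<Sum>m<Suc n. kap m t * x ^ m)\<bar> \<le> C * (2/7) ^ n" for n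
  proof -
    have "\<bar>t * x\<bar> \<le> t * (1/8)" unfolding abs_mult using x t by (auto intro: mult_left_mono)
    hence tx: "t * x \<le> t / 8" "- (t / 8) \<le> t * x" by auto
    obtain \<xi> where \<xi>: "7 * t / 8 \<le> \<xi>" and eq: "K (t * (1 + x)) =
        (\<Sum>m<Suc n. kd m t / fact m * (t * (1 + x) - t) ^ m) + kd (Suc n) \<xi> / fact (Suc n) * (t * (1 + x) - t) ^ Suc n"
    proof -
      have "\<exists>\<xi>. (if t * (1 + x) < t then t * (1 + x) < \<xi> \<and> \<xi> < t else t < \<xi> \<and> \<xi> < t * (1 + x)) \<and> K (t * (1 + x)) =
        (\<Sum>m<Suc n. kd m t / fact m * (t * (1 + x) - t) ^ m) + kd (Suc n) \<xi> / fact (Suc n) * (t * (1 + x) - t) ^ Suc n"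
        by (rule Taylor[of "Suc n" kd K "7 * t / 8" "9 * t / 8"])
          (use t tx False DERIV_kd in \<open>auto simp: algebra_simps\<close>)
      then obtain \<xi> where "if t * (1 + x) < t then t * (1 + x) < \<xi> \<and> \<xi> < t else t < \<xi> \<and> \<xi> < t * (1 + x)"
        "K (t * (1 + x)) =
        (\<Sum>m<Suc n. kd m t / fact m * (t * (1 + x) - t) ^ m) + kd (Suc n) \<xi> / fact (Suc n) * (t * (1 + x) - t) ^ Suc n" by blast
      thus ?thesis using tx t by (intro that[of \<xi>]) (auto simp: algebra_simps split: if_splits)
    qed
    have \<xi>0: "\<xi> > 0" using \<xi> t by simp
    have "K (t * (1 + x)) - (\<Sum>m<Suc n. kap m t * x ^ m) = kd (Suc n) \<xi> / fact (Suc n) * (t * x) ^ Suc n"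
      unfolding eq by (simp add: kap_def algebra_simps power_mult_distrib)
    also have "\<bar>\<dots>\<bar> = \<bar>kd (Suc n) \<xi>\<bar> / fact (Suc n) * \<bar>t * x\<bar> ^ Suc n"
      by (simp add: abs_mult power_abs)
    also have "\<dots> \<le> (fact n * (2 / \<xi>) ^ n * (- kd 1 (\<xi> / 2))) / fact (Suc n) * (t / 8) ^ Suc n"
    proof (intro mult_mono divide_right_mono power_mono abs_kd_le[OF \<xi>0])
      show "\<bar>t * x\<bar> \<le> t / 8" using tx by (auto simp: abs_le_iff)
      have "0 \<le> - kd 1 (\<xi> / 2)" using kd1_le[of "\<xi> / 2"] \<xi>0 by simp
      thus "0 \<le> fact n * (2 / \<xi>) ^ n * (- kd 1 (\<xi> / 2)) / fact (Suc n)"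
        using \<xi>0 by (intro divide_nonneg_pos mult_nonneg_nonneg) auto
    qed auto
    also have "\<dots> = ((2 / \<xi>) ^ n * (- kd 1 (\<xi> / 2)) * (t / 8) ^ Suc n) * (fact n / fact (Suc n))"
      by simp
    also have "\<dots> = ((2 / \<xi>) ^ n * (- kd 1 (\<xi> / 2)) * (t / 8) ^ Suc n) / real (Suc n)"
      by (simp add: divide_simps)
    also have "\<dots> \<le> ((2 / (7 * t / 8)) ^ n * (- kd 1 (7 * t / 16)) * (t / 8) ^ Suc n) / 1"
    proof (intro frac_le mult_right_mono mult_mono power_mono divide_left_mono)
      have k: "0 \<le> - kd 1 (7 * t / 16)" using kd1_le[of "7 * t / 16"] t by simp
      show "0 \<le> (2 / (7 * t / 8)) ^ n * (- kd 1 (7 * t / 16)) * (t / 8) ^ Suc n"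
        using t by (intro mult_nonneg_nonneg k) auto
      show "- kd 1 (\<xi> / 2) \<le> - kd 1 (7 * t / 16)" using kd1_mono[of "7 * t / 16" "\<xi> / 2"] \<xi> t by simp
    qed (use \<xi> \<xi>0 t kd1_le[of "7 * t / 16"] kd1_le[of "\<xi> / 2"] in auto)
    also have "\<dots> = C * ((2 / (7 * t / 8)) * (t / 8)) ^ n"
      unfolding power_mult_distrib by (simp add: C_def)
    also have "(2 / (7 * t / 8)) * (t / 8) = 2 / 7" using t by simp
    finally show ?thesis .
  qed
  have "(\<lambda>n. C * (2/7) ^ n) \<longlonglongrightarrow> 0"
    by (intro tendsto_mult_right_zero LIMSEQ_realpow_zero) auto
  hence "(\<lambda>n. (\<Sum>m<Suc n. kap m t * x ^ m) - K (t * (1 + x))) \<longlonglongrightarrow> 0"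
    by (rule Lim_null_comparison[rotated])
      (use rem in \<open>auto intro!: always_eventually simp: abs_minus_commute real_norm_def\<close>)
  hence "(\<lambda>n. \<Sum>m<Suc n. kap m t * x ^ m) \<longlonglongrightarrow> K (t * (1 + x))"
    by (rule LIM_zero_cancel)
  thus ?thesis unfolding sums_def by (rule LIMSEQ_imp_Suc)
qed

section \<open>Integrability of the kernel at chord lengths\<close>

lemma K_scaled_integrable:
  assumes c: "c > 0"
  shows "set_integrable lborel {0<..<b} (\<lambda>t. K (c * t))"
proof -
  have "integrable lborel (\<lambda>t. indicator {0<..<1} (0 + c * t) *\<^sub>R K (0 + c * t))"
    using integ c unfolding set_integrable_def by (intro lborel_integrable_real_affine) auto
  also have "(\<lambda>t. indicator {0<..<1} (0 + c * t) *\<^sub>R K (0 + c * t)) = (\<lambda>t. indicator {0<..<1/c} t *\<^sub>R K (c * t))"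
    using c by (auto simp: indicator_def field_simps zero_less_mult_iff)
  finally have 1: "set_integrable lborel {0<..<1/c} (\<lambda>t. K (c * t))"
    unfolding set_integrable_def .
  \<comment> \<open>Away from 0 continuity is enough. The interval starts at half the scaled
    endpoint, so that it overlaps the part near 0.\<close>
  have 2: "set_integrable lborel {1/(2*c)..b} (\<lambda>t. K (c * t))"
  proof (rule borel_integrable_atLeastAtMost')
    have "0 < c * t" if "t \<in> {1/(2*c)..b}" for t
    proof -
      have "0 < 1/(2*c)" using c by simp
      hence "0 < t" using that less_le_trans[of 0 "1/(2*c)" t] by auto
      thus ?thesis using c by simp
    qed
    thus "continuous_on {1/(2*c)..b} (\<lambda>t. K (c * t))"
      by (intro continuous_on_compose2[OF continuous_on_kd[of 0, unfolded kd_0]] continuous_intros) auto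
  qed
  have "1/(2*c) < 1/c" using c by (simp add: field_simps)
  hence "{0<..<b} \<subseteq> {0<..<1/c} \<union> {1/(2*c)..b}" by auto
  thus ?thesis
    using set_integrable_subset[OF set_integrable_Un[OF 1 2], of "{0<..<b}"] by auto
qed

text \<open>On each half of the interval the argument lies between \<open>c\<close> and a linear
  function that vanishes at the nearer end. A decreasing kernel is controlled by its values at these
  two bounds, and the linear one is a rescaling of the given integral.\<close>

lemma K_sine_integrable:
  assumes c: "c > 0"
  shows "set_integrable lborel {0<..<2*pi} (\<lambda>\<theta>. K (c * sin (\<theta> / 2)))"
proof -
  define g where "g \<theta> = \<bar>K (c / pi * \<theta>)\<bar> + \<bar>K (c / pi * (2 * pi - \<theta>))\<bar> + \<bar>K c\<bar>" for \<theta>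
  have 1: "set_integrable lborel {0<..<2*pi} (\<lambda>\<theta>. K (c / pi * \<theta>))"
    using c by (intro K_scaled_integrable) auto
  have "integrable lborel (\<lambda>\<theta>. indicator {0<..<2*pi} (2 * pi + (-1) * \<theta>) *\<^sub>R K (c / pi * (2 * pi + (-1) * \<theta>)))"
    using 1 unfolding set_integrable_def by (intro lborel_integrable_real_affine) auto
  also have "(\<lambda>\<theta>. indicator {0<..<2*pi} (2 * pi + (-1) * \<theta>) *\<^sub>R K (c / pi * (2 * pi + (-1) * \<theta>)))
      = (\<lambda>\<theta>. indicator {0<..<2*pi} \<theta> *\<^sub>R K (c / pi * (2 * pi - \<theta>)))"
    by (auto simp: indicator_def)
  finally have 2: "set_integrable lborel {0<..<2*pi} (\<lambda>\<theta>. K (c / pi * (2 * pi - \<theta>)))"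
    unfolding set_integrable_def .
  have 3: "set_integrable lborel {0<..<2*pi} (\<lambda>\<theta>. K c)"
    unfolding set_integrable_def by simp
  have g: "set_integrable lborel {0<..<2*pi} g"
    unfolding g_def using 1 2 3 by (intro set_integral_add set_integrable_abs) auto
  have meas: "set_borel_measurable lborel {0<..<2*pi} (\<lambda>\<theta>. K (c * sin (\<theta> / 2)))"
    using c sin_half_pos
    by (intro set_borel_measurable_open_cont continuous_on_compose2[OF continuous_on_kd[of 0, unfolded kd_0]] continuous_intros) auto
  have bound: "norm (K (c * sin (\<theta> / 2))) \<le> norm (g \<theta>)" if \<theta>: "\<theta> \<in> {0<..<2*pi}" for \<theta>
  proof (cases "\<theta> \<le> pi")
    case True
    have "c * (\<theta> / pi) \<le> c * sin (\<theta> / 2)" using half_sine_ge[of \<theta>] \<theta> True c by (intro mult_left_mono) auto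
    moreover have "c * sin (\<theta> / 2) \<le> c" using c by (simp add: mult_left_le)
    ultimately have "\<bar>K (c * sin (\<theta> / 2))\<bar> \<le> \<bar>K (c / pi * \<theta>)\<bar> + \<bar>K c\<bar>"
      using c \<theta> by (intro abs_K_le) auto
    thus ?thesis by (simp add: g_def)
  next
    case False
    have "sin (\<theta> / 2) = sin ((2 * pi - \<theta>) / 2)"
      using sin_pi_minus[of "\<theta> / 2"] by (simp add: diff_divide_distrib)
    hence "c * ((2 * pi - \<theta>) / pi) \<le> c * sin (\<theta> / 2)"
      using half_sine_ge[of "2 * pi - \<theta>"] \<theta> False c by (intro mult_left_mono) auto
    moreover have "c * sin (\<theta> / 2) \<le> c" using c by (simp add: mult_left_le)
    ultimately have "\<bar>K (c * sin (\<theta> / 2))\<bar> \<le> \<bar>K (c / pi * (2 * pi - \<theta>))\<bar> + \<bar>K c\<bar>"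
      using c \<theta> by (intro abs_K_le) auto
    thus ?thesis by (simp add: g_def)
  qed
  show ?thesis
    by (rule set_integrable_bound[OF g meas]) (use bound in auto)
qed

lemma kmaj_sine_integrable: "set_integrable lborel {0<..<2*pi} (\<lambda>\<theta>. kmaj (2 * sin (\<theta> / 2)))"
  unfolding kmaj_def
  using K_sine_integrable[of 2] K_sine_integrable[of "1/2"] K_sine_integrable[of 1]
  by (intro set_integral_add set_integrable_abs) auto

lemma dominated_sine_integrable:
  assumes "continuous_on {0<..<2*pi} g" "\<And>\<theta>. 0 < \<theta> \<Longrightarrow> \<theta> < 2*pi \<Longrightarrow> \<bar>g \<theta>\<bar> \<le> C * kmaj (2 * sin (\<theta> / 2))"
  shows "set_integrable lborel {0<..<2*pi} g"
proof (rule set_integrable_bound)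
  show "set_integrable lborel {0<..<2*pi} (\<lambda>\<theta>. C * kmaj (2 * sin (\<theta> / 2)))"
    using kmaj_sine_integrable by simp
  show "set_borel_measurable lborel {0<..<2*pi} g" by (rule set_borel_measurable_open_cont) fact
  show "AE x in lborel. x \<in> {0<..<2 * pi} \<longrightarrow> norm (g x) \<le> norm (C * kmaj (2 * sin (x / 2)))"
    using assms(2) by (auto intro!: AE_I2 order.trans[OF _ abs_ge_self])
qed

lemma kap_sine_integrable: "set_integrable lborel {0<..<2*pi} (\<lambda>\<theta>. kap j (2 * sin (\<theta> / 2)))"
  by (rule dominated_sine_integrable[of _ "2 * 2 ^ j"])
     (auto intro!: kap_bound sin_half_pos continuous_on_compose2[OF continuous_on_kap] continuous_intros)

text \<open>Since the kernel decreases, \<open>t/2\<close> times its value at \<open>t\<close> is at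
  most the integral of its modulus over [t/2, t], which tends to 0 by integrability. Boundary terms
  of the integrations by parts vanish for this reason.\<close>

lemma t_K_tendsto_0: "((\<lambda>t. t * K t) \<longlongrightarrow> 0) (at_right 0)"
proof (rule tendsto_sandwich)
  have "K absolutely_integrable_on {0<..<1}"
    using integ unfolding set_integrable_def
    by (subst integrable_completion) (auto intro: borel_measurable_integrable)
  hence "(\<lambda>t. \<bar>K t\<bar>) integrable_on {0<..<1}"
    by (simp add: absolutely_integrable_on_def)
  hence abs: "(\<lambda>t. \<bar>K t\<bar>) integrable_on {0..1}"
    by (simp add: integrable_on_Icc_iff_Ioo)
  define J where "J x = integral {0..x} (\<lambda>t. \<bar>K t\<bar>)" for x
  have cJ: "continuous_on {0..1} J"
    unfolding J_def by (rule indefinite_integral_continuous_1[OF abs])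
  have ev: "\<forall>\<^sub>F t in at_right 0. t \<in> {0<..<1::real}" by (rule eventually_at_right_real) simp
  show "\<forall>\<^sub>F t in at_right 0. t * K 1 \<le> t * K t"
    using ev by eventually_elim (auto intro: mult_left_mono K_antimono)
  show "\<forall>\<^sub>F t in at_right 0. t * K t \<le> 2 * (J t - J (t / 2))"
    using ev
  proof eventually_elim
    case (elim t)
    have "(t / 2) * K t = integral {t/2..t} (\<lambda>_. K t)" using elim by simp
    also have "\<dots> \<le> integral {t/2..t} (\<lambda>t. \<bar>K t\<bar>)"
    proof (rule integral_le)
      show "(\<lambda>t. \<bar>K t\<bar>) integrable_on {t/2..t}"
        using elim by (intro integrable_on_subinterval[OF abs]) auto
      show "K t \<le> \<bar>K s\<bar>" if "s \<in> {t/2..t}" for s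
        using K_antimono[of s t] that elim by auto
    qed auto
    also have "\<dots> = J t - J (t / 2)"
    proof -
      have "integral {0..t/2} (\<lambda>t. \<bar>K t\<bar>) + integral {t/2..t} (\<lambda>t. \<bar>K t\<bar>) = integral {0..t} (\<lambda>t. \<bar>K t\<bar>)"
        using elim by (intro Henstock_Kurzweil_Integration.integral_combine integrable_on_subinterval[OF abs]) auto
      thus ?thesis by (simp add: J_def)
    qed
    finally show ?case by simp
  qed
  have J0: "(J \<longlongrightarrow> J 0) (at_right 0)"
    by (rule continuous_on_Icc_at_rightD[OF cJ]) simp
  hence "((\<lambda>t. J (t / 2)) \<longlongrightarrow> J 0) (at_right 0)"
    by (rule filterlim_compose) (auto simp: filterlim_at intro!: tendsto_eq_intros intro: eventually_mono[OF eventually_at_right_less])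
  hence "((\<lambda>t. 2 * (J t - J (t / 2))) \<longlongrightarrow> 2 * (J 0 - J 0)) (at_right 0)"
    by (intro tendsto_intros J0)
  thus "((\<lambda>t. 2 * (J t - J (t / 2))) \<longlongrightarrow> 0) (at_right 0)" by simp
  show "((\<lambda>t. t * K 1) \<longlongrightarrow> 0) (at_right 0)" by (auto intro!: tendsto_eq_intros)
qed

end

section \<open>Cosine coefficients of the kernel on the circle\<close>

lemma abs_sin_mult_le: "\<bar>sin (real n * x)\<bar> \<le> real n * \<bar>sin x\<bar>"
proof (induction n)
  case (Suc n)
  have "\<bar>sin (real (Suc n) * x)\<bar> = \<bar>sin (real n * x) * cos x + cos (real n * x) * sin x\<bar>"
    using sin_add[of "real n * x" x] by (simp add: algebra_simps)
  also have "\<dots> \<le> \<bar>sin (real n * x)\<bar> * \<bar>cos x\<bar> + \<bar>cos (real n * x)\<bar> * \<bar>sin x\<bar>"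
    by (simp flip: abs_mult)
  also have "\<dots> \<le> (real n * \<bar>sin x\<bar>) * 1 + 1 * \<bar>sin x\<bar>"
    using Suc.IH by (intro add_mono mult_mono) auto
  finally show ?case by (simp add: algebra_simps)
qed simp

text \<open>In the addition formula the modulus of \<open>cos x\<close> is below 1 in the open
  interval, and it multiplies a positive multiple of \<open>sin x\<close>; this makes the inequality
  strict.\<close>

lemma abs_sin_mult_less:
  assumes "j \<ge> 2" "0 < x" "x < pi"
  shows "\<bar>sin (real j * x)\<bar> < real j * \<bar>sin x\<bar>"
proof -
  obtain n where n: "j = Suc n" "n \<ge> 1" using assms(1) by (cases j) auto
  have s: "sin x > 0" using assms by (intro sin_gt_zero) auto
  have "(cos x)\<^sup>2 < 1" using sin_cos_squared_add[of x] zero_less_power[OF s, of 2] by linarith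
  hence c: "\<bar>cos x\<bar> < 1" by (simp only: abs_square_less_1)
  have "\<bar>sin (real j * x)\<bar> = \<bar>sin (real n * x) * cos x + cos (real n * x) * sin x\<bar>"
    using sin_add[of "real n * x" x] by (simp add: n algebra_simps)
  also have "\<dots> \<le> \<bar>sin (real n * x)\<bar> * \<bar>cos x\<bar> + \<bar>cos (real n * x)\<bar> * \<bar>sin x\<bar>"
    by (simp flip: abs_mult)
  also have "\<dots> \<le> (real n * \<bar>sin x\<bar>) * \<bar>cos x\<bar> + 1 * \<bar>sin x\<bar>"
    using abs_sin_mult_le[of n x] by (intro add_mono mult_right_mono) auto
  also have "\<dots> < (real n * \<bar>sin x\<bar>) * 1 + 1 * \<bar>sin x\<bar>"
    using c s n by (intro add_strict_right_mono mult_strict_left_mono) auto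
  finally show ?thesis by (simp add: n algebra_simps)
qed

lemma one_minus_cos_half: "1 - cos x = 2 * (sin (x / 2))\<^sup>2" for x :: real
  using cos_double_sin[of "x / 2"] by simp

lemma integral_FTC_0_2pi:
  fixes F f :: "real \<Rightarrow> real"
  assumes "\<And>x. 0 < x \<Longrightarrow> x < 2*pi \<Longrightarrow> (F has_real_derivative f x) (at x)"
    and "continuous_on {0<..<2*pi} f" and "set_integrable lborel {0<..<2*pi} f"
    and "(F \<longlongrightarrow> A) (at_right 0)" "(F \<longlongrightarrow> B) (at_left (2*pi))"
  shows "(LINT x:{0<..<2*pi}|lborel. f x) = B - A"
proof -
  have "(LBINT x=ereal 0..ereal (2*pi). f x) = B - A"
  proof (rule interval_integral_FTC_integrable)
    show "isCont f x" if "ereal 0 < ereal x" "ereal x < ereal (2*pi)" for x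
      using assms(2) that by (simp add: continuous_on_eq_continuous_at)
    show "(F has_vector_derivative f x) (at x)" if "ereal 0 < ereal x" "ereal x < ereal (2*pi)" for x
      using assms(1) that by (simp add: has_real_derivative_iff_has_vector_derivative)
  qed (use assms in \<open>simp_all add: ereal_tendsto_simps einterval_eq_Icc\<close>)
  thus ?thesis by (simp add: interval_lebesgue_integral_def einterval_eq_Icc)
qed

lemma set_integral_pos_cont:
  fixes g :: "real \<Rightarrow> real"
  assumes g: "set_integrable lborel {0<..<2*pi} g" "continuous_on {0<..<2*pi} g"
    and nn: "\<And>x. 0 < x \<Longrightarrow> x < 2*pi \<Longrightarrow> g x \<ge> 0"
    and x0: "0 < x0" "x0 < 2*pi" "g x0 > 0"
  shows "(LINT x:{0<..<2*pi}|lborel. g x) > 0"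
proof -
  have "isCont g x0" using g(2) x0 by (simp add: continuous_on_eq_continuous_at)
  then obtain d where d: "d > 0" "\<And>x. \<bar>x - x0\<bar> < d \<Longrightarrow> \<bar>g x - g x0\<bar> < g x0 / 2"
    using continuous_at_real_range[THEN iffD1, rule_format, OF \<open>isCont g x0\<close> half_gt_zero[OF x0(3)]] by auto
  define a where "a = max (x0 - d) 0"
  have a: "a < x0" "0 \<le> a" using d x0 by (auto simp: a_def)
  have ge: "g x \<ge> g x0 / 2" if "x \<in> {a<..<x0}" for x
    using d(2)[of x] that by (auto simp: a_def abs_real_def split: if_splits)
  have "0 < (x0 - a) * (g x0 / 2)" using a x0 by simp
  also have "\<dots> = (LINT x|lborel. indicator {a<..<x0} x *\<^sub>R (g x0 / 2))"
    using a by simp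
  also have "\<dots> \<le> (LINT x|lborel. indicator {0<..<2*pi} x *\<^sub>R g x)"
  proof (rule integral_mono)
    show "integrable lborel (\<lambda>x. indicator {0<..<2*pi} x *\<^sub>R g x)"
      using g(1) by (simp add: set_integrable_def)
    show "indicator {a<..<x0} x *\<^sub>R (g x0 / 2) \<le> indicator {0<..<2*pi} x *\<^sub>R g x" for x
      using ge[of x] nn[of x] a x0 by (auto simp: indicator_def)
  qed (use a in simp)
  finally show ?thesis by (simp add: set_lebesgue_integral_def)
qed

text \<open>Cosine coefficients without a normalizing factor. The chord is symmetric under
  reflection of \<theta> at pi, so there are no sine coefficients.\<close>

definition fcos :: "(real \<Rightarrow> real) \<Rightarrow> int \<Rightarrow> real" where
  "fcos \<kappa> l = (LINT \<theta>:{0<..<2*pi}|lborel. \<kappa> (2 * sin (\<theta> / 2)) * cos (real_of_int l * \<theta>))"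

lemma fcos_minus [simp]: "fcos \<kappa> (- l) = fcos \<kappa> l"
  by (simp add: fcos_def)

lemma sine_cos_integrable:
  assumes "set_integrable lborel {0<..<2*pi} (\<lambda>\<theta>. \<kappa> (2 * sin (\<theta> / 2)))"
  shows "set_integrable lborel {0<..<2*pi} (\<lambda>\<theta>. \<kappa> (2 * sin (\<theta> / 2)) * cos (c * \<theta>))"
proof (rule set_integrable_bound[OF assms])
  have "(\<lambda>\<theta>. (indicator {0<..<2*pi} \<theta> *\<^sub>R \<kappa> (2 * sin (\<theta> / 2))) * cos (c * \<theta>)) \<in> borel_measurable lborel"
    using borel_measurable_integrable[OF assms[unfolded set_integrable_def]] by (intro borel_measurable_times) auto
  thus "set_borel_measurable lborel {0<..<2*pi} (\<lambda>\<theta>. \<kappa> (2 * sin (\<theta> / 2)) * cos (c * \<theta>))"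
    by (simp add: set_borel_measurable_def mult.assoc)
qed (auto simp: abs_mult mult_left_le)

context cm_kernel
begin

lemmas K_sine2_integrable = K_sine_integrable[of 2, simplified]

lemma t_kmaj_tendsto_0: "((\<lambda>t. t * kmaj t) \<longlongrightarrow> 0) (at_right 0)"
proof -
  have sc: "((\<lambda>t. t * \<bar>K (t / c)\<bar>) \<longlongrightarrow> 0) (at_right 0)" if c: "c > 0" for c
  proof -
    have "filterlim (\<lambda>t. t / c) (at_right 0) (at_right 0)"
      using c by (auto simp: filterlim_at intro!: tendsto_eq_intros intro: eventually_mono[OF eventually_at_right_less])
    from filterlim_compose[OF t_K_tendsto_0 this]
    have "((\<lambda>t. c * \<bar>t / c * K (t / c)\<bar>) \<longlongrightarrow> c * \<bar>0\<bar>) (at_right 0)"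
      by (intro tendsto_intros)
    hence lim: "((\<lambda>t. c * \<bar>t / c * K (t / c)\<bar>) \<longlongrightarrow> 0) (at_right 0)" by simp
    have "\<forall>\<^sub>F t in at_right 0. c * \<bar>t / c * K (t / c)\<bar> = t * \<bar>K (t / c)\<bar>"
      using eventually_at_right_less[of 0] by eventually_elim (use c in \<open>simp add: abs_mult\<close>)
    from Lim_transform_eventually[OF lim this] show ?thesis .
  qed
  have "((\<lambda>t. t * \<bar>K (t / 1)\<bar> + t * \<bar>K (t / 4)\<bar> + t * \<bar>K (t / 2)\<bar>) \<longlongrightarrow> 0 + 0 + 0) (at_right 0)"
    by (intro tendsto_add sc) auto
  thus ?thesis by (simp add: kmaj_def algebra_simps)
qed

lemma sine_at_ends:
  "filterlim (\<lambda>\<theta>::real. 2 * sin (\<theta> / 2)) (at_right 0) (at_right 0)"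
  "filterlim (\<lambda>\<theta>::real. 2 * sin (\<theta> / 2)) (at_right 0) (at_left (2*pi))"
proof -
  have "\<forall>\<^sub>F \<theta>::real in at_right 0. \<theta> \<in> {0<..<2*pi}" by (rule eventually_at_right_real) simp
  hence "\<forall>\<^sub>F \<theta>::real in at_right 0. 2 * sin (\<theta> / 2) > 0"
    by eventually_elim (simp add: sin_half_pos)
  thus "filterlim (\<lambda>\<theta>::real. 2 * sin (\<theta> / 2)) (at_right 0) (at_right 0)"
    by (auto simp: filterlim_at intro!: tendsto_eq_intros elim: eventually_mono)
  have "\<forall>\<^sub>F \<theta>::real in at_left (2*pi). \<theta> \<in> {0<..<2*pi}" by (rule eventually_at_left_real) simp
  hence "\<forall>\<^sub>F \<theta>::real in at_left (2*pi). 2 * sin (\<theta> / 2) > 0"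
    by eventually_elim (simp add: sin_half_pos)
  thus "filterlim (\<lambda>\<theta>::real. 2 * sin (\<theta> / 2)) (at_right 0) (at_left (2*pi))"
    by (auto simp: filterlim_at intro!: tendsto_eq_intros elim: eventually_mono)
qed

text \<open>Both ends of the interval correspond to chord length 0, where chord times
  \<open>kmaj\<close> vanishes.\<close>

lemma tendsto_0_at_ends:
  assumes "\<And>\<theta>. 0 < \<theta> \<Longrightarrow> \<theta> < 2*pi \<Longrightarrow> \<bar>F \<theta>\<bar> \<le> C * (2 * sin (\<theta> / 2) * kmaj (2 * sin (\<theta> / 2)))"
  shows "(F \<longlongrightarrow> 0) (at_right 0)" "(F \<longlongrightarrow> 0) (at_left (2*pi))"
proof -
  have *: "(F \<longlongrightarrow> 0) A" if lim: "filterlim (\<lambda>\<theta>::real. 2 * sin (\<theta> / 2)) (at_right 0) A"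
    and ev: "\<forall>\<^sub>F \<theta> in A. \<theta> \<in> {0<..<2*pi}" for A
  proof (rule Lim_null_comparison)
    show "\<forall>\<^sub>F \<theta> in A. norm (F \<theta>) \<le> C * (2 * sin (\<theta> / 2) * kmaj (2 * sin (\<theta> / 2)))"
      using ev by eventually_elim (use assms in auto)
    show "((\<lambda>\<theta>. C * (2 * sin (\<theta> / 2) * kmaj (2 * sin (\<theta> / 2)))) \<longlongrightarrow> 0) A"
      by (intro tendsto_mult_right_zero filterlim_compose[OF t_kmaj_tendsto_0 lim])
  qed
  show "(F \<longlongrightarrow> 0) (at_right 0)" by (rule *[OF sine_at_ends(1)]) (rule eventually_at_right_real, simp)
  show "(F \<longlongrightarrow> 0) (at_left (2*pi))" by (rule *[OF sine_at_ends(2)]) (rule eventually_at_left_real, simp)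
qed

lemma DERIV_kd_sine [derivative_intros]:
  assumes "0 < \<theta>" "\<theta> < 2*pi"
  shows "((\<lambda>\<theta>. kd n (2 * sin (\<theta> / 2))) has_real_derivative kd (Suc n) (2 * sin (\<theta> / 2)) * cos (\<theta> / 2)) (at \<theta>)"
proof -
  have "((\<lambda>\<theta>. 2 * sin (\<theta> / 2)) has_real_derivative cos (\<theta> / 2)) (at \<theta>)"
    by (auto intro!: derivative_eq_intros)
  from DERIV_chain2[OF DERIV_kd this] show ?thesis using assms sin_half_pos by simp
qed

lemmas DERIV_K_sine = DERIV_kd_sine[of _ 0, unfolded kd_0, simplified]

lemma continuous_on_kd_sine [continuous_intros]:
  "continuous_on {0<..<2*pi} (\<lambda>\<theta>. kd n (2 * sin (\<theta> / 2)))"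
  by (intro continuous_on_compose2[OF continuous_on_kd] continuous_intros) (auto simp: sin_half_pos)

lemmas continuous_on_K_sine [continuous_intros] = continuous_on_kd_sine[of 0, unfolded kd_0]

text \<open>An integration by parts that removes the derivative of K from the linearized equation.
  The four cosines combine so that \<open>kap 1\<close> times them is the angular derivative of K at
  the chord, times a smooth factor that vanishes at both ends.\<close>

lemma kap1_fcos:
  fixes n :: nat
  assumes "n \<ge> 1"
  shows "fcos (kap 1) (int n) + fcos (kap 1) (int n - 1) - fcos (kap 1) 0 - fcos (kap 1) 1
    = 2 * (fcos K 1 - real n * fcos K (int n) + (real n - 1) * fcos K (int n - 1))"
proof -
  let ?t = "\<lambda>\<theta>::real. 2 * sin (\<theta> / 2)"
  \<comment> \<open>The product whose derivative is integrated. The extra chord factor makes it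
    vanish at both ends of the interval although K may be unbounded there.\<close>
  define F where "F \<theta> = K (?t \<theta>) * (?t \<theta> * (2 * (cos ((real n - 1/2) * \<theta>) - cos (\<theta> / 2))))" for \<theta>
  define f1 where "f1 \<theta> = kap 1 (?t \<theta>) * cos (real n * \<theta>) + kap 1 (?t \<theta>) * cos ((real n - 1) * \<theta>)
     - kap 1 (?t \<theta>) * cos (0 * \<theta>) - kap 1 (?t \<theta>) * cos (1 * \<theta>)" for \<theta>
  define f2 where "f2 \<theta> = 2 * (K (?t \<theta>) * cos (1 * \<theta>) - real n * (K (?t \<theta>) * cos (real n * \<theta>))
     + (real n - 1) * (K (?t \<theta>) * cos ((real n - 1) * \<theta>)))" for \<theta>
  note i1 = sine_cos_integrable[OF kap_sine_integrable[of 1]]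
  note i2 = sine_cos_integrable[OF K_sine2_integrable]
  have i: "set_integrable lborel {0<..<2*pi} f1" "set_integrable lborel {0<..<2*pi} f2"
    unfolding f1_def f2_def by (intro set_integral_add set_integral_diff set_integrable_mult_right i1 i2)+
  have "(LINT \<theta>:{0<..<2*pi}|lborel. f1 \<theta> - f2 \<theta>) = 0 - 0"
  proof (rule integral_FTC_0_2pi)
    fix \<theta> :: real assume \<theta>: "0 < \<theta>" "\<theta> < 2*pi"
    define x where "x = \<theta> / 2"
    define y where "y = (real n - 1/2) * \<theta>"
    have eqs: "\<theta> = 2 * x" "real n * \<theta> = y + x" "(real n - 1) * \<theta> = y - x" "\<theta> / 2 = x"
      by (auto simp: x_def y_def algebra_simps)
    have es: "cos (real n * \<theta>) = cos (y + x)" "cos ((real n - 1) * \<theta>) = cos (y - x)"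
      "cos (0 * \<theta>) = 1" "cos (1 * \<theta>) = cos (2 * x)" "sin (\<theta> / 2) = sin x"
      by (simp_all only: eqs(2-4), simp_all add: x_def)
    have dF: "(F has_real_derivative kd 1 (2 * sin x) * cos x * (2 * sin x * (2 * (cos y - cos x))) +
        K (2 * sin x) * (cos x * (2 * (cos y - cos x)) + 2 * sin x * (2 * (- ((real n - 1/2) * sin y) + sin x / 2)))) (at \<theta>)"
      unfolding F_def
      by (auto intro!: derivative_eq_intros DERIV_K_sine \<theta> simp: x_def y_def algebra_simps)
    \<comment> \<open>Turning sums into products isolates the factor \<open>cos x\<close>, which is
      the derivative of the chord; it completes the derivative of K to an angular
      derivative.\<close>
    have c1: "cos (y + x) + cos (y - x) = 2 * cos y * cos x" by (simp add: cos_add cos_diff)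
    have c2: "1 + cos (2 * x) = 2 * cos x * cos x" by (simp add: cos_double_cos power2_eq_square)
    have "f1 \<theta> = kd 1 (2 * sin x) * (2 * sin x) * (cos (y + x) + cos (y - x) - (1 + cos (2 * x)))"
      unfolding f1_def es by (simp add: kap_def algebra_simps)
    also have "\<dots> = kd 1 (2 * sin x) * cos x * (2 * sin x * (2 * (cos y - cos x)))"
      unfolding c1 c2 by (simp add: algebra_simps)
    finally have f1: "f1 \<theta> = \<dots>" .
    have c3: "cos (2 * x) = (cos x)\<^sup>2 - (sin x)\<^sup>2" by (rule cos_double)
    have "- f2 \<theta> = K (2 * sin x) * (2 * (real n * cos (y + x) - (real n - 1) * cos (y - x) - cos (2 * x)))"
      unfolding f2_def es by (simp add: algebra_simps)
    also have "\<dots> = K (2 * sin x) * (cos x * (2 * (cos y - cos x)) + 2 * sin x * (2 * (- ((real n - 1/2) * sin y) + sin x / 2)))"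
      unfolding c3 by (simp add: cos_add cos_diff algebra_simps power2_eq_square)
    finally have f2: "- f2 \<theta> = \<dots>" .
    show "(F has_real_derivative f1 \<theta> - f2 \<theta>) (at \<theta>)"
      using dF unfolding f1[symmetric] f2[symmetric] by simp
  next
    show "continuous_on {0<..<2*pi} (\<lambda>\<theta>. f1 \<theta> - f2 \<theta>)"
      unfolding f1_def f2_def kap_def by (intro continuous_intros) auto
    have bd: "\<bar>F \<theta>\<bar> \<le> 4 * (?t \<theta> * kmaj (?t \<theta>))" if \<theta>: "0 < \<theta>" "\<theta> < 2*pi" for \<theta>
    proof -
      have s: "0 < ?t \<theta>" using sin_half_pos[OF \<theta>] by simp
      have 2: "\<bar>2 * (cos ((real n - 1/2) * \<theta>) - cos (\<theta> / 2))\<bar> \<le> 4"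
      proof -
        have "\<bar>2 * (cos a - cos b)\<bar> \<le> 4" for a b :: real
          using cos_le_one[of a] cos_le_one[of b] cos_ge_minus_one[of a] cos_ge_minus_one[of b] by (smt (verit))
        thus ?thesis .
      qed
      have "\<bar>F \<theta>\<bar> = \<bar>K (?t \<theta>)\<bar> * (?t \<theta> * \<bar>2 * (cos ((real n - 1/2) * \<theta>) - cos (\<theta> / 2))\<bar>)"
        unfolding F_def abs_mult[of "K _"] abs_mult[of "2 * sin _"] using s by simp
      also have "\<dots> \<le> kmaj (?t \<theta>) * (?t \<theta> * 4)"
        using s 2 by (intro mult_mono mult_left_mono) (auto simp: kmaj_def)
      finally show ?thesis by (simp add: mult_ac)
    qed
    show "(F \<longlongrightarrow> 0) (at_right 0)" "(F \<longlongrightarrow> 0) (at_left (2*pi))"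
      using tendsto_0_at_ends[OF bd] by auto
    show "set_integrable lborel {0<..<2*pi} (\<lambda>\<theta>. f1 \<theta> - f2 \<theta>)"
      using i by (rule set_integral_diff)
  qed
  hence "(LINT \<theta>:{0<..<2*pi}|lborel. f1 \<theta>) = (LINT \<theta>:{0<..<2*pi}|lborel. f2 \<theta>)"
    using set_integral_diff(2)[OF i] by simp
  moreover have "(LINT \<theta>:{0<..<2*pi}|lborel. f1 \<theta>)
      = (LINT \<theta>:{0<..<2*pi}|lborel. kap 1 (?t \<theta>) * cos (real n * \<theta>))
      + (LINT \<theta>:{0<..<2*pi}|lborel. kap 1 (?t \<theta>) * cos ((real n - 1) * \<theta>))
      - (LINT \<theta>:{0<..<2*pi}|lborel. kap 1 (?t \<theta>) * cos (0 * \<theta>))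
      - (LINT \<theta>:{0<..<2*pi}|lborel. kap 1 (?t \<theta>) * cos (1 * \<theta>))"
    unfolding f1_def by (simp only: set_integral_add set_integral_diff i1)
  moreover have "(LINT \<theta>:{0<..<2*pi}|lborel. f2 \<theta>)
      = 2 * ((LINT \<theta>:{0<..<2*pi}|lborel. K (?t \<theta>) * cos (1 * \<theta>))
      - real n * (LINT \<theta>:{0<..<2*pi}|lborel. K (?t \<theta>) * cos (real n * \<theta>))
      + (real n - 1) * (LINT \<theta>:{0<..<2*pi}|lborel. K (?t \<theta>) * cos ((real n - 1) * \<theta>)))"
    unfolding f2_def
    by (simp only: set_integral_add set_integral_diff set_integral_mult_right set_integrable_mult_right i2)
  ultimately show ?thesis by (simp add: fcos_def)
qed

text \<open>\<open>ddK\<close> is the second derivative of \<open>\<theta> \<mapsto> K (2 sin (\<theta>/2))\<close>; two integrations by parts turn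
  the cosine coefficient \<open>fcos K k\<close> into the integral of \<open>gk k\<close>.\<close>

definition ddK :: "real \<Rightarrow> real" where
  "ddK \<theta> = kd 2 (2 * sin (\<theta> / 2)) * (cos (\<theta> / 2))\<^sup>2 - kd 1 (2 * sin (\<theta> / 2)) * sin (\<theta> / 2) / 2"

definition gk :: "nat \<Rightarrow> real \<Rightarrow> real" where
  "gk k \<theta> = ddK \<theta> * (1 - cos (real k * \<theta>)) / (real k)\<^sup>2"

lemma ddK_nonneg: "0 < \<theta> \<Longrightarrow> \<theta> < 2*pi \<Longrightarrow> ddK \<theta> \<ge> 0"
  unfolding ddK_def using kd2_ge[of "2 * sin (\<theta> / 2)"] kd1_le[of "2 * sin (\<theta> / 2)"] sin_half_pos[of \<theta>]
  by (smt (verit) divide_nonneg_pos mult_nonneg_nonneg mult_nonpos_nonneg zero_le_power2 divide_nonpos_pos)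

lemma gk_eq: "gk k \<theta> = ddK \<theta> * (2 * (sin (real k * (\<theta> / 2)) / real k)\<^sup>2)"
  unfolding gk_def one_minus_cos_half by (simp add: power_divide)

lemma gk_nonneg: "0 < \<theta> \<Longrightarrow> \<theta> < 2*pi \<Longrightarrow> gk k \<theta> \<ge> 0"
  unfolding gk_eq by (intro mult_nonneg_nonneg ddK_nonneg) auto

text \<open>The sine of j times an angle is at most \<open>j\<close> times the sine in modulus, and
  the density \<open>ddK\<close> is nonnegative; so passing to a multiple of the frequency can only
  lower the integrand.\<close>

lemma gk_le:
  assumes "0 < \<theta>" "\<theta> < 2*pi" "m \<ge> 1" "j \<ge> 1"
  shows "gk (j * m) \<theta> \<le> gk m \<theta>"
proof -
  have "\<bar>sin (real (j * m) * (\<theta> / 2)) / real (j * m)\<bar> \<le> \<bar>sin (real m * (\<theta> / 2)) / real m\<bar>"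
    using abs_sin_mult_le[of j "real m * (\<theta> / 2)"] assms by (simp add: field_simps)
  hence "(sin (real (j * m) * (\<theta> / 2)) / real (j * m))\<^sup>2 \<le> (sin (real m * (\<theta> / 2)) / real m)\<^sup>2"
    by (simp only: abs_le_square_iff)
  thus ?thesis unfolding gk_eq using ddK_nonneg[OF assms(1,2)] by (intro mult_left_mono) auto
qed

lemma continuous_on_gk: "continuous_on {0<..<2*pi} (gk k)"
proof (cases "k = 0")
  case False
  thus ?thesis unfolding gk_def ddK_def by (intro continuous_intros) auto
qed (simp add: gk_def)

text \<open>Frequency 1 dominates all others. For it 1 - cos is half the squared chord, so the
  second derivative of K occurs only as \<open>kap 2\<close>, which is bounded by
  \<open>kmaj\<close>.\<close>

lemma gk_integrable:
  assumes "k \<ge> 1"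
  shows "set_integrable lborel {0<..<2*pi} (gk k)"
proof (rule dominated_sine_integrable[of _ 24, OF continuous_on_gk])
  fix \<theta> :: real assume \<theta>: "0 < \<theta>" "\<theta> < 2*pi"
  define t where "t = 2 * sin (\<theta> / 2)"
  have t: "t > 0" "t \<le> 2" using sin_half_pos[OF \<theta>] by (auto simp: t_def)
  have "\<bar>gk k \<theta>\<bar> \<le> gk 1 \<theta>" using gk_le[OF \<theta>, of 1 k] gk_nonneg[OF \<theta>, of k] assms by simp
  also have "gk 1 \<theta> = kap 2 t * (cos (\<theta> / 2))\<^sup>2 - kap 1 t * (t\<^sup>2 / 8)"
    by (simp add: gk_eq ddK_def kap_def t_def power2_eq_square algebra_simps)
  also have "\<dots> \<le> (2 * 2 ^ 2 * kmaj t) * 1 + (2 * 2 ^ 1 * kmaj t) * (2\<^sup>2 / 8)"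
  proof -
    have "kap 2 t * (cos (\<theta> / 2))\<^sup>2 \<le> (2 * 2 ^ 2 * kmaj t) * 1"
      using kap_bound[OF t(1), of 2] kmaj_nonneg[of t]
      by (intro mult_mono) (auto simp: abs_le_iff power_le_one_iff abs_square_le_1)
    moreover have "- kap 1 t * (t\<^sup>2 / 8) \<le> (2 * 2 ^ 1 * kmaj t) * (2\<^sup>2 / 8)"
      using kap_bound[OF t(1), of 1] kmaj_nonneg[of t] t
      by (intro mult_mono divide_right_mono power_mono) (auto simp: abs_le_iff)
    ultimately show ?thesis by linarith
  qed
  also have "\<dots> \<le> 24 * kmaj t" using kmaj_nonneg[of t] by simp
  finally show "\<bar>gk k \<theta>\<bar> \<le> 24 * kmaj (2 * sin (\<theta> / 2))" by (simp add: t_def)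
qed

lemma fcos_K_eq:
  assumes k: "k \<ge> 1"
  shows "fcos K (int k) = (LINT \<theta>:{0<..<2*pi}|lborel. gk k \<theta>)"
proof -
  let ?t = "\<lambda>\<theta>::real. 2 * sin (\<theta> / 2)"
  \<comment> \<open>The antiderivative of the sine is normalized as (1 - cos) / k^2, with a double
    zero at both ends; this is what makes the boundary term containing the derivative of K
    vanish.\<close>
  define H where "H \<theta> = K (?t \<theta>) * sin (real k * \<theta>) / real k
      - kd 1 (?t \<theta>) * cos (\<theta> / 2) * (1 - cos (real k * \<theta>)) / (real k)\<^sup>2" for \<theta>
  note i = sine_cos_integrable[OF K_sine2_integrable, of "real k"]
  have "(LINT \<theta>:{0<..<2*pi}|lborel. K (?t \<theta>) * cos (real k * \<theta>) - gk k \<theta>) = 0 - 0"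
  proof (rule integral_FTC_0_2pi)
    fix \<theta> :: real assume \<theta>: "0 < \<theta>" "\<theta> < 2*pi"
    show "(H has_real_derivative K (?t \<theta>) * cos (real k * \<theta>) - gk k \<theta>) (at \<theta>)"
      unfolding H_def using k
      by (auto intro!: derivative_eq_intros DERIV_K_sine \<theta> DERIV_kd_sine simp: gk_def ddK_def numeral_2_eq_2 field_simps)
  next
    show "continuous_on {0<..<2*pi} (\<lambda>\<theta>. K (?t \<theta>) * cos (real k * \<theta>) - gk k \<theta>)"
      by (intro continuous_intros continuous_on_gk)
    show "set_integrable lborel {0<..<2*pi} (\<lambda>\<theta>. K (?t \<theta>) * cos (real k * \<theta>) - gk k \<theta>)"
      using i gk_integrable[OF k] by (rule set_integral_diff)
    have bd: "\<bar>H \<theta>\<bar> \<le> 4 * (?t \<theta> * kmaj (?t \<theta>))" if \<theta>: "0 < \<theta>" "\<theta> < 2*pi" for \<theta>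
    proof -
      define t where "t = ?t \<theta>"
      have t: "0 < t" using sin_half_pos[OF \<theta>] by (simp add: t_def)
      have s1: "\<bar>sin (real k * \<theta>) / real k\<bar> \<le> t"
      proof -
        have "\<bar>sin (real (2 * k) * (\<theta> / 2))\<bar> \<le> real (2 * k) * \<bar>sin (\<theta> / 2)\<bar>" by (rule abs_sin_mult_le)
        thus ?thesis using k t by (simp add: t_def field_simps)
      qed
      have s2: "\<bar>(1 - cos (real k * \<theta>)) / (real k)\<^sup>2\<bar> \<le> t\<^sup>2 / 2"
      proof -
        have "\<bar>sin (real k * (\<theta> / 2)) / real k\<bar> \<le> \<bar>t / 2\<bar>"
          using abs_sin_mult_le[of k "\<theta> / 2"] k t by (simp add: t_def field_simps)
        hence "(sin (real k * (\<theta> / 2)) / real k)\<^sup>2 \<le> (t / 2)\<^sup>2" by (simp only: abs_le_square_iff)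
        thus ?thesis unfolding one_minus_cos_half by (simp add: power_divide mult.commute)
      qed
      have "\<bar>H \<theta>\<bar> \<le> \<bar>K t\<bar> * \<bar>sin (real k * \<theta>) / real k\<bar> + \<bar>kd 1 t\<bar> * \<bar>cos (\<theta> / 2)\<bar> * \<bar>(1 - cos (real k * \<theta>)) / (real k)\<^sup>2\<bar>"
        unfolding H_def t_def abs_mult[symmetric]
        using abs_triangle_ineq4[of "K (?t \<theta>) * sin (real k * \<theta>) / real k" "kd 1 (?t \<theta>) * cos (\<theta> / 2) * (1 - cos (real k * \<theta>)) / (real k)\<^sup>2"]
        by (simp add: mult.assoc)
      also have "\<dots> \<le> \<bar>K t\<bar> * t + \<bar>kd 1 t\<bar> * 1 * (t\<^sup>2 / 2)"
        using s1 s2 by (intro add_mono mult_mono) auto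
      also have "\<bar>kd 1 t\<bar> * 1 * (t\<^sup>2 / 2) = \<bar>kap 1 t\<bar> * (t / 2)"
        using t by (simp add: kap_def abs_mult power2_eq_square)
      also have "\<bar>K t\<bar> * t + \<bar>kap 1 t\<bar> * (t / 2) \<le> kmaj t * t + (2 * 2 ^ 1 * kmaj t) * (t / 2)"
        using t kap_bound[OF t, of 1] by (intro add_mono mult_right_mono) (auto simp: kmaj_def)
      also have "\<dots> \<le> 4 * (t * kmaj t)" using t kmaj_nonneg[of t] by (simp add: algebra_simps)
      finally show ?thesis by (simp add: t_def)
    qed
    show "(H \<longlongrightarrow> 0) (at_right 0)" "(H \<longlongrightarrow> 0) (at_left (2*pi))"
      using tendsto_0_at_ends[OF bd] by auto
  qed
  thus ?thesis using set_integral_diff(2)[OF i gk_integrable[OF k]] by (simp add: fcos_def)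
qed

text \<open>Nontriviality gives a strictly negative derivative of K at one point. Since the
  derivative increases, it is strictly negative at all smaller arguments, and chords are at most as
  long as the angle.\<close>

lemma ddK_pos_near_0:
  obtains \<theta>0 where "\<theta>0 > 0" "\<And>\<theta>. 0 < \<theta> \<Longrightarrow> \<theta> \<le> \<theta>0 \<Longrightarrow> \<theta> < 2*pi \<Longrightarrow> ddK \<theta> > 0"
proof -
  obtain t0 where t0: "t0 > 0" "deriv K t0 \<noteq> 0" using nontriv by auto
  have "deriv K t0 = kd 1 t0" by (simp add: kd_def)
  hence neg: "kd 1 t0 < 0" using t0 kd1_le[of t0] by simp
  show ?thesis
  proof (rule that[OF t0(1)])
    fix \<theta> :: real assume \<theta>: "0 < \<theta>" "\<theta> \<le> t0" "\<theta> < 2*pi"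
    have "2 * sin (\<theta> / 2) \<le> \<theta>" using sin_x_le_x[of "\<theta> / 2"] \<theta> by simp
    hence "kd 1 (2 * sin (\<theta> / 2)) < 0"
      using kd1_mono[of "2 * sin (\<theta> / 2)" t0] \<theta> sin_half_pos[of \<theta>] neg by simp
    hence "kd 1 (2 * sin (\<theta> / 2)) * sin (\<theta> / 2) < 0" using sin_half_pos[of \<theta>] \<theta> by (intro mult_neg_pos) auto
    moreover have "kd 2 (2 * sin (\<theta> / 2)) * (cos (\<theta> / 2))\<^sup>2 \<ge> 0"
      using sin_half_pos[of \<theta>] \<theta> by (intro mult_nonneg_nonneg kd2_ge) auto
    ultimately show "ddK \<theta> > 0" by (simp add: ddK_def)
  qed
qed

lemma fcos_K_strict:
  assumes m: "m \<ge> 1"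
  shows "fcos K (int m) > 0" "\<And>j. j \<ge> 2 \<Longrightarrow> fcos K (int (j * m)) < fcos K (int m)"
proof -
  obtain \<theta>0 where \<theta>0: "\<theta>0 > 0" "\<And>\<theta>. 0 < \<theta> \<Longrightarrow> \<theta> \<le> \<theta>0 \<Longrightarrow> \<theta> < 2*pi \<Longrightarrow> ddK \<theta> > 0"
    using ddK_pos_near_0 by blast
  \<comment> \<open>An angle at which \<open>ddK\<close> is positive and \<open>m\<close> times the
    half-angle stays inside (0, pi). By continuity a single such point suffices for strict
    inequalities between the integrals.\<close>
  define \<theta> where "\<theta> = min \<theta>0 (pi / real m)"
  have "pi / real m \<le> pi" using m by (simp add: divide_le_eq mult_le_cancel_left1)
  moreover have \<theta>m: "\<theta> \<le> pi / real m" by (simp add: \<theta>_def)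
  ultimately have "\<theta> < 2*pi" using pi_gt_zero by linarith
  moreover have "0 < \<theta>" "\<theta> \<le> \<theta>0" using \<theta>0 m by (auto simp: \<theta>_def)
  ultimately have \<theta>: "0 < \<theta>" "\<theta> < 2*pi" "\<theta> \<le> \<theta>0" by auto
  from \<theta>m have "real m * \<theta> \<le> pi" using m by (simp add: field_simps)
  hence y: "0 < real m * (\<theta> / 2)" "real m * (\<theta> / 2) < pi" using \<theta> m by auto
  have dd: "ddK \<theta> > 0" using \<theta>0(2) \<theta> by blast
  have sp: "sin (real m * (\<theta> / 2)) > 0" using y by (intro sin_gt_zero) auto
  have "gk m \<theta> > 0" unfolding gk_eq using dd sp m by (intro mult_pos_pos zero_less_power) auto
  thus "fcos K (int m) > 0"
    unfolding fcos_K_eq[OF m]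
    by (intro set_integral_pos_cont[of _ \<theta>] gk_integrable continuous_on_gk gk_nonneg m \<theta>) auto
  fix j :: nat assume j: "j \<ge> 2"
  have jm: "j * m \<ge> 1" using j m by (simp add: Suc_le_eq)
  have "\<bar>sin (real (j * m) * (\<theta> / 2)) / real (j * m)\<bar> < \<bar>sin (real m * (\<theta> / 2)) / real m\<bar>"
    using abs_sin_mult_less[OF j y] m j by (simp add: field_simps)
  hence "(sin (real (j * m) * (\<theta> / 2)) / real (j * m))\<^sup>2 < (sin (real m * (\<theta> / 2)) / real m)\<^sup>2"
    by (metis abs_le_square_iff not_le)
  hence "gk m \<theta> - gk (j * m) \<theta> > 0" unfolding gk_eq using dd by simp
  hence "(LINT \<theta>:{0<..<2*pi}|lborel. gk m \<theta> - gk (j * m) \<theta>) > 0"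
    using gk_le m j
    by (intro set_integral_pos_cont[of _ \<theta>] set_integral_diff gk_integrable jm continuous_intros continuous_on_gk m \<theta>) auto
  thus "fcos K (int (j * m)) < fcos K (int m)"
    unfolding fcos_K_eq[OF m] fcos_K_eq[OF jm]
    using set_integral_diff(2)[OF gk_integrable[OF m] gk_integrable[OF jm]] by simp
qed

lemma fcos_K_tendsto_0: "(\<lambda>k. fcos K (int k)) \<longlonglongrightarrow> 0"
proof -
  \<comment> \<open>Dominated convergence: the integrand for frequency 1 is a majorant, and the
    division by the squared frequency gives pointwise decay. The index is shifted because the
    representation starts at frequency 1.\<close>
  have "(\<lambda>k. LINT \<theta>:{0<..<2*pi}|lborel. gk (Suc k) \<theta>) \<longlonglongrightarrow> (LINT \<theta>:{0<..<2*pi}|lborel. 0)"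
    unfolding set_lebesgue_integral_def
  proof (rule integral_dominated_convergence[where w="\<lambda>\<theta>. indicator {0<..<2*pi} \<theta> *\<^sub>R gk 1 \<theta>"])
    show "integrable lborel (\<lambda>\<theta>. indicator {0<..<2*pi} \<theta> *\<^sub>R gk 1 \<theta>)"
      using gk_integrable[of 1] by (simp add: set_integrable_def)
    show "(\<lambda>\<theta>. indicator {0<..<2*pi} \<theta> *\<^sub>R gk (Suc k) \<theta>) \<in> borel_measurable lborel" for k
      using gk_integrable[of "Suc k"] by (auto simp: set_integrable_def)
    show "AE \<theta> in lborel. norm (indicator {0<..<2*pi} \<theta> *\<^sub>R gk (Suc k) \<theta>) \<le> indicator {0<..<2*pi} \<theta> *\<^sub>R gk 1 \<theta>" for k
      using gk_le[of _ 1 "Suc k"] gk_nonneg[of _ "Suc k"] by (auto simp: indicator_def)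
    show "AE \<theta> in lborel. (\<lambda>k. indicator {0<..<2*pi} \<theta> *\<^sub>R gk (Suc k) \<theta>) \<longlonglongrightarrow> indicator {0<..<2*pi} \<theta> *\<^sub>R 0"
    proof (rule AE_I2, rule tendsto_scaleR[OF tendsto_const])
      fix \<theta> :: real
      show "(\<lambda>k. gk (Suc k) \<theta>) \<longlonglongrightarrow> 0"
      proof (rule Lim_null_comparison)
        show "(\<lambda>k. 2 * \<bar>ddK \<theta>\<bar> * inverse (real (Suc k))) \<longlonglongrightarrow> 0"
          by (intro tendsto_mult_right_zero LIMSEQ_inverse_real_of_nat)
        show "\<forall>\<^sub>F k in sequentially. norm (gk (Suc k) \<theta>) \<le> 2 * \<bar>ddK \<theta>\<bar> * inverse (real (Suc k))"
        proof (intro always_eventually allI)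
          fix k
          have "norm (gk (Suc k) \<theta>) = \<bar>ddK \<theta>\<bar> * \<bar>1 - cos (real (Suc k) * \<theta>)\<bar> / (real (Suc k))\<^sup>2"
            by (simp add: gk_def abs_mult)
          also have "\<dots> \<le> \<bar>ddK \<theta>\<bar> * 2 / real (Suc k)"
            using abs_cos_le_one[of "real (Suc k) * \<theta>"]
            by (intro frac_le mult_left_mono) (auto simp: abs_le_iff power2_eq_square)
          finally show "norm (gk (Suc k) \<theta>) \<le> 2 * \<bar>ddK \<theta>\<bar> * inverse (real (Suc k))"
            by (simp add: field_simps)
        qed
      qed
    qed
  qed simp
  hence "(\<lambda>k. fcos K (int (Suc k))) \<longlonglongrightarrow> 0" by (simp add: fcos_K_eq del: of_nat_Suc)
  thus ?thesis by (rule LIMSEQ_imp_Suc)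
qed

end

section \<open>The boundary equation in the algebra\<close>

lemma bounded_linear_mult_on_emon:
  fixes F :: "wiener \<Rightarrow> 'b::{real_normed_algebra, banach}"
  assumes F: "bounded_linear F" and "\<And>p q. F (emon (p + q)) = F (emon p) * F (emon q)"
  shows "F (a * b) = F a * F b"
proof (rule bounded_linear_eq_on_emon[of "\<lambda>a. F (a * b)" "\<lambda>a. F a * F b"])
  show "bounded_linear (\<lambda>a. F (a * b))"
    by (rule bounded_linear_compose[OF F bounded_linear_mult_left])
  show "bounded_linear (\<lambda>a. F a * F b)"
    by (rule bounded_linear_mult_const[OF F])
  show "F (emon p * b) = F (emon p) * F b" for p
  proof (rule bounded_linear_eq_on_emon[of "\<lambda>b. F (emon p * b)" "\<lambda>b. F (emon p) * F b"])
    show "bounded_linear (\<lambda>b. F (emon p * b))"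
      by (rule bounded_linear_compose[OF F bounded_linear_mult_right])
    show "bounded_linear (\<lambda>b. F (emon p) * F b)"
      by (rule bounded_linear_const_mult[OF F])
    show "F (emon p * emon q) = F (emon p) * F (emon q)" for q
      by (simp add: emon_times assms(2))
  qed
qed

lemma one_wiener_emon: "(1 :: wiener) = emon (0, 0)"
  by (rule one_wiener_def)

lemma weight_minus [simp]: "weight (- p) = weight p"
  by (simp add: weight_def)

lemma weight_fst: "weight (k, l) = 1 + \<bar>real_of_int k\<bar>"
  by (simp add: weight_def)

text \<open>With real coefficients, negating exponents is complex conjugation on the torus.\<close>

definition bar :: "wiener \<Rightarrow> wiener" where
  "bar = wlin (\<lambda>p. emon (- p))"

text \<open>The substitution \<zeta> = 1, an algebra homomorphism; its fixed points are the elements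
  in which \<zeta> does not occur.\<close>

definition Z0op :: "wiener \<Rightarrow> wiener" where
  "Z0op = wlin (\<lambda>(k, l). emon (k, 0))"

text \<open>The boundary equation is odd under \<open>bar\<close>, so its positive frequencies, selected by \<open>Piop\<close>,
  determine it.\<close>

definition Piop :: "wiener \<Rightarrow> wiener" where
  "Piop = wlin (\<lambda>(k, l). if l = 0 \<and> k \<ge> 1 then emon (k, 0) else 0)"

text \<open>Projects to the complement of the critical monomial \<open>emon (1, 0)\<close> within
  the range of \<open>Piop\<close>.\<close>

definition Hop :: "wiener \<Rightarrow> wiener" where
  "Hop = wlin (\<lambda>(k, l). if l = 0 \<and> k \<ge> 2 then emon (k, 0) else 0)"

text \<open>Integration over \<theta> against \<kappa> at the chord: the variable \<zeta> is
  integrated out, and each of its powers leaves a cosine coefficient.\<close>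

definition Iop :: "(real \<Rightarrow> real) \<Rightarrow> wiener \<Rightarrow> wiener" where
  "Iop \<kappa> = wlin (\<lambda>(k, l). fcos \<kappa> l *\<^sub>R emon (k, 0))"

lemma abs_fcos_le:
  assumes "set_integrable lborel {0<..<2*pi} (\<lambda>\<theta>. \<kappa> (2 * sin (\<theta> / 2)))"
  shows "\<bar>fcos \<kappa> l\<bar> \<le> (LINT \<theta>:{0<..<2*pi}|lborel. \<bar>\<kappa> (2 * sin (\<theta> / 2))\<bar>)"
proof -
  have "\<bar>fcos \<kappa> l\<bar> \<le> (LINT \<theta>:{0<..<2*pi}|lborel. norm (\<kappa> (2 * sin (\<theta> / 2)) * cos (real_of_int l * \<theta>)))"
    unfolding fcos_def real_norm_def[symmetric] by (rule set_integral_norm_bound[OF sine_cos_integrable[OF assms]])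
  also have "\<dots> \<le> (LINT \<theta>:{0<..<2*pi}|lborel. \<bar>\<kappa> (2 * sin (\<theta> / 2))\<bar>)"
    unfolding real_norm_def
    by (intro set_integral_mono set_integrable_abs assms sine_cos_integrable) (auto simp: abs_mult mult_left_le)
  finally show ?thesis .
qed

lemma bounded_linear_bar: "bounded_linear bar"
  unfolding bar_def by (rule bounded_linear_wlin[of _ 1]) simp
lemma bounded_linear_Z0op: "bounded_linear Z0op"
  unfolding Z0op_def by (rule bounded_linear_wlin[of _ 1]) (auto simp: weight_fst)
lemma bounded_linear_Piop: "bounded_linear Piop"
  unfolding Piop_def by (rule bounded_linear_wlin[of _ 1]) (auto simp: weight_fst)
lemma bounded_linear_Hop: "bounded_linear Hop"
  unfolding Hop_def by (rule bounded_linear_wlin[of _ 1]) (auto simp: weight_fst)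

lemma Iop_bound:
  assumes "\<And>l. \<bar>fcos \<kappa> l\<bar> \<le> C"
  shows "bounded_linear (Iop \<kappa>)" "norm (Iop \<kappa> c) \<le> C * norm c"
proof -
  have b: "norm (case p of (k, l) \<Rightarrow> fcos \<kappa> l *\<^sub>R emon (k, 0)) \<le> C * weight p" for p
    using assms[of "snd p"] by (auto simp: weight_fst split: prod.splits intro!: mult_right_mono)
  show "bounded_linear (Iop \<kappa>)" "norm (Iop \<kappa> c) \<le> C * norm c"
    unfolding Iop_def by (rule bounded_linear_wlin[OF b], rule norm_wlin_le[OF b])
qed

lemma bar_emon [simp]: "bar (emon p) = emon (- p)"
  by (simp add: bar_def)
lemma Z0op_emon [simp]: "Z0op (emon (k, l)) = emon (k, 0)"
  by (simp add: Z0op_def)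
lemma Piop_emon [simp]: "Piop (emon (k, l)) = (if l = 0 \<and> k \<ge> 1 then emon (k, 0) else 0)"
  by (simp add: Piop_def)
lemma Hop_emon [simp]: "Hop (emon (k, l)) = (if l = 0 \<and> k \<ge> 2 then emon (k, 0) else 0)"
  by (simp add: Hop_def)
lemma Iop_emon [simp]: "Iop \<kappa> (emon (k, l)) = fcos \<kappa> l *\<^sub>R emon (k, 0)"
  by (simp add: Iop_def)

lemmas bar_lin [simp] = linear_simps[OF bounded_linear_bar]
lemmas Z0op_lin [simp] = linear_simps[OF bounded_linear_Z0op]
lemmas Piop_lin [simp] = linear_simps[OF bounded_linear_Piop]
lemmas Hop_lin [simp] = linear_simps[OF bounded_linear_Hop]

lemma bar_mult [simp]: "bar (a * b) = bar a * bar b"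
  by (rule bounded_linear_mult_on_emon[OF bounded_linear_bar]) (simp add: emon_times)

lemma Z0op_mult [simp]: "Z0op (a * b) = Z0op a * Z0op b"
  by (rule bounded_linear_mult_on_emon[OF bounded_linear_Z0op]) (auto simp: emon_times)

lemma bar_1 [simp]: "bar 1 = 1" and Z0op_1 [simp]: "Z0op 1 = 1"
  by (simp_all add: one_wiener_emon)

lemma bar_bar [simp]: "bar (bar c) = c"
  by (rule bounded_linear_eq_on_emon[of "\<lambda>c. bar (bar c)" "\<lambda>c. c", OF bounded_linear_compose[OF bounded_linear_bar bounded_linear_bar] bounded_linear_ident])
     simp

lemma norm_bar_le: "norm (bar c) \<le> norm c"
  unfolding bar_def using norm_wlin_le[of "\<lambda>p. emon (- p)" 1 c] by simp

lemma norm_bar [simp]: "norm (bar c) = norm c"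
  using norm_bar_le[of c] norm_bar_le[of "bar c"] by simp

lemma bar_power [simp]: "bar (c ^ n) = bar c ^ n"
  by (induction n) auto

lemma bar_Z0op: "bar (Z0op c) = Z0op (bar c)"
  by (rule bounded_linear_eq_on_emon[of "\<lambda>c. bar (Z0op c)" "\<lambda>c. Z0op (bar c)", OF bounded_linear_compose[OF bounded_linear_bar bounded_linear_Z0op] bounded_linear_compose[OF bounded_linear_Z0op bounded_linear_bar]])
     auto

lemma Z0op_Piop: "Z0op (Piop c) = Piop c"
  by (rule bounded_linear_eq_on_emon[of "\<lambda>c. Z0op (Piop c)" Piop, OF bounded_linear_compose[OF bounded_linear_Z0op bounded_linear_Piop] bounded_linear_Piop])
     auto

lemma coef_bar: "coef (bar c) p = coef c (- p)"
  by (rule bounded_linear_eq_on_emon[of "\<lambda>c. coef (bar c) p" "\<lambda>c. coef c (- p)", OF bounded_linear_compose[OF bounded_linear_coef bounded_linear_bar] bounded_linear_coef])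
     (simp add: coef_emon, metis minus_minus)

lemma Piop_Piop: "Piop (Piop c) = Piop c"
  by (rule bounded_linear_eq_on_emon[of "\<lambda>c. Piop (Piop c)" Piop, OF bounded_linear_compose[OF bounded_linear_Piop bounded_linear_Piop] bounded_linear_Piop])
     auto

lemma Piop_Hop: "Piop (Hop c) = Hop c"
  by (rule bounded_linear_eq_on_emon[of "\<lambda>c. Piop (Hop c)" Hop, OF bounded_linear_compose[OF bounded_linear_Piop bounded_linear_Hop] bounded_linear_Hop])
     auto

lemma Z0op_decomp: "Z0op c = Piop (Z0op c) + bar (Piop (bar (Z0op c))) + coef (Z0op c) (0, 0) *\<^sub>R emon (0, 0)"
proof (rule bounded_linear_eq_on_emon[of Z0op])
  note bl = bounded_linear_bar bounded_linear_Z0op bounded_linear_Piop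
  show "bounded_linear Z0op" by (rule bl)
  show "bounded_linear (\<lambda>c. Piop (Z0op c) + bar (Piop (bar (Z0op c))) + coef (Z0op c) (0, 0) *\<^sub>R emon (0, 0))"
    by (intro bounded_linear_add bounded_linear_compose[OF bl(3) bl(2)]
        bounded_linear_compose[OF bl(1) bounded_linear_compose[OF bl(3) bounded_linear_compose[OF bl(1) bl(2)]]]
        bounded_linear_scaleR_const bounded_linear_compose[OF bounded_linear_coef bl(2)])
  show "Z0op (emon p) = Piop (Z0op (emon p)) + bar (Piop (bar (Z0op (emon p)))) + coef (Z0op (emon p)) (0, 0) *\<^sub>R emon (0, 0)" for p
    by (cases p) (auto simp: coef_emon)
qed

text \<open>Oddness makes the mean coefficient equal to its own negative and makes the negative
  frequencies mirror the positive ones.\<close>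

lemma antisymmetric_zero:
  assumes "Z0op g = g" "bar g = - g" "Piop g = 0"
  shows "g = 0"
proof -
  have "coef g (0, 0) = 0" using coef_bar[of g "(0, 0)"] assms(2) by (simp flip: zero_prod_def)
  thus ?thesis using Z0op_decomp[of g] assms by simp
qed

section \<open>The nonlinear operator and its linearization at the disk\<close>

locale fold_kernel = cm_kernel +
  fixes m :: nat
  assumes m: "m \<ge> 1"
begin

text \<open>The monomial \<open>emon (k, l)\<close> stands for \<open>w\<^sup>k\<^sup>m \<zeta>\<^sup>l\<close> with \<open>w = e\<^sup>i\<^sup>\<beta>\<close>, \<open>\<zeta> = e\<^sup>i\<^sup>\<theta>\<close>. The unknown is \<open>y = f'(w)\<close>; with \<open>\<tau> = w \<zeta>\<close>,
  \<open>Qop y\<close> is \<open>(f(\<tau>) - f(w)) / (\<tau> - w)\<close>, \<open>Zop y\<close> is \<open>f'(\<tau>)\<close> and \<open>Pop y\<close> is \<open>f(w) / w\<close>.\<close>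

definition Qop :: "wiener \<Rightarrow> wiener" where
  "Qop = wlin (\<lambda>(k, l). if k \<ge> 0 then (1 / (real_of_int k * m + 1)) *\<^sub>R (\<Sum>i\<in>{0..k * int m}. emon (k, i)) else 0)"

definition Zop :: "wiener \<Rightarrow> wiener" where
  "Zop = wlin (\<lambda>(k, l). emon (k, k * int m))"

definition Pop :: "wiener \<Rightarrow> wiener" where
  "Pop = wlin (\<lambda>(k, l). if k \<ge> 0 then (1 / (real_of_int k * m + 1)) *\<^sub>R emon (k, l) else 0)"

text \<open>The monomials in the sum all have the same weight, as the weight ignores the exponent of
  \<zeta>. Their number is km + 1, which the factor from integrating f' compensates exactly.\<close>

lemma Q_bound: "norm (case p of (k, l) \<Rightarrow> if k \<ge> 0 then (1 / (real_of_int k * m + 1)) *\<^sub>R (\<Sum>i\<in>{0..k * int m}. emon (k, i)) else 0) \<le> 1 * weight p"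
proof (cases p)
  case (Pair k l)
  show ?thesis
  proof (cases "k \<ge> 0")
    case True
    have "norm (\<Sum>i\<in>{0..k * int m}. emon (k, i)) \<le> (\<Sum>i\<in>{0..k * int m}. weight (k, l))"
      by (rule sum_norm_le) (simp add: weight_fst)
    also have "\<dots> = (real_of_int k * m + 1) * weight (k, l)" using True by simp
    finally have "norm (\<Sum>i\<in>{0..k * int m}. emon (k, i)) / (real_of_int k * m + 1) \<le> weight (k, l)"
      using True by (subst pos_divide_le_eq) (auto simp: mult.commute intro: add_nonneg_pos)
    thus ?thesis using True Pair by simp
  qed (simp add: Pair)
qed

lemma P_bound: "norm (case p of (k, l) \<Rightarrow> if k \<ge> 0 then (1 / (real_of_int k * m + 1)) *\<^sub>R emon (k, l) else 0) \<le> 1 * weight p"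
proof (cases p)
  case (Pair k l)
  have "weight (k, l) / (real_of_int k * m + 1) \<le> weight (k, l) / 1" if "k \<ge> 0"
    using that by (intro divide_left_mono) (auto intro: add_nonneg_pos)
  thus ?thesis by (auto simp: Pair)
qed

lemma bounded_linear_Qop: "bounded_linear Qop"
  unfolding Qop_def by (rule bounded_linear_wlin[OF Q_bound])
lemma bounded_linear_Zop: "bounded_linear Zop"
  unfolding Zop_def by (rule bounded_linear_wlin[of _ 1]) (auto simp: weight_fst)
lemma bounded_linear_Pop: "bounded_linear Pop"
  unfolding Pop_def by (rule bounded_linear_wlin[OF P_bound])

lemma norm_Qop_le: "norm (Qop c) \<le> norm c"
  unfolding Qop_def using norm_wlin_le[OF Q_bound, of c] by simp

lemma Qop_emon: "k \<ge> 0 \<Longrightarrow> Qop (emon (k, l)) = (1 / (real_of_int k * m + 1)) *\<^sub>R (\<Sum>i\<in>{0..k * int m}. emon (k, i))"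
  by (simp add: Qop_def)
lemma Zop_emon [simp]: "Zop (emon (k, l)) = emon (k, k * int m)"
  by (simp add: Zop_def)
lemma Pop_emon: "k \<ge> 0 \<Longrightarrow> Pop (emon (k, l)) = (1 / (real_of_int k * m + 1)) *\<^sub>R emon (k, l)"
  by (simp add: Pop_def)

lemmas Qop_lin [simp] = linear_simps[OF bounded_linear_Qop]
lemmas Zop_lin [simp] = linear_simps[OF bounded_linear_Zop]
lemmas Pop_lin [simp] = linear_simps[OF bounded_linear_Pop]

lemma Z0op_Pop: "Z0op (Pop c) = Pop (Z0op c)"
  by (rule bounded_linear_eq_on_emon[of "\<lambda>c. Z0op (Pop c)" "\<lambda>c. Pop (Z0op c)", OF bounded_linear_compose[OF bounded_linear_Z0op bounded_linear_Pop] bounded_linear_compose[OF bounded_linear_Pop bounded_linear_Z0op]])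
     (auto simp: Pop_def)

definition Kmaj :: real where
  "Kmaj = (LINT \<theta>:{0<..<2*pi}|lborel. kmaj (2 * sin (\<theta> / 2)))"

lemma kap_abs_integral_le:
  "(LINT \<theta>:{0<..<2*pi}|lborel. \<bar>kap j (2 * sin (\<theta> / 2))\<bar>) \<le> 2 * Kmaj * 2 ^ j"
proof -
  have "(LINT \<theta>:{0<..<2*pi}|lborel. \<bar>kap j (2 * sin (\<theta> / 2))\<bar>)
      \<le> (LINT \<theta>:{0<..<2*pi}|lborel. 2 * 2 ^ j * kmaj (2 * sin (\<theta> / 2)))"
    using kmaj_sine_integrable
    by (intro set_integral_mono set_integrable_abs kap_sine_integrable kap_bound set_integrable_mult_right)
       (auto simp: sin_half_pos)
  also have "\<dots> = 2 * Kmaj * 2 ^ j" by (simp add: Kmaj_def)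
  finally show ?thesis .
qed

lemma Kmaj_nonneg: "Kmaj \<ge> 0"
  unfolding Kmaj_def set_lebesgue_integral_def by (intro Bochner_Integration.integral_nonneg) (auto simp: kmaj_nonneg)

lemma fcos_kap_le: "\<bar>fcos (kap j) l\<bar> \<le> 2 * Kmaj * 2 ^ j"
  using abs_fcos_le[OF kap_sine_integrable, of j l] kap_abs_integral_le[of j] by linarith

lemmas bounded_linear_Iop = Iop_bound(1)[OF fcos_kap_le]
lemmas norm_Iop_le = Iop_bound(2)[OF fcos_kap_le]

lemmas Iop_lin [simp] = linear_simps[OF bounded_linear_Iop]

lemma bar_Iop: "bar (Iop (kap j) c) = Iop (kap j) (bar c)"
  by (rule bounded_linear_eq_on_emon[of "\<lambda>c. bar (Iop (kap j) c)" "\<lambda>c. Iop (kap j) (bar c)", OF bounded_linear_compose[OF bounded_linear_bar bounded_linear_Iop] bounded_linear_compose[OF bounded_linear_Iop bounded_linear_bar]])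
     auto

lemma Z0op_Iop: "Z0op (Iop (kap j) c) = Iop (kap j) c"
  by (rule bounded_linear_eq_on_emon[of "\<lambda>c. Z0op (Iop (kap j) c)" "Iop (kap j)", OF bounded_linear_compose[OF bounded_linear_Z0op bounded_linear_Iop] bounded_linear_Iop])
     auto

text \<open>Since \<open>\<bar>\<Phi>(\<tau>) - \<Phi>(w)\<bar> = 2 sin (\<theta>/2) (1 + sqrt1m (pfun y))\<close>, the series \<open>Nfun y\<close> is the integral of
  \<open>K \<bar>\<Phi>(\<tau>) - \<Phi>(w)\<bar> (bfun y - bar (bfun y))\<close> over \<open>\<theta>\<close>, with \<open>K\<close> expanded around \<open>2 sin (\<theta>/2)\<close>.\<close>

definition pfun :: "wiener \<Rightarrow> wiener" where
  "pfun y = Qop y + bar (Qop y) + Qop y * bar (Qop y)"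

definition bfun :: "wiener \<Rightarrow> wiener" where
  "bfun y = emon (0, 1) * ((1 + bar y) * (1 + Zop y))"

definition Nfun :: "wiener \<Rightarrow> wiener" where
  "Nfun y = (\<Sum>j. Iop (kap j) (sqrt1m (pfun y) ^ j * (bfun y - bar (bfun y))))"

text \<open>On the circle this is the conjugate of \<Phi>(w) times w \<Phi>'(w), with w times its
  conjugate already cancelled. Its imaginary part is, up to sign, the tangential derivative of half
  the squared modulus of \<Phi>.\<close>

definition cfun :: "wiener \<Rightarrow> wiener" where
  "cfun y = (1 + bar (Pop y)) * (1 + y)"

definition Mfun :: "wiener \<Rightarrow> wiener" where
  "Mfun y = cfun y - bar (cfun y)"

definition Blin :: "wiener \<Rightarrow> wiener" where
  "Blin y = emon (0, 1) * (bar y + Zop y) - bar (emon (0, 1) * (bar y + Zop y))"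

definition Nlin :: "wiener \<Rightarrow> wiener" where
  "Nlin y = Iop (kap 0) (Blin y)
     + Iop (kap 1) ((1/2) *\<^sub>R (Qop y + bar (Qop y)) * (emon (0, 1) - emon (0, -1)))"

definition Mlin :: "wiener \<Rightarrow> wiener" where
  "Mlin y = (bar (Pop y) + y) - bar (bar (Pop y) + y)"

lemma affine_approx_pfun: "affine_approx pfun 0 (\<lambda>y. Qop y + bar (Qop y))"
proof -
  have Q: "affine_approx Qop 0 Qop" using bounded_linear_Qop by (rule affine_approx_linear)
  have bQ: "affine_approx (\<lambda>y. bar (Qop y)) 0 (\<lambda>y. bar (Qop y))"
    using affine_approx_compose[OF Q bounded_linear_bar] by simp
  show ?thesis
    using affine_approx_add[OF affine_approx_add[OF Q bQ] affine_approx_mult[OF Q bQ]]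
    by (simp add: pfun_def[abs_def])
qed

lemma affine_approx_b: "affine_approx (\<lambda>y. bfun y - bar (bfun y)) (emon (0, 1) - emon (0, -1)) Blin"
proof -
  have 1: "affine_approx (\<lambda>y. 1 + bar y) (1 + 0) (\<lambda>y. 0 + bar y)"
    by (intro affine_approx_add affine_approx_const affine_approx_linear bounded_linear_bar)
  have 2: "affine_approx (\<lambda>y. 1 + Zop y) (1 + 0) (\<lambda>y. 0 + Zop y)"
    by (intro affine_approx_add affine_approx_const affine_approx_linear bounded_linear_Zop)
  have 3: "affine_approx bfun (emon (0, 1)) (\<lambda>y. emon (0, 1) * (bar y + Zop y))"
    using affine_approx_compose[OF affine_approx_mult[OF 1 2] bounded_linear_mult_right[of "emon (0, 1)"]]
    by (simp add: bfun_def[abs_def] add.commute)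
  show ?thesis
    using affine_approx_minus[OF 3 affine_approx_compose[OF 3 bounded_linear_bar]]
    by (simp add: Blin_def[abs_def])
qed

lemma affine_approx_Nfun: "affine_approx Nfun 0 Nlin"
proof -
  \<comment> \<open>The constants \<open>2 * Kmaj\<close> and \<open>2\<close> are those of
    \<open>kap_bound\<close> after integration over the circle.\<close>
  have "affine_approx (\<lambda>y. \<Sum>j. Iop (kap j) (sqrt1m (pfun y) ^ j * (bfun y - bar (bfun y))))
      (Iop (kap 0) (emon (0, 1) - emon (0, -1)))
      (\<lambda>y. Iop (kap 0) (Blin y) + Iop (kap 1) ((1/2) *\<^sub>R (Qop y + bar (Qop y)) * (emon (0, 1) - emon (0, -1))))"
    by (rule affine_approx_series[where C="2 * Kmaj" and \<rho>=2, OF affine_approx_sqrt1m[OF affine_approx_pfun] affine_approx_b])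
      (use bounded_linear_Iop norm_Iop_le Kmaj_nonneg in auto)
  \<comment> \<open>The disk solves the equation because \<zeta> and its inverse have the same
    cosine coefficient.\<close>
  moreover have "Iop (kap 0) (emon (0, 1) - emon (0, -1)) = 0"
    using fcos_minus[of "kap 0" 1] by simp
  ultimately show ?thesis by (simp add: Nfun_def[abs_def] Nlin_def[abs_def])
qed

lemma affine_approx_Mfun: "affine_approx Mfun 0 Mlin"
proof -
  have 1: "affine_approx (\<lambda>y. 1 + bar (Pop y)) (1 + 0) (\<lambda>y. 0 + bar (Pop y))"
    by (intro affine_approx_add affine_approx_const affine_approx_linear bounded_linear_compose[OF bounded_linear_bar bounded_linear_Pop])
  have 2: "affine_approx (\<lambda>y. 1 + y :: wiener) (1 + 0) (\<lambda>y. 0 + y)"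
    by (intro affine_approx_add affine_approx_const affine_approx_linear bounded_linear_ident)
  have 3: "affine_approx cfun 1 (\<lambda>y. bar (Pop y) + y)"
    using affine_approx_mult[OF 1 2] by (simp add: cfun_def[abs_def] add.commute)
  show ?thesis
    using affine_approx_minus[OF 3 affine_approx_compose[OF 3 bounded_linear_bar]]
    by (simp add: Mfun_def[abs_def] Mlin_def[abs_def])
qed

definition mu :: "int \<Rightarrow> real" where "mu k = real_of_int k * m / (real_of_int k * m + 1)"

text \<open>The linearization acts on frequency \<open>k\<close> as \<open>mu k\<close> times the
  coefficient at \<open>k * int m\<close>, minus \<open>fcos K 1\<close>, plus \<Omega>. This value
  of \<Omega> makes it vanish at k = 1 and turns it into \<open>dd k\<close> in general.\<close>

definition Om :: real where "Om = fcos K 1 - fcos K (int m)"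

definition dd :: "int \<Rightarrow> real" where "dd k = mu k * (fcos K (k * int m) - fcos K (int m))"

lemma kap_0: "kap 0 = K"
  by (simp add: kap_def[abs_def])

lemma Piop_Mlin: "k \<ge> 1 \<Longrightarrow> Piop (Mlin (emon (k, 0))) = mu k *\<^sub>R emon (k, 0)"
proof -
  assume k: "k \<ge> 1"
  have "real_of_int k * m + 1 > 0" using k by (intro add_nonneg_pos) auto
  hence mu: "mu k = 1 - 1 / (real_of_int k * m + 1)" by (simp add: mu_def field_simps)
  show ?thesis unfolding mu using k by (simp add: Mlin_def Pop_emon algebra_simps)
qed

lemma sum_shift_telescope:
  fixes f :: "int \<Rightarrow> real"
  assumes "n \<ge> 0"
  shows "(\<Sum>i\<in>{0..n}. f (i + 1) - f (i - 1)) = f (n + 1) + f n - f 0 - f (-1)"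
  using assms
proof (induction n rule: int_ge_induct)
  case (step n)
  have "{0..n + 1} = insert (n + 1) {0..n}" using step by auto
  thus ?case using step by simp
qed simp

text \<open>The first-order change of the chord is an average over the exponents of \<zeta>.
  Shifting these by one in both directions telescopes to four coefficients of \<open>kap 1\<close>,
  which \<open>kap1_fcos\<close> converts into coefficients of K.\<close>

lemma Piop_Nlin:
  assumes k: "k \<ge> 1"
  shows "Piop (Nlin (emon (k, 0))) = (mu k * (fcos K (k * int m) - fcos K 1)) *\<^sub>R emon (k, 0)"
proof -
  \<comment> \<open>The exponent that occurs in f: a monomial w^(km) of f' integrates to w^n /
    n.\<close>
  define n where "n = nat k * m + 1"
  have n: "int n = k * int m + 1" "n \<ge> 1" "real n = real_of_int k * m + 1"
    using k by (auto simp: n_def)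
  have "Piop (Iop (kap 0) (Blin (emon (k, 0)))) = (fcos (kap 0) (int n) - fcos (kap 0) 1) *\<^sub>R emon (k, 0)"
    using k fcos_minus[of "kap 0" 1] by (simp add: Blin_def distrib_left emon_times n algebra_simps)
  also have "fcos (kap 0) = fcos K" by (simp only: kap_0)
  finally have 1: "Piop (Iop (kap 0) (Blin (emon (k, 0)))) = (fcos K (int n) - fcos K 1) *\<^sub>R emon (k, 0)" .
  have e: "Piop (Iop (kap 1) (emon (k, i) * (emon (0, 1) - emon (0, -1)) + emon (- k, - i) * (emon (0, 1) - emon (0, -1))))
      = (fcos (kap 1) (i + 1) - fcos (kap 1) (i - 1)) *\<^sub>R emon (k, 0)" for i
    using k by (simp add: right_diff_distrib emon_times scaleR_diff_left)
  have "Piop (Iop (kap 1) ((1/2) *\<^sub>R (Qop (emon (k, 0)) + bar (Qop (emon (k, 0)))) * (emon (0, 1) - emon (0, -1))))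
     = (1 / (2 * real n)) *\<^sub>R (\<Sum>i\<in>{0..k * int m}. Piop (Iop (kap 1) (emon (k, i) * (emon (0, 1) - emon (0, -1)) + emon (- k, - i) * (emon (0, 1) - emon (0, -1)))))"
  proof -
    have "(1/2) *\<^sub>R (Qop (emon (k, 0)) + bar (Qop (emon (k, 0)))) * (emon (0, 1) - emon (0, -1))
      = (1 / (2 * real n)) *\<^sub>R (\<Sum>i\<in>{0..k * int m}. emon (k, i) * (emon (0, 1) - emon (0, -1)) + emon (- k, - i) * (emon (0, 1) - emon (0, -1)))"
      using k by (simp add: Qop_emon n(3)[symmetric] linear_sum[OF bounded_linear.linear[OF bounded_linear_bar]]
          sum.distrib sum_distrib_right scaleR_right_distrib distrib_right del: right_diff_distrib)
    thus ?thesis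
      by (simp only: Iop_lin Piop_lin linear_sum[OF bounded_linear.linear[OF bounded_linear_Iop]]
          linear_sum[OF bounded_linear.linear[OF bounded_linear_Piop]])
  qed
  also have "\<dots> = (1 / (2 * real n)) *\<^sub>R (\<Sum>i\<in>{0..k * int m}. (fcos (kap 1) (i + 1) - fcos (kap 1) (i - 1)) *\<^sub>R emon (k, 0))"
    by (simp only: e)
  also have "\<dots> = (1 / (2 * real n) * (\<Sum>i\<in>{0..k * int m}. fcos (kap 1) (i + 1) - fcos (kap 1) (i - 1))) *\<^sub>R emon (k, 0)"
    by (simp only: scaleR_sum_left[symmetric] scaleR_scaleR)
  also have "(\<Sum>i\<in>{0..k * int m}. fcos (kap 1) (i + 1) - fcos (kap 1) (i - 1))
      = fcos (kap 1) (int n) + fcos (kap 1) (int n - 1) - fcos (kap 1) 0 - fcos (kap 1) 1"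
    using sum_shift_telescope[of "k * int m" "fcos (kap 1)"] fcos_minus[of "kap 1" 1] k n(1) by simp
  also have "\<dots> = 2 * (fcos K 1 - real n * fcos K (int n) + (real n - 1) * fcos K (int n - 1))"
    by (rule kap1_fcos[OF n(2)])
  finally have 2: "Piop (Iop (kap 1) ((1/2) *\<^sub>R (Qop (emon (k, 0)) + bar (Qop (emon (k, 0)))) * (emon (0, 1) - emon (0, -1))))
     = (1 / (2 * real n) * (2 * (fcos K 1 - real n * fcos K (int n) + (real n - 1) * fcos K (int n - 1)))) *\<^sub>R emon (k, 0)" .
  have mu: "mu k = (real n - 1) / real n" "k * int m = int n - 1" using n by (auto simp: mu_def)
  \<comment> \<open>The coefficients at \<open>n\<close> cancel, so only the frequencies 1 and n - 1
    = km survive.\<close>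
  have "(fcos K (int n) - fcos K 1) + 1 / (2 * real n) * (2 * (fcos K 1 - real n * fcos K (int n) + (real n - 1) * fcos K (int n - 1)))
      = mu k * (fcos K (k * int m) - fcos K 1)"
    unfolding mu using n(2) by (simp add: field_simps)
  thus ?thesis unfolding Nlin_def Piop_lin 1 2 by (metis scaleR_left_distrib)
qed

text \<open>From k = 2 on the multipliers are nonzero, by the strict comparison with frequency
  \<open>m\<close>, and they converge to the nonzero limit \<open>- fcos K (int m)\<close>, while
  \<open>mu k\<close> is at least 1/2. So there are no small divisors.\<close>

lemma dd_inverse_bounded: obtains C where "C > 0" "\<And>k. k \<ge> 2 \<Longrightarrow> dd k \<noteq> 0 \<and> \<bar>1 / dd k\<bar> \<le> C"
proof -
  have "strict_mono (\<lambda>j. j * m)" using m by (intro strict_monoI) simp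
  hence "(\<lambda>j. fcos K (int (j * m))) \<longlonglongrightarrow> 0"
    using LIMSEQ_subseq_LIMSEQ[OF fcos_K_tendsto_0] unfolding o_def by blast
  hence "(\<lambda>j. fcos K (int (j * m)) - fcos K (int m)) \<longlonglongrightarrow> 0 - fcos K (int m)"
    by (intro tendsto_intros)
  hence "(\<lambda>j. inverse (fcos K (int (j * m)) - fcos K (int m))) \<longlonglongrightarrow> inverse (0 - fcos K (int m))"
    using fcos_K_strict(1)[OF m] by (intro tendsto_inverse) auto
  \<comment> \<open>At j = 1 the difference is 0 and \<open>inverse\<close> returns 0, which does
    not affect boundedness.\<close>
  hence "Bseq (\<lambda>j. inverse (fcos K (int (j * m)) - fcos K (int m)))"
    by (intro convergent_imp_Bseq convergentI)
  then obtain B where B: "B > 0" "\<And>j. \<bar>inverse (fcos K (int (j * m)) - fcos K (int m))\<bar> \<le> B"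
    unfolding Bseq_def by auto
  show ?thesis
  proof (rule that[of "2 * B"])
    fix k :: int assume k: "k \<ge> 2"
    define j where "j = nat k"
    have j: "j \<ge> 2" "k = int j" using k by (auto simp: j_def)
    have ne: "fcos K (int (j * m)) - fcos K (int m) \<noteq> 0" using fcos_K_strict(2)[OF m j(1)] by simp
    have jm: "1 \<le> real j * real m" using j m mult_mono[of 1 "real j" 1 "real m"] by simp
    have mu: "mu k > 0" "1 / mu k \<le> 2" using jm by (auto simp: mu_def j field_simps)
    have dd: "dd k = mu k * (fcos K (int (j * m)) - fcos K (int m))" by (simp add: dd_def j)
    have "\<bar>1 / dd k\<bar> = (1 / mu k) * \<bar>inverse (fcos K (int (j * m)) - fcos K (int m))\<bar>"
      unfolding dd using mu by (simp add: abs_mult divide_simps)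
    also have "\<dots> \<le> 2 * B" using mu B by (intro mult_mono) auto
    finally show "dd k \<noteq> 0 \<and> \<bar>1 / dd k\<bar> \<le> 2 * B" using ne mu dd by auto
  qed (use B in auto)
qed

text \<open>A right inverse of the bordered linearization. From frequency 2 on it divides by the
  multiplier; on the critical frequency, where that multiplier is 0, it solves for the change of
  \<Omega> instead. The coefficient of the result at (1, 0) is therefore a parameter correction and
  not a component of f'.\<close>

definition Top :: "wiener \<Rightarrow> wiener" where
  "Top = wlin (\<lambda>(k, l). if l = 0 \<and> k = 1 then (1 / mu 1) *\<^sub>R emon (1, 0)
      else if l = 0 \<and> k \<ge> 2 then (1 / dd k) *\<^sub>R emon (k, 0) else 0)"

lemma bounded_linear_Top: "bounded_linear Top"
proof -
  obtain C where C: "C > 0" "\<And>k. k \<ge> 2 \<Longrightarrow> \<bar>1 / dd k\<bar> \<le> C" using dd_inverse_bounded by metis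
  show ?thesis
    unfolding Top_def
  proof (rule bounded_linear_wlin[of _ "\<bar>1 / mu 1\<bar> + C"])
    show "norm (case p of (k, l) \<Rightarrow> if l = 0 \<and> k = 1 then (1 / mu 1) *\<^sub>R emon (1, 0)
      else if l = 0 \<and> k \<ge> 2 then (1 / dd k) *\<^sub>R emon (k, 0) else 0) \<le> (\<bar>1 / mu 1\<bar> + C) * weight p" for p
    proof (cases p)
      case (Pair k l)
      have "\<bar>1 / dd k\<bar> * weight (k, 0) \<le> (\<bar>1 / mu 1\<bar> + C) * weight (k, 0)" if "k \<ge> 2"
        using C(2)[OF that] by (intro mult_right_mono add_increasing) auto
      moreover have "\<bar>1 / mu 1\<bar> * weight (1, 0) \<le> (\<bar>1 / mu 1\<bar> + C) * weight (1, 0)"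
        using C(1) by (intro mult_right_mono) auto
      ultimately show ?thesis using C(1) by (auto simp: Pair weight_fst)
    qed
  qed
qed

lemma Top_emon: "Top (emon (k, l)) = (if l = 0 \<and> k = 1 then (1 / mu 1) *\<^sub>R emon (1, 0)
      else if l = 0 \<and> k \<ge> 2 then (1 / dd k) *\<^sub>R emon (k, 0) else 0)"
  by (simp add: Top_def)

lemma bounded_linear_Nlin: "bounded_linear Nlin" and bounded_linear_Mlin: "bounded_linear Mlin"
  using affine_approx_Nfun affine_approx_Mfun by (auto simp: affine_approx_def)

definition Lop :: "wiener \<Rightarrow> wiener" where
  "Lop y = Piop (Nlin y + Om *\<^sub>R Mlin y)"

lemma bounded_linear_Lop: "bounded_linear Lop"
  unfolding Lop_def
  by (intro bounded_linear_compose[OF bounded_linear_Piop] bounded_linear_add bounded_linear_Nlin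
      bounded_linear_compose[OF bounded_linear_scaleR_right bounded_linear_Mlin])

lemma Lop_emon: "k \<ge> 1 \<Longrightarrow> Lop (emon (k, 0)) = dd k *\<^sub>R emon (k, 0)"
  by (simp add: Lop_def Piop_Nlin Piop_Mlin dd_def Om_def algebra_simps flip: scaleR_left_distrib)

lemma dd_1: "dd 1 = 0" by (simp add: dd_def)

lemma mu_1: "mu 1 \<noteq> 0" using m by (simp add: mu_def)

text \<open>The first summand is the effect of a change of \<Omega> on the critical monomial, the
  second that of a change of the solution. Because \<open>mu 1\<close> is nonzero, the two together
  reach every positive frequency.\<close>

lemma Lop_Top:
  "coef (Top v) (1, 0) *\<^sub>R mu 1 *\<^sub>R emon (1, 0) + Lop (Hop (Top v)) = Piop v"
proof (rule bounded_linear_eq_on_emon[where G=Piop])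
  show "bounded_linear (\<lambda>v. coef (Top v) (1, 0) *\<^sub>R mu 1 *\<^sub>R emon (1, 0) + Lop (Hop (Top v)))"
    by (intro bounded_linear_add bounded_linear_scaleR_const
        bounded_linear_compose[OF bounded_linear_coef bounded_linear_Top]
        bounded_linear_compose[OF bounded_linear_Lop bounded_linear_compose[OF bounded_linear_Hop bounded_linear_Top]])
  show "bounded_linear Piop" by (rule bounded_linear_Piop)
  fix p
  obtain C where C: "\<And>k. k \<ge> 2 \<Longrightarrow> dd k \<noteq> 0" using dd_inverse_bounded by metis
  have z: "Lop 0 = 0" by (rule linear_simps(3)[OF bounded_linear_Lop])
  show "coef (Top (emon p)) (1, 0) *\<^sub>R mu 1 *\<^sub>R emon (1, 0) + Lop (Hop (Top (emon p))) = Piop (emon p)"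
    using C mu_1
    by (cases p) (auto simp: Top_emon coef_emon z Lop_emon linear_simps[OF bounded_linear_Lop])
qed

theorem wiener_branch:
  assumes \<epsilon>: "\<epsilon> > 0"
  obtains \<delta> \<Omega> Y where "\<delta> > 0" "continuous_on {-\<delta><..<\<delta>} \<Omega>" "continuous_on {-\<delta><..<\<delta>} Y"
    "\<Omega> (0::real) = Om" "Y (0::real) = 0"
    "\<And>s. \<bar>s\<bar> < \<delta> \<Longrightarrow> norm (Y s) \<le> \<epsilon>"
    "\<And>s. \<bar>s\<bar> < \<delta> \<Longrightarrow> Piop (Y s) = Y s"
    "\<And>s. \<bar>s\<bar> < \<delta> \<Longrightarrow> coef (Y s) (1, 0) = s"
    "\<And>s. \<bar>s\<bar> < \<delta> \<Longrightarrow> Piop (Nfun (Y s) + \<Omega> s *\<^sub>R Mfun (Y s)) = 0"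
proof -
  define e where "e = emon (1, 0)"
  \<comment> \<open>\<open>RM\<close> is the quadratic remainder of the part multiplied by \<Omega>,
    and \<open>RN\<close> that of the whole equation at \<open>Om\<close>, both projected to
    positive frequencies.\<close>
  define RM where "RM y = Piop (Mfun y - 0 - Mlin y)" for y
  define RN where "RN y = Piop (Nfun y - 0 - Nlin y) + Om *\<^sub>R RM y" for y
  define M1 where "M1 y = Piop (Mlin y)" for y
  have qM: "quad_lipschitz RM"
    unfolding RM_def
    by (rule quad_lipschitz_linear[OF _ bounded_linear_Piop])
       (use affine_approx_Mfun[unfolded affine_approx_def] in blast)
  have qN: "quad_lipschitz RN"
    unfolding RN_def
    by (rule quad_lipschitz_add[OF quad_lipschitz_linear[OF _ bounded_linear_Piop]
          quad_lipschitz_linear[OF qM bounded_linear_scaleR_right]])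
       (use affine_approx_Nfun[unfolded affine_approx_def] in blast)
  have M1: "bounded_linear M1" unfolding M1_def
    by (rule bounded_linear_compose[OF bounded_linear_Piop bounded_linear_Mlin])
  obtain B where B: "B > 0" "\<And>u. norm (Hop u) \<le> B * norm u"
    using bounded_linear.pos_bounded[OF bounded_linear_Hop] by (metis mult.commute)
  obtain \<delta>0 U where U: "\<delta>0 > 0" "continuous_on {-\<delta>0<..<\<delta>0} U" "U 0 = 0"
    "\<And>s. \<bar>s\<bar> < \<delta>0 \<Longrightarrow> norm (U s) \<le> 1"
    "\<And>s. \<bar>s\<bar> < \<delta>0 \<Longrightarrow> U s = - Top (coef (U s) (1, 0) *\<^sub>R M1 (Hop (U s)) +
        (rescaled RN s (e + Hop (U s)) + coef (U s) (1, 0) *\<^sub>R rescaled RM s (e + Hop (U s))))"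
    using bifurcation_fixed_point[OF bounded_linear_Top M1 bounded_linear_Hop bounded_linear_coef[of "(1, 0)"] qN qM, of 1 e]
    by (metis zero_less_one)
  define E where "E = norm e + B"
  have E: "E > 0" using B by (auto simp: E_def intro: add_nonneg_pos)
  define \<delta> where "\<delta> = min \<delta>0 (\<epsilon> / E)"
  have \<delta>: "\<delta> > 0" "\<delta> \<le> \<delta>0" "\<delta> * E \<le> \<epsilon>" using U E \<epsilon> by (auto simp: \<delta>_def min_def field_simps)
  \<comment> \<open>One unknown \<open>U s\<close> carries both corrections: its critical
    coefficient shifts \<Omega>, and its higher frequencies bend the direction \<open>e\<close>. The
    amplitude multiplies the latter only.\<close>
  define \<Omega> where "\<Omega> s = Om + coef (U s) (1, 0)" for s
  define Y where "Y s = s *\<^sub>R (e + Hop (U s))" for s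
  have cU: "continuous_on {-\<delta><..<\<delta>} U" using U(2) by (rule continuous_on_subset) (use \<delta> in auto)
  have RN0: "RN 0 = 0" "RM 0 = 0" using qN qM by (auto simp: quad_lipschitz_def)
  have nf0: "Nfun 0 = 0" "Mfun 0 = 0" using affine_approx_0 affine_approx_Nfun affine_approx_Mfun by blast+
  show ?thesis
  proof (rule that[of \<delta> \<Omega> Y])
    show "continuous_on {-\<delta><..<\<delta>} \<Omega>" unfolding \<Omega>_def
      by (intro continuous_intros bounded_linear.continuous_on[OF bounded_linear_coef] cU)
    show "continuous_on {-\<delta><..<\<delta>} Y" unfolding Y_def
      by (intro continuous_intros bounded_linear.continuous_on[OF bounded_linear_Hop] cU)
    show "\<Omega> 0 = Om" "Y 0 = 0" by (simp_all add: \<Omega>_def Y_def U(3))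
    fix s :: real assume s: "\<bar>s\<bar> < \<delta>"
    hence s0: "\<bar>s\<bar> < \<delta>0" using \<delta> by simp
    have "norm (e + Hop (U s)) \<le> norm e + B * norm (U s)"
      by (intro order.trans[OF norm_triangle_ineq] add_mono B) auto
    also have "\<dots> \<le> E" using U(4)[OF s0] B(1) by (simp add: E_def mult_left_le)
    finally have "norm (Y s) \<le> \<bar>s\<bar> * E" by (simp add: Y_def mult_left_mono)
    also have "\<dots> \<le> \<delta> * E" using s E by (intro mult_right_mono) auto
    finally show "norm (Y s) \<le> \<epsilon>" using \<delta> by simp
    show "Piop (Y s) = Y s" by (simp add: Y_def e_def Piop_Hop)
    have "coef (Hop c) (1, 0) = 0" for c
      by (rule bounded_linear_eq_on_emon[of "\<lambda>c. coef (Hop c) (1, 0)" "\<lambda>_. 0", OF bounded_linear_compose[OF bounded_linear_coef bounded_linear_Hop] bounded_linear_zero])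
        (auto simp: coef_emon)
    thus "coef (Y s) (1, 0) = s" by (simp add: Y_def e_def coef_emon)
    show "Piop (Nfun (Y s) + \<Omega> s *\<^sub>R Mfun (Y s)) = 0"
    proof (cases "s = 0")
      case True
      thus ?thesis by (simp add: Y_def nf0)
    next
      case False
      define u where "u = U s"
      define lam where "lam = coef u (1, 0)"
      define v where "v = e + Hop u"
      define V where "V = lam *\<^sub>R M1 (Hop u) + (rescaled RN s v + lam *\<^sub>R rescaled RM s v)"
      have u: "u = - Top V" using U(5)[OF s0] by (simp add: V_def v_def lam_def u_def)
      have PiV: "Piop V = V"
        using False by (simp add: V_def M1_def rescaled_def RN_def RM_def Piop_Piop)
      have "- (lam *\<^sub>R mu 1 *\<^sub>R e + Lop (Hop u)) = V"
        using Lop_Top[of V] PiV unfolding lam_def u e_def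
        by (simp add: linear_simps[OF bounded_linear_Lop] add.commute)
      hence zero: "lam *\<^sub>R mu 1 *\<^sub>R e + Lop (Hop u) + V = 0" by (metis add.right_inverse minus_minus)
      \<comment> \<open>The direction \<open>e\<close> lies in the kernel of \<open>Lop\<close>, so
        it contributes only through the variation of \<Omega>, with multiplier
        \<open>mu 1\<close>.\<close>
      have L: "Lop v = Lop (Hop u)" and M: "M1 v = mu 1 *\<^sub>R e + M1 (Hop u)"
        by (simp_all add: v_def e_def linear_simps[OF bounded_linear_Lop] Lop_emon dd_1
            linear_simps[OF M1]) (simp add: M1_def Piop_Mlin)
      have Ys: "Y s = s *\<^sub>R v" by (simp add: Y_def v_def u_def)
      have "Piop (Nfun (Y s) + \<Omega> s *\<^sub>R Mfun (Y s)) = Lop (Y s) + lam *\<^sub>R M1 (Y s) + (RN (Y s) + lam *\<^sub>R RM (Y s))"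
        by (simp add: Lop_def M1_def RN_def RM_def \<Omega>_def lam_def u_def algebra_simps)
      \<comment> \<open>Linear parts scale with the amplitude and remainders become
        \<open>rescaled\<close>; the bracket is the equation that the fixed point solves.\<close>
      also have "\<dots> = s *\<^sub>R (Lop v + lam *\<^sub>R M1 v + (rescaled RN s v + lam *\<^sub>R rescaled RM s v))"
        using False unfolding Ys
        by (simp add: rescaled_def linear_simps[OF bounded_linear_Lop] linear_simps[OF M1] algebra_simps)
      also have "Lop v + lam *\<^sub>R M1 v + (rescaled RN s v + lam *\<^sub>R rescaled RM s v)
          = lam *\<^sub>R mu 1 *\<^sub>R e + Lop (Hop u) + V"
        unfolding L M V_def by (simp add: algebra_simps)
      finally show ?thesis unfolding zero by simp
    qed
  qed (use \<delta> in auto)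
qed

end

text \<open>Reflecting \<theta> at pi fixes the chord and reverses the sine, so the integral is its
  own negative.\<close>

lemma sine_sin_integral_zero:
  "(LINT \<theta>:{0<..<2*pi}|lborel. \<kappa> (2 * sin (\<theta> / 2)) * sin (real_of_int l * \<theta>)) = (0::real)"
proof -
  define f where "f \<theta> = indicator {0<..<2*pi} \<theta> *\<^sub>R (\<kappa> (2 * sin (\<theta> / 2)) * sin (real_of_int l * \<theta>))" for \<theta> :: real
  have "f (2 * pi + (-1) * \<theta>) = - f \<theta>" for \<theta>
  proof -
    have "sin ((2 * pi + (-1) * \<theta>) / 2) = sin (\<theta> / 2)"
      using sin_pi_minus[of "\<theta> / 2"] by (simp add: diff_divide_distrib)
    moreover have "sin (real_of_int l * (2 * pi + (-1) * \<theta>)) = - sin (real_of_int l * \<theta>)"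
    proof -
      have "real_of_int l * (2 * pi + (-1) * \<theta>) = 2 * pi * real_of_int l - real_of_int l * \<theta>"
        by (simp add: algebra_simps)
      thus ?thesis by (simp only: sin_diff sin_int_2pin cos_int_2pin)
    qed
    ultimately show ?thesis unfolding f_def by (auto simp: indicator_def)
  qed
  hence "integral\<^sup>L lborel f = - integral\<^sup>L lborel f"
    using lborel_integral_real_affine[of "-1" f "2 * pi"] by simp
  thus ?thesis by (simp add: set_lebesgue_integral_def f_def[abs_def])
qed

lemma coef_Piop: "coef (Piop c) (k, l) = (if l = 0 \<and> k \<ge> 1 then coef c (k, l) else 0)"
proof (rule bounded_linear_eq_on_emon[where F="\<lambda>c. coef (Piop c) (k, l)"])
  show "bounded_linear (\<lambda>c. coef (Piop c) (k, l))"
    by (rule bounded_linear_compose[OF bounded_linear_coef bounded_linear_Piop])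
  show "bounded_linear (\<lambda>c. if l = 0 \<and> k \<ge> 1 then coef c (k, l) else 0)"
    by (cases "l = 0 \<and> k \<ge> 1") (auto intro: bounded_linear_coef)
qed (auto simp: coef_emon split: if_splits)

section \<open>From elements of the algebra back to functions on the circle\<close>

definition pc :: "wiener \<Rightarrow> nat \<Rightarrow> real" where "pc y k = coef y (int k, 0)"

lemma Piop_coef_zero: "Piop y = y \<Longrightarrow> p \<notin> range (\<lambda>k. (int k, 0)) \<Longrightarrow> coef y p = 0"
proof -
  assume y: "Piop y = y" and p: "p \<notin> range (\<lambda>k. (int k, 0))"
  obtain k l where kl: "p = (k, l)" by (cases p)
  have "\<not> (l = 0 \<and> k \<ge> 1)"
  proof
    assume "l = 0 \<and> k \<ge> 1"
    hence "p = (int (nat k), 0)" by (simp add: kl)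
    with p show False by blast
  qed
  hence "coef (Piop y) (k, l) = 0" unfolding coef_Piop by auto
  thus "coef y p = 0" by (simp add: y kl)
qed

lemma pc_0: "Piop y = y \<Longrightarrow> pc y 0 = 0"
  using coef_Piop[of y 0 0] by (simp add: pc_def)

text \<open>An element fixed by \<open>Piop\<close> contains no \<zeta> and only positive
  frequencies, so the unordered sum over the lattice becomes an ordinary series; its term at k = 0
  vanishes.\<close>

lemma Piop_sums:
  assumes y: "Piop y = y" and F: "bounded_linear F"
  shows "(\<lambda>k. pc y k *\<^sub>R F (emon (int k, 0))) sums F y"
proof -
  have "((\<lambda>p. coef y p *\<^sub>R F (emon p)) has_sum F y) UNIV"
    by (rule bounded_linear_has_sum_emon[OF F])
  hence "((\<lambda>p. coef y p *\<^sub>R F (emon p)) has_sum F y) (range (\<lambda>k::nat. (int k, 0::int)))"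
    by (rule has_sum_cong_neutral[THEN iffD1, rotated -1]) (auto simp: Piop_coef_zero[OF y])
  hence "((\<lambda>k. coef y (int k, 0) *\<^sub>R F (emon (int k, 0))) has_sum F y) UNIV"
    by (subst (asm) has_sum_reindex) (auto simp: inj_on_def o_def)
  thus ?thesis unfolding pc_def by (rule has_sum_imp_sums)
qed

lemma pc_norm_sums:
  assumes y: "Piop y = y"
  shows "(\<lambda>k. (1 + real k) * \<bar>pc y k\<bar>) sums norm y"
proof -
  have "((\<lambda>p. weight p * \<bar>coef y p\<bar>) has_sum norm y) UNIV"
    unfolding norm_wiener_eq by (rule has_sum_infsum[OF coef_summable])
  hence "((\<lambda>p. weight p * \<bar>coef y p\<bar>) has_sum norm y) (range (\<lambda>k::nat. (int k, 0::int)))"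
    by (rule has_sum_cong_neutral[THEN iffD1, rotated -1]) (auto simp: Piop_coef_zero[OF y])
  hence "((\<lambda>k. weight (int k, 0) * \<bar>coef y (int k, 0)\<bar>) has_sum norm y) UNIV"
    by (subst (asm) has_sum_reindex) (auto simp: inj_on_def o_def)
  from has_sum_imp_sums[OF this] show ?thesis by (simp add: pc_def weight_fst)
qed

context fold_kernel
begin

text \<open>Evaluation at w = cis \<beta> and \<zeta> = cis \<theta>. The factor \<open>m\<close>
  realizes the convention that the first exponent counts multiples of \<open>m\<close>.\<close>

definition ev :: "real \<Rightarrow> real \<Rightarrow> wiener \<Rightarrow> complex" where
  "ev \<beta> \<theta> = wlin (\<lambda>(k, l). cis (real_of_int (k * int m) * \<beta> + real_of_int l * \<theta>))"

lemma ev_bound: "norm (case p of (k, l) \<Rightarrow> cis (real_of_int (k * int m) * \<beta> + real_of_int l * \<theta>)) \<le> 1 * weight p"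
  using weight_ge_1 by (auto split: prod.splits)

lemma bounded_linear_ev: "bounded_linear (ev \<beta> \<theta>)"
  unfolding ev_def by (rule bounded_linear_wlin[OF ev_bound])

lemma norm_ev_le: "norm (ev \<beta> \<theta> c) \<le> norm c"
  unfolding ev_def by (rule order.trans[OF norm_wlin_le[OF ev_bound]]) simp

lemma ev_emon [simp]: "ev \<beta> \<theta> (emon (k, l)) = cis (real_of_int (k * int m) * \<beta> + real_of_int l * \<theta>)"
  by (simp add: ev_def)

lemmas ev_lin [simp] = linear_simps[OF bounded_linear_ev]

lemma ev_mult [simp]: "ev \<beta> \<theta> (a * b) = ev \<beta> \<theta> a * ev \<beta> \<theta> b"
proof (rule bounded_linear_mult_on_emon[OF bounded_linear_ev])
  fix p q :: "int \<times> int"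
  show "ev \<beta> \<theta> (emon (p + q)) = ev \<beta> \<theta> (emon p) * ev \<beta> \<theta> (emon q)"
    by (cases p; cases q) (simp add: cis_mult algebra_simps)
qed

lemma ev_1 [simp]: "ev \<beta> \<theta> 1 = 1"
  by (simp add: one_wiener_emon)

lemma ev_power [simp]: "ev \<beta> \<theta> (c ^ n) = ev \<beta> \<theta> c ^ n"
  by (induction n) auto

lemma ev_bar [simp]: "ev \<beta> \<theta> (bar c) = cnj (ev \<beta> \<theta> c)"
proof (rule bounded_linear_eq_on_emon[where F="\<lambda>c. ev \<beta> \<theta> (bar c)"])
  show "bounded_linear (\<lambda>c. ev \<beta> \<theta> (bar c))"
    by (rule bounded_linear_compose[OF bounded_linear_ev bounded_linear_bar])
  show "bounded_linear (\<lambda>c. cnj (ev \<beta> \<theta> c))"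
    by (rule bounded_linear_compose[OF bounded_linear_cnj bounded_linear_ev])
  show "ev \<beta> \<theta> (bar (emon p)) = cnj (ev \<beta> \<theta> (emon p))" for p
    by (cases p) (simp add: cis_cnj)
qed

text \<open>The norm bounds evaluations uniformly in the angle, so the function is a uniform limit
  of trigonometric polynomials.\<close>

lemma continuous_on_ev: "continuous_on UNIV (\<lambda>\<theta>. ev \<beta> \<theta> c)"
proof (rule uniform_limit_theorem)
  let ?S = "\<lambda>F. \<Sum>p\<in>F. coef c p *\<^sub>R emon p"
  have lim: "(?S \<longlongrightarrow> c) (finite_subsets_at_top UNIV)"
    using wiener_has_sum[of c] by (simp add: has_sum_def)
  show "uniform_limit UNIV (\<lambda>F \<theta>. ev \<beta> \<theta> (?S F)) (\<lambda>\<theta>. ev \<beta> \<theta> c) (finite_subsets_at_top UNIV)"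
  proof (rule uniform_limitI)
    fix e :: real assume "e > 0"
    hence "\<forall>\<^sub>F F in finite_subsets_at_top UNIV. dist (?S F) c < e" by (rule tendstoD[OF lim])
    thus "\<forall>\<^sub>F F in finite_subsets_at_top UNIV. \<forall>\<theta>\<in>UNIV. dist (ev \<beta> \<theta> (?S F)) (ev \<beta> \<theta> c) < e"
    proof eventually_elim
      case (elim F)
      thus ?case using norm_ev_le[of \<beta> _ "?S F - c"] le_less_trans by (auto simp: dist_norm)
    qed
  qed
  show "\<forall>\<^sub>F F in finite_subsets_at_top UNIV. continuous_on UNIV (\<lambda>\<theta>. ev \<beta> \<theta> (?S F))"
  proof (intro always_eventually allI)
    fix F :: "(int \<times> int) set"
    have "ev \<beta> \<theta> (?S F) = (\<Sum>p\<in>F. coef c p *\<^sub>R cis (real_of_int (fst p * int m) * \<beta> + real_of_int (snd p) * \<theta>))" for \<theta>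
      by (simp add: linear_sum[OF bounded_linear.linear[OF bounded_linear_ev]])
        (intro sum.cong refl, auto)
    thus "continuous_on UNIV (\<lambda>\<theta>. ev \<beta> \<theta> (?S F))"
      by (simp only:) (intro continuous_intros continuous_on_compose2[OF continuous_on_cis], auto)
  qed
qed simp

lemma ev_sine_integrable:
  assumes \<kappa>: "set_integrable lborel {0<..<2*pi} (\<lambda>\<theta>. \<kappa> (2 * sin (\<theta> / 2)))"
  shows "set_integrable lborel {0<..<2*pi} (\<lambda>\<theta>. \<kappa> (2 * sin (\<theta> / 2)) *\<^sub>R ev \<beta> \<theta> c)"
proof (rule set_integrable_bound)
  show "set_integrable lborel {0<..<2*pi} (\<lambda>\<theta>. norm c * \<kappa> (2 * sin (\<theta> / 2)))"
    using \<kappa> by (rule set_integrable_mult_right)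
  have "(\<lambda>\<theta>. (indicator {0<..<2*pi} \<theta> *\<^sub>R \<kappa> (2 * sin (\<theta> / 2))) *\<^sub>R ev \<beta> \<theta> c) \<in> borel_measurable lborel"
    using borel_measurable_continuous_onI[OF continuous_on_ev[of \<beta> c]]
    by (intro borel_measurable_scaleR[OF borel_measurable_integrable[OF \<kappa>[unfolded set_integrable_def]]]) simp
  thus "set_borel_measurable lborel {0<..<2*pi} (\<lambda>\<theta>. \<kappa> (2 * sin (\<theta> / 2)) *\<^sub>R ev \<beta> \<theta> c)"
    by (simp add: set_borel_measurable_def)
  show "AE \<theta> in lborel. \<theta> \<in> {0<..<2*pi} \<longrightarrow> norm (\<kappa> (2 * sin (\<theta> / 2)) *\<^sub>R ev \<beta> \<theta> c) \<le> norm (norm c * \<kappa> (2 * sin (\<theta> / 2)))"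
    by (intro AE_I2) (auto simp: abs_mult mult.commute[of "norm c"] intro!: mult_left_mono norm_ev_le)
qed

text \<open>Evaluation turns \<open>Iop\<close> back into an integral. The angle on the left is
  arbitrary, because \<zeta> does not occur in the result of \<open>Iop\<close>.\<close>

lemma ev_Iop_kap:
  "ev \<beta> \<theta>0 (Iop (kap j) c) = (LINT \<theta>:{0<..<2*pi}|lborel. kap j (2 * sin (\<theta> / 2)) *\<^sub>R ev \<beta> \<theta> c)"
proof (rule bounded_linear_eq_on_emon[where F="\<lambda>c. ev \<beta> \<theta>0 (Iop (kap j) c)"])
  let ?k = "\<lambda>\<theta>. kap j (2 * sin (\<theta> / 2))"
  note \<kappa> = kap_sine_integrable[of j]
  note i = ev_sine_integrable[OF \<kappa>, of \<beta>]
  show "bounded_linear (\<lambda>c. ev \<beta> \<theta>0 (Iop (kap j) c))"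
    by (rule bounded_linear_compose[OF bounded_linear_ev bounded_linear_Iop])
  show "bounded_linear (\<lambda>c. LINT \<theta>:{0<..<2*pi}|lborel. ?k \<theta> *\<^sub>R ev \<beta> \<theta> c)"
  proof (rule bounded_linear_intro)
    show "(LINT \<theta>:{0<..<2*pi}|lborel. ?k \<theta> *\<^sub>R ev \<beta> \<theta> (a + b)) =
       (LINT \<theta>:{0<..<2*pi}|lborel. ?k \<theta> *\<^sub>R ev \<beta> \<theta> a) + (LINT \<theta>:{0<..<2*pi}|lborel. ?k \<theta> *\<^sub>R ev \<beta> \<theta> b)" for a b
      by (simp add: scaleR_add_right set_integral_add i)
    show "(LINT \<theta>:{0<..<2*pi}|lborel. ?k \<theta> *\<^sub>R ev \<beta> \<theta> (r *\<^sub>R a)) = r *\<^sub>R (LINT \<theta>:{0<..<2*pi}|lborel. ?k \<theta> *\<^sub>R ev \<beta> \<theta> a)" for r a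
      unfolding set_lebesgue_integral_def by (simp add: mult_ac flip: integral_scaleR_right)
    show "norm (LINT \<theta>:{0<..<2*pi}|lborel. ?k \<theta> *\<^sub>R ev \<beta> \<theta> a) \<le> norm a * (LINT \<theta>:{0<..<2*pi}|lborel. \<bar>?k \<theta>\<bar>)" for a
    proof -
      have "norm (LINT \<theta>:{0<..<2*pi}|lborel. ?k \<theta> *\<^sub>R ev \<beta> \<theta> a) \<le> (LINT \<theta>:{0<..<2*pi}|lborel. norm (?k \<theta> *\<^sub>R ev \<beta> \<theta> a))"
        by (rule set_integral_norm_bound[OF i])
      also have "\<dots> \<le> (LINT \<theta>:{0<..<2*pi}|lborel. norm a * \<bar>?k \<theta>\<bar>)"
        using \<kappa> norm_ev_le[of \<beta> _ a]
        by (intro set_integral_mono set_integrable_norm[OF i] set_integrable_mult_right set_integrable_abs)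
           (auto simp: mult.commute[of "norm a"] intro!: mult_left_mono)
      finally show ?thesis by simp
    qed
  qed
  show "ev \<beta> \<theta>0 (Iop (kap j) (emon p)) = (LINT \<theta>:{0<..<2*pi}|lborel. ?k \<theta> *\<^sub>R ev \<beta> \<theta> (emon p))" for p
  proof (cases p)
    case (Pair k l)
    define A where "A = cis (real_of_int (k * int m) * \<beta>)"
    have evp: "x *\<^sub>R ev \<beta> \<theta> (emon p) = A * (complex_of_real (x * cos (real_of_int l * \<theta>)) + \<i> * complex_of_real (x * sin (real_of_int l * \<theta>)))" for x \<theta>
    proof -
      have "ev \<beta> \<theta> (emon p) = A * cis (real_of_int l * \<theta>)" by (simp add: Pair A_def cis_mult)
      moreover have "cis \<phi> = complex_of_real (cos \<phi>) + \<i> * complex_of_real (sin \<phi>)" for \<phi>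
        by (simp add: complex_eq_iff)
      ultimately show ?thesis by (simp add: scaleR_conv_of_real algebra_simps)
    qed
    have "(LINT \<theta>:{0<..<2*pi}|lborel. ?k \<theta> *\<^sub>R ev \<beta> \<theta> (emon p))
      = (LINT \<theta>:{0<..<2*pi}|lborel. A * (complex_of_real (?k \<theta> * cos (real_of_int l * \<theta>)) + \<i> * complex_of_real (?k \<theta> * sin (real_of_int l * \<theta>))))"
      by (simp only: evp)
    also have "\<dots> = A * (complex_of_real (LINT \<theta>:{0<..<2*pi}|lborel. ?k \<theta> * cos (real_of_int l * \<theta>))
        + \<i> * complex_of_real (LINT \<theta>:{0<..<2*pi}|lborel. ?k \<theta> * sin (real_of_int l * \<theta>)))"
    proof -
      have c: "set_integrable lborel {0<..<2*pi} (\<lambda>\<theta>. ?k \<theta> * cos (real_of_int l * \<theta>))"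
        by (rule sine_cos_integrable[OF \<kappa>])
      have s: "set_integrable lborel {0<..<2*pi} (\<lambda>\<theta>. ?k \<theta> * sin (real_of_int l * \<theta>))"
      proof (rule set_integrable_bound[OF \<kappa>])
        have "(\<lambda>\<theta>. (indicator {0<..<2*pi} \<theta> *\<^sub>R ?k \<theta>) * sin (real_of_int l * \<theta>)) \<in> borel_measurable lborel"
          using borel_measurable_integrable[OF \<kappa>[unfolded set_integrable_def]] by (intro borel_measurable_times) auto
        thus "set_borel_measurable lborel {0<..<2*pi} (\<lambda>\<theta>. ?k \<theta> * sin (real_of_int l * \<theta>))"
          by (simp add: set_borel_measurable_def mult.assoc)
      qed (auto simp: abs_mult mult_left_le)
      have c': "set_integrable lborel {0<..<2*pi} (\<lambda>\<theta>. complex_of_real (?k \<theta> * cos (real_of_int l * \<theta>)))"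
        and s': "set_integrable lborel {0<..<2*pi} (\<lambda>\<theta>. complex_of_real (?k \<theta> * sin (real_of_int l * \<theta>)))"
        using c s by (auto simp: set_integrable_def scaleR_conv_of_real simp flip: of_real_mult intro: integrable_of_real)
      show ?thesis
        by (simp only: set_integral_mult_right set_integral_add(2)[OF c' set_integrable_mult_right[OF s']] set_integral_complex_of_real)
    qed
    also have "\<dots> = ev \<beta> \<theta>0 (Iop (kap j) (emon p))"
    proof -
      have "ev \<beta> \<theta>0 (Iop (kap j) (emon p)) = fcos (kap j) l *\<^sub>R A" by (simp add: Pair A_def)
      thus ?thesis by (simp add: sine_sin_integral_zero fcos_def scaleR_conv_of_real mult.commute[of A])
    qed
    finally show ?thesis by simp
  qed
qed

lemma norm_pfun_le: "norm (pfun y) \<le> 2 * norm y + (norm y)\<^sup>2"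
proof -
  have "norm (pfun y) \<le> norm (Qop y) + norm (bar (Qop y)) + norm (Qop y) * norm (bar (Qop y))"
    unfolding pfun_def by (intro order.trans[OF norm_triangle_ineq] add_mono norm_mult_ineq order_refl)
  also have "\<dots> \<le> norm y + norm y + norm y * norm y"
    using norm_Qop_le[of y] by (intro add_mono mult_mono) auto
  finally show ?thesis by (simp add: power2_eq_square)
qed

lemma pfun_half:
  assumes "norm y \<le> 1/16" shows "norm (pfun y) \<le> 1/2"
proof -
  have "(norm y)\<^sup>2 \<le> (1/16)\<^sup>2" using assms by (intro power_mono) auto
  thus ?thesis using norm_pfun_le[of y] assms by (simp add: power2_eq_square)
qed

text \<open>Evaluated at a point, 1 plus \<open>pfun y\<close> is the squared modulus of 1 plus the
  difference quotient. It is real and close to 1, so the root in the algebra becomes the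
  modulus.\<close>

lemma ev_sqrt1m_pfun:
  assumes y: "norm y \<le> 1/16"
  shows "ev \<beta> \<theta> (sqrt1m (pfun y)) = of_real (norm (1 + ev \<beta> \<theta> (Qop y)) - 1)"
proof -
  define q where "q = ev \<beta> \<theta> (Qop y)"
  define p where "p = (norm (1 + q))\<^sup>2 - 1"
  have evp: "ev \<beta> \<theta> (pfun y) = of_real p"
  proof -
    have "complex_of_real ((norm (1 + q))\<^sup>2) = (1 + q) * cnj (1 + q)"
      using complex_norm_square[of "1 + q"] by simp
    thus ?thesis by (simp add: pfun_def p_def algebra_simps flip: q_def)
  qed
  have "norm (ev \<beta> \<theta> (pfun y)) \<le> 1/2" using norm_ev_le[of \<beta> \<theta> "pfun y"] pfun_half[OF y] by linarith
  hence p: "\<bar>p\<bar> \<le> 1/2" unfolding evp by simp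
  have "ev \<beta> \<theta> (sqrt1m (pfun y)) = sqrt1m (complex_of_real p)"
    using bounded_hom_sqrt1m[OF bounded_linear_ev ev_1 ev_mult pfun_half[OF y]] p evp by simp
  also have "\<dots> = of_real (sqrt1m p)"
    using bounded_hom_sqrt1m[of "of_real :: real \<Rightarrow> complex" p] p by (simp add: bounded_linear_of_real)
  also have "sqrt1m p = norm (1 + q) - 1"
    using sqrt1m_real[OF p] by (simp add: p_def)
  finally show ?thesis by (simp add: q_def)
qed

text \<open>The threshold 1/4, times the growth rate 2 of the kernel coefficients, is the margin 1/2
  required for summability.\<close>

lemma Nfun_sums:
  assumes "norm (sqrt1m (pfun y)) \<le> 1/4"
  shows "(\<lambda>j. Iop (kap j) (sqrt1m (pfun y) ^ j * (bfun y - bar (bfun y)))) sums Nfun y"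
proof -
  have "summable (\<lambda>j. norm (Iop (kap j) (sqrt1m (pfun y) ^ j * (bfun y - bar (bfun y)))))"
    by (rule power_series_operator_summable[of _ "2 * Kmaj" 2]) (use assms norm_Iop_le Kmaj_nonneg in auto)
  from summable_norm_cancel[OF this] show ?thesis unfolding Nfun_def by (rule summable_sums)
qed

text \<open>The equation contains no \<zeta> and is odd under \<open>bar\<close>: the root is
  symmetric, its cofactor is odd, and \<open>Iop\<close> commutes with \<open>bar\<close>. Its
  positive frequencies therefore decide it.\<close>

lemma equation_zero:
  assumes y: "Piop y = y" "norm y \<le> 1/16" and s: "norm (sqrt1m (pfun y)) \<le> 1/4"
    and eq: "Piop (Nfun y + \<Omega> *\<^sub>R Mfun y) = 0"
  shows "Nfun y + \<Omega> *\<^sub>R Mfun y = 0"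
proof (rule antisymmetric_zero[OF _ _ eq])
  have zy: "Z0op y = y" using Z0op_Piop[of y] y by simp
  have pb: "bar (pfun y) = pfun y" by (simp add: pfun_def mult.commute add.commute)
  have xb: "bar (sqrt1m (pfun y)) = sqrt1m (pfun y)"
    using bounded_hom_sqrt1m[OF bounded_linear_bar bar_1 bar_mult pfun_half[OF y(2)]] pfun_half[OF y(2)] by (simp add: pb)
  have "(\<lambda>j. bar (Iop (kap j) (sqrt1m (pfun y) ^ j * (bfun y - bar (bfun y))))) sums bar (Nfun y)"
    by (rule bounded_linear.sums[OF bounded_linear_bar Nfun_sums[OF s]])
  moreover have "bar (Iop (kap j) (sqrt1m (pfun y) ^ j * (bfun y - bar (bfun y)))) =
     - Iop (kap j) (sqrt1m (pfun y) ^ j * (bfun y - bar (bfun y)))" for j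
    unfolding bar_Iop by (simp add: xb right_diff_distrib)
  ultimately have "bar (Nfun y) = - Nfun y"
    using sums_minus[OF Nfun_sums[OF s]] by (simp add: sums_iff)
  thus "bar (Nfun y + \<Omega> *\<^sub>R Mfun y) = - (Nfun y + \<Omega> *\<^sub>R Mfun y)"
    by (simp add: Mfun_def algebra_simps)
  have "Z0op (Nfun y) = Nfun y"
    using bounded_linear.sums[OF bounded_linear_Z0op Nfun_sums[OF s]] Nfun_sums[OF s]
    by (simp only: Z0op_Iop sums_iff)
  thus "Z0op (Nfun y + \<Omega> *\<^sub>R Mfun y) = Nfun y + \<Omega> *\<^sub>R Mfun y"
    by (simp add: Mfun_def cfun_def Z0op_Pop zy flip: bar_Z0op)
qed

text \<open>Sum and integral are interchanged with a multiple of \<open>kmaj\<close> times powers of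
  1/8 as majorant: the rate 2 of the kernel coefficients meets the bound 1/16 on the relative change
  of the chord. Pointwise the series is the Taylor series of K at the deformed chord.\<close>

lemma ev_Nfun:
  assumes y: "norm y \<le> 1/16" and s: "norm (sqrt1m (pfun y)) \<le> 1/4"
  defines "b \<equiv> \<lambda>\<beta> \<theta>. ev \<beta> \<theta> (bfun y - bar (bfun y))"
  shows "ev \<beta> \<theta>0 (Nfun y) = (LINT \<theta>:{0<..<2*pi}|lborel.
      K (2 * sin (\<theta> / 2) * norm (1 + ev \<beta> \<theta> (Qop y))) *\<^sub>R b \<beta> \<theta>)"
proof -
  define X where "X \<theta> = norm (1 + ev \<beta> \<theta> (Qop y)) - 1" for \<theta>
  define B where "B = norm (bfun y - bar (bfun y))"
  define f where "f j \<theta> = indicator {0<..<2*pi} \<theta> *\<^sub>R ((kap j (2 * sin (\<theta> / 2)) * X \<theta> ^ j) *\<^sub>R b \<beta> \<theta>)" for j \<theta>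
  have X: "\<bar>X \<theta>\<bar> \<le> 1/16" for \<theta>
  proof -
    have "\<bar>norm (1 + ev \<beta> \<theta> (Qop y)) - norm (1::complex)\<bar> \<le> norm (1 + ev \<beta> \<theta> (Qop y) - 1)"
      by (rule norm_triangle_ineq3)
    also have "\<dots> \<le> norm y" using norm_ev_le[of \<beta> \<theta> "Qop y"] norm_Qop_le[of y] by simp
    finally show ?thesis using y by (simp add: X_def)
  qed
  have b: "norm (b \<beta> \<theta>) \<le> B" for \<theta> unfolding b_def B_def by (rule norm_ev_le)
  have fev: "kap j (2 * sin (\<theta> / 2)) *\<^sub>R ev \<beta> \<theta> (sqrt1m (pfun y) ^ j * (bfun y - bar (bfun y)))
      = (kap j (2 * sin (\<theta> / 2)) * X \<theta> ^ j) *\<^sub>R b \<beta> \<theta>" for j \<theta>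
    unfolding ev_mult ev_power ev_sqrt1m_pfun[OF y] b_def X_def
    by (simp add: scaleR_conv_of_real)
  have fint: "integrable lborel (f j)" and fI: "integral\<^sup>L lborel (f j) = ev \<beta> \<theta>0 (Iop (kap j) (sqrt1m (pfun y) ^ j * (bfun y - bar (bfun y))))" for j
    using ev_sine_integrable[OF kap_sine_integrable[of j], of \<beta> "sqrt1m (pfun y) ^ j * (bfun y - bar (bfun y))"]
      ev_Iop_kap[of \<beta> \<theta>0 j "sqrt1m (pfun y) ^ j * (bfun y - bar (bfun y))"]
    unfolding fev f_def[abs_def] set_integrable_def set_lebesgue_integral_def by auto
  have nf: "norm (f j \<theta>) \<le> (2 * B * (1/8) ^ j) * (indicator {0<..<2*pi} \<theta> *\<^sub>R kmaj (2 * sin (\<theta> / 2)))" for j \<theta>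
  proof (cases "\<theta> \<in> {0<..<2*pi}")
    case True
    hence t: "2 * sin (\<theta> / 2) > 0" by (simp add: sin_half_pos)
    have "norm (f j \<theta>) = \<bar>kap j (2 * sin (\<theta> / 2))\<bar> * \<bar>X \<theta>\<bar> ^ j * norm (b \<beta> \<theta>)"
      using True by (simp add: f_def abs_mult power_abs)
    also have "\<dots> \<le> (2 * 2 ^ j * kmaj (2 * sin (\<theta> / 2))) * (1/16) ^ j * B"
      using kap_bound[OF t, of j] X b kmaj_nonneg by (intro mult_mono power_mono) auto
    also have "\<dots> = 2 * B * (2 * (1/16)) ^ j * kmaj (2 * sin (\<theta> / 2))"
      unfolding power_mult_distrib by (simp add: mult_ac)
    finally show ?thesis using True by simp
  qed (simp add: f_def)
  have AEs: "AE \<theta> in lborel. summable (\<lambda>j. norm (f j \<theta>))"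
  proof (rule AE_I2, rule summable_comparison_test'[where N=0])
    fix \<theta> :: real
    show "summable (\<lambda>j. (2 * B * (1/8) ^ j) * (indicator {0<..<2*pi} \<theta> *\<^sub>R kmaj (2 * sin (\<theta> / 2))))"
      by (intro summable_mult2 summable_mult summable_geometric) auto
    show "norm (norm (f j \<theta>)) \<le> (2 * B * (1/8) ^ j) * (indicator {0<..<2*pi} \<theta> *\<^sub>R kmaj (2 * sin (\<theta> / 2)))" for j
      using nf by simp
  qed
  have Is: "summable (\<lambda>j. \<integral>\<theta>. norm (f j \<theta>) \<partial>lborel)"
  proof (rule summable_comparison_test'[where N=0])
    show "summable (\<lambda>j. (2 * B * (1/8) ^ j) * Kmaj)"
      by (intro summable_mult2 summable_mult summable_geometric) auto
    fix j :: nat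
    have "(\<integral>\<theta>. norm (f j \<theta>) \<partial>lborel) \<le> (\<integral>\<theta>. (2 * B * (1/8) ^ j) * (indicator {0<..<2*pi} \<theta> *\<^sub>R kmaj (2 * sin (\<theta> / 2))) \<partial>lborel)"
      using kmaj_sine_integrable[unfolded set_integrable_def]
      by (intro integral_mono nf integrable_norm fint integrable_mult_right) auto
    also have "\<dots> = (2 * B * (1/8) ^ j) * Kmaj"
      by (simp only: integral_mult_right_zero Kmaj_def set_lebesgue_integral_def)
    finally show "norm (\<integral>\<theta>. norm (f j \<theta>) \<partial>lborel) \<le> (2 * B * (1/8) ^ j) * Kmaj"
      by simp
  qed
  have "(\<lambda>j. integral\<^sup>L lborel (f j)) sums (\<integral>\<theta>. (\<Sum>j. f j \<theta>) \<partial>lborel)"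
    by (rule sums_integral[OF fint AEs Is])
  moreover have "(\<lambda>j. integral\<^sup>L lborel (f j)) sums ev \<beta> \<theta>0 (Nfun y)"
    unfolding fI by (rule bounded_linear.sums[OF bounded_linear_ev Nfun_sums[OF s]])
  ultimately have "ev \<beta> \<theta>0 (Nfun y) = (\<integral>\<theta>. (\<Sum>j. f j \<theta>) \<partial>lborel)" by (simp add: sums_iff)
  also have "\<dots> = (LINT \<theta>:{0<..<2*pi}|lborel. K (2 * sin (\<theta> / 2) * norm (1 + ev \<beta> \<theta> (Qop y))) *\<^sub>R b \<beta> \<theta>)"
    unfolding set_lebesgue_integral_def
  proof (intro Bochner_Integration.integral_cong refl)
    fix \<theta> :: real
    show "(\<Sum>j. f j \<theta>) = indicator {0<..<2*pi} \<theta> *\<^sub>R K (2 * sin (\<theta> / 2) * norm (1 + ev \<beta> \<theta> (Qop y))) *\<^sub>R b \<beta> \<theta>"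
    proof (cases "\<theta> \<in> {0<..<2*pi}")
      case True
      hence "(\<lambda>j. kap j (2 * sin (\<theta> / 2)) * X \<theta> ^ j) sums K (2 * sin (\<theta> / 2) * (1 + X \<theta>))"
        using X[of \<theta>] by (intro K_taylor_sums) (auto simp: sin_half_pos)
      from sums_scaleR_left[OF this, of "b \<beta> \<theta>"] show ?thesis
        using True by (simp add: f_def X_def sums_iff)
    qed (simp add: f_def)
  qed
  finally show ?thesis .
qed

text \<open>The series of f', as \<open>fser\<close> is that of f. Both are given on the whole
  closed disk, while the algebra determines them on the circle only.\<close>

definition gser :: "wiener \<Rightarrow> complex \<Rightarrow> complex" where
  "gser y z = (\<Sum>k. of_real (pc y k) * z ^ (k * m))"

definition fser :: "wiener \<Rightarrow> complex \<Rightarrow> complex" where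
  "fser y z = (\<Sum>k. of_real (pc y k / real (k * m + 1)) * z ^ (k * m + 1))"

lemma pc_summable: "Piop y = y \<Longrightarrow> summable (\<lambda>k. (1 + real k) * \<bar>pc y k\<bar>)"
  using pc_norm_sums sums_summable by blast

lemma gser_sums:
  assumes "Piop y = y" "norm z \<le> 1"
  shows "(\<lambda>k. of_real (pc y k) * z ^ (k * m)) sums gser y z"
  unfolding gser_def
proof (rule summable_sums, rule summable_comparison_test'[OF pc_summable[OF assms(1)], where N=0])
  fix k
  have "norm (of_real (pc y k) * z ^ (k * m)) = \<bar>pc y k\<bar> * norm z ^ (k * m)" by (simp add: norm_mult norm_power)
  also have "\<dots> \<le> \<bar>pc y k\<bar> * 1" using assms(2) by (intro mult_left_mono power_le_one) auto
  also have "\<dots> \<le> (1 + real k) * \<bar>pc y k\<bar>" by (simp add: algebra_simps)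
  finally show "norm (of_real (pc y k) * z ^ (k * m)) \<le> (1 + real k) * \<bar>pc y k\<bar>" .
qed

lemma fser_sums:
  assumes "Piop y = y" "norm z \<le> 1"
  shows "(\<lambda>k. of_real (pc y k / real (k * m + 1)) * z ^ (k * m + 1)) sums fser y z"
  unfolding fser_def
proof (rule summable_sums, rule summable_comparison_test'[OF pc_summable[OF assms(1)], where N=0])
  fix k
  have "norm (of_real (pc y k / real (k * m + 1)) * z ^ (k * m + 1)) = (\<bar>pc y k\<bar> / real (k * m + 1)) * norm z ^ (k * m + 1)"
    unfolding norm_mult norm_power norm_of_real abs_divide by simp
  also have "\<dots> \<le> (\<bar>pc y k\<bar> / 1) * 1" using assms(2) by (intro mult_mono power_le_one frac_le) auto
  also have "\<dots> \<le> (1 + real k) * \<bar>pc y k\<bar>" by (simp add: algebra_simps)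
  finally show "norm (of_real (pc y k / real (k * m + 1)) * z ^ (k * m + 1)) \<le> (1 + real k) * \<bar>pc y k\<bar>" .
qed

lemma cis_power: "cis \<beta> ^ n = cis (real n * \<beta>)"
  by (rule Complex.DeMoivre)

lemma ev_series:
  assumes y: "Piop y = y"
  shows "ev \<beta> \<theta> y = gser y (cis \<beta>)"
    and "ev \<beta> \<theta> (Zop y) = gser y (cis \<beta> * cis \<theta>)"
    and "cis \<beta> * ev \<beta> \<theta> (Pop y) = fser y (cis \<beta>)"
    and "cis \<beta> * ((cis \<theta> - 1) * ev \<beta> \<theta> (Qop y)) = fser y (cis \<beta> * cis \<theta>) - fser y (cis \<beta>)"
proof -
  have "(\<lambda>k. pc y k *\<^sub>R ev \<beta> \<theta> (emon (int k, 0))) sums ev \<beta> \<theta> y"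
    by (rule Piop_sums[OF y bounded_linear_ev])
  moreover have "pc y k *\<^sub>R ev \<beta> \<theta> (emon (int k, 0)) = of_real (pc y k) * cis \<beta> ^ (k * m)" for k
    by (simp add: cis_power scaleR_conv_of_real)
  ultimately show "ev \<beta> \<theta> y = gser y (cis \<beta>)"
    using gser_sums[OF y, of "cis \<beta>"] by (simp add: sums_iff)
  have "(\<lambda>k. pc y k *\<^sub>R ev \<beta> \<theta> (Zop (emon (int k, 0)))) sums ev \<beta> \<theta> (Zop y)"
    by (rule Piop_sums[OF y bounded_linear_compose[OF bounded_linear_ev bounded_linear_Zop]])
  moreover have "pc y k *\<^sub>R ev \<beta> \<theta> (Zop (emon (int k, 0))) = of_real (pc y k) * (cis \<beta> * cis \<theta>) ^ (k * m)" for k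
    by (simp add: cis_power cis_mult scaleR_conv_of_real algebra_simps)
  ultimately show "ev \<beta> \<theta> (Zop y) = gser y (cis \<beta> * cis \<theta>)"
    using gser_sums[OF y, of "cis \<beta> * cis \<theta>"] by (simp add: sums_iff norm_mult)
  have "(\<lambda>k. pc y k *\<^sub>R (cis \<beta> * ev \<beta> \<theta> (Pop (emon (int k, 0))))) sums (cis \<beta> * ev \<beta> \<theta> (Pop y))"
    by (rule Piop_sums[OF y bounded_linear_const_mult[OF bounded_linear_compose[OF bounded_linear_ev bounded_linear_Pop]]])
  moreover have "pc y k *\<^sub>R (cis \<beta> * ev \<beta> \<theta> (Pop (emon (int k, 0)))) = of_real (pc y k / real (k * m + 1)) * cis \<beta> ^ (k * m + 1)" for k
  proof -
    have "ev \<beta> \<theta> (Pop (emon (int k, 0))) = (1 / real (k * m + 1)) *\<^sub>R cis \<beta> ^ (k * m)"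
      by (simp add: Pop_emon cis_power)
    thus ?thesis by (simp add: scaleR_conv_of_real)
  qed
  ultimately show "cis \<beta> * ev \<beta> \<theta> (Pop y) = fser y (cis \<beta>)"
    using fser_sums[OF y, of "cis \<beta>"] by (simp add: sums_iff)
  have "(\<lambda>k. pc y k *\<^sub>R (cis \<beta> * ((cis \<theta> - 1) * ev \<beta> \<theta> (Qop (emon (int k, 0)))))) sums (cis \<beta> * ((cis \<theta> - 1) * ev \<beta> \<theta> (Qop y)))"
    by (rule Piop_sums[OF y bounded_linear_const_mult[OF bounded_linear_const_mult[OF bounded_linear_compose[OF bounded_linear_ev bounded_linear_Qop]]]])
  moreover have "pc y k *\<^sub>R (cis \<beta> * ((cis \<theta> - 1) * ev \<beta> \<theta> (Qop (emon (int k, 0)))))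
      = of_real (pc y k / real (k * m + 1)) * (cis \<beta> * cis \<theta>) ^ (k * m + 1) - of_real (pc y k / real (k * m + 1)) * cis \<beta> ^ (k * m + 1)" for k
  proof -
    \<comment> \<open>Rewritten as a geometric sum over the naturals, the difference quotient
      telescopes when multiplied by \<open>cis \<theta> - 1\<close>; no division is made, so
      \<theta> = 0 needs no separate case.\<close>
    have "(\<Sum>i\<in>{0..int k * int m}. ev \<beta> \<theta> (emon (int k, i))) = (\<Sum>i<k * m + 1. cis \<beta> ^ (k * m) * cis \<theta> ^ i)"
      by (rule sum.reindex_bij_witness[of _ int nat])
        (auto simp: cis_power cis_mult nat_less_iff zle_int simp flip: of_nat_mult)
    hence "ev \<beta> \<theta> (Qop (emon (int k, 0))) = (1 / real (k * m + 1)) *\<^sub>R (\<Sum>i<k * m + 1. cis \<beta> ^ (k * m) * cis \<theta> ^ i)"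
      by (simp add: Qop_emon linear_sum[OF bounded_linear.linear[OF bounded_linear_ev]] del: sum.lessThan_Suc ev_emon)
    hence "ev \<beta> \<theta> (Qop (emon (int k, 0))) = of_real (1 / real (k * m + 1)) * (cis \<beta> ^ (k * m) * (\<Sum>i<k * m + 1. cis \<theta> ^ i))"
      by (simp only: scaleR_conv_of_real sum_distrib_left)
    hence "cis \<beta> * ((cis \<theta> - 1) * ev \<beta> \<theta> (Qop (emon (int k, 0)))) = of_real (1 / real (k * m + 1)) * (cis \<beta> ^ (k * m + 1) * ((cis \<theta> - 1) * (\<Sum>i<k * m + 1. cis \<theta> ^ i)))"
      by (simp add: mult_ac)
    also have "(cis \<theta> - 1) * (\<Sum>i<k * m + 1. cis \<theta> ^ i) = cis \<theta> ^ (k * m + 1) - 1"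
      using power_diff_1_eq[of "cis \<theta>" "k * m + 1"] by simp
    finally have "cis \<beta> * ((cis \<theta> - 1) * ev \<beta> \<theta> (Qop (emon (int k, 0)))) = of_real (1 / real (k * m + 1)) * (cis \<beta> ^ (k * m + 1) * (cis \<theta> ^ (k * m + 1) - 1))" .
    moreover have "of_real c * (of_real (1 / n) * (W * (Z - 1))) = of_real (c / n) * (W * Z) - of_real (c / n) * W"
      for c n :: real and W Z :: complex by (simp add: algebra_simps diff_divide_distrib)
    ultimately show ?thesis by (simp only: scaleR_conv_of_real power_mult_distrib)
  qed
  ultimately have "(\<lambda>k. of_real (pc y k / real (k * m + 1)) * (cis \<beta> * cis \<theta>) ^ (k * m + 1) - of_real (pc y k / real (k * m + 1)) * cis \<beta> ^ (k * m + 1)) sums (cis \<beta> * ((cis \<theta> - 1) * ev \<beta> \<theta> (Qop y)))"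
    by simp
  moreover have "(\<lambda>k. of_real (pc y k / real (k * m + 1)) * (cis \<beta> * cis \<theta>) ^ (k * m + 1) - of_real (pc y k / real (k * m + 1)) * cis \<beta> ^ (k * m + 1)) sums (fser y (cis \<beta> * cis \<theta>) - fser y (cis \<beta>))"
    by (intro sums_diff fser_sums y) (auto simp: norm_mult)
  ultimately show "cis \<beta> * ((cis \<theta> - 1) * ev \<beta> \<theta> (Qop y)) = fser y (cis \<beta> * cis \<theta>) - fser y (cis \<beta>)"
    by (rule sums_unique2)
qed

lemma norm_cis_minus_1: "0 < \<theta> \<Longrightarrow> \<theta> < 2 * pi \<Longrightarrow> norm (cis \<theta> - 1) = 2 * sin (\<theta> / 2)"
proof -
  assume \<theta>: "0 < \<theta>" "\<theta> < 2 * pi"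
  have "(norm (cis \<theta> - 1))\<^sup>2 = 2 - 2 * cos \<theta>"
    unfolding cmod_power2 using sin_cos_squared_add[of \<theta>] by (simp add: power2_eq_square algebra_simps)
  also have "\<dots> = (2 * sin (\<theta> / 2))\<^sup>2" using one_minus_cos_half[of \<theta>] by (simp add: power_mult_distrib)
  finally show ?thesis by (rule power2_eq_imp_eq) (use sin_half_pos[OF \<theta>] in auto)
qed

theorem boundary_identity:
  fixes y :: wiener
  assumes y: "Piop y = y" "norm y \<le> 1/16" and s: "norm (sqrt1m (pfun y)) \<le> 1/4"
    and eq: "Piop (Nfun y + \<Omega> *\<^sub>R Mfun y) = 0"
  defines "\<Phi> \<equiv> \<lambda>z. z + fser y z" and "\<Phi>' \<equiv> \<lambda>z. 1 + gser y z"
  shows "(LINT \<theta>:{0<..<2*pi}|lborel. K (norm (\<Phi> (cis \<beta> * cis \<theta>) - \<Phi> (cis \<beta>))) *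
      Im (cnj (\<Phi>' (cis \<beta>)) * cis \<theta> * \<Phi>' (cis \<beta> * cis \<theta>))) + \<Omega> * Im (cnj (\<Phi> (cis \<beta>)) * cis \<beta> * \<Phi>' (cis \<beta>)) = 0"
proof -
  define k where "k \<theta> = K (norm (\<Phi> (cis \<beta> * cis \<theta>) - \<Phi> (cis \<beta>)))" for \<theta>
  define b where "b \<theta> = Im (cnj (\<Phi>' (cis \<beta>)) * cis \<theta> * \<Phi>' (cis \<beta> * cis \<theta>))" for \<theta>
  \<comment> \<open>Both parts of the equation are of the form z minus its conjugate and share the
    factor 2i, which is cancelled at the end.\<close>
  have im2: "z - cnj z = of_real (2 * Im z) * \<i>" for z by (simp add: complex_eq_iff)
  have evb: "ev \<beta> \<theta> (bfun y - bar (bfun y)) = of_real (2 * b \<theta>) * \<i>" for \<theta>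
  proof -
    have "ev \<beta> \<theta> (bfun y) = cnj (\<Phi>' (cis \<beta>)) * cis \<theta> * \<Phi>' (cis \<beta> * cis \<theta>)"
      by (simp add: bfun_def ev_series[OF y(1)] \<Phi>'_def mult_ac)
    thus ?thesis by (simp only: ev_lin ev_bar im2 b_def)
  qed
  have "ev \<beta> 0 (Nfun y) = (LINT \<theta>:{0<..<2*pi}|lborel. k \<theta> *\<^sub>R (of_real (2 * b \<theta>) * \<i>))"
    unfolding ev_Nfun[OF y(2) s] set_lebesgue_integral_def evb
  proof (intro Bochner_Integration.integral_cong refl)
    fix \<theta> :: real
    show "indicator {0<..<2*pi} \<theta> *\<^sub>R K (2 * sin (\<theta> / 2) * norm (1 + ev \<beta> \<theta> (Qop y))) *\<^sub>R (complex_of_real (2 * b \<theta>) * \<i>)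
        = indicator {0<..<2*pi} \<theta> *\<^sub>R k \<theta> *\<^sub>R (complex_of_real (2 * b \<theta>) * \<i>)"
    proof (cases "\<theta> \<in> {0<..<2*pi}")
      case True
      have "\<Phi> (cis \<beta> * cis \<theta>) - \<Phi> (cis \<beta>) = cis \<beta> * (cis \<theta> - 1) + (fser y (cis \<beta> * cis \<theta>) - fser y (cis \<beta>))"
        by (simp add: \<Phi>_def algebra_simps)
      also have "\<dots> = cis \<beta> * ((cis \<theta> - 1) * (1 + ev \<beta> \<theta> (Qop y)))"
        unfolding ev_series(4)[OF y(1), symmetric] by (simp add: algebra_simps)
      finally have "norm (\<Phi> (cis \<beta> * cis \<theta>) - \<Phi> (cis \<beta>)) = 2 * sin (\<theta> / 2) * norm (1 + ev \<beta> \<theta> (Qop y))"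
        using True norm_cis_minus_1[of \<theta>] by (simp add: norm_mult)
      thus ?thesis by (simp add: k_def)
    qed simp
  qed
  also have "\<dots> = of_real (2 * (LINT \<theta>:{0<..<2*pi}|lborel. k \<theta> * b \<theta>)) * \<i>"
  proof -
    have "(LINT \<theta>:{0<..<2*pi}|lborel. k \<theta> *\<^sub>R (of_real (2 * b \<theta>) * \<i>)) = (LINT \<theta>:{0<..<2*pi}|lborel. complex_of_real (2 * (k \<theta> * b \<theta>)) * \<i>)"
      by (simp add: scaleR_conv_of_real mult_ac)
    also have "\<dots> = of_real (LINT \<theta>:{0<..<2*pi}|lborel. 2 * (k \<theta> * b \<theta>)) * \<i>"
      by (simp only: set_integral_mult_left set_integral_complex_of_real)
    finally show ?thesis by simp
  qed
  finally have N: "ev \<beta> 0 (Nfun y) = of_real (2 * (LINT \<theta>:{0<..<2*pi}|lborel. k \<theta> * b \<theta>)) * \<i>" .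
  have ec: "ev \<beta> 0 (cfun y) = cnj (\<Phi> (cis \<beta>)) * cis \<beta> * \<Phi>' (cis \<beta>)"
  proof -
    have "\<Phi> (cis \<beta>) = cis \<beta> * (1 + ev \<beta> 0 (Pop y))"
      by (simp add: \<Phi>_def ev_series(3)[OF y(1), of \<beta> 0, symmetric] algebra_simps)
    hence "cnj (\<Phi> (cis \<beta>)) * cis \<beta> = (cnj (cis \<beta>) * cis \<beta>) * (1 + cnj (ev \<beta> 0 (Pop y)))"
      by (simp add: mult_ac)
    also have "cnj (cis \<beta>) * cis \<beta> = 1" by (simp add: cis_cnj cis_mult)
    finally show ?thesis by (simp add: cfun_def ev_series(1)[OF y(1)] \<Phi>'_def)
  qed
  define c where "c = Im (cnj (\<Phi> (cis \<beta>)) * cis \<beta> * \<Phi>' (cis \<beta>))"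
  define a where "a = (LINT \<theta>:{0<..<2*pi}|lborel. k \<theta> * b \<theta>)"
  from ec have M: "ev \<beta> 0 (Mfun y) = of_real (2 * c) * \<i>"
    unfolding Mfun_def by (simp only: ev_lin ev_bar im2 c_def)
  have "ev \<beta> 0 (Nfun y + \<Omega> *\<^sub>R Mfun y) = 0"
    using equation_zero[OF y s eq] by simp
  hence "of_real (2 * (a + \<Omega> * c)) * \<i> = 0"
    by (simp only: ev_lin N M a_def[symmetric]) (simp add: scaleR_conv_of_real algebra_simps)
  hence "complex_of_real (2 * (a + \<Omega> * c)) = 0"
    by (simp only: mult_eq_0_iff complex_i_not_zero simp_thms)
  hence "a + \<Omega> * c = 0"
    unfolding of_real_eq_0_iff by (simp only: mult_eq_0_iff) simp
  thus ?thesis by (simp add: k_def b_def a_def c_def)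
qed

end

section \<open>The potential of a conformal image of the disk\<close>

no_notation fps_nth (infixl "$" 75)

section \<open>Change of variables from the polar rectangle to the domain\<close>

lemma distr_lborel_coordinates:
  fixes b1 b2 :: "'b::euclidean_space"
  assumes B: "Basis = {b1, b2}" "b1 \<noteq> b2"
  shows "distr lborel borel (\<lambda>v::real^2. (v $ 1) *\<^sub>R b1 + (v $ 2) *\<^sub>R b2) = lborel"
proof (rule lborel_eqI[symmetric])
  let ?c = "\<lambda>v::real^2. (v $ 1) *\<^sub>R b1 + (v $ 2) *\<^sub>R b2"
  have meas: "?c \<in> borel_measurable lborel"
    using borel_measurable_continuous_onI[of ?c] by (simp add: continuous_intros)
  have b: "b1 \<in> Basis" "b2 \<in> Basis" using B by auto
  have in1: "?c v \<bullet> b1 = v $ 1" "?c v \<bullet> b2 = v $ 2" for v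
    using b B(2) by (auto simp: inner_add_left inner_Basis)
  fix l u :: 'b assume le: "\<And>b. b \<in> Basis \<Longrightarrow> l \<bullet> b \<le> u \<bullet> b"
  define l' u' :: "real^2" where "l' = vector [l \<bullet> b1, l \<bullet> b2]" and "u' = vector [u \<bullet> b1, u \<bullet> b2]"
  have vim: "?c -` box l u = box l' u'"
  proof (rule set_eqI)
    fix v
    have "v \<in> box l' u' \<longleftrightarrow> l \<bullet> b1 < v $ 1 \<and> v $ 1 < u \<bullet> b1 \<and> l \<bullet> b2 < v $ 2 \<and> v $ 2 < u \<bullet> b2"
      by (auto simp: mem_box_cart l'_def u'_def forall_2)
    moreover have "?c v \<in> box l u \<longleftrightarrow> l \<bullet> b1 < v $ 1 \<and> v $ 1 < u \<bullet> b1 \<and> l \<bullet> b2 < v $ 2 \<and> v $ 2 < u \<bullet> b2"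
      by (auto simp: mem_box B(1) in1)
    ultimately show "v \<in> ?c -` box l u \<longleftrightarrow> v \<in> box l' u'" by simp
  qed
  have le': "\<forall>b\<in>Basis. l' \<bullet> b \<le> u' \<bullet> b"
    using le b by (auto simp: Basis_vec_def inner_axis l'_def u'_def forall_2 exhaust_2 UNIV_2)
  have "emeasure (distr lborel borel ?c) (box l u) = emeasure lborel (box l' u')"
    using meas by (simp add: emeasure_distr vim)
  also have "\<dots> = (\<Prod>b\<in>Basis. (u' - l') \<bullet> b)"
    using le' by (simp add: emeasure_lborel_box_eq)
  also have "(\<Prod>b\<in>Basis. (u' - l') \<bullet> b) = (\<Prod>i\<in>UNIV. (u' - l') $ i)"
  proof -
    have 1: "(Basis :: (real^2) set) = (\<lambda>i. axis i 1) ` UNIV" by (auto simp: Basis_vec_def)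
    have 2: "inj (\<lambda>i::2. axis i (1::real))" by (auto simp: inj_on_def axis_eq_axis)
    show ?thesis unfolding 1 by (subst prod.reindex[OF 2]) (simp add: inner_axis)
  qed
  also have "\<dots> = (\<Prod>b\<in>Basis. (u - l) \<bullet> b)"
    unfolding B(1) using B(2) by (simp add: UNIV_2 l'_def u'_def inner_diff_left)
  finally show "emeasure (distr lborel borel ?c) (box l u) = ennreal (\<Prod>b\<in>Basis. (u - l) \<bullet> b)" .
qed simp

definition vec_to_complex :: "real^2 \<Rightarrow> complex" where "vec_to_complex v = Complex (v $ 1) (v $ 2)"
definition vec_to_pair :: "real^2 \<Rightarrow> real \<times> real" where "vec_to_pair v = (v $ 1, v $ 2)"
definition complex_to_vec :: "complex \<Rightarrow> real^2" where "complex_to_vec z = vector [Re z, Im z]"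

lemma vec_to_complex_eq: "vec_to_complex v = (v $ 1) *\<^sub>R 1 + (v $ 2) *\<^sub>R \<i>"
  by (simp add: vec_to_complex_def complex_eq_iff)

lemma vec_to_pair_eq: "vec_to_pair v = (v $ 1) *\<^sub>R (1, 0) + (v $ 2) *\<^sub>R (0, 1)"
  by (simp add: vec_to_pair_def)

lemma distr_vec_to_complex: "distr lborel borel vec_to_complex = lborel"
  unfolding vec_to_complex_eq[abs_def] by (rule distr_lborel_coordinates) (auto simp: Basis_complex_def)

lemma distr_vec_to_pair: "distr lborel borel vec_to_pair = lborel"
  unfolding vec_to_pair_eq[abs_def] by (rule distr_lborel_coordinates) (auto simp: Basis_prod_def)

lemma complex_to_vec_inverse [simp]: "complex_to_vec (vec_to_complex v) = v" "vec_to_complex (complex_to_vec z) = z"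
  by (auto simp: complex_to_vec_def vec_to_complex_def vec_eq_iff forall_2)

lemma bounded_linear_vec_to_complex: "bounded_linear vec_to_complex"
  unfolding vec_to_complex_eq[abs_def]
  by (intro bounded_linear_add bounded_linear_scaleR_const bounded_linear_vec_nth)

lemma bounded_linear_vec_to_pair: "bounded_linear vec_to_pair"
  unfolding vec_to_pair_def by (intro bounded_linear_Pair bounded_linear_vec_nth)

lemma bounded_linear_complex_to_vec: "bounded_linear complex_to_vec"
  by (rule linear_conv_bounded_linear[THEN iffD1], rule linearI)
    (auto simp: complex_to_vec_def vec_eq_iff forall_2)

text \<open>The substitution is carried out in \<open>real^2\<close>. Measure-preserving linear
  coordinates carry integrals over subsets of the complex plane and of the parameter rectangle to
  it.\<close>

lemma transport_integral:
  fixes h :: "'b::euclidean_space \<Rightarrow> real" and c :: "real^2 \<Rightarrow> 'b"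
  assumes c: "distr lborel borel c = lborel" "bounded_linear c"
    and h: "set_borel_measurable lborel S h"
  shows "set_integrable lborel S h \<longleftrightarrow> (\<lambda>v. h (c v)) absolutely_integrable_on (c -` S)"
    and "(LINT y:S|lborel. h y) = integral\<^sup>L lebesgue (\<lambda>v. indicator (c -` S) v *\<^sub>R h (c v))"
proof -
  have m: "c \<in> borel_measurable lborel"
    using borel_measurable_continuous_onI[OF linear_continuous_on[OF c(2)]] by simp
  define H where "H y = indicator S y *\<^sub>R h y" for y
  have H: "H \<in> borel_measurable borel" using h by (simp add: set_borel_measurable_def H_def[abs_def])
  have Hc: "(\<lambda>v. H (c v)) \<in> borel_measurable lborel" using measurable_compose[OF m H] by simp
  have "set_integrable lborel S h \<longleftrightarrow> integrable (distr lborel borel c) H"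
    by (simp add: c set_integrable_def H_def[abs_def])
  also have "\<dots> \<longleftrightarrow> integrable lborel (\<lambda>v. H (c v))" by (rule integrable_distr_eq[OF m H])
  also have "\<dots> \<longleftrightarrow> integrable lebesgue (\<lambda>v. H (c v))" using Hc by (simp add: integrable_completion)
  also have "\<dots> \<longleftrightarrow> (\<lambda>v. h (c v)) absolutely_integrable_on (c -` S)"
    by (simp add: set_integrable_def H_def indicator_def)
  finally show "set_integrable lborel S h \<longleftrightarrow> (\<lambda>v. h (c v)) absolutely_integrable_on (c -` S)" .
  have "(LINT y:S|lborel. h y) = integral\<^sup>L (distr lborel borel c) H"
    by (simp add: c set_lebesgue_integral_def H_def[abs_def])
  also have "\<dots> = integral\<^sup>L lborel (\<lambda>v. H (c v))" by (rule integral_distr[OF m H])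
  also have "\<dots> = integral\<^sup>L lebesgue (\<lambda>v. H (c v))" using Hc by (simp add: integral_completion)
  finally show "(LINT y:S|lborel. h y) = integral\<^sup>L lebesgue (\<lambda>v. indicator (c -` S) v *\<^sub>R h (c v))"
    by (simp add: H_def indicator_def)
qed

lemma det_complex_deriv:
  fixes h :: "real^2 \<Rightarrow> real^2"
  assumes "\<And>v. h v = complex_to_vec ((v $ 1) *\<^sub>R A + (v $ 2) *\<^sub>R B)"
  shows "det (matrix h) = Im (cnj A * B)"
  by (simp add: det_2 matrix_def assms complex_to_vec_def axis_def algebra_simps)

text \<open>Polar coordinates in the disk, transported by the conformal map \<open>\<Phi>\<close>; the slit
  \<open>\<theta> = \<beta>\<close> is negligible.\<close>

lemma conformal_polar_coordinates:
  fixes \<Phi> \<Phi>' :: "complex \<Rightarrow> complex" and F :: "complex \<Rightarrow> real" and \<beta> :: real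
  assumes der: "\<And>z. z \<in> ball 0 1 \<Longrightarrow> (\<Phi> has_field_derivative \<Phi>' z) (at z)"
    and inj: "inj_on \<Phi> (ball 0 1)"
    and cont': "continuous_on (ball 0 1) \<Phi>'"
    and F: "continuous_on (\<Phi> ` ball 0 1) F"
  defines "R \<equiv> {0<..<1} \<times> {\<beta><..<\<beta> + 2 * pi}"
  defines "G \<equiv> \<lambda>(r, \<theta>). (r * (norm (\<Phi>' (of_real r * cis \<theta>)))\<^sup>2) * F (\<Phi> (of_real r * cis \<theta>))"
  shows "set_integrable lborel (\<Phi> ` ball 0 1) F \<longleftrightarrow> set_integrable lborel R G"
    and "set_integrable lborel R G \<Longrightarrow> (LINT y:\<Phi> ` ball 0 1|lborel. F y) = (LINT p:R|lborel. G p)"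
proof -
  define D where "D = \<Phi> ` ball 0 1"
  have contP: "continuous_on (ball 0 1) \<Phi>"
    by (intro continuous_at_imp_continuous_on ballI DERIV_isCont[OF der])
  have holo: "\<Phi> holomorphic_on ball 0 1"
    unfolding holomorphic_on_def field_differentiable_def using der has_field_derivative_at_within by blast
  have oD: "open D" unfolding D_def using open_mapping_thm3[OF holo _ inj] by simp
  have Fm: "set_borel_measurable lborel D F"
    unfolding set_borel_measurable_def
    using borel_measurable_continuous_on_indicator[OF _ F] oD by (simp add: D_def)
  have inb: "of_real r * cis \<theta> \<in> ball 0 1" if "(r, \<theta>) \<in> R" for r \<theta>
    using that by (auto simp: R_def norm_mult)
  have oR: "open R" unfolding R_def by (intro open_Times) auto
  have contG: "continuous_on R G"
    unfolding G_def case_prod_beta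
    by (intro continuous_intros continuous_on_compose2[OF cont'] continuous_on_compose2[OF F]
         continuous_on_compose2[OF contP] continuous_on_compose2[OF continuous_on_cis])
      (use inb in \<open>auto intro!: imageI\<close>)
  have Gm: "set_borel_measurable lborel R G"
    unfolding set_borel_measurable_def
    using borel_measurable_continuous_on_indicator[OF _ contG] oR by simp
  define S where "S = vec_to_pair -` R"
  define Y where "Y v = \<Phi> (of_real (v $ 1) * cis (v $ 2))" for v :: "real^2"
  define g where "g v = complex_to_vec (Y v)" for v
  define Y1 where "Y1 v = cis (v $ 2) * \<Phi>' (of_real (v $ 1) * cis (v $ 2))" for v :: "real^2"
  define Y2 where "Y2 v = of_real (v $ 1) * (\<i> * cis (v $ 2)) * \<Phi>' (of_real (v $ 1) * cis (v $ 2))" for v :: "real^2"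
  define g' where "g' v h = complex_to_vec ((h $ 1) *\<^sub>R Y1 v + (h $ 2) *\<^sub>R Y2 v)" for v h :: "real^2"
  have oS: "open S" unfolding S_def
    by (intro open_vimage oR linear_continuous_on bounded_linear_vec_to_pair)
  have SR: "(v $ 1, v $ 2) \<in> R" if "v \<in> S" for v using that by (simp add: S_def vec_to_pair_def)
  have der_g: "(g has_derivative g' v) (at v within S)" if v: "v \<in> S" for v
  proof -
    have 1: "((\<lambda>v. of_real (v $ 1) * cis (v $ 2)) has_derivative
       (\<lambda>h. of_real (h $ 1) * cis (v $ 2) + of_real (v $ 1) * ((h $ 2) *\<^sub>R (\<i> * cis (v $ 2))))) (at v)"
      by (auto intro!: derivative_eq_intros has_derivative_cis bounded_linear_imp_has_derivative[OF bounded_linear_vec_nth] simp: scaleR_conv_of_real)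
    have "(\<Phi> has_derivative (\<lambda>h. \<Phi>' (of_real (v $ 1) * cis (v $ 2)) * h)) (at (of_real (v $ 1) * cis (v $ 2)))"
      using der[OF inb[OF SR[OF v]]] by (simp add: has_field_derivative_def)
    from has_derivative_compose[OF 1 this]
    have "(Y has_derivative (\<lambda>h. (h $ 1) *\<^sub>R Y1 v + (h $ 2) *\<^sub>R Y2 v)) (at v)"
      unfolding Y_def Y1_def Y2_def
      by (rule has_derivative_eq_rhs) (auto simp: algebra_simps scaleR_conv_of_real)
    from bounded_linear.has_derivative[OF bounded_linear_complex_to_vec this]
    show ?thesis unfolding g_def g'_def by (rule has_derivative_at_withinI)
  qed
  have det: "det (matrix (g' v)) = v $ 1 * (norm (\<Phi>' (of_real (v $ 1) * cis (v $ 2))))\<^sup>2" for v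
  proof -
    have "det (matrix (g' v)) = Im (cnj (Y1 v) * Y2 v)"
      by (rule det_complex_deriv) (simp add: g'_def)
    also have "cnj (Y1 v) * Y2 v = of_real (v $ 1) * \<i> * ((cnj (cis (v $ 2)) * cis (v $ 2)) *
        (\<Phi>' (of_real (v $ 1) * cis (v $ 2)) * cnj (\<Phi>' (of_real (v $ 1) * cis (v $ 2)))))"
      unfolding Y1_def Y2_def by (simp add: mult_ac)
    also have "cnj (cis (v $ 2)) * cis (v $ 2) = 1" by (simp add: cis_cnj cis_mult)
    finally show ?thesis by (simp add: complex_norm_square[symmetric] flip: of_real_power)
  qed
  have polar_inj: "p = q" if "p \<in> R" "q \<in> R" "of_real (fst p) * cis (snd p) = of_real (fst q) * cis (snd q)" for p q
  proof -
    have n: "0 < fst p" "0 < fst q" using that by (auto simp: R_def)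
    have "norm (of_real (fst p) * cis (snd p)) = norm (of_real (fst q) * cis (snd q))" using that by simp
    hence eq: "fst p = fst q" using n by (simp add: norm_mult)
    hence "cis (snd p) = cis (snd q)" using that n by simp
    hence "cis (snd p - snd q) = 1" by (simp flip: cis_divide)
    hence "cos (snd p - snd q) = 1" by (simp add: complex_eq_iff)
    then obtain n :: int where n: "snd p - snd q = of_int n * 2 * pi" unfolding cos_one_2pi_int by auto
    have "\<bar>snd p - snd q\<bar> < 2 * pi" using that by (auto simp: R_def)
    hence "\<bar>of_int n\<bar> * (2 * pi) < 1 * (2 * pi)" unfolding n by (simp add: abs_mult)
    hence "\<bar>real_of_int n\<bar> < 1" by (rule mult_right_less_imp_less) simp
    hence "n = 0" by linarith
    thus ?thesis using n eq by (simp add: prod_eq_iff)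
  qed
  have injg: "inj_on g S"
  proof (rule inj_onI)
    fix v w assume vw: "v \<in> S" "w \<in> S" "g v = g w"
    hence "Y v = Y w" unfolding g_def by (metis complex_to_vec_inverse(2))
    hence "of_real (v $ 1) * cis (v $ 2) = of_real (w $ 1) * cis (w $ 2)"
      unfolding Y_def using inj_onD[OF inj _ inb[OF SR[OF vw(1)]] inb[OF SR[OF vw(2)]]] by simp
    hence "(v $ 1, v $ 2) = (w $ 1, w $ 2)" using polar_inj[OF SR[OF vw(1)] SR[OF vw(2)]] by simp
    thus "v = w" by (simp add: vec_eq_iff forall_2)
  qed
  \<comment> \<open>The exceptional set is the image of the ray at angle \<open>\<beta>\<close>
    including the centre, where polar coordinates degenerate.\<close>
  define T where "T = complex_to_vec ` (\<Phi> ` ((\<lambda>r. of_real r * cis \<beta>) ` {0..<1}))"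
  have DT: "vec_to_complex -` D \<subseteq> g ` S \<union> T"
  proof
    fix v assume "v \<in> vec_to_complex -` D"
    then obtain z where z: "norm z < 1" "vec_to_complex v = \<Phi> z" by (auto simp: D_def)
    have v: "v = complex_to_vec (\<Phi> z)" using z(2) by (metis complex_to_vec_inverse(1))
    obtain \<theta> where \<theta>: "\<beta> \<le> \<theta>" "\<theta> < \<beta> + 2 * pi" "z = of_real (norm z) * cis \<theta>"
    proof -
      \<comment> \<open>Whole turns are removed so that the argument falls into the window that
        starts at \<open>\<beta>\<close>.\<close>
      define k where "k = \<lfloor>(Arg z - \<beta>) / (2 * pi)\<rfloor>"
      have k: "of_int k * (2 * pi) \<le> Arg z - \<beta>" "Arg z - \<beta> < (of_int k + 1) * (2 * pi)"
        using floor_correct[of "(Arg z - \<beta>) / (2 * pi)"] unfolding k_def[symmetric]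
        by (auto simp: field_simps)
      have "cis (Arg z - of_int k * (2 * pi)) = cis (Arg z)"
        using cis_multiple_2pi[of "of_int k"] by (simp add: cis_divide[symmetric] mult.commute)
      hence "z = of_real (norm z) * cis (Arg z - of_int k * (2 * pi))"
        using rcis_cmod_Arg[of z] by (simp add: rcis_def)
      thus ?thesis using k by (intro that[of "Arg z - of_int k * (2 * pi)"]) (auto simp: algebra_simps)
    qed
    show "v \<in> g ` S \<union> T"
    proof (cases "z = 0 \<or> \<theta> = \<beta>")
      case True
      hence "z \<in> (\<lambda>r. of_real r * cis \<beta>) ` {0..<1}"
      proof
        assume "z = 0" thus ?thesis by (intro image_eqI[of _ _ 0]) auto
      next
        assume "\<theta> = \<beta>" thus ?thesis using z \<theta> by (intro image_eqI[of _ _ "norm z"]) auto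
      qed
      thus ?thesis using v by (auto simp: T_def)
    next
      case False
      define w :: "real^2" where "w = vector [norm z, \<theta>]"
      have "w \<in> S" using False z \<theta> by (auto simp: S_def vec_to_pair_def w_def R_def)
      moreover have "g w = v" using \<theta>(3) by (simp add: g_def Y_def w_def v)
      ultimately show ?thesis by blast
    qed
  qed
  have gD: "g ` S \<subseteq> vec_to_complex -` D"
    using inb[OF SR] by (auto simp: g_def Y_def D_def)
  have negT: "negligible T"
  proof -
    have "negligible ((\<lambda>r. of_real r * cis \<beta>) ` {0..<1} :: complex set)"
    proof (rule negligible_subset)
      show "negligible {x. (\<i> * cis \<beta>) \<bullet> x = 0}" by (rule negligible_hyperplane) simp
      show "(\<lambda>r. of_real r * cis \<beta>) ` {0..<1} \<subseteq> {x. (\<i> * cis \<beta>) \<bullet> x = 0}"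
        by (auto simp: inner_complex_def)
    qed
    hence "negligible (\<Phi> ` ((\<lambda>r. of_real r * cis \<beta>) ` {0..<1}))"
    proof (rule negligible_differentiable_image_negligible[OF order_refl])
      show "\<Phi> differentiable_on (\<lambda>r. of_real r * cis \<beta>) ` {0..<1}"
        unfolding differentiable_on_def
      proof
        fix z assume "z \<in> (\<lambda>r. of_real r * cis \<beta>) ` {0..<1::real}"
        hence "z \<in> ball 0 1" by (auto simp: norm_mult)
        from der[OF this] show "\<Phi> differentiable at z within (\<lambda>r. of_real r * cis \<beta>) ` {0..<1}"
          unfolding has_field_derivative_def by (meson differentiableI differentiable_at_withinI)
      qed
    qed
    thus ?thesis unfolding T_def
      by (rule negligible_differentiable_image_negligible[rotated])
        (auto intro: bounded_linear_imp_differentiable_on bounded_linear_complex_to_vec)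
  qed
  have sym: "negligible (sym_diff (vec_to_complex -` D) (g ` S))"
    by (rule negligible_subset[OF negT]) (use DT gD in auto)
  define f where "f v = F (vec_to_complex v)" for v
  have fg: "v $ 1 * (norm (\<Phi>' (of_real (v $ 1) * cis (v $ 2))))\<^sup>2 * f (g v) = G (vec_to_pair v)" for v
    by (simp add: f_def g_def Y_def G_def vec_to_pair_def)
  have absdet: "\<bar>det (matrix (g' v))\<bar> *\<^sub>R vec (f (g v)) = (vec (G (vec_to_pair v)) :: real^1)" if "v \<in> S" for v
    using SR[OF that] fg[of v] unfolding det by (auto simp: R_def vec_eq_iff)
  note cov = has_absolute_integral_change_of_variables[OF _ der_g injg, of "\<lambda>v. vec (f v) :: real^1"]
  have Sl: "S \<in> sets lebesgue" using oS by (simp add: lborelD)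
  have abseq: "(\<lambda>v. \<bar>det (matrix (g' v))\<bar> *\<^sub>R (vec (f (g v)) :: real^1)) absolutely_integrable_on S
      \<longleftrightarrow> (\<lambda>v. G (vec_to_pair v)) absolutely_integrable_on S"
    using absolutely_integrable_spike_eq[of "{}" S "\<lambda>v. \<bar>det (matrix (g' v))\<bar> *\<^sub>R (vec (f (g v)) :: real^1)" "\<lambda>v. vec (G (vec_to_pair v))"] absdet
    by (simp add: absolutely_integrable_on_1_iff)
  have inteq: "integral S (\<lambda>v. \<bar>det (matrix (g' v))\<bar> *\<^sub>R (vec (f (g v)) :: real^1)) = integral S (\<lambda>v. vec (G (vec_to_pair v)))"
    by (rule integral_cong[OF absdet])
  have iff: "(\<lambda>v. G (vec_to_pair v)) absolutely_integrable_on S \<longleftrightarrow> f absolutely_integrable_on (g ` S)"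
    using cov[OF Sl] unfolding abseq by (auto simp: absolutely_integrable_on_1_iff)
  have iff2: "f absolutely_integrable_on (g ` S) \<longleftrightarrow> f absolutely_integrable_on (vec_to_complex -` D)"
    by (rule absolutely_integrable_spike_set_eq; rule negligible_subset[OF sym]) auto
  note t1 = transport_integral[OF distr_vec_to_complex bounded_linear_vec_to_complex Fm]
  note t2 = transport_integral[OF distr_vec_to_pair bounded_linear_vec_to_pair Gm]
  show main: "set_integrable lborel (\<Phi> ` ball 0 1) F \<longleftrightarrow> set_integrable lborel R G"
    using t1(1) t2(1) iff iff2 by (simp add: D_def[symmetric] S_def[symmetric] f_def[abs_def])
  assume i: "set_integrable lborel R G"
  have aG: "(\<lambda>v. G (vec_to_pair v)) absolutely_integrable_on S" using t2(1) i by (simp add: S_def)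
  have af: "f absolutely_integrable_on (vec_to_complex -` D)" using aG iff iff2 by simp
  have "integral S (\<lambda>v. vec (G (vec_to_pair v)) :: real^1) = integral (g ` S) (\<lambda>v. vec (f v))"
    using cov[OF Sl, of "integral (g ` S) (\<lambda>v. vec (f v))"] aG iff unfolding abseq inteq
    by (auto simp: absolutely_integrable_on_1_iff)
  hence "integral S (\<lambda>v. G (vec_to_pair v)) = integral (g ` S) f"
    by (simp add: integral_on_1_eq vec_eq_iff)
  also have "\<dots> = integral (vec_to_complex -` D) f"
    by (rule integral_spike_set; rule negligible_subset[OF sym]) auto
  finally have "(LINT v:S|lebesgue. G (vec_to_pair v)) = (LINT v:vec_to_complex -` D|lebesgue. f v)"
    using set_lebesgue_integral_eq_integral(2)[OF aG] set_lebesgue_integral_eq_integral(2)[OF af] by simp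
  thus "(LINT y:\<Phi> ` ball 0 1|lborel. F y) = (LINT p:R|lborel. G p)"
    using t1(2) t2(2) by (simp add: D_def[symmetric] S_def[symmetric] f_def set_lebesgue_integral_def)
qed

section \<open>Derivative of a regular potential along the boundary\<close>

definition cross :: "complex \<Rightarrow> complex \<Rightarrow> real" where
  "cross a b = Re a * Im b - Im a * Re b"

lemma cross_eq_Im: "cross a b = Im (cnj a * b)"
  by (simp add: cross_def)

lemma cross_cramer: "cross a b *\<^sub>R s = cross s b *\<^sub>R a + cross a s *\<^sub>R b"
  by (simp add: cross_def complex_eq_iff algebra_simps)

text \<open>The kernel is taken as a function of the squared distance, which is differentiable also
  at coinciding points. The vector \<open>s\<close> is frozen, so the same formula serves
  derivatives in the radius and in the angle.\<close>

lemma has_real_derivative_kernel_cross: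
  fixes y a :: "real \<Rightarrow> complex"
  assumes y: "(y has_vector_derivative y') (at t within T)" and a: "(a has_vector_derivative a') (at t within T)"
    and k: "(k has_real_derivative k') (at ((norm (p - y t))\<^sup>2))"
  shows "((\<lambda>t. k ((norm (p - y t))\<^sup>2) * cross s (a t)) has_real_derivative
      (- 2 * k' * ((p - y t) \<bullet> y') * cross s (a t) + k ((norm (p - y t))\<^sup>2) * cross s a')) (at t within T)"
proof -
  have 1: "((\<lambda>t. Re (y t)) has_real_derivative Re y') (at t within T)"
    "((\<lambda>t. Im (y t)) has_real_derivative Im y') (at t within T)"
    "((\<lambda>t. Re (a t)) has_real_derivative Re a') (at t within T)"
    "((\<lambda>t. Im (a t)) has_real_derivative Im a') (at t within T)"
    using bounded_linear.has_vector_derivative[OF bounded_linear_Re] bounded_linear.has_vector_derivative[OF bounded_linear_Im] y a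
    by (auto simp: has_real_derivative_iff_has_vector_derivative)
  have n: "(norm (p - y t))\<^sup>2 = (Re p - Re (y t))\<^sup>2 + (Im p - Im (y t))\<^sup>2" for t
    by (simp add: cmod_power2)
  have 2: "((\<lambda>t. (norm (p - y t))\<^sup>2) has_real_derivative - 2 * ((p - y t) \<bullet> y')) (at t within T)"
    unfolding n by (rule derivative_eq_intros 1 refl)+ (simp add: inner_complex_def algebra_simps)
  have 3: "((\<lambda>t. k ((norm (p - y t))\<^sup>2)) has_real_derivative k' * (- 2 * ((p - y t) \<bullet> y'))) (at t within T)"
    by (rule DERIV_chain2[OF k 2])
  show ?thesis
    unfolding cross_def by (rule derivative_eq_intros 1 3 refl)+ (simp add: algebra_simps)
qed

text \<open>For a nonnegative shift the excess over one period is cut off and moved back by a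
  period; a negative shift is made nonnegative by adding whole periods.\<close>

lemma integral_periodic_shift:
  fixes f :: "real \<Rightarrow> real"
  assumes c: "continuous_on UNIV f" and per: "\<And>x. f (x + 2 * pi) = f x"
  shows "integral {0..2*pi} (\<lambda>x. f (x + \<beta>)) = integral {0..2*pi} f"
proof -
  have int: "f integrable_on {a..b}" for a b
    using c by (intro integrable_continuous_interval) (auto intro: continuous_on_subset)
  define F where "F \<beta> = integral {0..2*pi} (\<lambda>x. f (x + \<beta>))" for \<beta>
  have *: "F \<beta> = integral {0..2*pi} f" if b: "\<beta> \<ge> 0" for \<beta>
  proof -
    have "F \<beta> = integral {\<beta>..2*pi + \<beta>} f"
      using integral_shift_Icc_real[of 0 "2*pi" f \<beta>] by (simp add: F_def o_def add.commute)
    moreover have "integral {0..\<beta>} f + integral {\<beta>..2*pi + \<beta>} f = integral {0..2*pi + \<beta>} f"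
      using b by (intro Henstock_Kurzweil_Integration.integral_combine int) auto
    moreover have "integral {0..2*pi} f + integral {2*pi..2*pi + \<beta>} f = integral {0..2*pi + \<beta>} f"
      using b by (intro Henstock_Kurzweil_Integration.integral_combine int) auto
    moreover have "integral {2*pi..2*pi + \<beta>} f = integral {0..\<beta>} f"
      using integral_shift_Icc_real[of 0 \<beta> f "2*pi"] per by (simp add: o_def add.commute)
    ultimately show ?thesis by simp
  qed
  define n where "n = nat \<lceil>\<bar>\<beta>\<bar>\<rceil>"
  have pern: "f (x + real n * (2 * pi)) = f x" for x and n :: nat
  proof (induction n)
    case (Suc n)
    have "f (x + real (Suc n) * (2 * pi)) = f ((x + real n * (2 * pi)) + 2 * pi)" by (simp add: algebra_simps)
    thus ?case using per Suc by simp
  qed simp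
  have "\<bar>\<beta>\<bar> \<le> real n" unfolding n_def by linarith
  also have "\<dots> \<le> real n * (2 * pi)" using pi_gt3 by (simp add: mult_le_cancel_left1)
  finally have "0 \<le> \<beta> + real n * (2 * pi)" by linarith
  from *[OF this] have "F (\<beta> + real n * (2 * pi)) = integral {0..2*pi} f" .
  moreover have "F (\<beta> + real n * (2 * pi)) = F \<beta>"
    unfolding F_def add.assoc[symmetric] pern ..
  ultimately show ?thesis by (simp add: F_def)
qed

text \<open>Derivatives are taken within the closed disk, so that they are available on the circle
  too. The second derivative enters through the mixed derivative in polar coordinates.\<close>

locale disk_map =
  fixes \<Phi> \<Phi>' \<Phi>'' :: "complex \<Rightarrow> complex"
  assumes d1: "\<And>z. z \<in> cball 0 1 \<Longrightarrow> (\<Phi> has_field_derivative \<Phi>' z) (at z within cball 0 1)"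
    and d2: "\<And>z. z \<in> cball 0 1 \<Longrightarrow> (\<Phi>' has_field_derivative \<Phi>'' z) (at z within cball 0 1)"
    and c3: "continuous_on (cball 0 1) \<Phi>''"
begin

lemma c1: "continuous_on (cball 0 1) \<Phi>" and c2: "continuous_on (cball 0 1) \<Phi>'"
  using d1 d2 by (auto intro!: DERIV_continuous_on)

definition Y :: "real \<Rightarrow> real \<Rightarrow> complex" where "Y r \<theta> = \<Phi> (of_real r * cis \<theta>)"
definition Yr :: "real \<Rightarrow> real \<Rightarrow> complex" where "Yr r \<theta> = cis \<theta> * \<Phi>' (of_real r * cis \<theta>)"
definition Yt :: "real \<Rightarrow> real \<Rightarrow> complex" where "Yt r \<theta> = \<i> * of_real r * cis \<theta> * \<Phi>' (of_real r * cis \<theta>)"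
text \<open>The mixed derivative of \<open>Y\<close>. Obtaining it in either order is what cancels
  the second-order terms in the curl identity.\<close>

definition Yrt :: "real \<Rightarrow> real \<Rightarrow> complex" where
  "Yrt r \<theta> = \<i> * cis \<theta> * \<Phi>' (of_real r * cis \<theta>) + \<i> * of_real r * (cis \<theta>)\<^sup>2 * \<Phi>'' (of_real r * cis \<theta>)"

lemma in_disk: "0 \<le> r \<Longrightarrow> r \<le> 1 \<Longrightarrow> of_real r * cis \<theta> \<in> cball 0 1"
  by (simp add: norm_mult)

lemma chain_r:
  assumes g: "\<And>z. z \<in> cball 0 1 \<Longrightarrow> (g has_field_derivative g' z) (at z within cball 0 1)" and r: "r \<in> {0..1}"
  shows "((\<lambda>r. g (of_real r * cis \<theta>)) has_vector_derivative cis \<theta> * g' (of_real r * cis \<theta>)) (at r within {0..1})"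
proof -
  have "((\<lambda>r. of_real r * cis \<theta>) has_vector_derivative cis \<theta>) (at r within {0..1})"
    by (auto intro!: derivative_eq_intros has_vector_derivative_of_real simp: has_vector_derivative_def scaleR_conv_of_real)
  moreover have "(g has_field_derivative g' (of_real r * cis \<theta>)) (at (of_real r * cis \<theta>) within (\<lambda>r. of_real r * cis \<theta>) ` {0..1})"
    by (rule DERIV_subset[OF g]) (use r in_disk in auto)
  ultimately show ?thesis using field_vector_diff_chain_within by (fastforce simp: o_def)
qed

lemma chain_t:
  assumes g: "\<And>z. z \<in> cball 0 1 \<Longrightarrow> (g has_field_derivative g' z) (at z within cball 0 1)" and r: "r \<in> {0..1}"
  shows "((\<lambda>\<theta>. g (of_real r * cis \<theta>)) has_vector_derivative (of_real r * (\<i> * cis \<theta>)) * g' (of_real r * cis \<theta>)) (at \<theta> within T)"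
proof -
  have "((\<lambda>\<theta>. of_real r * cis \<theta>) has_vector_derivative of_real r * (\<i> * cis \<theta>)) (at \<theta> within T)"
    unfolding has_vector_derivative_def
    by (auto intro!: derivative_eq_intros has_derivative_cis simp: scaleR_conv_of_real algebra_simps)
  moreover have "(g has_field_derivative g' (of_real r * cis \<theta>)) (at (of_real r * cis \<theta>) within (\<lambda>\<theta>. of_real r * cis \<theta>) ` T)"
    by (rule DERIV_subset[OF g]) (use r in_disk in auto)
  ultimately show ?thesis using field_vector_diff_chain_within by (fastforce simp: o_def)
qed

lemma Y_deriv_r: "r \<in> {0..1} \<Longrightarrow> ((\<lambda>r. Y r \<theta>) has_vector_derivative Yr r \<theta>) (at r within {0..1})"
  unfolding Y_def Yr_def by (rule chain_r[OF d1])

lemma Y_deriv_t: "r \<in> {0..1} \<Longrightarrow> ((\<lambda>\<theta>. Y r \<theta>) has_vector_derivative Yt r \<theta>) (at \<theta> within T)"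
  unfolding Y_def Yt_def using chain_t[OF d1, of r \<theta> T] by (simp add: mult_ac)

lemma Yt_deriv_r:
  assumes "r \<in> {0..1}"
  shows "((\<lambda>r. Yt r \<theta>) has_vector_derivative Yrt r \<theta>) (at r within {0..1})"
proof -
  have "((\<lambda>r. (\<i> * cis \<theta>) * (of_real r * \<Phi>' (of_real r * cis \<theta>))) has_vector_derivative
      (\<i> * cis \<theta>) * (of_real r * (cis \<theta> * \<Phi>'' (of_real r * cis \<theta>)) + 1 * \<Phi>' (of_real r * cis \<theta>))) (at r within {0..1})"
    by (intro has_vector_derivative_mult_right has_vector_derivative_mult chain_r[OF d2 assms])
       (auto simp: has_vector_derivative_def scaleR_conv_of_real intro!: derivative_eq_intros)
  thus ?thesis unfolding Yt_def Yrt_def by (simp add: algebra_simps power2_eq_square)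
qed

lemma Yr_deriv_t:
  assumes "r \<in> {0..1}"
  shows "((\<lambda>\<theta>. Yr r \<theta>) has_vector_derivative Yrt r \<theta>) (at \<theta> within T)"
proof -
  have "((\<lambda>\<theta>. cis \<theta> * \<Phi>' (of_real r * cis \<theta>)) has_vector_derivative
      (cis \<theta> * ((of_real r * (\<i> * cis \<theta>)) * \<Phi>'' (of_real r * cis \<theta>)) + (\<i> * cis \<theta>) * \<Phi>' (of_real r * cis \<theta>))) (at \<theta> within T)"
    by (intro has_vector_derivative_mult chain_t[OF d2 assms])
       (auto simp: has_vector_derivative_def scaleR_conv_of_real algebra_simps intro!: derivative_eq_intros has_derivative_cis)
  thus ?thesis unfolding Yr_def Yrt_def by (simp add: algebra_simps power2_eq_square)
qed

lemma cont_polar: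
  assumes g: "continuous_on (cball 0 1) g"
  shows "continuous_on ({0..1} \<times> UNIV) (\<lambda>x. g (of_real (fst x) * cis (snd x)))"
  by (intro continuous_on_compose2[OF g] continuous_intros continuous_on_compose2[OF continuous_on_cis])
     (auto simp: norm_mult)

lemma cont_Y:
  "continuous_on ({0..1} \<times> UNIV) (\<lambda>x. Y (fst x) (snd x))"
  "continuous_on ({0..1} \<times> UNIV) (\<lambda>x. Yr (fst x) (snd x))"
  "continuous_on ({0..1} \<times> UNIV) (\<lambda>x. Yt (fst x) (snd x))"
  "continuous_on ({0..1} \<times> UNIV) (\<lambda>x. Yrt (fst x) (snd x))"
  unfolding Y_def Yr_def Yt_def Yrt_def
  by (intro continuous_intros cont_polar c1 c2 c3 continuous_on_compose2[OF continuous_on_cis] subset_UNIV)+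

lemma cont_Y1: "continuous_on UNIV (Y 1)" "continuous_on UNIV (Yt 1)"
proof -
  have p: "continuous_on UNIV (\<lambda>\<theta>::real. (1::real, \<theta>))" by (intro continuous_intros)
  have r: "range (\<lambda>\<theta>::real. (1::real, \<theta>)) \<subseteq> {0..1} \<times> UNIV" by auto
  show "continuous_on UNIV (Y 1)" "continuous_on UNIV (Yt 1)"
    using continuous_on_compose2[OF cont_Y(1) p r] continuous_on_compose2[OF cont_Y(3) p r] by simp_all
qed

lemma cross_Yr_Yt: "cross (Yr r \<theta>) (Yt r \<theta>) = r * (norm (\<Phi>' (of_real r * cis \<theta>)))\<^sup>2"
proof -
  have "cnj (Yr r \<theta>) * Yt r \<theta> = of_real r * \<i> * ((cnj (cis \<theta>) * cis \<theta>) *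
      (\<Phi>' (of_real r * cis \<theta>) * cnj (\<Phi>' (of_real r * cis \<theta>))))"
    unfolding Yr_def Yt_def by (simp add: mult_ac)
  also have "cnj (cis \<theta>) * cis \<theta> = 1" by (simp add: cis_cnj cis_mult)
  finally show ?thesis by (simp add: cross_eq_Im complex_norm_square[symmetric] flip: of_real_power)
qed

text \<open>Differentiating the potential along the boundary: by Cramer's rule the integrand becomes a
  curl in the coordinates \<open>(r, \<theta>)\<close>.\<close>

lemma potential_derivative:
  fixes k k' :: "real \<Rightarrow> real"
  assumes k: "\<And>u. u \<ge> 0 \<Longrightarrow> (k has_real_derivative k' u) (at u)" and k': "continuous_on {0..} k'"
  shows "((\<lambda>\<beta>. integral (cbox (0, 0) (1, 2*pi)) (\<lambda>x. k ((norm (Y 1 \<beta> - Y (fst x) (snd x)))\<^sup>2) * cross (Yr (fst x) (snd x)) (Yt (fst x) (snd x))))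
     has_vector_derivative - integral {0..2*pi} (\<lambda>\<theta>. k ((norm (Y 1 \<beta> - Y 1 \<theta>))\<^sup>2) * cross (Yt 1 \<beta>) (Yt 1 \<theta>))) (at \<beta>)"
proof -
  define R where "R = cbox (0::real, 0::real) (1, 2*pi)"
  have Rs: "R \<subseteq> {0..1} \<times> UNIV" by (auto simp: R_def cbox_Pair_eq)
  have kc: "continuous_on {0..} k" using k by (auto intro!: DERIV_continuous_on intro: has_field_derivative_at_within)
  define fx where "fx \<beta> x = k' ((norm (Y 1 \<beta> - Y (fst x) (snd x)))\<^sup>2) * (2 * ((Y 1 \<beta> - Y (fst x) (snd x)) \<bullet> Yt 1 \<beta>)) * cross (Yr (fst x) (snd x)) (Yt (fst x) (snd x))" for \<beta> x
  note cY1 = cont_Y1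
  note cR = continuous_on_subset[OF cont_Y(1) Rs] continuous_on_subset[OF cont_Y(2) Rs]
    continuous_on_subset[OF cont_Y(3) Rs] continuous_on_subset[OF cont_Y(4) Rs]
  have cfx: "continuous_on (UNIV \<times> R) (\<lambda>(\<beta>, x). fx \<beta> x)"
    unfolding fx_def case_prod_beta cross_def
    by (intro continuous_intros continuous_on_compose2[OF k'] continuous_on_compose2[OF cR(1)] continuous_on_compose2[OF cR(2)]
        continuous_on_compose2[OF cR(3)] continuous_on_compose2[OF cY1(1)] continuous_on_compose2[OF cY1(2)]) auto
  have "((\<lambda>\<beta>. integral R (\<lambda>x. k ((norm (Y 1 \<beta> - Y (fst x) (snd x)))\<^sup>2) * cross (Yr (fst x) (snd x)) (Yt (fst x) (snd x))))
     has_vector_derivative integral R (fx \<beta>)) (at \<beta> within UNIV)"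
    unfolding R_def
  proof (rule leibniz_rule_vector_derivative)
    show "continuous_on (UNIV \<times> cbox (0, 0) (1, 2 * pi)) (\<lambda>(\<beta>, x). fx \<beta> x)" using cfx by (simp add: R_def)
    show "(\<lambda>x. k ((norm (Y 1 \<beta> - Y (fst x) (snd x)))\<^sup>2) * cross (Yr (fst x) (snd x)) (Yt (fst x) (snd x))) integrable_on cbox (0, 0) (1, 2 * pi)" for \<beta>
      unfolding R_def[symmetric] cross_def
      by (rule integrable_continuous[of "(0::real, 0::real)" "(1, 2*pi)", folded R_def])
         (intro continuous_intros continuous_on_compose2[OF kc] cR, auto)
    fix \<beta> :: real and x :: "real \<times> real"
    have "((\<lambda>\<beta>. Y 1 \<beta> - Y (fst x) (snd x)) has_vector_derivative Yt 1 \<beta> - 0) (at \<beta>)"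
      by (intro has_vector_derivative_diff Y_deriv_t has_vector_derivative_const) auto
    hence 1: "((\<lambda>\<beta>. Re (Y 1 \<beta> - Y (fst x) (snd x))) has_real_derivative Re (Yt 1 \<beta>)) (at \<beta>)"
      "((\<lambda>\<beta>. Im (Y 1 \<beta> - Y (fst x) (snd x))) has_real_derivative Im (Yt 1 \<beta>)) (at \<beta>)"
      using bounded_linear.has_vector_derivative[OF bounded_linear_Re, of "\<lambda>\<beta>. Y 1 \<beta> - Y (fst x) (snd x)"]
         bounded_linear.has_vector_derivative[OF bounded_linear_Im, of "\<lambda>\<beta>. Y 1 \<beta> - Y (fst x) (snd x)"]
      by (auto simp: has_real_derivative_iff_has_vector_derivative)
    have 2: "((\<lambda>\<beta>. (norm (Y 1 \<beta> - Y (fst x) (snd x)))\<^sup>2) has_real_derivative 2 * ((Y 1 \<beta> - Y (fst x) (snd x)) \<bullet> Yt 1 \<beta>)) (at \<beta>)"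
      unfolding cmod_power2 by (rule derivative_eq_intros 1 refl)+ (simp add: inner_complex_def algebra_simps)
    have "((\<lambda>\<beta>. k ((norm (Y 1 \<beta> - Y (fst x) (snd x)))\<^sup>2) * cross (Yr (fst x) (snd x)) (Yt (fst x) (snd x))) has_real_derivative fx \<beta> x) (at \<beta>)"
      unfolding fx_def by (intro DERIV_cmult_right DERIV_chain2[OF k 2]) auto
    thus "((\<lambda>\<beta>. k ((norm (Y 1 \<beta> - Y (fst x) (snd x)))\<^sup>2) * cross (Yr (fst x) (snd x)) (Yt (fst x) (snd x))) has_vector_derivative fx \<beta> x) (at \<beta> within UNIV)"
      by (simp add: has_real_derivative_iff_has_vector_derivative)
  qed auto
  moreover have "integral R (fx \<beta>) = - integral {0..2*pi} (\<lambda>\<theta>. k ((norm (Y 1 \<beta> - Y 1 \<theta>))\<^sup>2) * cross (Yt 1 \<beta>) (Yt 1 \<theta>))"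
  proof -
    define p where "p = Y 1 \<beta>"
    define s where "s = Yt 1 \<beta>"
    define A where "A r \<theta> = k ((norm (p - Y r \<theta>))\<^sup>2) * cross s (Yt r \<theta>)" for r \<theta>
    define B where "B r \<theta> = k ((norm (p - Y r \<theta>))\<^sup>2) * cross s (Yr r \<theta>)" for r \<theta>
    define A' where "A' r \<theta> = - 2 * k' ((norm (p - Y r \<theta>))\<^sup>2) * ((p - Y r \<theta>) \<bullet> Yr r \<theta>) * cross s (Yt r \<theta>) + k ((norm (p - Y r \<theta>))\<^sup>2) * cross s (Yrt r \<theta>)" for r \<theta>
    define B' where "B' r \<theta> = - 2 * k' ((norm (p - Y r \<theta>))\<^sup>2) * ((p - Y r \<theta>) \<bullet> Yt r \<theta>) * cross s (Yr r \<theta>) + k ((norm (p - Y r \<theta>))\<^sup>2) * cross s (Yrt r \<theta>)" for r \<theta>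
    have cA': "continuous_on R (\<lambda>x. A' (fst x) (snd x))" "continuous_on R (\<lambda>x. B' (fst x) (snd x))"
      unfolding A'_def B'_def cross_def
      by (intro continuous_intros continuous_on_compose2[OF kc] continuous_on_compose2[OF k'] cR, auto)+
    have eq: "fx \<beta> x = B' (fst x) (snd x) - A' (fst x) (snd x)" for x
    proof -
      define v where "v = p - Y (fst x) (snd x)"
      define a where "a = Yr (fst x) (snd x)"
      define b where "b = Yt (fst x) (snd x)"
      have "cross a b * (v \<bullet> s) = v \<bullet> (cross s b *\<^sub>R a + cross a s *\<^sub>R b)"
        unfolding cross_cramer[symmetric] by simp
      hence "cross a b * (v \<bullet> s) = cross s b * (v \<bullet> a) + cross a s * (v \<bullet> b)"
        by (simp add: inner_add_right)
      moreover have "cross a s = - cross s a" by (simp add: cross_def)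
      ultimately have "cross a b * (v \<bullet> s) = cross s b * (v \<bullet> a) - cross s a * (v \<bullet> b)" by simp
      hence "k' ((norm v)\<^sup>2) * (2 * (v \<bullet> s)) * cross a b = 2 * k' ((norm v)\<^sup>2) * (cross s b * (v \<bullet> a) - cross s a * (v \<bullet> b))"
        by (simp add: mult_ac)
      thus ?thesis unfolding fx_def A'_def B'_def p_def[symmetric] s_def[symmetric] v_def[symmetric] a_def[symmetric] b_def[symmetric]
        by (simp add: algebra_simps)
    qed
    have iA: "integral R (\<lambda>x. A' (fst x) (snd x)) = integral {0..2*pi} (\<lambda>\<theta>. A 1 \<theta>)"
    proof -
      have "integral R (\<lambda>x. A' (fst x) (snd x)) = integral (cbox 0 1) (\<lambda>r. integral (cbox 0 (2*pi)) (\<lambda>\<theta>. A' r \<theta>))"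
        using integral_prod_continuous[of 0 0 1 "2*pi" "\<lambda>x. A' (fst x) (snd x)"] cA' by (simp add: R_def)
      also have "\<dots> = integral (cbox 0 (2*pi)) (\<lambda>\<theta>. integral (cbox 0 1) (\<lambda>r. A' r \<theta>))"
        using integral_swap_continuous[of 0 0 1 "2*pi" A'] cA' by (simp add: R_def case_prod_beta')
      also have "\<dots> = integral (cbox 0 (2*pi)) (\<lambda>\<theta>. A 1 \<theta>)"
      proof (rule integral_cong)
        fix \<theta>
        have "((\<lambda>r. A' r \<theta>) has_integral (A 1 \<theta> - A 0 \<theta>)) {0..1}"
        proof (rule fundamental_theorem_of_calculus)
          fix r :: real assume r: "r \<in> {0..1}"
          show "((\<lambda>r. A r \<theta>) has_vector_derivative A' r \<theta>) (at r within {0..1})"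
            unfolding A_def A'_def has_real_derivative_iff_has_vector_derivative[symmetric]
            by (rule has_real_derivative_kernel_cross[OF Y_deriv_r[OF r] Yt_deriv_r[OF r] k]) simp
        qed simp
        \<comment> \<open>The inner endpoint contributes nothing, as the angular derivative vanishes
          at the centre of the disk; only the boundary term at radius 1 remains.\<close>
        moreover have "A 0 \<theta> = 0" by (simp add: A_def Yt_def cross_def)
        ultimately show "integral (cbox 0 1) (\<lambda>r. A' r \<theta>) = A 1 \<theta>" by (simp add: integral_unique)
      qed
      finally show ?thesis by simp
    qed
    have iB: "integral R (\<lambda>x. B' (fst x) (snd x)) = 0"
    proof -
      have "integral R (\<lambda>x. B' (fst x) (snd x)) = integral (cbox 0 1) (\<lambda>r. integral (cbox 0 (2*pi)) (\<lambda>\<theta>. B' r \<theta>))"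
        using integral_prod_continuous[of 0 0 1 "2*pi" "\<lambda>x. B' (fst x) (snd x)"] cA' by (simp add: R_def)
      also have "\<dots> = integral (cbox 0 1) (\<lambda>r::real. 0)"
      proof (rule integral_cong)
        fix r :: real assume r: "r \<in> cbox 0 1"
        have "((\<lambda>\<theta>. B' r \<theta>) has_integral (B r (2*pi) - B r 0)) {0..2*pi}"
        proof (rule fundamental_theorem_of_calculus)
          fix \<theta> :: real
          show "((\<lambda>\<theta>. B r \<theta>) has_vector_derivative B' r \<theta>) (at \<theta> within {0..2*pi})"
            unfolding B_def B'_def has_real_derivative_iff_has_vector_derivative[symmetric]
            using r by (intro has_real_derivative_kernel_cross[OF Y_deriv_t Yr_deriv_t k]) auto
        qed simp
        \<comment> \<open>Periodicity in the angle: the two edges of the polar rectangle are mapped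
          to the same ray.\<close>
        moreover have "B r (2*pi) = B r 0" by (simp add: B_def Y_def Yr_def)
        ultimately show "integral (cbox 0 (2*pi)) (\<lambda>\<theta>. B' r \<theta>) = 0" by (simp add: integral_unique)
      qed
      finally show ?thesis by simp
    qed
    have "integral R (fx \<beta>) = integral R (\<lambda>x. B' (fst x) (snd x)) - integral R (\<lambda>x. A' (fst x) (snd x))"
      unfolding eq[abs_def]
      by (rule integral_diff) (use integrable_continuous[of "(0::real, 0::real)" "(1, 2*pi)", folded R_def] cA' in auto)
    thus ?thesis unfolding iA iB by (simp add: A_def[abs_def] p_def s_def)
  qed
  ultimately show ?thesis by (simp add: R_def)
qed

end

lemma set_integrable_product_snd:
  fixes h :: "real \<Rightarrow> real"
  assumes h: "set_integrable lborel {a<..<b} h"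
  shows "set_integrable lborel ({0<..<1::real} \<times> {a<..<b}) (\<lambda>(r, \<theta>). h \<theta>)"
proof -
  define f where "f x = indicator {0<..<1::real} (fst x) * (indicator {a<..<b} (snd x) *\<^sub>R h (snd x))" for x :: "real \<times> real"
  have hm: "(\<lambda>\<theta>. indicator {a<..<b} \<theta> *\<^sub>R h \<theta>) \<in> borel_measurable borel"
    using borel_measurable_integrable[OF h[unfolded set_integrable_def]] by simp
  have i0: "integrable lborel (\<lambda>r::real. indicator {0<..<1::real} r :: real)" by simp
  have "integrable (lborel \<Otimes>\<^sub>M lborel) f"
  proof (rule lborel_pair.Fubini_integrable)
    show "f \<in> borel_measurable (lborel \<Otimes>\<^sub>M lborel)"
      unfolding f_def[abs_def]
      by (intro borel_measurable_times measurable_compose[OF measurable_fst] measurable_compose[OF measurable_snd]) (use hm in auto)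
    have "(\<integral>y. norm (f (x, y)) \<partial>lborel) = indicator {0<..<1} x * (\<integral>y. norm (indicator {a<..<b} y *\<^sub>R h y) \<partial>lborel)" for x
      by (simp add: f_def abs_mult)
    thus "integrable lborel (\<lambda>x. \<integral>y. norm (f (x, y)) \<partial>lborel)"
      using integrable_mult_left[OF i0] by simp
    show "AE x in lborel. integrable lborel (\<lambda>y. f (x, y))"
      using h by (auto simp: f_def set_integrable_def)
  qed
  moreover have "f = (\<lambda>x. indicator ({0<..<1} \<times> {a<..<b}) x *\<^sub>R (case x of (r, \<theta>) \<Rightarrow> h \<theta>))"
    by (auto simp: f_def indicator_def fun_eq_iff)
  ultimately show ?thesis by (simp add: set_integrable_def lborel_prod)
qed

section \<open>Passage from regularized kernels to the singular kernel\<close>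

locale patch_map = cm_kernel K + disk_map \<Phi> \<Phi>' \<Phi>''
  for K :: "real \<Rightarrow> real" and \<Phi> \<Phi>' \<Phi>'' :: "complex \<Rightarrow> complex" +
  assumes low: "\<And>z w. z \<in> cball 0 1 \<Longrightarrow> w \<in> cball 0 1 \<Longrightarrow> norm (z - w) / 2 \<le> norm (\<Phi> z - \<Phi> w)"
    and up: "\<And>z w. z \<in> cball 0 1 \<Longrightarrow> w \<in> cball 0 1 \<Longrightarrow> norm (\<Phi> z - \<Phi> w) \<le> 2 * norm (z - w)"
begin

definition D :: "complex set" where "D = \<Phi> ` ball 0 1"

lemma inj_cball: "inj_on \<Phi> (cball 0 1)"
proof (rule inj_onI)
  fix z w assume "z \<in> cball 0 1" "w \<in> cball 0 1" "\<Phi> z = \<Phi> w"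
  with low[of z w] show "z = w" by simp
qed

lemma inj_ball: "inj_on \<Phi> (ball 0 1)"
  by (rule inj_on_subset[OF inj_cball]) auto

lemma der_ball: "z \<in> ball 0 1 \<Longrightarrow> (\<Phi> has_field_derivative \<Phi>' z) (at z)"
  using d1[of z] at_within_interior[of z "cball 0 1"] by (simp add: interior_cball)

lemma holo: "\<Phi> holomorphic_on ball 0 1"
  unfolding holomorphic_on_def field_differentiable_def using der_ball has_field_derivative_at_within by blast

lemma open_D: "open D"
  unfolding D_def using open_mapping_thm3[OF holo _ inj_ball] by simp

lemma closure_D: "closure D = \<Phi> ` cball 0 1"
proof
  show "closure D \<subseteq> \<Phi> ` cball 0 1"
    by (rule closure_minimal)
      (auto simp: D_def intro!: compact_imp_closed compact_continuous_image[OF c1])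
  have "\<Phi> ` closure (ball 0 1) \<subseteq> closure (\<Phi> ` ball 0 1)"
    using image_closure_subset[of "ball 0 1" \<Phi> "closure (\<Phi> ` ball 0 1)"] c1 by (auto simp: closure_subset)
  thus "\<Phi> ` cball 0 1 \<subseteq> closure D" by (simp add: D_def)
qed

lemma frontier_D: "frontier D = \<Phi> ` sphere 0 1"
proof -
  have "frontier D = \<Phi> ` cball 0 1 - \<Phi> ` ball 0 1"
    using open_D by (simp add: frontier_def closure_D interior_open) (simp add: D_def)
  also have "\<dots> = \<Phi> ` (cball 0 1 - ball 0 1)"
    by (rule inj_on_image_set_diff[OF inj_cball, symmetric]) auto
  finally show ?thesis by (simp add: cball_diff_eq_sphere)
qed

lemma bounded_D: "bounded D"
  using bounded_subset[OF compact_imp_bounded[OF compact_continuous_image[OF c1 compact_cball]], of D]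
  by (simp add: D_def image_mono)

lemma deriv_bound: obtains M where "M > 0" "\<And>z. z \<in> cball 0 1 \<Longrightarrow> norm (\<Phi>' z) \<le> M"
proof -
  have "bounded (\<Phi>' ` cball 0 1)" by (intro compact_imp_bounded compact_continuous_image c2 compact_cball)
  thus ?thesis using that by (auto simp: bounded_pos)
qed

lemma cis_shift_dist: "norm (cis \<beta> - cis (\<beta> + \<theta>)) = \<bar>2 * sin (\<theta> / 2)\<bar>"
proof -
  have "cis \<beta> - cis (\<beta> + \<theta>) = cis \<beta> * (1 - cis \<theta>)" by (simp add: right_diff_distrib cis_mult)
  moreover have "(norm (1 - cis \<theta>))\<^sup>2 = \<bar>2 * sin (\<theta> / 2)\<bar>\<^sup>2"
    unfolding cmod_power2 using sin_cos_squared_add[of \<theta>] one_minus_cos_half[of \<theta>]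
    by (simp add: power2_eq_square algebra_simps)
  hence "norm (1 - cis \<theta>) = \<bar>2 * sin (\<theta> / 2)\<bar>" by (rule power2_eq_imp_eq) auto
  ultimately show ?thesis by (simp add: norm_mult)
qed

text \<open>The distance from the boundary point is at least 1 - r, so moving radially out to the
  circle costs no more than that distance. This bounds the distance below by a purely angular
  quantity, uniformly in the radius.\<close>

lemma polar_dist:
  assumes r: "0 \<le> r" "r \<le> 1"
  shows "norm (cis \<beta> - cis \<theta>) / 2 \<le> norm (cis \<beta> - of_real r * cis \<theta>)"
proof -
  have "norm (cis \<theta> - of_real r * cis \<theta>) = 1 - r"
  proof -
    have "cis \<theta> - of_real r * cis \<theta> = of_real (1 - r) * cis \<theta>" by (simp add: algebra_simps)
    thus ?thesis using r by (simp only: norm_mult norm_of_real norm_cis) simp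
  qed
  also have "1 - r \<le> norm (cis \<beta> - of_real r * cis \<theta>)"
    using norm_triangle_ineq2[of "cis \<beta>" "of_real r * cis \<theta>"] r by (simp add: norm_mult)
  finally have "norm (cis \<theta> - of_real r * cis \<theta>) \<le> norm (cis \<beta> - of_real r * cis \<theta>)" .
  moreover have "norm (cis \<beta> - cis \<theta>) \<le> norm (cis \<beta> - of_real r * cis \<theta>) + norm (cis \<theta> - of_real r * cis \<theta>)"
    using norm_triangle_ineq4[of "cis \<beta> - of_real r * cis \<theta>" "cis \<theta> - of_real r * cis \<theta>"] by simp
  ultimately show ?thesis by simp
qed

lemma boundary_not_in_D: "\<Phi> (cis \<beta>) \<notin> D"
  using inj_onD[OF inj_cball, of "cis \<beta>"] by (force simp: D_def)

lemma cont_kernel_D: "continuous_on D (\<lambda>y. K (norm (\<Phi> (cis \<beta>) - y)))"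
  using boundary_not_in_D[of \<beta>]
  by (intro continuous_on_compose2[OF continuous_on_kd[of 0, unfolded kd_0]] continuous_intros) auto

lemma potential_integrable: "set_integrable lborel D (\<lambda>y. K (norm (\<Phi> (cis \<beta>) - y)))"
proof -
  obtain M where M: "M > 0" "\<And>z. z \<in> cball 0 1 \<Longrightarrow> norm (\<Phi>' z) \<le> M" using deriv_bound by blast
  \<comment> \<open>The angular window starts at \<open>\<beta>\<close>, so the singular direction
    lies at its two ends and not inside.\<close>
  define R where "R = {0<..<1::real} \<times> {\<beta><..<\<beta> + 2 * pi}"
  define G where "G = (\<lambda>(r, \<theta>). (r * (norm (\<Phi>' (of_real r * cis \<theta>)))\<^sup>2) * K (norm (\<Phi> (cis \<beta>) - \<Phi> (of_real r * cis \<theta>))))"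
  \<comment> \<open>A majorant independent of the radius: the distance lies between half the sine of
    the half-angle and 4, and a decreasing kernel is controlled by its values at these
    bounds.\<close>
  define h where "h \<theta> = M\<^sup>2 * (\<bar>K (1/2 * sin ((\<theta> - \<beta>) / 2))\<bar> + \<bar>K 4\<bar>)" for \<theta>
  have "set_integrable lborel {\<beta><..<\<beta> + 2 * pi} (\<lambda>\<theta>. K (1/2 * sin ((\<theta> - \<beta>) / 2)))"
  proof -
    have "integrable lborel (\<lambda>\<theta>. indicator {0<..<2*pi} (- \<beta> + 1 * \<theta>) *\<^sub>R K (1/2 * sin ((- \<beta> + 1 * \<theta>) / 2)))"
      using K_sine_integrable[of "1/2"] unfolding set_integrable_def by (intro lborel_integrable_real_affine) auto
    also have "(\<lambda>\<theta>. indicator {0<..<2*pi} (- \<beta> + 1 * \<theta>) *\<^sub>R K (1/2 * sin ((- \<beta> + 1 * \<theta>) / 2)))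
        = (\<lambda>\<theta>. indicator {\<beta><..<\<beta> + 2*pi} \<theta> *\<^sub>R K (1/2 * sin ((\<theta> - \<beta>) / 2)))"
      by (auto simp: indicator_def algebra_simps)
    finally show ?thesis by (simp add: set_integrable_def)
  qed
  moreover have "set_integrable lborel {\<beta><..<\<beta> + 2 * pi} (\<lambda>\<theta>. K 4)"
    unfolding set_integrable_def by simp
  ultimately have hi: "set_integrable lborel {\<beta><..<\<beta> + 2 * pi} h"
    unfolding h_def by (intro set_integrable_mult_right set_integral_add(1) set_integrable_abs)
  have "set_integrable lborel R G"
  proof (rule set_integrable_bound)
    show "set_integrable lborel R (\<lambda>(r, \<theta>). h \<theta>)"
      unfolding R_def by (rule set_integrable_product_snd[OF hi])
    have "continuous_on R G"
      unfolding G_def case_prod_beta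
    proof (intro continuous_intros continuous_on_compose2[OF continuous_on_kd[of 0, unfolded kd_0]]
        continuous_on_compose2[OF c2] continuous_on_compose2[OF c1] continuous_on_compose2[OF continuous_on_cis])
      show "(\<lambda>x. norm (\<Phi> (cis \<beta>) - \<Phi> (of_real (fst x) * cis (snd x)))) ` R \<subseteq> {0<..}"
      proof clarsimp
        fix r \<theta> assume x: "(r, \<theta>) \<in> R" and eq: "\<Phi> (cis \<beta>) = \<Phi> (of_real r * cis \<theta>)"
        have "of_real r * cis \<theta> \<in> ball 0 1" using x by (auto simp: R_def norm_mult)
        hence "\<Phi> (cis \<beta>) \<in> D" unfolding eq D_def by blast
        with boundary_not_in_D show False by blast
      qed
    qed (auto simp: R_def norm_mult)
    moreover have "open R" unfolding R_def by (intro open_Times) auto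
    ultimately show "set_borel_measurable lborel R G"
      unfolding set_borel_measurable_def using borel_measurable_continuous_on_indicator[of R G] by simp
    show "AE x in lborel. x \<in> R \<longrightarrow> norm (G x) \<le> norm (case x of (r, \<theta>) \<Rightarrow> h \<theta>)"
    proof (intro AE_I2 impI)
      fix x assume "x \<in> R"
      then obtain r \<theta> where x: "x = (r, \<theta>)" "0 < r" "r < 1" "\<beta> < \<theta>" "\<theta> < \<beta> + 2 * pi" by (auto simp: R_def)
      have s: "sin ((\<theta> - \<beta>) / 2) > 0" using x by (intro sin_half_pos) auto
      have n: "norm (of_real r * cis \<theta>) \<le> 1" using x by (simp add: norm_mult)
      have "1/2 * sin ((\<theta> - \<beta>) / 2) = norm (cis \<beta> - cis \<theta>) / 4"
        using cis_shift_dist[of \<beta> "\<theta> - \<beta>"] s by simp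
      also have "\<dots> \<le> norm (cis \<beta> - of_real r * cis \<theta>) / 2"
        using polar_dist[of r \<beta> \<theta>] x by simp
      also have "\<dots> \<le> norm (\<Phi> (cis \<beta>) - \<Phi> (of_real r * cis \<theta>))"
        using n by (intro low) auto
      finally have l: "1/2 * sin ((\<theta> - \<beta>) / 2) \<le> norm (\<Phi> (cis \<beta>) - \<Phi> (of_real r * cis \<theta>))" .
      have "norm (\<Phi> (cis \<beta>) - \<Phi> (of_real r * cis \<theta>)) \<le> 2 * norm (cis \<beta> - of_real r * cis \<theta>)"
        using n by (intro up) auto
      also have "\<dots> \<le> 2 * (1 + 1)"
        using norm_triangle_ineq4[of "cis \<beta>" "of_real r * cis \<theta>"] n by simp
      finally have "\<bar>K (norm (\<Phi> (cis \<beta>) - \<Phi> (of_real r * cis \<theta>)))\<bar> \<le> \<bar>K (1/2 * sin ((\<theta> - \<beta>) / 2))\<bar> + \<bar>K 4\<bar>"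
        using l s by (intro abs_K_le) auto
      moreover have "r * (norm (\<Phi>' (of_real r * cis \<theta>)))\<^sup>2 \<le> 1 * M\<^sup>2"
        using x M(2)[of "of_real r * cis \<theta>"] n by (intro mult_mono power_mono) auto
      ultimately have "(r * (norm (\<Phi>' (of_real r * cis \<theta>)))\<^sup>2) * \<bar>K (norm (\<Phi> (cis \<beta>) - \<Phi> (of_real r * cis \<theta>)))\<bar> \<le> h \<theta>"
        unfolding h_def using x by (intro mult_mono) auto
      thus "norm (G x) \<le> norm (case x of (r, \<theta>) \<Rightarrow> h \<theta>)"
        using x by (simp add: G_def abs_mult)
    qed
  qed
  thus ?thesis
    using conformal_polar_coordinates(1)[OF der_ball inj_ball continuous_on_subset[OF c2] cont_kernel_D[unfolded D_def], of \<beta> \<beta>]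
    by (simp add: D_def R_def G_def ball_subset_cball)
qed

text \<open>A function of the squared distance, regularised so that the potential can be differentiated
  under the integral sign.\<close>

definition keps :: "real \<Rightarrow> real \<Rightarrow> real" where
  "keps \<epsilon> u = K (sqrt (u + \<epsilon>))"

lemma keps_deriv:
  assumes "\<epsilon> > 0" "u \<ge> 0"
  shows "(keps \<epsilon> has_real_derivative kd 1 (sqrt (u + \<epsilon>)) / (2 * sqrt (u + \<epsilon>))) (at u)"
proof -
  have "((\<lambda>u. sqrt (u + \<epsilon>)) has_real_derivative 1 / (2 * sqrt (u + \<epsilon>))) (at u)"
    using assms by (auto intro!: derivative_eq_intros simp: field_simps)
  from DERIV_chain2[OF DERIV_kd[of "sqrt (u + \<epsilon>)" 0] this] assms show ?thesis
    by (simp add: keps_def[abs_def])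
qed

lemma keps_deriv_cont:
  "\<epsilon> > 0 \<Longrightarrow> continuous_on {0..} (\<lambda>u. kd 1 (sqrt (u + \<epsilon>)) / (2 * sqrt (u + \<epsilon>)))"
  by (intro continuous_intros continuous_on_compose2[OF continuous_on_kd]) auto

lemma keps_cont: "\<epsilon> > 0 \<Longrightarrow> continuous_on {0..} (keps \<epsilon>)"
  by (rule DERIV_continuous_on) (auto intro: has_field_derivative_at_within keps_deriv)

lemma keps_le: "\<epsilon> > 0 \<Longrightarrow> \<rho> > 0 \<Longrightarrow> keps \<epsilon> (\<rho>\<^sup>2) \<le> K \<rho>"
  unfolding keps_def by (intro K_antimono real_le_rsqrt) auto

text \<open>With t the regularized distance, the slope of the error at x is K'(x) - K'(t) x / t. It
  is nonpositive, because K' is increasing and nonpositive and x \<le> t. The error at a distance is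
  thus controlled by the error at any smaller comparison distance.\<close>

lemma keps_diff_antimono:
  assumes e: "\<epsilon> > 0" and s: "0 < s" "s \<le> \<rho>"
  shows "K \<rho> - keps \<epsilon> (\<rho>\<^sup>2) \<le> K s - keps \<epsilon> (s\<^sup>2)"
proof (rule DERIV_nonpos_imp_nonincreasing[OF s(2)])
  fix x assume "s \<le> x"
  hence x: "x > 0" using s by simp
  define t where "t = sqrt (x\<^sup>2 + \<epsilon>)"
  have t: "x \<le> t" "0 < t" using x e by (auto simp: t_def intro!: real_le_rsqrt add_pos_pos)
  have "((\<lambda>x. keps \<epsilon> (x\<^sup>2)) has_real_derivative kd 1 t / (2 * t) * (2 * x)) (at x)"
    unfolding t_def using x
    by (intro DERIV_chain2[OF keps_deriv[OF e]]) (auto intro!: derivative_eq_intros)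
  hence "((\<lambda>x. K x - keps \<epsilon> (x\<^sup>2)) has_real_derivative kd 1 x - kd 1 t / (2 * t) * (2 * x)) (at x)"
    using DERIV_kd[OF x, of 0] by (intro DERIV_diff) auto
  moreover have "kd 1 x - kd 1 t / (2 * t) * (2 * x) \<le> 0"
  proof -
    have "kd 1 x \<le> kd 1 t" using x t by (intro kd1_mono) auto
    also have "kd 1 t = kd 1 t * 1" by simp
    also have "kd 1 t * 1 \<le> kd 1 t * (x / t)" using t kd1_le[of t] by (intro mult_left_mono_neg) auto
    finally show ?thesis using t by simp
  qed
  ultimately show "\<exists>y. ((\<lambda>x. K x - keps \<epsilon> (x\<^sup>2)) has_real_derivative y) (at x) \<and> y \<le> 0" by blast
qed

definition Veps :: "real \<Rightarrow> real \<Rightarrow> real" where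
  "Veps \<epsilon> \<beta> = integral (cbox (0, 0) (1, 2*pi)) (\<lambda>x. keps \<epsilon> ((norm (Y 1 \<beta> - Y (fst x) (snd x)))\<^sup>2) * cross (Yr (fst x) (snd x)) (Yt (fst x) (snd x)))"

lemma Veps_eq:
  assumes e: "\<epsilon> > 0"
  shows "Veps \<epsilon> \<beta> = (LINT y:D|lborel. keps \<epsilon> ((norm (\<Phi> (cis \<beta>) - y))\<^sup>2))"
    and "set_integrable lborel D (\<lambda>y. keps \<epsilon> ((norm (\<Phi> (cis \<beta>) - y))\<^sup>2))"
proof -
  define R where "R = {0<..<1::real} \<times> {0<..<0 + 2 * pi}"
  define G where "G = (\<lambda>(r, \<theta>). (r * (norm (\<Phi>' (of_real r * cis \<theta>)))\<^sup>2) * keps \<epsilon> ((norm (\<Phi> (cis \<beta>) - \<Phi> (of_real r * cis \<theta>)))\<^sup>2))"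
  define F where "F y = keps \<epsilon> ((norm (\<Phi> (cis \<beta>) - y))\<^sup>2)" for y
  have cF: "continuous_on A F" for A
    unfolding F_def by (intro continuous_on_compose2[OF keps_cont[OF e]] continuous_intros) auto
  have G: "G x = keps \<epsilon> ((norm (Y 1 \<beta> - Y (fst x) (snd x)))\<^sup>2) * cross (Yr (fst x) (snd x)) (Yt (fst x) (snd x))" for x
    by (cases x) (simp add: G_def cross_Yr_Yt Y_def)
  have box: "R = box (0, 0) (1, 2 * pi)" by (auto simp: R_def box_def Basis_prod_def)
  have cG: "continuous_on (cbox (0, 0) (1, 2*pi)) G"
  proof -
    have s: "cbox (0::real, 0::real) (1, 2*pi) \<subseteq> {0..1} \<times> UNIV" by (auto simp: cbox_Pair_eq)
    show ?thesis unfolding G[abs_def] cross_def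
      by (intro continuous_intros continuous_on_compose2[OF keps_cont[OF e]] continuous_on_subset[OF cont_Y(1) s]
          continuous_on_subset[OF cont_Y(2) s] continuous_on_subset[OF cont_Y(3) s]) auto
  qed
  have ic: "set_integrable lborel (cbox (0, 0) (1, 2*pi)) G"
    unfolding set_integrable_def by (rule borel_integrable_compact[OF compact_cbox cG])
  have iR: "set_integrable lborel R G"
    by (rule set_integrable_subset[OF ic]) (auto simp: box box_subset_cbox)
  note cp = conformal_polar_coordinates[OF der_ball inj_ball continuous_on_subset[OF c2 ball_subset_cball] cF, of 0]
  have cp1: "set_integrable lborel D F"
    using cp(1) iR by (simp add: D_def R_def G_def F_def)
  thus "set_integrable lborel D (\<lambda>y. keps \<epsilon> ((norm (\<Phi> (cis \<beta>) - y))\<^sup>2))" by (simp add: F_def[abs_def])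
  have "(LINT y:D|lborel. F y) = (LINT x:R|lborel. G x)"
    using cp(2) iR by (simp add: D_def R_def G_def F_def)
  also have "\<dots> = integral R G" by (rule set_borel_integral_eq_integral(2)[OF iR])
  also have "\<dots> = integral (cbox (0, 0) (1, 2*pi)) G" unfolding box by (rule integral_open_interval)
  finally show "Veps \<epsilon> \<beta> = (LINT y:D|lborel. keps \<epsilon> ((norm (\<Phi> (cis \<beta>) - y))\<^sup>2))"
    by (simp add: Veps_def F_def G[abs_def])
qed

text \<open>The cross product of the boundary tangents at two points, with \<theta> measured
  relative to \<beta>.\<close>

definition bint :: "real \<Rightarrow> real \<Rightarrow> real" where
  "bint \<beta> \<theta> = Im (cnj (\<Phi>' (cis \<beta>)) * cis \<theta> * \<Phi>' (cis \<beta> * cis \<theta>))"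

definition rho :: "real \<Rightarrow> real \<Rightarrow> real" where
  "rho \<beta> \<theta> = norm (\<Phi> (cis \<beta> * cis \<theta>) - \<Phi> (cis \<beta>))"

lemma cont_shift: "continuous_on UNIV (rho \<beta>)" "continuous_on UNIV (bint \<beta>)"
  unfolding rho_def[abs_def] bint_def[abs_def]
  by (intro continuous_intros continuous_on_compose2[OF c1] continuous_on_compose2[OF c2] continuous_on_compose2[OF continuous_on_cis];
      auto simp: norm_mult)+

lemma Veps_deriv:
  assumes e: "\<epsilon> > 0"
  shows "(Veps \<epsilon> has_real_derivative - integral {0..2*pi} (\<lambda>\<theta>. keps \<epsilon> ((rho \<beta> \<theta>)\<^sup>2) * bint \<beta> \<theta>)) (at \<beta>)"
proof -
  define f where "f \<theta> = keps \<epsilon> ((norm (Y 1 \<beta> - Y 1 \<theta>))\<^sup>2) * cross (Yt 1 \<beta>) (Yt 1 \<theta>)" for \<theta>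
  have "(Veps \<epsilon> has_real_derivative - integral {0..2*pi} f) (at \<beta>)"
    unfolding Veps_def[abs_def] f_def has_real_derivative_iff_has_vector_derivative
    by (rule potential_derivative[OF keps_deriv[OF e] keps_deriv_cont[OF e]])
  moreover have "integral {0..2*pi} f = integral {0..2*pi} (\<lambda>\<theta>. f (\<theta> + \<beta>))"
  proof (rule integral_periodic_shift[symmetric])
    show "continuous_on UNIV f"
      unfolding f_def cross_def
      by (intro continuous_intros continuous_on_compose2[OF keps_cont[OF e]] cont_Y1) auto
    show "f (x + 2 * pi) = f x" for x by (simp add: f_def Y_def Yt_def flip: cis_mult)
  qed
  moreover have "f (\<theta> + \<beta>) = keps \<epsilon> ((rho \<beta> \<theta>)\<^sup>2) * bint \<beta> \<theta>" for \<theta>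
  proof -
    have c: "cis (\<theta> + \<beta>) = cis \<beta> * cis \<theta>" by (simp add: cis_mult add.commute)
    have "cnj (Yt 1 \<beta>) * Yt 1 (\<theta> + \<beta>) = (cnj (cis \<beta>) * cis \<beta>) * (cnj (\<Phi>' (cis \<beta>)) * cis \<theta> * \<Phi>' (cis \<beta> * cis \<theta>))"
      by (simp add: Yt_def c mult_ac)
    also have "cnj (cis \<beta>) * cis \<beta> = 1" by (simp add: cis_cnj cis_mult)
    finally have "cross (Yt 1 \<beta>) (Yt 1 (\<theta> + \<beta>)) = bint \<beta> \<theta>" by (simp add: cross_eq_Im bint_def)
    thus ?thesis by (simp add: f_def Y_def c rho_def norm_minus_commute)
  qed
  ultimately show ?thesis by simp
qed

lemma rho_lower: "0 < \<theta> \<Longrightarrow> \<theta> < 2 * pi \<Longrightarrow> sin (\<theta> / 2) \<le> rho \<beta> \<theta>"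
  using low[of "cis \<beta>" "cis \<beta> * cis \<theta>"] cis_shift_dist[of \<beta> \<theta>] sin_half_pos[of \<theta>]
  by (simp add: rho_def norm_minus_commute cis_mult)

lemma rho_upper: "rho \<beta> \<theta> \<le> 4"
proof -
  have "rho \<beta> \<theta> \<le> 2 * norm (cis \<beta> * cis \<theta> - cis \<beta>)"
    unfolding rho_def by (rule up) (auto simp: norm_mult)
  also have "\<dots> \<le> 4" using norm_triangle_ineq4[of "cis \<beta> * cis \<theta>" "cis \<beta>"] by (simp add: norm_mult)
  finally show ?thesis .
qed

lemma kernel_rho_integrable: "set_integrable lborel {0<..<2*pi} (\<lambda>\<theta>. K (rho \<beta> \<theta>) * bint \<beta> \<theta>)"
  and bint_bound: "\<exists>B\<ge>0. \<forall>\<beta> \<theta>. \<bar>bint \<beta> \<theta>\<bar> \<le> B"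
proof -
  obtain M where M: "M > 0" "\<And>z. z \<in> cball 0 1 \<Longrightarrow> norm (\<Phi>' z) \<le> M" using deriv_bound by blast
  have B: "\<bar>bint \<beta> \<theta>\<bar> \<le> M * M" for \<beta> \<theta>
  proof -
    have "\<bar>bint \<beta> \<theta>\<bar> \<le> norm (cnj (\<Phi>' (cis \<beta>)) * cis \<theta> * \<Phi>' (cis \<beta> * cis \<theta>))"
      unfolding bint_def by (rule abs_Im_le_cmod)
    also have "\<dots> = norm (\<Phi>' (cis \<beta>)) * norm (\<Phi>' (cis \<beta> * cis \<theta>))" by (simp add: norm_mult)
    also have "\<dots> \<le> M * M" using M by (intro mult_mono M) (auto simp: norm_mult)
    finally show ?thesis .
  qed
  thus "\<exists>B\<ge>0. \<forall>\<beta> \<theta>. \<bar>bint \<beta> \<theta>\<bar> \<le> B" using M by (intro exI[of _ "M * M"]) auto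
  show "set_integrable lborel {0<..<2*pi} (\<lambda>\<theta>. K (rho \<beta> \<theta>) * bint \<beta> \<theta>)"
  proof (rule set_integrable_bound)
    show "set_integrable lborel {0<..<2*pi} (\<lambda>\<theta>. (\<bar>K (1 * sin (\<theta> / 2))\<bar> + \<bar>K 4\<bar>) * (M * M))"
    proof (intro set_integrable_mult_left set_integral_add(1) set_integrable_abs K_sine_integrable)
      show "set_integrable lborel {0<..<2*pi} (\<lambda>\<theta>. K 4)" unfolding set_integrable_def by simp
    qed auto
    show "set_borel_measurable lborel {0<..<2*pi} (\<lambda>\<theta>. K (rho \<beta> \<theta>) * bint \<beta> \<theta>)"
    proof (intro set_borel_measurable_open_cont continuous_intros continuous_on_compose2[OF continuous_on_kd[of 0, unfolded kd_0]])
      show "continuous_on {0<..<2 * pi} (rho \<beta>)" "continuous_on {0<..<2 * pi} (bint \<beta>)"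
        using cont_shift continuous_on_subset by blast+
      show "rho \<beta> ` {0<..<2 * pi} \<subseteq> {0<..}" using rho_lower sin_half_pos by (force intro: less_le_trans)
    qed
    show "AE \<theta> in lborel. \<theta> \<in> {0<..<2*pi} \<longrightarrow> norm (K (rho \<beta> \<theta>) * bint \<beta> \<theta>) \<le> norm ((\<bar>K (1 * sin (\<theta> / 2))\<bar> + \<bar>K 4\<bar>) * (M * M))"
    proof (intro AE_I2 impI)
      fix \<theta> :: real assume "\<theta> \<in> {0<..<2*pi}"
      hence \<theta>: "0 < \<theta>" "\<theta> < 2 * pi" by auto
      have "\<bar>K (rho \<beta> \<theta>)\<bar> \<le> \<bar>K (1 * sin (\<theta> / 2))\<bar> + \<bar>K 4\<bar>"
        using rho_lower[OF \<theta>] rho_upper sin_half_pos[OF \<theta>] by (intro abs_K_le) auto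
      hence "\<bar>K (rho \<beta> \<theta>)\<bar> * \<bar>bint \<beta> \<theta>\<bar> \<le> (\<bar>K (1 * sin (\<theta> / 2))\<bar> + \<bar>K 4\<bar>) * (M * M)"
        using B by (intro mult_mono) auto
      thus "norm (K (rho \<beta> \<theta>) * bint \<beta> \<theta>) \<le> norm ((\<bar>K (1 * sin (\<theta> / 2))\<bar> + \<bar>K 4\<bar>) * (M * M))"
        using M by (simp add: abs_mult)
    qed
  qed
qed

text \<open>The integrated regularization error at the comparison distance
  \<open>sin (\<theta> / 2)\<close>. It does not depend on the boundary point, and this yields
  uniformity in \<beta>.\<close>

definition edelta :: "real \<Rightarrow> real" where
  "edelta \<epsilon> = (LINT \<theta>:{0<..<2*pi}|lborel. K (sin (\<theta> / 2)) - keps \<epsilon> ((sin (\<theta> / 2))\<^sup>2))"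

text \<open>The regularized distance lies between \<rho> and the square root of 17, hence below 5,
  and the kernel is decreasing.\<close>

lemma keps_abs_le:
  assumes "0 < \<epsilon>" "\<epsilon> \<le> 1" "0 < \<rho>" "\<rho> \<le> 4"
  shows "\<bar>keps \<epsilon> (\<rho>\<^sup>2)\<bar> \<le> \<bar>K \<rho>\<bar> + \<bar>K 5\<bar>"
  unfolding keps_def
proof (rule abs_K_le)
  show "\<rho> \<le> sqrt (\<rho>\<^sup>2 + \<epsilon>)" using assms by (intro real_le_rsqrt) auto
  have "\<rho>\<^sup>2 \<le> 4\<^sup>2" using assms by (intro power_mono) auto
  thus "sqrt (\<rho>\<^sup>2 + \<epsilon>) \<le> 5" using assms by (intro real_le_lsqrt) auto
qed (use assms in auto)

lemma keps_sine_integrable: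
  assumes e: "0 < \<epsilon>" "\<epsilon> \<le> 1"
  shows "set_integrable lborel {0<..<2*pi} (\<lambda>\<theta>. keps \<epsilon> ((sin (\<theta> / 2))\<^sup>2))"
proof -
  have "set_integrable lborel {0..2*pi} (\<lambda>\<theta>. keps \<epsilon> ((sin (\<theta> / 2))\<^sup>2))"
    by (intro borel_integrable_atLeastAtMost' continuous_on_compose2[OF keps_cont[OF e(1)]] continuous_intros) auto
  thus ?thesis by (rule set_integrable_subset) auto
qed

lemma keps_tendsto:
  assumes "\<rho> > 0"
  shows "(\<lambda>n. keps (1 / real (Suc n)) (\<rho>\<^sup>2)) \<longlonglongrightarrow> K \<rho>"
proof -
  have "(\<lambda>n. sqrt (\<rho>\<^sup>2 + 1 / real (Suc n))) \<longlonglongrightarrow> sqrt (\<rho>\<^sup>2 + 0)"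
    using LIMSEQ_inverse_real_of_nat by (intro tendsto_intros) (simp add: inverse_eq_divide)
  hence "(\<lambda>n. sqrt (\<rho>\<^sup>2 + 1 / real (Suc n))) \<longlonglongrightarrow> \<rho>" using assms by simp
  from isCont_tendsto_compose[OF isCont_kd[OF assms, of 0] this] show ?thesis
    by (simp add: keps_def)
qed

lemma edelta_tendsto: "(\<lambda>n. edelta (1 / real (Suc n))) \<longlonglongrightarrow> 0"
proof -
  have "(\<lambda>n. LINT \<theta>:{0<..<2*pi}|lborel. K (sin (\<theta> / 2)) - keps (1 / real (Suc n)) ((sin (\<theta> / 2))\<^sup>2)) \<longlonglongrightarrow> (LINT \<theta>:{0<..<2*pi}|lborel. 0)"
    unfolding set_lebesgue_integral_def
  proof (rule integral_dominated_convergence[where w="\<lambda>\<theta>. indicator {0<..<2*pi} \<theta> *\<^sub>R (2 * \<bar>K (1 * sin (\<theta> / 2))\<bar> + \<bar>K 5\<bar>)"])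
    have "set_integrable lborel {0<..<2*pi} (\<lambda>\<theta>. 2 * \<bar>K (1 * sin (\<theta> / 2))\<bar> + \<bar>K 5\<bar>)"
    proof (intro set_integrable_mult_right set_integral_add(1) set_integrable_abs K_sine_integrable)
      show "set_integrable lborel {0<..<2*pi} (\<lambda>\<theta>. K 5)" unfolding set_integrable_def by simp
    qed auto
    thus "integrable lborel (\<lambda>\<theta>. indicator {0<..<2*pi} \<theta> *\<^sub>R (2 * \<bar>K (1 * sin (\<theta> / 2))\<bar> + \<bar>K 5\<bar>))"
      by (simp add: set_integrable_def)
    show "(\<lambda>\<theta>. indicator {0<..<2*pi} \<theta> *\<^sub>R (K (sin (\<theta> / 2)) - keps (1 / real (Suc n)) ((sin (\<theta> / 2))\<^sup>2))) \<in> borel_measurable lborel" for n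
      using set_integral_diff(1)[OF K_sine_integrable[of 1] keps_sine_integrable[of "1 / real (Suc n)"]]
      by (auto simp: set_integrable_def)
    show "AE \<theta> in lborel. norm (indicator {0<..<2*pi} \<theta> *\<^sub>R (K (sin (\<theta> / 2)) - keps (1 / real (Suc n)) ((sin (\<theta> / 2))\<^sup>2)))
        \<le> indicator {0<..<2*pi} \<theta> *\<^sub>R (2 * \<bar>K (1 * sin (\<theta> / 2))\<bar> + \<bar>K 5\<bar>)" for n
    proof (rule AE_I2)
      fix \<theta> :: real
      show "norm (indicator {0<..<2*pi} \<theta> *\<^sub>R (K (sin (\<theta> / 2)) - keps (1 / real (Suc n)) ((sin (\<theta> / 2))\<^sup>2)))
        \<le> indicator {0<..<2*pi} \<theta> *\<^sub>R (2 * \<bar>K (1 * sin (\<theta> / 2))\<bar> + \<bar>K 5\<bar>)"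
      proof (cases "\<theta> \<in> {0<..<2*pi}")
        case True
        hence s: "0 < sin (\<theta> / 2)" by (simp add: sin_half_pos)
        have "sin (\<theta> / 2) \<le> 4" using sin_le_one[of "\<theta> / 2"] by linarith
        from keps_abs_le[OF _ _ s this, of "1 / real (Suc n)"] True show ?thesis by simp
      qed simp
    qed
    show "AE \<theta> in lborel. (\<lambda>n. indicator {0<..<2*pi} \<theta> *\<^sub>R (K (sin (\<theta> / 2)) - keps (1 / real (Suc n)) ((sin (\<theta> / 2))\<^sup>2))) \<longlonglongrightarrow> indicator {0<..<2*pi} \<theta> *\<^sub>R 0"
    proof (rule AE_I2)
      fix \<theta> :: real
      show "(\<lambda>n. indicator {0<..<2*pi} \<theta> *\<^sub>R (K (sin (\<theta> / 2)) - keps (1 / real (Suc n)) ((sin (\<theta> / 2))\<^sup>2))) \<longlonglongrightarrow> indicator {0<..<2*pi} \<theta> *\<^sub>R 0"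
      proof (cases "\<theta> \<in> {0<..<2*pi}")
        case True
        hence s: "0 < sin (\<theta> / 2)" by (simp add: sin_half_pos)
        have "(\<lambda>n. K (sin (\<theta> / 2)) - keps (1 / real (Suc n)) ((sin (\<theta> / 2))\<^sup>2)) \<longlonglongrightarrow> K (sin (\<theta> / 2)) - K (sin (\<theta> / 2))"
          by (intro tendsto_intros keps_tendsto s)
        thus ?thesis using True by simp
      qed simp
    qed
  qed simp
  thus ?thesis by (simp add: edelta_def)
qed

lemma Veps_tendsto:
  "(\<lambda>n. Veps (1 / real (Suc n)) \<beta>) \<longlonglongrightarrow> (LINT y:D|lborel. K (norm (\<Phi> (cis \<beta>) - y)))"
proof -
  have pos: "norm (\<Phi> (cis \<beta>) - y) > 0" "norm (\<Phi> (cis \<beta>) - y) \<le> 4" if "y \<in> D" for y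
  proof -
    show "norm (\<Phi> (cis \<beta>) - y) > 0" using boundary_not_in_D[of \<beta>] that by auto
    obtain z where z: "norm z < 1" "y = \<Phi> z" using \<open>y \<in> D\<close> by (auto simp: D_def)
    have "norm (\<Phi> (cis \<beta>) - y) \<le> 2 * norm (cis \<beta> - z)" unfolding z(2) using z by (intro up) auto
    also have "\<dots> \<le> 4" using norm_triangle_ineq4[of "cis \<beta>" z] z by simp
    finally show "norm (\<Phi> (cis \<beta>) - y) \<le> 4" .
  qed
  have "(\<lambda>n. LINT y:D|lborel. keps (1 / real (Suc n)) ((norm (\<Phi> (cis \<beta>) - y))\<^sup>2)) \<longlonglongrightarrow> (LINT y:D|lborel. K (norm (\<Phi> (cis \<beta>) - y)))"
    unfolding set_lebesgue_integral_def
  proof (rule integral_dominated_convergence[where w="\<lambda>y. indicator D y *\<^sub>R (\<bar>K (norm (\<Phi> (cis \<beta>) - y))\<bar> + \<bar>K 5\<bar>)"])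
    have "emeasure lborel D < \<infinity>" by (rule emeasure_bounded_finite[OF bounded_D])
    hence "set_integrable lborel D (\<lambda>_. K 5)"
      using open_D by (simp add: set_integrable_def)
    hence "set_integrable lborel D (\<lambda>y. \<bar>K (norm (\<Phi> (cis \<beta>) - y))\<bar> + \<bar>K 5\<bar>)"
      by (intro set_integral_add(1) set_integrable_abs potential_integrable)
    thus "integrable lborel (\<lambda>y. indicator D y *\<^sub>R (\<bar>K (norm (\<Phi> (cis \<beta>) - y))\<bar> + \<bar>K 5\<bar>))"
      by (simp add: set_integrable_def)
    show "(\<lambda>y. indicator D y *\<^sub>R K (norm (\<Phi> (cis \<beta>) - y))) \<in> borel_measurable lborel"
      using potential_integrable[of \<beta>] by (auto simp: set_integrable_def)
    show "(\<lambda>y. indicator D y *\<^sub>R keps (1 / real (Suc n)) ((norm (\<Phi> (cis \<beta>) - y))\<^sup>2)) \<in> borel_measurable lborel" for n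
      using Veps_eq(2)[of "1 / real (Suc n)" \<beta>] by (auto simp: set_integrable_def)
    show "AE y in lborel. norm (indicator D y *\<^sub>R keps (1 / real (Suc n)) ((norm (\<Phi> (cis \<beta>) - y))\<^sup>2))
        \<le> indicator D y *\<^sub>R (\<bar>K (norm (\<Phi> (cis \<beta>) - y))\<bar> + \<bar>K 5\<bar>)" for n
    proof (rule AE_I2)
      fix y
      show "norm (indicator D y *\<^sub>R keps (1 / real (Suc n)) ((norm (\<Phi> (cis \<beta>) - y))\<^sup>2))
        \<le> indicator D y *\<^sub>R (\<bar>K (norm (\<Phi> (cis \<beta>) - y))\<bar> + \<bar>K 5\<bar>)"
        using keps_abs_le[of "1 / real (Suc n)" "norm (\<Phi> (cis \<beta>) - y)"] pos[of y] by (cases "y \<in> D") auto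
    qed
    show "AE y in lborel. (\<lambda>n. indicator D y *\<^sub>R keps (1 / real (Suc n)) ((norm (\<Phi> (cis \<beta>) - y))\<^sup>2))
        \<longlonglongrightarrow> indicator D y *\<^sub>R K (norm (\<Phi> (cis \<beta>) - y))"
    proof (rule AE_I2)
      fix y
      show "(\<lambda>n. indicator D y *\<^sub>R keps (1 / real (Suc n)) ((norm (\<Phi> (cis \<beta>) - y))\<^sup>2))
        \<longlonglongrightarrow> indicator D y *\<^sub>R K (norm (\<Phi> (cis \<beta>) - y))"
        using keps_tendsto[OF pos(1), of y] by (cases "y \<in> D") auto
    qed
  qed
  thus ?thesis by (simp add: Veps_eq(1))
qed

text \<open>The singular potential itself is never differentiated. The derivative of the regularized
  relative potential is the singular minus the regularized boundary integral, which tends to 0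
  uniformly in \<beta>; hence the limit has Lipschitz constant 0.\<close>

theorem potential_constant:
  assumes eq: "\<And>\<beta>. (LINT \<theta>:{0<..<2*pi}|lborel. K (rho \<beta> \<theta>) * bint \<beta> \<theta>) + \<Omega> * Im (cnj (\<Phi> (cis \<beta>)) * cis \<beta> * \<Phi>' (cis \<beta>)) = 0"
  shows "\<exists>\<mu>. \<forall>\<beta>. (LINT y:D|lborel. K (norm (\<Phi> (cis \<beta>) - y))) + \<Omega> / 2 * (norm (\<Phi> (cis \<beta>)))\<^sup>2 = \<mu>"
proof -
  obtain B where B: "B \<ge> 0" "\<And>\<beta> \<theta>. \<bar>bint \<beta> \<theta>\<bar> \<le> B" using bint_bound by blast
  define H where "H \<epsilon> \<beta> = Veps \<epsilon> \<beta> + \<Omega> / 2 * (norm (Y 1 \<beta>))\<^sup>2" for \<epsilon> \<beta>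
  define H' where "H' \<epsilon> \<beta> = (LINT \<theta>:{0<..<2*pi}|lborel. K (rho \<beta> \<theta>) * bint \<beta> \<theta>) - integral {0..2*pi} (\<lambda>\<theta>. keps \<epsilon> ((rho \<beta> \<theta>)\<^sup>2) * bint \<beta> \<theta>)" for \<epsilon> \<beta>
  have dH: "(H \<epsilon> has_real_derivative H' \<epsilon> \<beta>) (at \<beta>)" if e: "\<epsilon> > 0" for \<epsilon> \<beta>
  proof -
    have "((Y 1) has_vector_derivative Yt 1 \<beta>) (at \<beta>)" using Y_deriv_t[of 1 \<beta> UNIV] by simp
    hence 1: "((\<lambda>\<beta>. Re (Y 1 \<beta>)) has_real_derivative Re (Yt 1 \<beta>)) (at \<beta>)"
      "((\<lambda>\<beta>. Im (Y 1 \<beta>)) has_real_derivative Im (Yt 1 \<beta>)) (at \<beta>)"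
      using bounded_linear.has_vector_derivative[OF bounded_linear_Re] bounded_linear.has_vector_derivative[OF bounded_linear_Im]
      by (auto simp: has_real_derivative_iff_has_vector_derivative)
    have "((\<lambda>\<beta>. (norm (Y 1 \<beta>))\<^sup>2) has_real_derivative 2 * (Y 1 \<beta> \<bullet> Yt 1 \<beta>)) (at \<beta>)"
      unfolding cmod_power2 by (rule derivative_eq_intros 1 refl)+ (simp add: inner_complex_def algebra_simps)
    hence 2: "((\<lambda>\<beta>. \<Omega> / 2 * (norm (Y 1 \<beta>))\<^sup>2) has_real_derivative \<Omega> / 2 * (2 * (Y 1 \<beta> \<bullet> Yt 1 \<beta>))) (at \<beta>)"
      by (rule DERIV_cmult)
    define c where "c = Im (cnj (\<Phi> (cis \<beta>)) * cis \<beta> * \<Phi>' (cis \<beta>))"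
    have "Y 1 \<beta> \<bullet> Yt 1 \<beta> = - Im (cnj (\<Phi> (cis \<beta>)) * cis \<beta> * \<Phi>' (cis \<beta>))"
      by (simp add: Y_def Yt_def inner_complex_def algebra_simps)
    \<comment> \<open>The boundary equation turns the derivative of the rotation term into the
      singular boundary integral, so the total derivative is a pure regularization error.\<close>
    hence 3: "\<Omega> / 2 * (2 * (Y 1 \<beta> \<bullet> Yt 1 \<beta>)) = (LINT \<theta>:{0<..<2*pi}|lborel. K (rho \<beta> \<theta>) * bint \<beta> \<theta>)"
      using eq[of \<beta>] unfolding c_def[symmetric] by simp
    show ?thesis unfolding H_def H'_def using DERIV_add[OF Veps_deriv[OF e, of \<beta>] 2] unfolding 3 by (simp add: add.commute)
  qed
  have H'_bound: "\<bar>H' \<epsilon> \<beta>\<bar> \<le> B * edelta \<epsilon>" if e: "0 < \<epsilon>" "\<epsilon> \<le> 1" for \<epsilon> \<beta>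
  proof -
    have k: "set_integrable lborel {0..2*pi} (\<lambda>\<theta>. keps \<epsilon> ((rho \<beta> \<theta>)\<^sup>2) * bint \<beta> \<theta>)"
      by (intro borel_integrable_atLeastAtMost' continuous_on_compose2[OF keps_cont[OF e(1)]] continuous_intros
          continuous_on_subset[OF cont_shift(1)] continuous_on_subset[OF cont_shift(2)]) auto
    hence k2: "set_integrable lborel {0<..<2*pi} (\<lambda>\<theta>. keps \<epsilon> ((rho \<beta> \<theta>)\<^sup>2) * bint \<beta> \<theta>)"
      by (rule set_integrable_subset) auto
    have "integral {0..2*pi} (\<lambda>\<theta>. keps \<epsilon> ((rho \<beta> \<theta>)\<^sup>2) * bint \<beta> \<theta>) = integral {0<..<2*pi} (\<lambda>\<theta>. keps \<epsilon> ((rho \<beta> \<theta>)\<^sup>2) * bint \<beta> \<theta>)"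
      by (simp add: integral_open_interval_real)
    also have "\<dots> = (LINT \<theta>:{0<..<2*pi}|lborel. keps \<epsilon> ((rho \<beta> \<theta>)\<^sup>2) * bint \<beta> \<theta>)"
      by (rule set_borel_integral_eq_integral(2)[OF k2, symmetric])
    finally have "H' \<epsilon> \<beta> = (LINT \<theta>:{0<..<2*pi}|lborel. K (rho \<beta> \<theta>) * bint \<beta> \<theta> - keps \<epsilon> ((rho \<beta> \<theta>)\<^sup>2) * bint \<beta> \<theta>)"
      unfolding H'_def using set_integral_diff(2)[OF kernel_rho_integrable k2] by simp
    hence "\<bar>H' \<epsilon> \<beta>\<bar> \<le> (LINT \<theta>:{0<..<2*pi}|lborel. norm (K (rho \<beta> \<theta>) * bint \<beta> \<theta> - keps \<epsilon> ((rho \<beta> \<theta>)\<^sup>2) * bint \<beta> \<theta>))"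
      using set_integral_norm_bound[OF set_integral_diff(1)[OF kernel_rho_integrable k2]] by simp
    \<comment> \<open>Boundary distances are at least \<open>sin (\<theta> / 2)\<close>, and the
      error decreases with the distance; so one comparison serves every \<beta>.\<close>
    also have "\<dots> \<le> (LINT \<theta>:{0<..<2*pi}|lborel. B * (K (1 * sin (\<theta> / 2)) - keps \<epsilon> ((sin (\<theta> / 2))\<^sup>2)))"
    proof (rule set_integral_mono)
      show "set_integrable lborel {0<..<2*pi} (\<lambda>\<theta>. norm (K (rho \<beta> \<theta>) * bint \<beta> \<theta> - keps \<epsilon> ((rho \<beta> \<theta>)\<^sup>2) * bint \<beta> \<theta>))"
        by (rule set_integrable_norm[OF set_integral_diff(1)[OF kernel_rho_integrable k2]])
      show "set_integrable lborel {0<..<2*pi} (\<lambda>\<theta>. B * (K (1 * sin (\<theta> / 2)) - keps \<epsilon> ((sin (\<theta> / 2))\<^sup>2)))"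
        by (intro set_integrable_mult_right set_integral_diff(1) K_sine_integrable keps_sine_integrable e) simp
      fix \<theta> :: real assume "\<theta> \<in> {0<..<2*pi}"
      hence \<theta>: "0 < \<theta>" "\<theta> < 2 * pi" by auto
      have s: "0 < sin (\<theta> / 2)" by (rule sin_half_pos[OF \<theta>])
      have r: "sin (\<theta> / 2) \<le> rho \<beta> \<theta>" by (rule rho_lower[OF \<theta>])
      have "norm (K (rho \<beta> \<theta>) * bint \<beta> \<theta> - keps \<epsilon> ((rho \<beta> \<theta>)\<^sup>2) * bint \<beta> \<theta>) = (K (rho \<beta> \<theta>) - keps \<epsilon> ((rho \<beta> \<theta>)\<^sup>2)) * \<bar>bint \<beta> \<theta>\<bar>"
        using keps_le[OF e(1), of "rho \<beta> \<theta>"] r s by (simp add: abs_mult flip: left_diff_distrib)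
      also have "\<dots> \<le> (K (sin (\<theta> / 2)) - keps \<epsilon> ((sin (\<theta> / 2))\<^sup>2)) * B"
        using keps_diff_antimono[OF e(1) s r] B keps_le[OF e(1) s] by (intro mult_mono) auto
      finally show "norm (K (rho \<beta> \<theta>) * bint \<beta> \<theta> - keps \<epsilon> ((rho \<beta> \<theta>)\<^sup>2) * bint \<beta> \<theta>) \<le> B * (K (1 * sin (\<theta> / 2)) - keps \<epsilon> ((sin (\<theta> / 2))\<^sup>2))"
        by (simp add: mult.commute)
    qed
    also have "\<dots> = B * edelta \<epsilon>" by (simp add: edelta_def)
    finally show ?thesis .
  qed
  define L where "L \<beta> = (LINT y:D|lborel. K (norm (\<Phi> (cis \<beta>) - y))) + \<Omega> / 2 * (norm (Y 1 \<beta>))\<^sup>2" for \<beta>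
  have "L \<beta> = L 0" for \<beta>
  proof -
    have "norm (H (1 / real (Suc n)) \<beta> - H (1 / real (Suc n)) 0) \<le> B * edelta (1 / real (Suc n)) * norm (\<beta> - 0)" for n
      by (rule field_differentiable_bound[of UNIV _ "H' (1 / real (Suc n))"])
        (use dH[of "1 / real (Suc n)"] H'_bound[of "1 / real (Suc n)"] in auto)
    hence le: "norm (H (1 / real (Suc n)) \<beta> - H (1 / real (Suc n)) 0) \<le> B * edelta (1 / real (Suc n)) * \<bar>\<beta>\<bar>" for n by simp
    have l1: "(\<lambda>n. norm (H (1 / real (Suc n)) \<beta> - H (1 / real (Suc n)) 0)) \<longlonglongrightarrow> norm (L \<beta> - L 0)"
      unfolding H_def L_def by (intro tendsto_intros Veps_tendsto)
    have l2: "(\<lambda>n. B * edelta (1 / real (Suc n)) * \<bar>\<beta>\<bar>) \<longlonglongrightarrow> B * 0 * \<bar>\<beta>\<bar>"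
      by (intro tendsto_intros edelta_tendsto)
    have "norm (L \<beta> - L 0) \<le> B * 0 * \<bar>\<beta>\<bar>"
      by (rule LIMSEQ_le[OF l1 l2]) (use le in auto)
    thus ?thesis by simp
  qed
  thus ?thesis by (intro exI[of _ "L 0"]) (auto simp: L_def Y_def)
qed

end

section \<open>Bifurcating patches\<close>

lemma C1_holder_norm_cong:
  assumes "\<And>w. w \<in> sphere 0 1 \<Longrightarrow> f w = g w"
  shows "C1_holder_norm \<alpha> f = C1_holder_norm \<alpha> g"
proof -
  have d: "circle_deriv f w = circle_deriv g w" if "w \<in> sphere 0 1" for w
  proof -
    have "(\<lambda>t. f (w * cis t)) = (\<lambda>t. g (w * cis t))"
      using assms that by (auto simp: norm_mult)
    thus ?thesis by (simp add: circle_deriv_def)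
  qed
  have "(SUP w\<in>sphere 0 1. norm (f w)) = (SUP w\<in>sphere 0 1. norm (g w))"
    "(SUP w\<in>sphere 0 1. norm (circle_deriv f w)) = (SUP w\<in>sphere 0 1. norm (circle_deriv g w))"
    "(SUP (z, w)\<in>{(z, w). z \<in> sphere 0 1 \<and> w \<in> sphere 0 1 \<and> z \<noteq> w}.
        norm (circle_deriv f z - circle_deriv f w) / norm (z - w) powr \<alpha>)
     = (SUP (z, w)\<in>{(z, w). z \<in> sphere 0 1 \<and> w \<in> sphere 0 1 \<and> z \<noteq> w}.
        norm (circle_deriv g z - circle_deriv g w) / norm (z - w) powr \<alpha>)"
    by (rule SUP_cong; use assms d in auto)+
  thus ?thesis by (simp add: C1_holder_norm_def)
qed

lemma C1_holder_norm_bound: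
  assumes "\<And>w. w \<in> sphere 0 1 \<Longrightarrow> norm (f w) \<le> A" "\<And>w. w \<in> sphere 0 1 \<Longrightarrow> norm (circle_deriv f w) \<le> B"
    "\<And>z w. z \<in> sphere 0 1 \<Longrightarrow> w \<in> sphere 0 1 \<Longrightarrow> norm (circle_deriv f z - circle_deriv f w) \<le> C * norm (z - w) powr \<alpha>"
  shows "0 \<le> C1_holder_norm \<alpha> f" "C1_holder_norm \<alpha> f \<le> A + B + C"
proof -
  let ?P = "{(z, w). z \<in> sphere 0 1 \<and> w \<in> sphere 0 1 \<and> z \<noteq> w} :: (complex \<times> complex) set"
  let ?q = "\<lambda>(z, w). norm (circle_deriv f z - circle_deriv f w) / norm (z - w) powr \<alpha>"
  have 1: "(1::complex) \<in> sphere 0 1" and p: "(1, -1) \<in> ?P" by auto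
  have q: "?q x \<le> C" if "x \<in> ?P" for x
    using that assms(3) by (auto simp: divide_le_eq)
  have q0: "0 \<le> ?q x" for x by (cases x) auto
  have u: "(SUP w\<in>sphere 0 1. norm (f w)) \<le> A" "(SUP w\<in>sphere 0 1. norm (circle_deriv f w)) \<le> B"
    by (rule cSUP_least; use 1 assms in blast)+
  have u3: "(SUP x\<in>?P. ?q x) \<le> C"
    by (rule cSUP_least[OF _ q]) (use p in blast)
  have l1: "0 \<le> (SUP w\<in>sphere 0 1. norm (f w))"
    by (rule cSUP_upper2[OF _ 1]) (use assms in \<open>auto intro!: bdd_aboveI2\<close>)
  have l2: "0 \<le> (SUP w\<in>sphere 0 1. norm (circle_deriv f w))"
    by (rule cSUP_upper2[OF _ 1]) (use assms in \<open>auto intro!: bdd_aboveI2\<close>)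
  have l3: "0 \<le> (SUP x\<in>?P. ?q x)"
    by (rule cSUP_upper2[OF _ p q0]) (use q in \<open>auto intro!: bdd_aboveI2\<close>)
  show "0 \<le> C1_holder_norm \<alpha> f" "C1_holder_norm \<alpha> f \<le> A + B + C"
    unfolding C1_holder_norm_def using u u3 l1 l2 l3 by linarith+
qed

text \<open>Chords are at most 2, so the missing power 1 - \<alpha> costs at most a factor 2. This
  converts Lipschitz bounds into Hoelder bounds.\<close>

lemma le_2_powr:
  fixes t \<alpha> :: real
  assumes "0 \<le> t" "t \<le> 2" "0 < \<alpha>" "\<alpha> < 1"
  shows "t \<le> 2 * t powr \<alpha>"
proof (cases "t = 0")
  case False
  have "t = t powr (1 - \<alpha>) * t powr \<alpha>" using assms False by (simp flip: powr_add)
  also have "\<dots> \<le> 2 powr 1 * t powr \<alpha>"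
  proof (rule mult_right_mono)
    have "t powr (1 - \<alpha>) \<le> 2 powr (1 - \<alpha>)" using assms by (intro powr_mono2) auto
    also have "\<dots> \<le> 2 powr 1" using assms by (intro powr_mono) auto
    finally show "t powr (1 - \<alpha>) \<le> 2 powr 1" .
  qed simp
  finally show ?thesis by simp
qed simp

text \<open>The circle lies in the closed disk, so a complex derivative relative to the disk already
  determines the angular one.\<close>

lemma circle_deriv_field:
  assumes "(f has_field_derivative f') (at w within cball 0 1)" "w \<in> sphere 0 1"
  shows "((\<lambda>t. f (w * cis t)) has_vector_derivative \<i> * w * f') (at 0)"
proof -
  have "((\<lambda>t. w * cis t) has_vector_derivative w * \<i>) (at 0 within UNIV)"
    unfolding has_vector_derivative_def
    by (auto intro!: derivative_eq_intros has_derivative_cis simp: scaleR_conv_of_real algebra_simps)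
  moreover have "(f has_field_derivative f') (at (w * cis 0) within (\<lambda>t. w * cis t) ` UNIV)"
    by (rule DERIV_subset[of _ _ _ "cball 0 1"]) (use assms in \<open>auto simp: norm_mult\<close>)
  ultimately have "(f \<circ> (\<lambda>t. w * cis t) has_vector_derivative w * \<i> * f') (at 0 within UNIV)"
    by (rule field_vector_diff_chain_within)
  thus ?thesis by (simp add: o_def mult_ac)
qed

section \<open>Regularity of the power series up to the circle\<close>

context fold_kernel
begin

text \<open>The series of f''. Its terms are of size k times the coefficient of f', which the weight
  makes summable; this gives continuity up to the circle.\<close>

definition hser :: "wiener \<Rightarrow> complex \<Rightarrow> complex" where
  "hser y z = (\<Sum>k. of_real (pc y k) * (of_nat (k * m) * z ^ (k * m - 1)))"

lemma km_le: "real (k * m + 1) \<le> real m * (1 + real k)"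
  using m by (simp add: algebra_simps)

lemma pc_abs_summable: "Piop y = y \<Longrightarrow> summable (\<lambda>k. \<bar>pc y k\<bar>)"
  by (rule summable_comparison_test'[OF pc_summable, where N=0]) (auto simp: algebra_simps)

lemma pc_abs_suminf_le: "Piop y = y \<Longrightarrow> (\<Sum>k. \<bar>pc y k\<bar>) \<le> norm y"
proof -
  assume y: "Piop y = y"
  have "(\<Sum>k. \<bar>pc y k\<bar>) \<le> (\<Sum>k. (1 + real k) * \<bar>pc y k\<bar>)"
    by (rule suminf_le[OF _ pc_abs_summable[OF y] pc_summable[OF y]]) (simp add: algebra_simps)
  also have "\<dots> = norm y" by (rule sums_unique[OF pc_norm_sums[OF y], symmetric])
  finally show ?thesis .
qed

lemma norm_pow_le: "norm z \<le> 1 \<Longrightarrow> norm (of_real c * z ^ n :: complex) \<le> \<bar>c\<bar>"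
  by (simp add: norm_mult norm_power mult_left_le power_le_one)

text \<open>The majorant holds on the closed disk, so termwise differentiation remains valid at
  boundary points, with the derivative relative to the disk.\<close>

lemma series_derivative:
  fixes c d :: "nat \<Rightarrow> complex \<Rightarrow> complex"
  assumes der: "\<And>k z. z \<in> cball 0 1 \<Longrightarrow> (c k has_field_derivative d k z) (at z)"
    and bd: "\<And>k z. z \<in> cball 0 1 \<Longrightarrow> norm (d k z) \<le> M k" "summable M"
    and F: "\<And>z. z \<in> cball 0 1 \<Longrightarrow> (\<lambda>k. c k z) sums F z" and z: "z \<in> cball 0 1"
  shows "(F has_field_derivative (\<Sum>k. d k z)) (at z within cball 0 1)"
proof -
  have "\<exists>g. \<forall>x\<in>cball 0 1. (\<lambda>n. c n x) sums g x \<and> (g has_field_derivative (\<Sum>k. d k x)) (at x within cball 0 1)"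
  proof (rule has_field_derivative_series)
    show "(c n has_field_derivative d n x) (at x within cball 0 1)" if "x \<in> cball 0 1" for n x
      using der[OF that] by (rule has_field_derivative_at_within)
    show "uniform_limit (cball 0 1) (\<lambda>n x. \<Sum>i<n. d i x) (\<lambda>x. \<Sum>k. d k x) sequentially"
      by (rule Weierstrass_m_test[OF bd])
    show "0 \<in> cball (0::complex) 1" by simp
    show "summable (\<lambda>n. c n 0)" using F[of 0] by (simp add: sums_iff)
  qed simp
  then obtain g where g: "\<And>x. x \<in> cball 0 1 \<Longrightarrow> (\<lambda>n. c n x) sums g x"
    "\<And>x. x \<in> cball 0 1 \<Longrightarrow> (g has_field_derivative (\<Sum>k. d k x)) (at x within cball 0 1)" by blast
  have "F x = g x" if "x \<in> cball 0 1" for x using F[OF that] g(1)[OF that] by (rule sums_unique2)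
  thus ?thesis using g(2)[OF z] z unfolding has_field_derivative_def
    by (intro has_derivative_transform[of z "cball 0 1" F g]) auto
qed

lemma DERIV_complex_pow: "((\<lambda>z::complex. z ^ n) has_field_derivative of_nat n * z ^ (n - 1)) (at z)"
  using DERIV_power[OF DERIV_ident, of n z UNIV] by (simp add: mult.commute)

lemma fser_deriv:
  assumes y: "Piop y = y" and z: "z \<in> cball 0 1"
  shows "(fser y has_field_derivative gser y z) (at z within cball 0 1)"
  unfolding gser_def
proof (rule series_derivative[where c="\<lambda>k z. of_real (pc y k / real (k * m + 1)) * z ^ (k * m + 1)", OF _ _ pc_abs_summable[OF y] _ z])
  fix k and z :: complex assume z: "z \<in> cball 0 1"
  have "((\<lambda>z. of_real (pc y k / real (k * m + 1)) * z ^ (k * m + 1)) has_field_derivative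
      of_real (pc y k / real (k * m + 1)) * (of_nat (k * m + 1) * z ^ (k * m))) (at z)"
    using DERIV_cmult[OF DERIV_complex_pow[of "k * m + 1" z], of "of_real (pc y k / real (k * m + 1))"] by (simp only: add_diff_cancel_right')
  also have "of_real (pc y k / real (k * m + 1)) * (of_nat (k * m + 1) * z ^ (k * m)) = of_real (pc y k) * z ^ (k * m)"
  proof -
    have "of_real (pc y k / real (k * m + 1)) * (of_nat (k * m + 1) :: complex) = of_real (pc y k / real (k * m + 1) * real (k * m + 1))"
      by (simp only: of_real_mult of_real_of_nat_eq)
    also have "pc y k / real (k * m + 1) * real (k * m + 1) = pc y k" by (rule nonzero_eq_divide_eq[THEN iffD1, OF _ refl]) (use of_nat_neq_0[of "k * m"] in \<open>simp only: Suc_eq_plus1 not_False_eq_True\<close>)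
    finally show ?thesis by (simp only: mult.assoc[symmetric])
  qed
  finally show "((\<lambda>z. of_real (pc y k / real (k * m + 1)) * z ^ (k * m + 1)) has_field_derivative of_real (pc y k) * z ^ (k * m)) (at z)" .
  show "norm (of_real (pc y k) * z ^ (k * m)) \<le> \<bar>pc y k\<bar>" using z by (intro norm_pow_le) simp
  show "(\<lambda>k. of_real (pc y k / real (k * m + 1)) * z ^ (k * m + 1)) sums fser y z"
    using z by (intro fser_sums y) simp
qed

lemma hser_bound:
  assumes "z \<in> cball 0 1"
  shows "norm (of_real (pc y k) * (of_nat (k * m) * z ^ (k * m - 1)) :: complex) \<le> real m * ((1 + real k) * \<bar>pc y k\<bar>)"
proof -
  have "norm (of_real (pc y k) * (of_nat (k * m) * z ^ (k * m - 1)) :: complex) = \<bar>pc y k\<bar> * (real (k * m) * norm z ^ (k * m - 1))"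
    by (simp only: norm_mult norm_of_real norm_of_nat norm_power)
  also have "\<dots> \<le> \<bar>pc y k\<bar> * ((real m * (1 + real k)) * 1)"
    using assms km_le[of k] by (intro mult_left_mono mult_mono power_le_one) auto
  finally show ?thesis by (simp add: mult_ac)
qed

lemma gser_deriv:
  assumes y: "Piop y = y" and z: "z \<in> cball 0 1"
  shows "(gser y has_field_derivative hser y z) (at z within cball 0 1)"
  unfolding hser_def
proof (rule series_derivative[where c="\<lambda>k z. of_real (pc y k) * z ^ (k * m)", OF _ hser_bound summable_mult[OF pc_summable[OF y]] _ z])
  fix k and z :: complex assume z: "z \<in> cball 0 1"
  show "((\<lambda>z. of_real (pc y k) * z ^ (k * m)) has_field_derivative of_real (pc y k) * (of_nat (k * m) * z ^ (k * m - 1))) (at z)"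
    by (rule DERIV_cmult[OF DERIV_complex_pow])
  show "(\<lambda>k. of_real (pc y k) * z ^ (k * m)) sums gser y z"
    using z by (intro gser_sums y) simp
qed

lemma hser_cont:
  assumes y: "Piop y = y"
  shows "continuous_on (cball 0 1) (hser y)"
proof (rule uniform_limit_theorem)
  show "uniform_limit (cball 0 1) (\<lambda>n x. \<Sum>k<n. of_real (pc y k) * (of_nat (k * m) * x ^ (k * m - 1))) (hser y) sequentially"
    unfolding hser_def by (rule Weierstrass_m_test[OF hser_bound summable_mult[OF pc_summable[OF y]]])
  show "\<forall>\<^sub>F n in sequentially. continuous_on (cball 0 1) (\<lambda>x::complex. \<Sum>k<n. of_real (pc y k) * (of_nat (k * m) * x ^ (k * m - 1)))"
    by (intro always_eventually allI continuous_on_sum continuous_on_mult continuous_on_const continuous_on_power continuous_on_id)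
qed simp

lemma norm_gser_le:
  assumes y: "Piop y = y" and z: "z \<in> cball 0 1"
  shows "norm (gser y z) \<le> norm y"
proof -
  have "norm (gser y z) \<le> (\<Sum>k. \<bar>pc y k\<bar>)"
    unfolding gser_def using z by (intro norm_suminf_le norm_pow_le pc_abs_summable y) simp
  thus ?thesis using pc_abs_suminf_le[OF y] by simp
qed

lemma fser_lipschitz:
  assumes y: "Piop y = y" and z: "z \<in> cball 0 1" "w \<in> cball 0 1"
  shows "norm (fser y z - fser y w) \<le> norm y * norm (z - w)"
  by (rule field_differentiable_bound[OF convex_cball fser_deriv[OF y] norm_gser_le[OF y]]) (use z in auto)

lemma fser_0: "fser y 0 = 0"
  by (simp add: fser_def)

lemma norm_fser_le:
  assumes y: "Piop y = y" and z: "z \<in> cball 0 1"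
  shows "norm (fser y z) \<le> norm y"
proof -
  have "norm (fser y z) \<le> norm y * norm z" using fser_lipschitz[OF y z, of 0] by (simp add: fser_0)
  thus ?thesis using z mult_left_mono[of "norm z" 1 "norm y"] by simp
qed

text \<open>The difference of two powers with exponent km + 1 costs the factor km + 1, which is at
  most \<open>m\<close> times the weight. Up to the factor i this is the angular derivative of f, so
  the bound gives its Hoelder regularity.\<close>

lemma zgser_lipschitz:
  assumes y: "Piop y = y" and z: "z \<in> cball 0 1" "w \<in> cball 0 1"
  shows "norm (z * gser y z - w * gser y w) \<le> real m * norm y * norm (z - w)"
proof -
  let ?t = "\<lambda>k. of_real (pc y k) * (z ^ (k * m + 1) - w ^ (k * m + 1))"
  have "(\<lambda>k. z * (of_real (pc y k) * z ^ (k * m)) - w * (of_real (pc y k) * w ^ (k * m))) sums (z * gser y z - w * gser y w)"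
    using z by (intro sums_diff sums_mult gser_sums y) auto
  hence s: "?t sums (z * gser y z - w * gser y w)" by (simp add: algebra_simps)
  have b: "norm (?t k) \<le> real m * norm (z - w) * ((1 + real k) * \<bar>pc y k\<bar>)" for k
  proof -
    have "norm (z ^ Suc (k * m) - w ^ Suc (k * m)) \<le> real (Suc (k * m)) * 1 ^ (k * m) * norm (z - w)"
      using z by (intro norm_power_diff_le) auto
    also have "\<dots> \<le> (real m * (1 + real k)) * norm (z - w)"
      using km_le[of k] by (intro mult_right_mono) auto
    finally have "\<bar>pc y k\<bar> * norm (z ^ Suc (k * m) - w ^ Suc (k * m)) \<le> \<bar>pc y k\<bar> * ((real m * (1 + real k)) * norm (z - w))"
      by (intro mult_left_mono) auto
    thus ?thesis by (simp add: norm_mult mult_ac)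
  qed
  have "norm (\<Sum>k. ?t k) \<le> (\<Sum>k. real m * norm (z - w) * ((1 + real k) * \<bar>pc y k\<bar>))"
    by (rule norm_suminf_le[OF b summable_mult[OF pc_summable[OF y]]])
  also have "\<dots> = real m * norm (z - w) * norm y"
    using pc_norm_sums[OF y] by (simp only: suminf_mult[OF pc_summable[OF y]] sums_iff)
  finally show ?thesis using s by (simp add: sums_iff mult_ac)
qed

lemma circle_deriv_fser:
  assumes y: "Piop y = y" and w: "w \<in> sphere 0 1"
  shows "((\<lambda>t. fser y (w * cis t)) has_vector_derivative \<i> * w * gser y w) (at 0)"
    and "circle_deriv (fser y) w = \<i> * w * gser y w"
proof -
  show d: "((\<lambda>t. fser y (w * cis t)) has_vector_derivative \<i> * w * gser y w) (at 0)"
    by (rule circle_deriv_field[OF fser_deriv[OF y]]) (use w in auto)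
  show "circle_deriv (fser y) w = \<i> * w * gser y w"
    unfolding circle_deriv_def by (rule vector_derivative_at[OF d])
qed

lemma norm_diff_circle_le: "z \<in> sphere 0 1 \<Longrightarrow> w \<in> sphere 0 1 \<Longrightarrow> norm (z - w :: complex) \<le> 2"
  using norm_triangle_ineq4[of z w] by simp

lemma holder_fser:
  assumes y: "Piop y = y" and z: "z \<in> sphere 0 1" "w \<in> sphere 0 1" and \<alpha>: "0 < \<alpha>" "\<alpha> < 1"
  shows "norm (circle_deriv (fser y) z - circle_deriv (fser y) w) \<le> (real m * norm y * 2) * norm (z - w) powr \<alpha>"
proof -
  have "circle_deriv (fser y) z - circle_deriv (fser y) w = \<i> * (z * gser y z - w * gser y w)"
    by (simp only: circle_deriv_fser(2)[OF y z(1)] circle_deriv_fser(2)[OF y z(2)]) (simp add: algebra_simps)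
  hence "norm (circle_deriv (fser y) z - circle_deriv (fser y) w) = norm (z * gser y z - w * gser y w)"
    by (simp add: norm_mult)
  also have "\<dots> \<le> real m * norm y * norm (z - w)" using z by (intro zgser_lipschitz y) auto
  also have "\<dots> \<le> real m * norm y * (2 * norm (z - w) powr \<alpha>)"
    using norm_diff_circle_le[OF z] \<alpha> by (intro mult_left_mono le_2_powr) auto
  finally show ?thesis by simp
qed

lemma C1_holder_circle_fser:
  assumes y: "Piop y = y" and \<alpha>: "0 < \<alpha>" "\<alpha> < 1"
  shows "C1_holder_circle \<alpha> (fser y)"
  unfolding C1_holder_circle_def holder_on_circle_def
  using circle_deriv_fser(1)[OF y] holder_fser[OF y _ _ \<alpha>] by (blast intro: differentiableI_vector)

lemma C1_holder_norm_fser: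
  assumes y: "Piop y = y" and \<alpha>: "0 < \<alpha>" "\<alpha> < 1"
  shows "0 \<le> C1_holder_norm \<alpha> (fser y)" "C1_holder_norm \<alpha> (fser y) \<le> norm y + norm y + real m * norm y * 2"
proof -
  have "norm (circle_deriv (fser y) w) \<le> norm y" if "w \<in> sphere 0 1" for w
    using norm_gser_le[OF y, of w] that by (simp add: circle_deriv_fser(2)[OF y] norm_mult)
  thus "0 \<le> C1_holder_norm \<alpha> (fser y)" "C1_holder_norm \<alpha> (fser y) \<le> norm y + norm y + real m * norm y * 2"
    using C1_holder_norm_bound[of "fser y" "norm y" "norm y" "real m * norm y * 2" \<alpha>]
      norm_fser_le[OF y] holder_fser[OF y _ _ \<alpha>] by auto
qed

lemma pc_diff: "pc (a - b) k = pc a k - pc b k"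
  by (simp add: pc_def)

lemma fser_diff:
  assumes "Piop a = a" "Piop b = b" "z \<in> cball 0 1"
  shows "fser a z - fser b z = fser (a - b) z"
proof -
  have "(\<lambda>k. of_real (pc a k / real (k * m + 1)) * z ^ (k * m + 1) - of_real (pc b k / real (k * m + 1)) * z ^ (k * m + 1)) sums (fser a z - fser b z)"
    using assms by (intro sums_diff fser_sums) auto
  moreover have "(\<lambda>k. of_real (pc (a - b) k / real (k * m + 1)) * z ^ (k * m + 1)) sums fser (a - b) z"
    using assms by (intro fser_sums) auto
  ultimately show ?thesis by (simp add: sums_iff pc_diff diff_divide_distrib left_diff_distrib)
qed

text \<open>At small positive x the terms from index 2 on are smaller than x^m by a further factor
  x; dividing by x^m and letting x tend to 0 isolates the first coefficient.\<close>

lemma gser_zero_imp: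
  assumes y: "Piop y = y" and z: "\<And>x. 0 < x \<Longrightarrow> x < 1 \<Longrightarrow> gser y (of_real x) = 0"
  shows "pc y 1 = 0"
proof -
  have b: "\<bar>pc y 1\<bar> \<le> x * norm y" if x: "0 < x" "x < 1" for x :: real
  proof -
    let ?t = "\<lambda>k. of_real (pc y k) * (of_real x :: complex) ^ (k * m)"
    have "?t sums 0" using gser_sums[OF y, of "of_real x"] z[OF x] x by simp
    hence "(\<lambda>k. ?t (k + 2)) sums (0 - (\<Sum>k<2. ?t k))" by (rule sums_split_initial_segment)
    hence s: "(\<lambda>k. ?t (k + 2)) sums (- (of_real (pc y 1) * of_real x ^ m))"
      using pc_0[OF y] by (simp add: numeral_2_eq_2)
    have le: "norm (?t (k + 2)) \<le> x ^ m * x * \<bar>pc y (k + 2)\<bar>" for k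
    proof -
      have "norm (?t (k + 2)) = \<bar>pc y (k + 2)\<bar> * x ^ ((k + 2) * m)" using x by (simp add: norm_mult norm_power)
      also have "\<dots> \<le> \<bar>pc y (k + 2)\<bar> * x ^ (m + 1)"
        using x m by (intro mult_left_mono power_decreasing) (auto simp: algebra_simps)
      finally show ?thesis by (simp add: mult_ac)
    qed
    have s2: "summable (\<lambda>k. \<bar>pc y (k + 2)\<bar>)" using pc_abs_summable[OF y] by (rule summable_ignore_initial_segment)
    have "norm (\<Sum>k. ?t (k + 2)) \<le> (\<Sum>k. x ^ m * x * \<bar>pc y (k + 2)\<bar>)"
      by (rule norm_suminf_le[OF le summable_mult[OF s2]])
    also have "\<dots> = x ^ m * x * (\<Sum>k. \<bar>pc y (k + 2)\<bar>)" by (rule suminf_mult[OF s2])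
    also have "\<dots> \<le> x ^ m * x * norm y"
    proof (rule mult_left_mono)
      have "(\<Sum>k. \<bar>pc y (k + 2)\<bar>) \<le> (\<Sum>k. \<bar>pc y k\<bar>)"
        using suminf_split_initial_segment[OF pc_abs_summable[OF y], of 2] sum_nonneg[of "{..<2::nat}" "\<lambda>k. \<bar>pc y k\<bar>"] by simp
      thus "(\<Sum>k. \<bar>pc y (k + 2)\<bar>) \<le> norm y" using pc_abs_suminf_le[OF y] by simp
    qed (use x in auto)
    finally have "\<bar>pc y 1\<bar> * x ^ m \<le> (x * norm y) * x ^ m"
      using s x by (simp add: sums_iff norm_mult norm_power mult_ac)
    thus ?thesis using x by (simp add: mult_le_cancel_right)
  qed
  have "\<bar>pc y 1\<bar> \<le> 0 * norm y"
  proof (rule tendsto_lowerbound)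
    show "((\<lambda>x. x * norm y) \<longlongrightarrow> 0 * norm y) (at_right 0)" by (intro tendsto_intros)
    have "\<forall>\<^sub>F x in at_right 0. x \<in> {0<..<1::real}" by (rule eventually_at_right_real) simp
    thus "\<forall>\<^sub>F x in at_right 0. \<bar>pc y 1\<bar> \<le> x * norm y" by eventually_elim (use b in auto)
  qed simp
  thus ?thesis by simp
qed

lemma fser_zero_imp:
  assumes y: "Piop y = y" and z: "\<And>z. z \<in> ball 0 1 \<Longrightarrow> fser y z = 0"
  shows "pc y 1 = 0"
proof (rule gser_zero_imp[OF y])
  fix x :: real assume x: "0 < x" "x < 1"
  hence xb: "complex_of_real x \<in> ball 0 1" by simp
  have "(fser y has_field_derivative gser y (of_real x)) (at (of_real x) within ball 0 1)"
    by (rule DERIV_subset[OF fser_deriv[OF y]]) (use x in auto)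
  hence 1: "(fser y has_field_derivative gser y (of_real x)) (at (of_real x))"
    using xb by (simp only: at_within_open[OF xb open_ball])
  have "((\<lambda>_. 0) has_field_derivative gser y (of_real x)) (at (of_real x) within ball 0 1)"
    using DERIV_subset[OF 1, of "ball 0 1"] xb z unfolding has_field_derivative_def
    by (intro has_derivative_transform[of "of_real x" "ball 0 1" "\<lambda>_. 0" "fser y"]) auto
  hence "((\<lambda>_. 0) has_field_derivative gser y (of_real x)) (at (of_real x))"
    by (simp only: at_within_open[OF xb open_ball])
  thus "gser y (of_real x) = 0" using DERIV_unique[OF _ DERIV_const] by blast
qed

section \<open>Patches from solutions in the algebra, and the branch\<close>

lemma patch_from_solution:
  assumes y: "Piop y = y" "norm y \<le> 1/16" and s: "norm (sqrt1m (pfun y)) \<le> 1/4"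
    and eq: "Piop (Nfun y + \<Omega> *\<^sub>R Mfun y) = 0" and \<alpha>: "0 < \<alpha>" "\<alpha> < 1"
  defines "\<Phi> \<equiv> \<lambda>w. w + fser y w"
  shows "\<Phi> holomorphic_on ball 0 1" "inj_on \<Phi> (ball 0 1)"
    "rotating_patch K \<Omega> (\<Phi> ` ball 0 1)" "m_fold_symmetric m (\<Phi> ` ball 0 1)"
    "C1_holder_boundary \<alpha> (\<Phi> ` ball 0 1)"
    "pc y 1 \<noteq> 0 \<Longrightarrow> \<Phi> ` ball 0 1 \<noteq> ball 0 1"
    "pc y 1 \<noteq> 0 \<Longrightarrow> \<exists>w\<in>sphere 0 1. fser y w \<noteq> 0"
proof -
  have d\<Phi>: "(\<Phi> has_field_derivative 1 + gser y z) (at z within cball 0 1)" if "z \<in> cball 0 1" for z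
    unfolding \<Phi>_def by (intro derivative_intros fser_deriv[OF y(1)] that)
  \<comment> \<open>The Lipschitz constant of f is at most \<open>norm y\<close>, below 1/2; hence
    the factors 1/2 and 2 in the comparison of distances.\<close>
  have fl: "norm (fser y z - fser y w) \<le> norm (z - w) / 2" if "z \<in> cball 0 1" "w \<in> cball 0 1" for z w
    using fser_lipschitz[OF y(1) that] mult_right_mono[of "norm y" "1/2" "norm (z - w)"] y(2) by simp
  interpret P: patch_map K \<Phi> "\<lambda>z. 1 + gser y z" "hser y"
  proof
    show "(\<Phi> has_field_derivative 1 + gser y z) (at z within cball 0 1)" if "z \<in> cball 0 1" for z by (rule d\<Phi>[OF that])
    show "((\<lambda>z. 1 + gser y z) has_field_derivative hser y z) (at z within cball 0 1)" if "z \<in> cball 0 1" for z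
      using DERIV_add[OF DERIV_const gser_deriv[OF y(1) that], of 1] by simp
    show "continuous_on (cball 0 1) (hser y)" by (rule hser_cont[OF y(1)])
    fix z w :: complex assume zw: "z \<in> cball 0 1" "w \<in> cball 0 1"
    have e: "\<Phi> z - \<Phi> w = (z - w) + (fser y z - fser y w)" by (simp add: \<Phi>_def)
    show "norm (z - w) / 2 \<le> norm (\<Phi> z - \<Phi> w)"
      unfolding e using fl[OF zw] norm_diff_ineq[of "z - w" "fser y z - fser y w"] by linarith
    show "norm (\<Phi> z - \<Phi> w) \<le> 2 * norm (z - w)"
      unfolding e using fl[OF zw] norm_triangle_ineq[of "z - w" "fser y z - fser y w"] norm_ge_zero[of "z - w"] by linarith
  qed
  have D: "P.D = \<Phi> ` ball 0 1" by (simp add: P.D_def)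
  show holo: "\<Phi> holomorphic_on ball 0 1" by (rule P.holo)
  show inj: "inj_on \<Phi> (ball 0 1)" by (rule P.inj_ball)
  have sphere_cis: "\<exists>\<beta>. w = cis \<beta>" if "w \<in> sphere 0 1" for w
    using that rcis_cmod_Arg[of w] by (intro exI[of _ "Arg w"]) (simp add: rcis_def)
  have "\<exists>\<mu>. \<forall>\<beta>. (LINT x:P.D|lborel. K (norm (\<Phi> (cis \<beta>) - x))) + \<Omega> / 2 * (norm (\<Phi> (cis \<beta>)))\<^sup>2 = \<mu>"
  proof (rule P.potential_constant, unfold P.rho_def P.bint_def)
    fix \<beta>
    show "(LINT \<theta>:{0<..<2*pi}|lborel. K (norm (\<Phi> (cis \<beta> * cis \<theta>) - \<Phi> (cis \<beta>))) *
        Im (cnj (1 + gser y (cis \<beta>)) * cis \<theta> * (1 + gser y (cis \<beta> * cis \<theta>)))) +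
        \<Omega> * Im (cnj (\<Phi> (cis \<beta>)) * cis \<beta> * (1 + gser y (cis \<beta>))) = 0"
      unfolding \<Phi>_def by (rule boundary_identity[OF y s eq])
  qed
  then obtain \<mu> where \<mu>: "\<And>\<beta>. (LINT x:P.D|lborel. K (norm (\<Phi> (cis \<beta>) - x))) + \<Omega> / 2 * (norm (\<Phi> (cis \<beta>)))\<^sup>2 = \<mu>" by blast
  have sc: "simply_connected P.D"
  proof -
    have "ball (0::complex) 1 homeomorphic \<Phi> ` ball 0 1"
      by (rule invariance_of_domain_homeomorphic[OF _ holomorphic_on_imp_continuous_on[OF holo] _ inj]) auto
    moreover have "simply_connected (ball (0::complex) 1)" by (intro convex_imp_simply_connected convex_ball)
    ultimately show ?thesis using homeomorphic_simply_connected_eq D by metis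
  qed
  show "rotating_patch K \<Omega> (\<Phi> ` ball 0 1)"
    unfolding rotating_patch_def D[symmetric]
  proof (intro conjI exI[of _ \<mu>] ballI)
    show "P.D \<noteq> {}" by (simp add: D)
    show "open P.D" by (rule P.open_D)
    show "bounded P.D" by (rule P.bounded_D)
    show "simply_connected P.D" by (rule sc)
    fix z assume "z \<in> frontier P.D"
    then obtain w where w: "w \<in> sphere 0 1" "z = \<Phi> w" by (auto simp: P.frontier_D)
    then obtain \<beta> where "w = cis \<beta>" using sphere_cis by blast
    with w have z: "z = \<Phi> (cis \<beta>)" by simp
    show "set_integrable lborel P.D (\<lambda>y. K (norm (z - y)))" unfolding z by (rule P.potential_integrable)
    show "(LINT y:P.D|lborel. K (norm (z - y))) + \<Omega> / 2 * (norm z)\<^sup>2 = \<mu>" unfolding z by (rule \<mu>)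
  qed
  show "m_fold_symmetric m (\<Phi> ` ball 0 1)"
  proof -
    \<comment> \<open>All exponents in f are 1 modulo \<open>m\<close>, so \<Phi> commutes with
      rotation by this root of unity.\<close>
    define \<epsilon> where "\<epsilon> = cis (2 * pi / real m)"
    have \<epsilon>: "\<epsilon> ^ m = 1" "norm \<epsilon> = 1" using m by (simp_all add: \<epsilon>_def cis_power)
    have pw: "(\<epsilon> * z) ^ (k * m + 1) = \<epsilon> * z ^ (k * m + 1)" for k z
    proof -
      have "\<epsilon> ^ (k * m + 1) = \<epsilon>" using \<epsilon>(1) by (simp add: power_mult mult.commute[of k])
      thus ?thesis by (simp only: power_mult_distrib)
    qed
    have eqv: "\<Phi> (\<epsilon> * z) = \<epsilon> * \<Phi> z" if "norm z < 1" for z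
    proof -
      have "(\<lambda>k. \<epsilon> * (of_real (pc y k / real (k * m + 1)) * z ^ (k * m + 1))) sums (\<epsilon> * fser y z)"
        using that by (intro sums_mult fser_sums y) auto
      moreover have "(\<lambda>k. of_real (pc y k / real (k * m + 1)) * (\<epsilon> * z) ^ (k * m + 1)) sums fser y (\<epsilon> * z)"
        using that \<epsilon> by (intro fser_sums y) (auto simp: norm_mult)
      ultimately have "fser y (\<epsilon> * z) = \<epsilon> * fser y z" unfolding pw by (simp add: sums_iff mult_ac)
      thus ?thesis by (simp add: \<Phi>_def algebra_simps)
    qed
    have rot: "(\<lambda>z. \<epsilon> * z) ` ball 0 1 = ball 0 1"
    proof
      show "(\<lambda>z. \<epsilon> * z) ` ball 0 1 \<subseteq> ball 0 1" using \<epsilon> by (auto simp: norm_mult)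
      show "ball 0 1 \<subseteq> (\<lambda>z. \<epsilon> * z) ` ball 0 1"
      proof
        fix z :: complex assume "z \<in> ball 0 1"
        thus "z \<in> (\<lambda>z. \<epsilon> * z) ` ball 0 1"
          using \<epsilon> by (intro image_eqI[of _ _ "z / \<epsilon>"]) (auto simp: norm_divide)
      qed
    qed
    have "(\<lambda>z. \<epsilon> * z) ` \<Phi> ` ball 0 1 = (\<lambda>z. \<Phi> (\<epsilon> * z)) ` ball 0 1"
      unfolding image_image by (rule image_cong) (auto simp: eqv)
    also have "\<dots> = \<Phi> ` (\<lambda>z. \<epsilon> * z) ` ball 0 1" by (simp add: image_image)
    finally show ?thesis by (simp add: m_fold_symmetric_def rot flip: \<epsilon>_def)
  qed
  have dc: "((\<lambda>t. \<Phi> (w * cis t)) has_vector_derivative \<i> * w * (1 + gser y w)) (at 0)" if "w \<in> sphere 0 1" for w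
    by (rule circle_deriv_field[OF d\<Phi>]) (use that in auto)
  hence cd: "circle_deriv \<Phi> w = \<i> * w * (1 + gser y w)" if "w \<in> sphere 0 1" for w
    using that unfolding circle_deriv_def by (intro vector_derivative_at) auto
  show "C1_holder_boundary \<alpha> (\<Phi> ` ball 0 1)"
    unfolding C1_holder_boundary_def
  proof (intro exI[of _ \<Phi>] conjI ballI)
    have "norm (circle_deriv \<Phi> z - circle_deriv \<Phi> w) \<le> ((1 + real m * norm y) * 2) * norm (z - w) powr \<alpha>"
      if zw: "z \<in> sphere 0 1" "w \<in> sphere 0 1" for z w
    proof -
      have "circle_deriv \<Phi> z - circle_deriv \<Phi> w = \<i> * ((z - w) + (z * gser y z - w * gser y w))"
        by (simp only: cd[OF zw(1)] cd[OF zw(2)]) (simp add: algebra_simps)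
      hence "norm (circle_deriv \<Phi> z - circle_deriv \<Phi> w) \<le> norm (z - w) + norm (z * gser y z - w * gser y w)"
        using norm_triangle_ineq[of "z - w" "z * gser y z - w * gser y w"] by (simp add: norm_mult)
      also have "\<dots> \<le> norm (z - w) + real m * norm y * norm (z - w)"
        using zgser_lipschitz[OF y(1), of z w] zw by simp
      also have "\<dots> = (1 + real m * norm y) * norm (z - w)" by (simp add: algebra_simps)
      also have "\<dots> \<le> (1 + real m * norm y) * (2 * norm (z - w) powr \<alpha>)"
        using norm_diff_circle_le[OF zw] \<alpha> by (intro mult_left_mono le_2_powr) auto
      finally show ?thesis by (simp only: mult.assoc)
    qed
    thus "C1_holder_circle \<alpha> \<Phi>"
      unfolding C1_holder_circle_def holder_on_circle_def using dc by (blast intro: differentiableI_vector)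
    show "inj_on \<Phi> (sphere 0 1)" by (rule inj_on_subset[OF P.inj_cball]) auto
    show "frontier (\<Phi> ` ball 0 1) = \<Phi> ` sphere 0 1" using P.frontier_D by (simp add: D)
    fix w :: complex assume w: "w \<in> sphere 0 1"
    have "norm (gser y w) \<le> 1/16" using norm_gser_le[OF y(1), of w] w y(2) by simp
    hence "1 + gser y w \<noteq> 0" using norm_diff_ineq[of 1 "gser y w"] by auto
    thus "circle_deriv \<Phi> w \<noteq> 0" using w by (auto simp: cd)
  qed
  show "\<Phi> ` ball 0 1 \<noteq> ball 0 1" if ne: "pc y 1 \<noteq> 0"
  proof
    assume eqb: "\<Phi> ` ball 0 1 = ball 0 1"
    have g0: "gser y 0 = 0"
    proof -
      have "of_real (pc y k) * (0::complex) ^ (k * m) = 0" for k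
        using pc_0[OF y(1)] m by (cases k) auto
      thus ?thesis unfolding gser_def by (simp only: suminf_zero)
    qed
    have "deriv \<Phi> 0 = 1" using P.der_ball[of 0] g0 by (intro DERIV_imp_deriv) simp
    moreover have "norm (\<Phi> z) < 1" if "norm z < 1" for z
      using eqb that by (metis image_eqI mem_ball_0)
    \<comment> \<open>Schwarz lemma at the fixed point 0: a self-map of the disk with derivative of
      modulus 1 there is a rotation. The derivative is exactly 1, so the map is the identity and f
      vanishes.\<close>
    ultimately obtain a where a: "\<And>z. norm z < 1 \<Longrightarrow> \<Phi> z = a * z" "norm a = 1"
      using Schwarz_Lemma(3)[OF holo _ _, of 0] fser_0 by (auto simp: \<Phi>_def)
    have "((\<lambda>z. a * z) has_field_derivative a) (at 0)" by (auto intro!: derivative_eq_intros)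
    moreover have "((\<lambda>z. a * z) has_field_derivative 1) (at 0)"
    proof -
      have "(\<Phi> has_field_derivative 1) (at 0)" using P.der_ball[of 0] g0 by simp
      thus ?thesis
        by (rule has_field_derivative_transform_within_open[of _ _ _ "ball 0 1"]) (use a in auto)
    qed
    ultimately have "a = 1" by (rule DERIV_unique)
    hence "fser y z = 0" if "z \<in> ball 0 1" for z using a(1)[of z] that by (simp add: \<Phi>_def)
    with fser_zero_imp[OF y(1)] ne show False by blast
  qed
  show "\<exists>w\<in>sphere 0 1. fser y w \<noteq> 0" if ne: "pc y 1 \<noteq> 0"
  proof (rule ccontr)
    assume "\<not> (\<exists>w\<in>sphere 0 1. fser y w \<noteq> 0)"
    hence z: "norm (fser y w) \<le> 0" if "w \<in> sphere 0 1" for w using that by auto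
    have "fser y w = 0" if w: "w \<in> ball 0 1" for w
    proof -
      have fh: "fser y holomorphic_on ball 0 1"
      proof -
        have "(\<lambda>w. \<Phi> w - w) holomorphic_on ball 0 1" by (intro holomorphic_intros holo)
        thus ?thesis by (simp add: \<Phi>_def)
      qed
      have fc: "continuous_on (cball 0 1) (fser y)"
        by (rule DERIV_continuous_on[OF fser_deriv[OF y(1)]])
      \<comment> \<open>By the maximum modulus principle, vanishing on the circle forces vanishing
        inside.\<close>
      have "norm (fser y w) \<le> 0"
        by (rule maximum_modulus_frontier[of "fser y" "ball 0 1"]) (use fh fc z w in auto)
      thus ?thesis by simp
    qed
    with fser_zero_imp[OF y(1)] ne show False by blast
  qed
qed

text \<open>Reindexes the series of f by the full exponent n = km + 1. The cut at 2 loses nothing,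
  as exponent 1 belongs to k = 0, where the coefficient of f' vanishes.\<close>

definition acoef :: "wiener \<Rightarrow> nat \<Rightarrow> real" where
  "acoef y n = (if n \<ge> 2 \<and> m dvd (n - 1) then pc y ((n - 1) div m) / real n else 0)"

lemma acoef_sums:
  assumes y: "Piop y = y" and w: "w \<in> cball 0 1"
  shows "(\<lambda>n. of_real (acoef y (n + 2)) * w ^ (n + 2)) sums fser y w"
proof -
  let ?b = "\<lambda>n. of_real (acoef y n) * w ^ n"
  have bk: "?b (k * m + 1) = of_real (pc y k / real (k * m + 1)) * w ^ (k * m + 1)" for k
    using m pc_0[OF y] by (cases k) (auto simp: acoef_def)
  have "(\<lambda>k. ?b (k * m + 1)) sums fser y w"
    unfolding bk using w by (intro fser_sums y) simp
  hence "?b sums fser y w"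
  proof (subst (asm) sums_mono_reindex[of "\<lambda>k. k * m + 1" ?b])
    show "strict_mono (\<lambda>k. k * m + 1)" using m by (auto intro!: strict_monoI)
    fix n assume n: "n \<notin> range (\<lambda>k. k * m + 1)"
    have "\<not> (n \<ge> 2 \<and> m dvd (n - 1))"
    proof
      assume a: "n \<ge> 2 \<and> m dvd (n - 1)"
      then obtain k where "n - 1 = m * k" by (auto elim: dvdE)
      hence "n = k * m + 1" using a by (simp add: mult.commute)
      with n show False by blast
    qed
    hence "acoef y n = 0" unfolding acoef_def by (rule if_not_P)
    thus "?b n = 0" by simp
  qed
  hence "(\<lambda>n. ?b (n + 2)) sums (fser y w - (\<Sum>i<2. ?b i))" by (rule sums_split_initial_segment)
  thus ?thesis by (simp add: numeral_2_eq_2 acoef_def)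
qed

theorem branch_exists:
  assumes \<alpha>: "0 < \<alpha>" "\<alpha> < 1"
  shows "\<exists>\<Omega>\<^sub>m V. branch_from_disk \<alpha> K m \<Omega>\<^sub>m V \<and>
       (\<forall>(\<Omega>, D)\<in>V. rotating_patch K \<Omega> D \<and> m_fold_symmetric m D \<and> D \<noteq> ball 0 1 \<and> C1_holder_boundary \<alpha> D)"
proof -
  obtain C d where C: "C > 0" "d > 0" "\<And>y. norm y \<le> d \<Longrightarrow> norm (sqrt1m (pfun y) - 0) \<le> C * norm y"
    using affine_approx_local_bounds[OF affine_approx_sqrt1m[OF affine_approx_pfun]] by metis
  \<comment> \<open>\<open>1/16\<close> serves the square root and the distance comparison,
    \<open>d\<close> is the range of the local bound, and the last entry brings the root below the
    threshold 1/4 of the kernel series.\<close>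
  define \<epsilon> where "\<epsilon> = Min {1/16, d, 1 / (4 * C)}"
  have \<epsilon>: "\<epsilon> > 0" "\<epsilon> \<le> 1/16" "\<epsilon> \<le> d" "\<epsilon> \<le> 1 / (4 * C)" using C by (auto simp: \<epsilon>_def)
  have small: "norm (sqrt1m (pfun y)) \<le> 1/4" if "norm y \<le> \<epsilon>" for y
  proof -
    have "norm (sqrt1m (pfun y)) \<le> C * norm y" using C(3)[of y] that \<epsilon> by simp
    also have "\<dots> \<le> C * (1 / (4 * C))" using that \<epsilon> C by (intro mult_left_mono) auto
    also have "\<dots> = 1/4" using C by simp
    finally show ?thesis .
  qed
  obtain \<delta> \<Omega> Y where B: "\<delta> > 0" "continuous_on {-\<delta><..<\<delta>} \<Omega>" "continuous_on {-\<delta><..<\<delta>} Y"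
    "\<Omega> (0::real) = Om" "Y (0::real) = 0"
    "\<And>s. \<bar>s\<bar> < \<delta> \<Longrightarrow> norm (Y s) \<le> \<epsilon>"
    "\<And>s. \<bar>s\<bar> < \<delta> \<Longrightarrow> Piop (Y s) = Y s"
    "\<And>s. \<bar>s\<bar> < \<delta> \<Longrightarrow> coef (Y s) (1, 0) = s"
    "\<And>s. \<bar>s\<bar> < \<delta> \<Longrightarrow> Piop (Nfun (Y s) + \<Omega> s *\<^sub>R Mfun (Y s)) = 0"
    using wiener_branch[OF \<epsilon>(1)] by blast
  have I: "s \<in> {-\<delta><..<\<delta>} \<longleftrightarrow> \<bar>s\<bar> < \<delta>" for s by auto
  note patch = patch_from_solution[OF B(7) order.trans[OF B(6) \<epsilon>(2)] small[OF B(6)] B(9) \<alpha>]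
  \<comment> \<open>The amplitude is itself the first coefficient of f', so every
    \<open>s \<noteq> 0\<close> gives a patch other than the disk.\<close>
  have pc1: "pc (Y s) 1 = s" if "\<bar>s\<bar> < \<delta>" for s using B(8)[OF that] by (simp add: pc_def)
  define V where "V = (\<lambda>s. (\<Omega> s, (\<lambda>w. w + fser (Y s) w) ` ball 0 1)) ` ({-\<delta><..<\<delta>} - {0})"
  have lim: "((\<lambda>r. C1_holder_norm \<alpha> (\<lambda>w. fser (Y r) w - fser (Y s) w)) \<longlongrightarrow> 0) (at s within {-\<delta><..<\<delta>})"
    if s: "s \<in> {-\<delta><..<\<delta>}" for s
  proof -
    have "(Y \<longlongrightarrow> Y s) (at s within {-\<delta><..<\<delta>})" using B(3) s by (simp add: continuous_on_def)
    hence "((\<lambda>r. norm (Y r - Y s)) \<longlongrightarrow> 0) (at s within {-\<delta><..<\<delta>})"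
      by (intro tendsto_norm_zero LIM_zero)
    hence "((\<lambda>r. (2 + real m * 2) * norm (Y r - Y s)) \<longlongrightarrow> 0) (at s within {-\<delta><..<\<delta>})"
      by (rule tendsto_mult_right_zero)
    thus ?thesis
    proof (rule Lim_null_comparison[rotated])
      show "\<forall>\<^sub>F r in at s within {-\<delta><..<\<delta>}. norm (C1_holder_norm \<alpha> (\<lambda>w. fser (Y r) w - fser (Y s) w)) \<le> (2 + real m * 2) * norm (Y r - Y s)"
        unfolding eventually_at_filter
      proof (intro always_eventually allI impI)
        fix r assume r: "r \<in> {-\<delta><..<\<delta>}"
        have Pr: "Piop (Y r) = Y r" "Piop (Y s) = Y s" using B(7) r s by auto
        have "C1_holder_norm \<alpha> (\<lambda>w. fser (Y r) w - fser (Y s) w) = C1_holder_norm \<alpha> (fser (Y r - Y s))"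
          by (rule C1_holder_norm_cong) (use fser_diff[OF Pr] in auto)
        moreover have "Piop (Y r - Y s) = Y r - Y s" using Pr by simp
        ultimately show "norm (C1_holder_norm \<alpha> (\<lambda>w. fser (Y r) w - fser (Y s) w)) \<le> (2 + real m * 2) * norm (Y r - Y s)"
          using C1_holder_norm_fser[of "Y r - Y s" \<alpha>] \<alpha> by (simp add: algebra_simps)
      qed
    qed
  qed
  have "branch_from_disk \<alpha> K m Om V"
    unfolding branch_from_disk_def
  proof (intro exI[of _ \<delta>] exI[of _ \<Omega>] exI[of _ "\<lambda>s. fser (Y s)"] exI[of _ "\<lambda>s. acoef (Y s)"] conjI ballI)
    show "\<delta> > 0" "continuous_on {-\<delta><..<\<delta>} \<Omega>" "\<Omega> 0 = Om" by fact+
    show "V = (\<lambda>s. (\<Omega> s, (\<lambda>w. w + fser (Y s) w) ` ball 0 1)) ` ({-\<delta><..<\<delta>} - {0})" by (rule V_def)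
    show "fser (Y 0) w = 0" if "w \<in> sphere 0 1" for w by (simp add: B(5) fser_def pc_def)
    show "C1_holder_circle \<alpha> (fser (Y s))" if "s \<in> {-\<delta><..<\<delta>}" for s
      using that by (intro C1_holder_circle_fser B(7) \<alpha>) auto
    show "(\<lambda>n. of_real (acoef (Y s) (n + 2)) * w ^ (n + 2)) sums fser (Y s) w"
      if "s \<in> {-\<delta><..<\<delta>}" "w \<in> cball 0 1" for s w
      using that by (intro acoef_sums B(7)) auto
    show "((\<lambda>r. C1_holder_norm \<alpha> (\<lambda>w. fser (Y r) w - fser (Y s) w)) \<longlongrightarrow> 0) (at s within {-\<delta><..<\<delta>})"
      if "s \<in> {-\<delta><..<\<delta>}" for s by (rule lim[OF that])
    show "\<exists>w\<in>sphere 0 1. fser (Y s) w \<noteq> 0" if "s \<in> {-\<delta><..<\<delta>} - {0}" for s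
      using patch(7)[of s] pc1[of s] that by auto
    fix s assume "s \<in> {-\<delta><..<\<delta>}"
    hence s: "\<bar>s\<bar> < \<delta>" by auto
    show "(\<lambda>w. w + fser (Y s) w) holomorphic_on ball 0 1" by (rule patch(1)[OF s s s s])
    show "inj_on (\<lambda>w. w + fser (Y s) w) (ball 0 1)" by (rule patch(2)[OF s s s s])
    show "rotating_patch K (\<Omega> s) ((\<lambda>w. w + fser (Y s) w) ` ball 0 1)" by (rule patch(3)[OF s s s s])
    show "m_fold_symmetric m ((\<lambda>w. w + fser (Y s) w) ` ball 0 1)" by (rule patch(4)[OF s s s s])
  qed
  moreover have "\<forall>(\<Omega>, D)\<in>V. rotating_patch K \<Omega> D \<and> m_fold_symmetric m D \<and> D \<noteq> ball 0 1 \<and> C1_holder_boundary \<alpha> D"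
    unfolding V_def ball_simps case_prod_conv
  proof
    fix s assume "s \<in> {-\<delta><..<\<delta>} - {0}"
    hence s: "\<bar>s\<bar> < \<delta>" "s \<noteq> 0" by auto
    show "rotating_patch K (\<Omega> s) ((\<lambda>w. w + fser (Y s) w) ` ball 0 1) \<and> m_fold_symmetric m ((\<lambda>w. w + fser (Y s) w) ` ball 0 1) \<and>
       (\<lambda>w. w + fser (Y s) w) ` ball 0 1 \<noteq> ball 0 1 \<and> C1_holder_boundary \<alpha> ((\<lambda>w. w + fser (Y s) w) ` ball 0 1)"
      using patch[of s] pc1[of s] s by auto
  qed
  ultimately show ?thesis by blast
qed

end

theorem theorem7p5p1:
  fixes \<alpha> :: real and K0 :: "real \<Rightarrow> real"
  assumes "0 < \<alpha>" and "\<alpha> < 1"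
    and "smooth_on_pos K0"
    and "completely_monotone (\<lambda>t. - deriv K0 t)"
    and "\<exists>t>0. - deriv K0 t \<noteq> 0"
    and "set_integrable lborel {0<..<1} (\<lambda>t. \<bar>K0 t\<bar> * t powr (- \<alpha>))"
  shows "\<forall>m::nat. m \<ge> 2 \<longrightarrow>
    (\<exists>(\<Omega>\<^sub>m :: real) (V :: (real \<times> complex set) set).
       branch_from_disk \<alpha> K0 m \<Omega>\<^sub>m V \<and>
       (\<forall>(\<Omega>, D)\<in>V. rotating_patch K0 \<Omega> D \<and> m_fold_symmetric m D \<and> D \<noteq> ball 0 1 \<and>
          C1_holder_boundary \<alpha> D))"
proof (intro allI impI)
  fix m :: nat assume m: "m \<ge> 2"
  \<comment> \<open>On (0, 1) the factor \<open>t powr (- \<alpha>)\<close> is at least 1, so the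
    weighted integrand dominates the kernel.\<close>
  have K: "set_integrable lborel {0<..<1} K0"
  proof (rule set_integrable_bound[OF assms(6)])
    have "isCont K0 t" if "t > 0" for t
    proof -
      have "((deriv ^^ 0) K0) field_differentiable (at t)" using assms(3) that unfolding smooth_on_pos_def by blast
      thus ?thesis by (simp add: field_differentiable_imp_continuous_at)
    qed
    hence "continuous_on {0<..<1} K0" by (intro continuous_at_imp_continuous_on) auto
    thus "set_borel_measurable lborel {0<..<1} K0" by (rule set_borel_measurable_open_cont)
    show "AE t in lborel. t \<in> {0<..<1} \<longrightarrow> norm (K0 t) \<le> norm (\<bar>K0 t\<bar> * t powr (- \<alpha>))"
    proof (intro AE_I2 impI)
      fix t :: real assume t: "t \<in> {0<..<1}"
      have "t powr \<alpha> \<le> 1" using t assms(1) by (intro powr_le1) auto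
      hence "1 \<le> t powr (- \<alpha>)" using t by (simp add: powr_minus one_le_inverse_iff)
      thus "norm (K0 t) \<le> norm (\<bar>K0 t\<bar> * t powr (- \<alpha>))"
        by (simp add: abs_mult mult_le_cancel_left1)
    qed
  qed
  interpret fold_kernel K0 m
    by unfold_locales (use assms K m in auto)
  show "\<exists>\<Omega>\<^sub>m V. branch_from_disk \<alpha> K0 m \<Omega>\<^sub>m V \<and>
       (\<forall>(\<Omega>, D)\<in>V. rotating_patch K0 \<Omega> D \<and> m_fold_symmetric m D \<and> D \<noteq> ball 0 1 \<and> C1_holder_boundary \<alpha> D)"
    by (rule branch_exists[OF assms(1,2)])
qed

end
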